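(* Consider the cross-fitted estimator $\hat\theta_n=\tfrac12(\hat\theta_{1,n}+\hat\theta_{2,n})$ and its Bayesian bootstrap version $\hat\theta_{n,BB}=\tfrac12(\hat\theta_{1,n,BB}+\hat\theta_{2,n,BB})$ built from $N=2n$ i.i.d. observations $O_1,\dots,O_N$ with the linear score $m(O;\theta,h)=A(O;h)\theta+B(O;h)$, as defined in the context. Suppose Assumptions (i)-(iv) listed in the context hold. Let $$\Sigma=\left[\mathbb{E}A(O;h_0)\right]^{-1}\,\mathbb{E}\left\{m(O;\theta_0,h_0)m(O;\theta_0,h_0)^\top\right\}\,\left[\mathbb{E}A(O;h_0)\right]^{-\top}.$$ Then, as $N\to\infty$: 1. $\sqrt N(\hat\theta_n-\theta_0)$ converges in distribution to $\mathcal N(0,\Sigma)$; 2. conditionally on $O_1,\dots,O_N$, $\sqrt N(\hat\theta_{n,BB}-\hat\theta_n)$ converges in distribution to $\mathcal N(0,\Sigma)$.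
   Context: Setting. $\Theta\subseteq\mathbb{R}^p$ is the target parameter space and $\mathcal H$, the nuisance space, is a convex subset of a normed space. $\|\cdot\|_{p,2}$ denotes the Euclidean norm (of vectors, and of $p\times p$ matrices). $O$ has distribution $P_O$ on $\mathcal O$. The score $m:\mathcal O\times\Theta\times\mathcal H\to\mathbb{R}^p$ is linear in $\theta$: $m(O;\theta,h)=A(O;h)\theta+B(O;h)$ with $A:\mathcal O\times\mathcal H\to\mathbb{R}^{p\times p}$, $B:\mathcal O\times\mathcal H\to\mathbb{R}^p$. The true values $\theta_0\in\Theta$, $h_0\in\mathcal H$ satisfy $\mathbb{E}_{P_O}\{m(O;\theta_0,h_0)\}=0$. The matrix $M_{\theta_0}:=\mathbb{E}A(O;h_0)$ is invertible and $\mathbb{E}\|m(O;\theta_0,h_0)\|_{p,2}^2<\infty$. Data and sample splitting. $O_1,\dots,O_N$ are i.i.d. from $P_O$, $N=2n$, $I_1=\{1,\dots,n\}$, $I_2=\{n+1,\dots,2n\}$. $\hat h_1$ is an estimator of $h_0$ based only on the data in $I_1$ and $\hat h_2$ one based only on the data in $I_2$. Both belong to $H_N\subseteq\mathcal H$, where $(H_N)_{N\ge1}$ are shrinking neighborhoods of $h_0$. Weights. $\mathbf W_n=(w_{1n},\dots,w_{nn})$ and $\mathbf V_n=(v_{1n},\dots,v_{nn})$ are each distributed as $\mathrm{Dirichlet}(1,\dots,1)$, and $(\mathbf W_n,\mathbf V_n)$ is independent of the data; either $\mathbf W_n$ and $\mathbf V_n$ are independent of each other, or they are identical ($v_{jn}=w_{jn}$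 for all $j$). Estimators. $\hat\theta_{1,n},\hat\theta_{1,n,BB},\hat\theta_{2,n},\hat\theta_{2,n,BB}$ satisfy respectively $\frac1n\sum_{i=1}^n m(O_i;\hat\theta_{1,n},\hat h_2)=0$, $\sum_{i=1}^n w_{in}m(O_i;\hat\theta_{1,n,BB},\hat h_2)=0$, $\frac1n\sum_{i=1}^n m(O_{n+i};\hat\theta_{2,n},\hat h_1)=0$, $\sum_{i=1}^n v_{in}m(O_{n+i};\hat\theta_{2,n,BB},\hat h_1)=0$. Assumptions. (i) $\sup_{h\in H_N}\|\mathbb{E}A(O;h)-\mathbb{E}A(O;h_0)\|_{p,2}\le a_N$ for a sequence of positive numbers $a_N\to0$. (ii) $\sup_{h\in H_N}\mathbb{E}\{\|A(O;h)\|_{p,2}^2\}\le C$ for some positive constant $C$. (iii) $\sup_{h\in H_N}\mathbb{E}\{\|m(O;\theta_0,h)-m(O;\theta_0,h_0)\|_{p,2}^2\}\le\delta_N^2$ for a sequence of positive numbers $\delta_N\to0$. (iv) For $h\in H_N$ let $f_h(t)=\mathbb{E}\,m\{O;\theta_0,h_0+t(h-h_0)\}$. Then $f_h$ is twice differentiable on $(0,1)$, $f_h'(0)=0$, and $\sqrt n\int_0^1\|f_h''(t)\|\,dt\to0$ as $n\to\infty$ uniformly in $h\in H_N$; this is taken to imply that $\sqrt n\,\mathbb{E}_{P_O}m(O;\theta_0,h)\to0$ uniformly in $h\in H_N$. Convention. Conditional convergence in distribution given $O_1,\dots,O_N$ means that the conditional law given the data converges weakly to the limit law, in probability with respect to the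 data. *)

theory Defs
  imports "HOL-Probability.Probability"
begin

section \<open>Limit laws and modes of convergence\<close>

definition std_normal_vec :: "(real ^ 'p) measure" where
  "std_normal_vec = density lborel (\<lambda>x. ennreal (\<Prod>i\<in>UNIV. std_normal_density (x $ i)))"

text \<open>
  The law of \<open>\<mu> + B Z\<close> with \<open>Z\<close> standard normal and \<open>B B\<^sup>T = S\<close>. It does not depend on the
  factor \<open>B\<close>, and a factor exists for every symmetric positive semidefinite \<open>S\<close>; a singular
  \<open>S\<close> is allowed, so the measure need not have a density.
\<close>

definition mv_normal :: "real ^ 'p \<Rightarrow> real ^ 'p ^ 'p \<Rightarrow> (real ^ 'p) measure" where
  "mv_normal \<mu> S =
     distr std_normal_vec borel (\<lambda>z. \<mu> + (SOME B :: real ^ 'p ^ 'p. B ** transpose B = S) *v z)"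

text \<open>Weak convergence of measures on a topological space (\<^const>\<open>weak_conv_m\<close> only covers
  measures on the real line).\<close>

definition weakly_converges ::
    "(nat \<Rightarrow> 'a::topological_space measure) \<Rightarrow> 'a measure \<Rightarrow> bool" where
  "weakly_converges \<mu> \<nu> \<longleftrightarrow>
     (\<forall>g :: 'a \<Rightarrow> real. continuous_on UNIV g \<longrightarrow> bounded (range g) \<longrightarrow>
        (\<lambda>n. \<integral>x. g x \<partial>\<mu> n) \<longlonglongrightarrow> (\<integral>x. g x \<partial>\<nu>))"

definition converges_in_distribution ::
    "'w measure \<Rightarrow> (nat \<Rightarrow> 'w \<Rightarrow> 'a::topological_space) \<Rightarrow> 'a measure \<Rightarrow> bool" where
  "converges_in_distribution M Y \<nu> \<longleftrightarrow> weakly_converges (\<lambda>n. distr M borel (Y n)) \<nu>"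

definition converges_in_probability ::
    "'w measure \<Rightarrow> (nat \<Rightarrow> 'w \<Rightarrow> real) \<Rightarrow> real \<Rightarrow> bool" where
  "converges_in_probability M Z c \<longleftrightarrow>
     (\<forall>\<epsilon>>0. (\<lambda>n. measure M {\<omega> \<in> space M. \<bar>Z n \<omega> - c\<bar> > \<epsilon>}) \<longlonglongrightarrow> 0)"

text \<open>
  Weak convergence, in probability, of the conditional laws of \<open>Y n\<close> given the sub-\<open>\<sigma>\<close>-algebra
  \<open>F n\<close>: the integral of \<open>g\<close> against the conditional law of \<open>Y n\<close> is the conditional
  expectation of \<open>g (Y n)\<close>.
\<close>

definition cond_converges_in_distribution ::
    "'w measure \<Rightarrow> (nat \<Rightarrow> 'w measure) \<Rightarrow> (nat \<Rightarrow> 'w \<Rightarrow> 'a::topological_space) \<Rightarrow>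
     'a measure \<Rightarrow> bool" where
  "cond_converges_in_distribution M F Y \<nu> \<longleftrightarrow>
     (\<forall>g :: 'a \<Rightarrow> real. continuous_on UNIV g \<longrightarrow> bounded (range g) \<longrightarrow>
        converges_in_probability M (\<lambda>n. real_cond_exp M (F n) (\<lambda>\<omega>. g (Y n \<omega>))) (\<integral>x. g x \<partial>\<nu>))"

section \<open>The Dirichlet distribution\<close>

text \<open>
  The Dirichlet distribution on the simplex in \<open>\<real>\<^sup>n\<close>, given by its usual density with
  respect to Lebesgue measure in the first \<open>n - 1\<close> coordinates. Vectors in \<open>\<real>\<^sup>n\<close> are
  extensional functions on \<open>{1..n}\<close>. The construction is meant for \<open>n \<ge> 1\<close>.
\<close>

definition simplex_point :: "nat \<Rightarrow> (nat \<Rightarrow> real) \<Rightarrow> nat \<Rightarrow> real" where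
  "simplex_point n x = (\<lambda>i\<in>{1..n}. if i = n then 1 - (\<Sum>j\<in>{1..<n}. x j) else x i)"

definition dirichlet_density :: "nat \<Rightarrow> (nat \<Rightarrow> real) \<Rightarrow> (nat \<Rightarrow> real) \<Rightarrow> real" where
  "dirichlet_density n \<alpha> w =
     (if \<forall>i\<in>{1..n}. 0 < w i
      then Gamma (\<Sum>i\<in>{1..n}. \<alpha> i) / (\<Prod>i\<in>{1..n}. Gamma (\<alpha> i)) *
           (\<Prod>i\<in>{1..n}. w i powr (\<alpha> i - 1))
      else 0)"

definition dirichlet :: "nat \<Rightarrow> (nat \<Rightarrow> real) \<Rightarrow> (nat \<Rightarrow> real) measure" where
  "dirichlet n \<alpha> =
     distr
       (density (PiM {1..<n} (\<lambda>_. lborel))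
          (\<lambda>x. ennreal (dirichlet_density n \<alpha> (simplex_point n x))))
       (PiM {1..n} (\<lambda>_. borel))
       (simplex_point n)"

section \<open>Linear scores and the orthogonality condition\<close>

definition score ::
    "('o \<Rightarrow> 'h \<Rightarrow> real ^ 'p ^ 'p) \<Rightarrow> ('o \<Rightarrow> 'h \<Rightarrow> real ^ 'p) \<Rightarrow>
     'o \<Rightarrow> real ^ 'p \<Rightarrow> 'h \<Rightarrow> real ^ 'p" where
  "score A B x \<theta> h = A x h *v \<theta> + B x h"

definition sandwich_variance ::
    "'o measure \<Rightarrow> ('o \<Rightarrow> 'h \<Rightarrow> real ^ 'p ^ 'p) \<Rightarrow> ('o \<Rightarrow> 'h \<Rightarrow> real ^ 'p) \<Rightarrow>
     real ^ 'p \<Rightarrow> 'h \<Rightarrow> real ^ 'p ^ 'p" where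
  "sandwich_variance P A B \<theta> h =
     matrix_inv (\<integral>x. A x h \<partial>P) **
     (\<integral>x. (\<chi> i j. score A B x \<theta> h $ i * score A B x \<theta> h $ j) \<partial>P) **
     transpose (matrix_inv (\<integral>x. A x h \<partial>P))"

definition mean_score_path ::
    "'o measure \<Rightarrow> ('o \<Rightarrow> 'h::real_normed_vector \<Rightarrow> real ^ 'p ^ 'p) \<Rightarrow>
     ('o \<Rightarrow> 'h \<Rightarrow> real ^ 'p) \<Rightarrow> real ^ 'p \<Rightarrow> 'h \<Rightarrow> 'h \<Rightarrow> real \<Rightarrow> real ^ 'p" where
  "mean_score_path P A B \<theta> h0 h t = (\<integral>x. score A B x \<theta> (h0 + t *\<^sub>R (h - h0)) \<partial>P)"

definition deriv1 :: "(real \<Rightarrow> 'a::real_normed_vector) \<Rightarrow> real \<Rightarrow> 'a" where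
  "deriv1 f t = vector_derivative f (at t)"

definition deriv2 :: "(real \<Rightarrow> 'a::real_normed_vector) \<Rightarrow> real \<Rightarrow> 'a" where
  "deriv2 f t = vector_derivative (deriv1 f) (at t)"

definition twice_differentiable_on_unit :: "(real \<Rightarrow> 'a::real_normed_vector) \<Rightarrow> bool" where
  "twice_differentiable_on_unit f \<longleftrightarrow>
     (\<forall>t\<in>{0<..<1}. f differentiable (at t) \<and> deriv1 f differentiable (at t))"

text \<open>
  Neighborhoods are taken in the subspace topology of \<open>H\<close>; shrinking means that they are
  eventually contained in every ball around \<open>h0\<close>.
\<close>

definition shrinking_neighborhoods ::
    "'h::real_normed_vector set \<Rightarrow> 'h \<Rightarrow> (nat \<Rightarrow> 'h set) \<Rightarrow> bool" where
  "shrinking_neighborhoods H h0 HN \<longleftrightarrow>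
     (\<forall>N\<ge>1. HN N \<subseteq> H \<and> (\<exists>r>0. ball h0 r \<inter> H \<subseteq> HN N)) \<and>
     (\<forall>r>0. eventually (\<lambda>N. HN N \<subseteq> ball h0 r) sequentially)"

section \<open>Data\<close>

definition sample :: "(nat \<Rightarrow> 'w \<Rightarrow> 'o) \<Rightarrow> nat set \<Rightarrow> 'w \<Rightarrow> nat \<Rightarrow> 'o" where
  "sample X I \<omega> = (\<lambda>i\<in>I. X i \<omega>)"

definition sample_algebra ::
    "'w measure \<Rightarrow> 'o measure \<Rightarrow> (nat \<Rightarrow> 'w \<Rightarrow> 'o) \<Rightarrow> nat set \<Rightarrow> 'w measure" where
  "sample_algebra M P X I = vimage_algebra (space M) (sample X I) (PiM I (\<lambda>_. P))"

text \<open>The \<open>\<sigma>\<close>-algebra generated by the pair \<open>(W n, V n)\<close>.\<close>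

definition weight_algebra ::
    "'w measure \<Rightarrow> (nat \<Rightarrow> 'w \<Rightarrow> nat \<Rightarrow> real) \<Rightarrow> (nat \<Rightarrow> 'w \<Rightarrow> nat \<Rightarrow> real) \<Rightarrow> nat \<Rightarrow> 'w measure" where
  "weight_algebra M W V n =
     vimage_algebra (space M) (\<lambda>\<omega>. (W n \<omega>, V n \<omega>))
       (PiM {1..n} (\<lambda>_. borel) \<Otimes>\<^sub>M PiM {1..n} (\<lambda>_. borel))"

end

theory Submission
  imports Defs
begin

text \<open>
  Cross-fitting makes the nuisance estimate independent of the observations it is used with, so the
  estimating equations expand, by second moment bounds alone, to
  \<open>sqrt n (\<theta> - \<theta>0) = - J U + o(1)\<close> and, for the difference of the bootstrapped and the plain
  estimator, \<open>- J V + o(1)\<close>, where \<open>J\<close> is the inverse mean of \<open>A\<close> and \<open>U\<close>, \<open>V\<close> are the plain and the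
  centred weighted sums of the scores at the true values.

  A Dirichlet vector \<open>w\<close> is a vector of independent exponentials divided by its total \<open>T\<close>, with \<open>T\<close>
  independent of \<open>w\<close> and close to \<open>n\<close>. Hence the characteristic function of \<open>V\<close> given the data is, up
  to a small error in mean square, the product over the observations of the characteristic function
  of a centred exponential at multiples of the scores. The first two moments of this random product
  are themselves characteristic functions of normalised i.i.d. sums, and these converge, so the
  product converges in mean square to the Gaussian value. Bounded continuous test functions are
  reduced to trigonometric ones by tightness and the Stone--Weierstrass theorem.
\<close>

text \<open>The scores have only second moments. Given the data, the weighted sum is a triangular
  array with random coefficients, and a conditional central limit theorem would ask for a Lindeberg
  condition along the data. Working with the second moment of the random characteristic function
  puts the average over the data first, where the summands are i.i.d. and a dominated remainder
  suffices. The mean-square limit is then used in L1, the mode that conditional expectation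
  preserves.

  The two admissible couplings of the weights lead to different arrays. Independent weights give one
  exponential to each of the \<open>2 n\<close> observations; identical weights give one to each
  pair of observations \<open>i\<close> and \<open>n + i\<close>, whose score sum is divided by
  \<open>sqrt 2\<close>. Both arrays have the same variance because the scores are centred and the
  halves independent, hence the common limit.

  The limit law is built from a chosen factor of its covariance, which may be singular. The
  existence of such a factor is the reason for the linear algebra at the start.\<close>

section \<open>Linear algebra: a norm bound and factors of positive semidefinite matrices\<close>

text \<open>The norm on matrices is the Frobenius norm, so Cauchy--Schwarz applies row by row and
  the row norms recombine into \<open>norm A\<close>.\<close>

lemma norm_matrix_vector_mult_le:
  fixes A :: "real ^ 'n ^ 'm" and v :: "real ^ 'n"
  shows "norm (A *v v) \<le> norm A * norm v"
proof -
  have "norm (A *v v) = L2_set (\<lambda>i. norm ((A *v v) $ i)) UNIV"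
    by (simp add: norm_vec_def)
  also have "\<dots> \<le> L2_set (\<lambda>i. norm (A $ i) * norm v) UNIV"
  proof (rule L2_set_mono)
    fix i
    have "(A *v v) $ i = inner (A $ i) v"
      by (simp add: matrix_vector_mult_def inner_vec_def)
    then show "norm ((A *v v) $ i) \<le> norm (A $ i) * norm v"
      by (metis Cauchy_Schwarz_ineq2 real_norm_def)
  qed simp
  also have "\<dots> = norm A * norm v"
    by (simp add: L2_set_left_distrib [symmetric] norm_vec_def[of A])
  finally show ?thesis .
qed

text \<open>Vectors supported on two indices reduce the hypothesis to binary quadratic forms. When a
  diagonal entry vanishes, the form is affine in that coordinate, and nonnegativity leaves no room
  for a slope.\<close>

lemma psd_quadratic_form:
  fixes K :: "'n::finite \<Rightarrow> 'n \<Rightarrow> real"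
  assumes sym: "\<And>i j. K i j = K j i"
    and psd: "\<And>x. 0 \<le> (\<Sum>i\<in>UNIV. \<Sum>j\<in>UNIV. x i * K i j * x j)"
  shows psd_diag_nonneg: "0 \<le> K i i"
    and psd_zero_row: "K i i = 0 \<Longrightarrow> K i j = 0"
proof -
  have delta: "(\<Sum>k\<in>UNIV. (if k = a then u else 0) * f k) = u * f a" for a u and f :: "'n \<Rightarrow> real"
    by (simp add: if_distrib[where f="\<lambda>z. z * _"] cong: if_cong)
  \<comment> \<open>The two indicator terms are added instead of distinguished by cases, so the
    formula also covers \<open>a = b\<close>.\<close>
  have two: "(\<Sum>k\<in>UNIV. \<Sum>l\<in>UNIV. ((if k = a then u else 0) + (if k = b then v else 0)) * K k l *
      ((if l = a then u else 0) + (if l = b then v else 0)))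
     = u * u * K a a + 2 * u * v * K a b + v * v * K b b" for a b :: 'n and u v :: real
  proof -
    have "(\<Sum>l\<in>UNIV. c * K k l * ((if l = a then u else 0) + (if l = b then v else 0)))
        = c * (K k a * u + K k b * v)" for c k
    proof -
      have "(\<Sum>l\<in>UNIV. c * K k l * ((if l = a then u else 0) + (if l = b then v else 0)))
        = (\<Sum>l\<in>UNIV. (if l = a then u else 0) * (c * K k l)) + (\<Sum>l\<in>UNIV. (if l = b then v else 0) * (c * K k l))"
        by (simp add: sum.distrib[symmetric] algebra_simps cong: if_cong)
      then show ?thesis
        by (simp only: delta) (simp add: algebra_simps)
    qed
    note inner = this
    have "(\<Sum>k\<in>UNIV. \<Sum>l\<in>UNIV. ((if k = a then u else 0) + (if k = b then v else 0)) * K k l *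
      ((if l = a then u else 0) + (if l = b then v else 0)))
     = (\<Sum>k\<in>UNIV. (if k = a then u else 0) * (K k a * u + K k b * v)) +
       (\<Sum>k\<in>UNIV. (if k = b then v else 0) * (K k a * u + K k b * v))"
      unfolding inner by (simp add: sum.distrib[symmetric] algebra_simps cong: if_cong)
    then show ?thesis
      using sym[of b a] by (simp only: delta) (simp add: algebra_simps)
  qed
  have form: "0 \<le> u * u * K a a + 2 * u * v * K a b + v * v * K b b" for a b u v
    using psd[of "\<lambda>k. (if k = a then u else 0) + (if k = b then v else 0)"] unfolding two .
  show "0 \<le> K i i"
    using form[of 1 i 0 i] by simp
  show "K i j = 0" if "K i i = 0"
  proof (rule ccontr)
    assume ne: "K i j \<noteq> 0"
    \<comment> \<open>With this \<open>u\<close> and second coordinate 1 the form equals -1: the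
      pivot contributes nothing and the cross term is \<open>- (K j j + 1)\<close>.\<close>
    define u where "u = - (K j j + 1) / (2 * K i j)"
    have "2 * u * K i j = - (K j j + 1)"
      using ne by (simp add: u_def)
    then show False
      using form[of u i 1 j] that by simp
  qed
qed

text \<open>Outer-product Cholesky elimination, one index at a time.\<close>

lemma psd_sum_outer_products:
  fixes K :: "'n::finite \<Rightarrow> 'n \<Rightarrow> real"
  assumes "finite I"
    and "\<And>i j. K i j = K j i"
    and "\<And>x. 0 \<le> (\<Sum>i\<in>UNIV. \<Sum>j\<in>UNIV. x i * K i j * x j)"
    and "\<And>i j. i \<notin> I \<Longrightarrow> K i j = 0"
  shows "\<exists>b. \<forall>j k. K j k = (\<Sum>i\<in>I. b i j * b i k)"
  using assms
proof (induction I arbitrary: K rule: finite_induct)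
  case empty
  then show ?case by simp
next
  case (insert i I)
  note sym = insert.prems(1) and psd = insert.prems(2)
  \<comment> \<open>The Cholesky vector for the pivot \<open>i\<close>. A vanishing pivot forces the
    whole row of \<open>K\<close> to vanish, and then nothing has to be eliminated.\<close>
  define c where "c j = (if K i i = 0 then 0 else K i j / sqrt (K i i))" for j
  have Kii: "0 \<le> K i i"
    by (rule psd_diag_nonneg[of K, OF sym psd])
  have row: "K i j = c i * c j" for j
    using psd_zero_row[of K i j, OF sym psd] Kii
    by (auto simp: c_def)
  define L where "L j k = K j k - c j * c k" for j k
  have "\<exists>b. \<forall>j k. L j k = (\<Sum>i\<in>I. b i j * b i k)"
  proof (rule insert.IH)
    show "L j k = L k j" for j k
      using sym[of j k] by (simp add: L_def)
    show "L j k = 0" if "j \<notin> I" for j k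
    proof (cases "j = i")
      case True
      then show ?thesis using row[of k] by (simp add: L_def)
    next
      case False
      then have "K j l = 0" for l
        using insert.prems(3) that by auto
      then show ?thesis
        using sym[of i j] by (simp add: L_def c_def)
    qed
    show "0 \<le> (\<Sum>j\<in>UNIV. \<Sum>k\<in>UNIV. x j * L j k * x k)" for x
    proof (cases "K i i = 0")
      case True
      then show ?thesis using psd[of x] by (simp add: L_def c_def)
    next
      case False
      define s where "s = (\<Sum>k\<in>UNIV. c k * x k)"
      \<comment> \<open>\<open>y\<close> changes only coordinate \<open>i\<close> of
        \<open>x\<close>, which \<open>L\<close> does not see, and is made orthogonal to
        \<open>c\<close>, where the subtracted rank-one term vanishes. So the form of
        \<open>L\<close> at \<open>x\<close> is that of \<open>K\<close> at
        \<open>y\<close>.\<close>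
      define y where "y k = x k - (if k = i then s / c i else 0)" for k
      have ci: "c i \<noteq> 0"
        using False row[of i] by auto
      have cy: "(\<Sum>k\<in>UNIV. c k * y k) = 0"
      proof -
        have "(\<Sum>k\<in>UNIV. c k * y k) = s - (\<Sum>k\<in>UNIV. if k = i then c i * (s / c i) else 0)"
          unfolding s_def y_def sum_subtractf[symmetric]
          by (rule sum.cong) (auto simp: algebra_simps)
        then show ?thesis using ci by simp
      qed
      have Lrow: "L i k = 0" "L k i = 0" for k
        using row[of k] sym[of i k] by (simp_all add: L_def)
      have "(\<Sum>j\<in>UNIV. \<Sum>k\<in>UNIV. x j * L j k * x k) = (\<Sum>j\<in>UNIV. \<Sum>k\<in>UNIV. y j * L j k * y k)"
        by (intro sum.cong refl) (auto simp: y_def Lrow)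
      also have "\<dots> = (\<Sum>j\<in>UNIV. \<Sum>k\<in>UNIV. y j * K j k * y k)
          - (\<Sum>j\<in>UNIV. \<Sum>k\<in>UNIV. (c j * y j) * (c k * y k))"
        by (simp add: L_def sum_subtractf[symmetric] algebra_simps)
      also have "(\<Sum>j\<in>UNIV. \<Sum>k\<in>UNIV. (c j * y j) * (c k * y k)) = 0"
        by (simp add: sum_product[symmetric] cy)
      finally show ?thesis using psd[of y] by simp
    qed
  qed
  then obtain b where b: "\<And>j k. L j k = (\<Sum>i\<in>I. b i j * b i k)" by blast
  have "K j k = (\<Sum>l\<in>insert i I. (b(i := c)) l j * (b(i := c)) l k)" for j k
  proof -
    have "(\<Sum>l\<in>I. (b(i := c)) l j * (b(i := c)) l k) = L j k"
      unfolding b by (rule sum.cong) (use insert.hyps in auto)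
    then show ?thesis using insert.hyps by (simp add: L_def)
  qed
  then show ?case by blast
qed

text \<open>Singular matrices are included, so this justifies the choice of a factor in
  \<open>mv_normal\<close> for every covariance matrix.\<close>

lemma psd_matrix_factor:
  fixes S :: "real ^ 'n ^ 'n"
  assumes sym: "transpose S = S"
    and psd: "\<And>x. 0 \<le> inner x (S *v x)"
  shows "\<exists>B :: real ^ 'n ^ 'n. B ** transpose B = S"
proof -
  have "\<exists>b. \<forall>j k. S $ j $ k = (\<Sum>i\<in>(UNIV::'n set). b i j * b i k)"
  proof (rule psd_sum_outer_products[of UNIV "\<lambda>j k. S $ j $ k"])
    show "S $ j $ k = S $ k $ j" for j k
      using sym by (metis transpose_def vec_lambda_beta)
    show "0 \<le> (\<Sum>i\<in>UNIV. \<Sum>j\<in>UNIV. x i * S $ i $ j * x j)" for x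
      using psd[of "\<chi> i. x i"]
      by (simp add: inner_vec_def matrix_vector_mult_def sum_distrib_left mult.assoc)
  qed auto
  then obtain b where b: "\<And>j k. S $ j $ k = (\<Sum>i\<in>(UNIV::'n set). b i j * b i k)" by blast
  have "(\<chi> j i. b i j) ** transpose (\<chi> j i. b i j) = S"
    by (simp add: vec_eq_iff matrix_matrix_mult_def transpose_def b)
  then show ?thesis by blast
qed

section \<open>Normal laws on Euclidean space\<close>

text \<open>\<open>std_normal_vec\<close> has its density on vectors, whereas products of
  one-dimensional laws live in \<open>PiM\<close>. Lebesgue measure is determined by its values on
  boxes, and these are products.\<close>

lemma distr_lborel_PiM_vec:
  "(lborel :: (real ^ 'p) measure) = distr (PiM UNIV (\<lambda>_::'p. lborel)) borel (\<lambda>f. \<chi> i. f i)"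
proof (rule lborel_eqI)
  interpret product_sigma_finite "\<lambda>_::'p. lborel :: real measure" ..
  have [measurable]: "(\<lambda>f. \<chi> i. f i) \<in> PiM UNIV (\<lambda>_::'p. lborel) \<rightarrow>\<^sub>M (borel :: (real^'p) measure)"
  proof (rule borel_measurable_euclidean_space[THEN iffD2], rule ballI)
    fix b :: "real^'p" assume "b \<in> Basis"
    then obtain i where "b = axis i 1" by (auto simp: Basis_vec_def)
    then have "(\<lambda>f. (\<chi> i. f i) \<bullet> b) = (\<lambda>f. f i)"
      by (auto simp: inner_axis fun_eq_iff)
    then show "(\<lambda>f. (\<chi> i. f i) \<bullet> b) \<in> borel_measurable (PiM UNIV (\<lambda>_::'p. lborel))"
      by simp
  qed
  fix l u :: "real^'p" assume le: "\<And>b. b \<in> Basis \<Longrightarrow> l \<bullet> b \<le> u \<bullet> b"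
  have le': "l $ i \<le> u $ i" for i
    using le[of "axis i 1"] by (simp add: axis_in_Basis_iff inner_axis)
  have "emeasure (distr (PiM UNIV (\<lambda>_::'p. lborel)) borel (\<lambda>f. \<chi> i. f i)) (box l u)
      = emeasure (PiM UNIV (\<lambda>_::'p. lborel)) (PiE UNIV (\<lambda>i. {l $ i <..< u $ i}))"
    by (subst emeasure_distr)
       (auto intro!: arg_cong2[where f=emeasure] simp: space_PiM mem_box_cart PiE_def Pi_iff)
  also have "\<dots> = (\<Prod>i\<in>UNIV. ennreal (u $ i - l $ i))"
    by (subst emeasure_PiM) (auto simp: le')
  also have "\<dots> = ennreal (\<Prod>i\<in>UNIV. u $ i - l $ i)"
    by (rule prod_ennreal) (simp add: le')
  also have "(\<Prod>i\<in>UNIV. u $ i - l $ i) = (\<Prod>b\<in>Basis. (u - l) \<bullet> b)"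
  proof -
    have "(\<Prod>b\<in>Basis. (u - l) \<bullet> b) = (\<Prod>b\<in>range (\<lambda>i::'p. axis i (1::real)). (u - l) \<bullet> b)"
      by (rule prod.cong) (auto simp: Basis_vec_def)
    also have "\<dots> = (\<Prod>i\<in>UNIV. u $ i - l $ i)"
      by (subst prod.reindex) (auto simp: inj_def axis_eq_axis inner_axis)
    finally show ?thesis by simp
  qed
  finally show "emeasure (distr (PiM UNIV (\<lambda>_::'p. lborel)) borel (\<lambda>f. \<chi> i. f i)) (box l u)
      = (\<Prod>b\<in>Basis. (u - l) \<bullet> b)" .
qed simp

text \<open>Serves both the Gaussian and the exponential product laws. A product measure is
  determined by rectangles, and on a rectangle the density and the indicator both factor.\<close>

lemma density_PiM:
  fixes f :: "'i \<Rightarrow> 'a \<Rightarrow> real"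
  assumes I: "finite I"
    and M: "\<And>i. sigma_finite_measure (M i)"
    and f [measurable]: "\<And>i. f i \<in> borel_measurable (M i)"
    and nonneg: "\<And>i x. 0 \<le> f i x"
    and D: "\<And>i. sigma_finite_measure (density (M i) (f i))"
  shows "density (PiM I M) (\<lambda>x. ennreal (\<Prod>i\<in>I. f i (x i))) = PiM I (\<lambda>i. density (M i) (f i))"
proof -
  interpret P: product_sigma_finite M
    by (rule product_sigma_finite.intro) (rule M)
  interpret Q: product_sigma_finite "\<lambda>i. density (M i) (f i)"
    by (rule product_sigma_finite.intro) (rule D)
  show ?thesis
  proof (rule Q.PiM_eqI[OF I])
    show "sets (density (PiM I M) (\<lambda>x. ennreal (\<Prod>i\<in>I. f i (x i)))) = sets (PiM I (\<lambda>i. density (M i) (f i)))"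
      by (simp cong: sets_PiM_cong)
    fix A assume "\<And>i. i \<in> I \<Longrightarrow> A i \<in> sets (density (M i) (f i))"
    then have A [measurable]: "\<And>i. i \<in> I \<Longrightarrow> A i \<in> sets (M i)" by simp
    have "emeasure (density (PiM I M) (\<lambda>x. ennreal (\<Prod>i\<in>I. f i (x i)))) (Pi\<^sub>E I A)
        = (\<integral>\<^sup>+x. ennreal (\<Prod>i\<in>I. f i (x i)) * indicator (Pi\<^sub>E I A) x \<partial>PiM I M)"
      by (rule emeasure_density) (use I A in \<open>auto intro!: sets_PiM_I_finite\<close>)
    also have "\<dots> = (\<integral>\<^sup>+x. (\<Prod>i\<in>I. ennreal (f i (x i)) * indicator (A i) (x i)) \<partial>PiM I M)"
    proof (rule nn_integral_cong)
      fix x assume "x \<in> space (PiM I M)"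
      then have "indicator (Pi\<^sub>E I A) x = (\<Prod>i\<in>I. indicator (A i) (x i) :: ennreal)"
        using I by (auto simp: indicator_def space_PiM PiE_def Pi_iff prod_zero_iff split: if_splits)
      then show "ennreal (\<Prod>i\<in>I. f i (x i)) * indicator (Pi\<^sub>E I A) x
          = (\<Prod>i\<in>I. ennreal (f i (x i)) * indicator (A i) (x i))"
        by (simp add: prod.distrib prod_ennreal nonneg)
    qed
    also have "\<dots> = (\<Prod>i\<in>I. \<integral>\<^sup>+x. ennreal (f i x) * indicator (A i) x \<partial>M i)"
      by (rule P.product_nn_integral_prod[OF I]) auto
    also have "\<dots> = (\<Prod>i\<in>I. emeasure (density (M i) (f i)) (A i))"
      by (intro prod.cong refl) (simp add: emeasure_density)
    finally show "emeasure (density (PiM I M) (\<lambda>x. ennreal (\<Prod>i\<in>I. f i (x i)))) (Pi\<^sub>E I A) = \<dots>" .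
  qed
qed

lemma measurable_vec_lambda_PiM [measurable]:
  assumes "\<And>i. sets (N i) = sets borel"
  shows "(\<lambda>f. \<chi> i. f i) \<in> PiM UNIV N \<rightarrow>\<^sub>M (borel :: (real^'p) measure)"
proof (rule borel_measurable_euclidean_space[THEN iffD2], rule ballI)
  fix b :: "real^'p" assume "b \<in> Basis"
  then obtain i where "b = axis i 1" by (auto simp: Basis_vec_def)
  then have eq: "(\<lambda>f. (\<chi> i. f i) \<bullet> b) = (\<lambda>f. f i)"
    by (auto simp: inner_axis fun_eq_iff)
  have "(\<lambda>f. f i) \<in> measurable (PiM UNIV N) (N i)" by simp
  then show "(\<lambda>f. (\<chi> i. f i) \<bullet> b) \<in> borel_measurable (PiM UNIV N)"
    unfolding eq using assms by (simp cong: measurable_cong_sets)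
qed

lemma std_normal_vec_eq:
  "(std_normal_vec :: (real ^ 'p) measure) = distr (PiM UNIV (\<lambda>_::'p. std_normal_distribution)) borel (\<lambda>f. \<chi> i. f i)"
proof -
  have [measurable]: "(\<lambda>x::real^'p. x $ i) \<in> borel_measurable borel" for i
    by (rule borel_measurable_continuous_onI) (intro continuous_intros)
  have [measurable]: "(\<lambda>f. \<chi> i. f i) \<in> PiM UNIV (\<lambda>_. lborel) \<rightarrow>\<^sub>M (borel :: (real^'p) measure)"
    by (rule measurable_vec_lambda_PiM) simp
  have "(std_normal_vec :: (real ^ 'p) measure)
      = distr (density (PiM UNIV (\<lambda>_::'p. lborel)) (\<lambda>x. ennreal (\<Prod>i\<in>UNIV. std_normal_density (x i)))) borel (\<lambda>f. \<chi> i. f i)"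
    unfolding std_normal_vec_def by (subst distr_lborel_PiM_vec, subst density_distr) auto
  also have "density (PiM UNIV (\<lambda>_::'p. lborel)) (\<lambda>x. ennreal (\<Prod>i\<in>UNIV. std_normal_density (x i)))
      = PiM UNIV (\<lambda>_::'p. std_normal_distribution)"
    by (rule density_PiM)
       (auto intro!: lborel.sigma_finite_measure_axioms prob_space_imp_sigma_finite prob_space_normal_density)
  finally show ?thesis .
qed

lemma prob_space_std_normal_vec: "prob_space (std_normal_vec :: (real ^ 'p) measure)"
  unfolding std_normal_vec_eq
  by (intro prob_space.prob_space_distr prob_space_PiM prob_space_normal_density
      measurable_vec_lambda_PiM) auto

lemma sets_std_normal_vec [measurable_cong, simp]: "sets std_normal_vec = sets borel"
  by (simp add: std_normal_vec_def)

lemma integral_iexp_std_normal_vec: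
  fixes t :: "real ^ 'p"
  shows "(\<integral>z. iexp (t \<bullet> z) \<partial>std_normal_vec) = of_real (exp (- (norm t)\<^sup>2 / 2))"
proof -
  interpret N: prob_space std_normal_distribution
    by (rule prob_space_normal_density) simp
  interpret product_sigma_finite "\<lambda>_::'p. std_normal_distribution" ..
  have "(\<integral>z. iexp (t \<bullet> z) \<partial>std_normal_vec)
      = (\<integral>f. iexp (t \<bullet> (\<chi> i. f i)) \<partial>PiM UNIV (\<lambda>_::'p. std_normal_distribution))"
    unfolding std_normal_vec_eq by (rule integral_distr) (auto intro!: measurable_vec_lambda_PiM)
  also have "\<dots> = (\<integral>f. (\<Prod>i\<in>UNIV. iexp (t $ i * f i)) \<partial>PiM UNIV (\<lambda>_::'p. std_normal_distribution))"
    by (simp add: inner_vec_def sum_distrib_left exp_sum)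
  also have "\<dots> = (\<Prod>i\<in>UNIV. \<integral>x. iexp (t $ i * x) \<partial>std_normal_distribution)"
    by (rule product_integral_prod) (auto intro!: N.integrable_iexp)
  also have "\<dots> = (\<Prod>i\<in>UNIV. of_real (exp (- (t $ i)\<^sup>2 / 2)))"
    using char_std_normal_distribution by (simp add: char_def fun_eq_iff)
  also have "\<dots> = of_real (exp (- (\<Sum>i\<in>UNIV. (t $ i)\<^sup>2) / 2))"
    by (simp add: exp_sum[symmetric] sum_divide_distrib sum_negf flip: of_real_prod)
  also have "(\<Sum>i\<in>UNIV. (t $ i)\<^sup>2) = (norm t)\<^sup>2"
    unfolding power2_norm_eq_inner inner_vec_def by (simp add: power2_eq_square)
  finally show ?thesis .
qed

lemma borel_measurable_matrix_vector_mult [measurable (raw)]: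
  fixes A :: "'a \<Rightarrow> real ^ 'n ^ 'm" and v :: "'a \<Rightarrow> real ^ 'n"
  assumes "A \<in> borel_measurable M" "v \<in> borel_measurable M"
  shows "(\<lambda>x. A x *v v x) \<in> borel_measurable M"
proof (rule borel_measurable_continuous_Pair[OF assms])
  show "continuous_on UNIV (\<lambda>x :: (real ^ 'n ^ 'm) \<times> (real ^ 'n). fst x *v snd x)"
    unfolding matrix_vector_mult_def by (intro continuous_intros)
qed

lemma prob_space_mv_normal: "prob_space (mv_normal \<mu> S)"
proof -
  interpret prob_space "std_normal_vec :: (real^'a) measure"
    by (rule prob_space_std_normal_vec)
  show ?thesis
    unfolding mv_normal_def by (rule prob_space_distr) measurable
qed

lemma sets_mv_normal [measurable_cong, simp]: "sets (mv_normal \<mu> S) = sets borel"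
  by (simp add: mv_normal_def)

lemma cos_add_eq_Re_iexp: "cos (x + s) = Re (iexp s * iexp x)"
  by (simp add: exp_add[symmetric] Re_exp algebra_simps)

text \<open>The characteristic function at \<open>t\<close> is that of the standard normal law at
  \<open>transpose B *v t\<close>, so only \<open>B ** transpose B\<close> enters, whichever factor
  was chosen. The phase \<open>s\<close> carries the imaginary part along.\<close>

lemma integral_cos_mv_normal:
  fixes S :: "real ^ 'p ^ 'p"
  assumes "transpose S = S" "\<And>x. 0 \<le> x \<bullet> (S *v x)"
  shows "(\<integral>x. cos (t \<bullet> x + s) \<partial>mv_normal 0 S) = cos s * exp (- (t \<bullet> (S *v t)) / 2)"
proof -
  interpret Z: prob_space "std_normal_vec :: (real^'p) measure"
    by (rule prob_space_std_normal_vec)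
  define B where "B = (SOME B :: real ^ 'p ^ 'p. B ** transpose B = S)"
  have B: "B ** transpose B = S"
    unfolding B_def by (rule someI_ex[OF psd_matrix_factor[OF assms]])
  have Bm: "(\<lambda>z. B *v z) \<in> borel_measurable borel"
    by measurable
  define u where "u = transpose B *v t"
  have u: "t \<bullet> (B *v z) = u \<bullet> z" for z
    unfolding u_def by (simp add: dot_lmul_matrix[symmetric])
  have "(\<integral>x. cos (t \<bullet> x + s) \<partial>mv_normal 0 S) = (\<integral>z. cos (t \<bullet> (0 + B *v z) + s) \<partial>std_normal_vec)"
    unfolding mv_normal_def B_def[symmetric] by (rule integral_distr) (use Bm in auto)
  also have "\<dots> = (\<integral>z. Re (iexp s * iexp (u \<bullet> z)) \<partial>std_normal_vec)"
    by (simp only: cos_add_eq_Re_iexp u add_0)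
  also have "\<dots> = Re (\<integral>z. iexp s * iexp (u \<bullet> z) \<partial>std_normal_vec)"
    by (intro integral_Re integrable_mult_right Z.integrable_iexp) auto
  also have "\<dots> = cos s * exp (- (norm u)\<^sup>2 / 2)"
    unfolding integral_mult_right_zero integral_iexp_std_normal_vec by (simp add: Re_exp)
  also have "(norm u)\<^sup>2 = t \<bullet> (B *v u)"
    by (simp only: power2_norm_eq_inner u)
  also have "B *v u = S *v t"
    by (simp only: u_def matrix_vector_mul_assoc B)
  finally show ?thesis .
qed

section \<open>Trigonometric test functions\<close>

text \<open>The real span of the characters: the phase \<open>s\<close> supplies the sines and
  \<open>t = 0\<close> the constants. Real functions are used because \<open>real_cond_exp\<close>
  conditions real variables.\<close>

inductive trig_function :: "('a::real_inner \<Rightarrow> real) \<Rightarrow> bool" where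
  cos: "trig_function (\<lambda>x. cos (t \<bullet> x + s))"
| add: "trig_function f \<Longrightarrow> trig_function g \<Longrightarrow> trig_function (\<lambda>x. f x + g x)"
| scale: "trig_function f \<Longrightarrow> trig_function (\<lambda>x. c * f x)"

text \<open>Product-to-sum on the generators, extended bilinearly. This makes the class an algebra,
  as Stone--Weierstrass requires.\<close>

lemma trig_function_mult:
  assumes "trig_function f" "trig_function g"
  shows "trig_function (\<lambda>x. f x * g x)"
  using assms
proof (induction f rule: trig_function.induct)
  case (cos t s)
  show ?case
    using cos
  proof (induction g rule: trig_function.induct)
    case (cos u r)
    have "(\<lambda>x. cos (t \<bullet> x + s) * cos (u \<bullet> x + r))
      = (\<lambda>x. (1/2) * cos ((t - u) \<bullet> x + (s - r)) + (1/2) * cos ((t + u) \<bullet> x + (s + r)))"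
    proof
      fix x
      have "(t - u) \<bullet> x + (s - r) = (t \<bullet> x + s) - (u \<bullet> x + r)"
        "(t + u) \<bullet> x + (s + r) = (t \<bullet> x + s) + (u \<bullet> x + r)"
        by (simp_all add: inner_add_left inner_diff_left)
      then show "cos (t \<bullet> x + s) * cos (u \<bullet> x + r)
          = (1/2) * cos ((t - u) \<bullet> x + (s - r)) + (1/2) * cos ((t + u) \<bullet> x + (s + r))"
        by (simp only: cos_times_cos) (simp add: add_divide_distrib)
    qed
    then show ?case
      by (simp only:) (intro trig_function.intros)
  next
    case (add f g)
    then show ?case
      using trig_function.add[of "\<lambda>x. cos (t \<bullet> x + s) * f x"] by (simp add: distrib_left)
  next
    case (scale f c)
    then show ?case
      using trig_function.scale[of "\<lambda>x. cos (t \<bullet> x + s) * f x" c] by (simp add: mult.left_commute)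
  qed
next
  case (add f h)
  then show ?case
    using trig_function.add[of "\<lambda>x. f x * g x"] by (simp add: distrib_right)
next
  case (scale f c)
  then show ?case
    using trig_function.scale[of "\<lambda>x. f x * g x" c] by (simp add: mult.assoc)
qed

lemma trig_function_continuous: "trig_function f \<Longrightarrow> continuous_on UNIV f"
  by (induction rule: trig_function.induct) (intro continuous_intros | assumption)+

lemma trig_function_bounded: "trig_function f \<Longrightarrow> bounded (range f)"
proof (induction rule: trig_function.induct)
  case (cos t s)
  then show ?case by (intro boundedI[of _ 1]) auto
next
  case (add f g)
  then obtain F G where "\<And>x. \<bar>f x\<bar> \<le> F" "\<And>x. \<bar>g x\<bar> \<le> G"
    by (auto simp: bounded_iff)
  then show ?case
    by (intro boundedI[of _ "F + G"]) (auto intro: order_trans[OF abs_triangle_ineq] add_mono)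
next
  case (scale f c)
  then obtain F where "\<And>x. \<bar>f x\<bar> \<le> F"
    by (auto simp: bounded_iff)
  then show ?case
    by (intro boundedI[of _ "\<bar>c\<bar> * F"]) (auto simp: abs_mult mult_left_mono)
qed

text \<open>The approximant is a polynomial in the functions \<open>sin (c (x \<bullet> b))\<close>; its values on the
  whole space are already taken on the box, so it stays bounded outside the box.\<close>

lemma trig_function_approx:
  fixes g :: "'a::euclidean_space \<Rightarrow> real"
  assumes g: "continuous_on UNIV g" and G: "\<And>x. \<bar>g x\<bar> \<le> G" and K: "0 < K" and e: "0 < e"
  obtains q where "trig_function q" "\<And>x. \<bar>q x\<bar> \<le> G + e" "\<And>x. norm x \<le> K \<Longrightarrow> \<bar>g x - q x\<bar> \<le> e"
proof -
  \<comment> \<open>This scale maps \<open>[-K, K]\<close> onto \<open>[-pi/2, pi/2]\<close>, where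
    the sine is injective, so the coordinate sines separate the points of the box.\<close>
  define c where "c = pi / (2 * K)"
  have c: "0 < c" using K by (simp add: c_def)
  define S where "S = cbox ((\<Sum>b\<in>Basis. (- K) *\<^sub>R b)) (\<Sum>b\<in>Basis. K *\<^sub>R b :: 'a)"
  have S: "x \<in> S \<longleftrightarrow> (\<forall>b\<in>Basis. \<bar>x \<bullet> b\<bar> \<le> K)" for x
    unfolding S_def mem_box by (intro ball_cong refl) (simp only: inner_sum_left_Basis, auto)
  define R where "R = {f. trig_function f \<and>
    (\<forall>x y. (\<forall>b\<in>Basis. sin (c * (x \<bullet> b)) = sin (c * (y \<bullet> b))) \<longrightarrow> f x = f (y::'a))}"
  have range: "\<bar>c * (x \<bullet> b)\<bar> \<le> pi / 2" if "x \<in> S" "b \<in> Basis" for x b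
  proof -
    have "c * \<bar>x \<bullet> b\<bar> \<le> c * K" using that c by (auto simp: S)
    then show ?thesis using K c by (simp add: abs_mult c_def)
  qed
  interpret function_ring_on R S
  proof
    show "compact S" by (simp add: S_def)
    show "continuous_on S f" if "f \<in> R" for f
      using that trig_function_continuous[of f] by (auto simp: R_def intro: continuous_on_subset)
    show "(\<lambda>x. f x + h x) \<in> R" if "f \<in> R" "h \<in> R" for f h
      using that unfolding R_def by (auto intro!: trig_function.add) metis+
    show "(\<lambda>x. f x * h x) \<in> R" if "f \<in> R" "h \<in> R" for f h
      using that unfolding R_def by (auto intro!: trig_function_mult) metis+
    show "(\<lambda>_. r) \<in> R" for r
      using trig_function.scale[OF trig_function.cos[of 0 0], of r] by (simp add: R_def)
    show "\<exists>f\<in>R. f x \<noteq> f y" if xy: "x \<in> S" "y \<in> S" "x \<noteq> y" for x y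
    proof -
      obtain b where b: "b \<in> Basis" "x \<bullet> b \<noteq> y \<bullet> b"
        using xy(3) by (auto simp: euclidean_eq_iff[of x y])
      have "trig_function (\<lambda>x. cos ((c *\<^sub>R b) \<bullet> x + (- pi/2)))"
        by (rule trig_function.cos)
      also have "(\<lambda>x. cos ((c *\<^sub>R b) \<bullet> x + (- pi/2))) = (\<lambda>x. sin (c * (x \<bullet> b)))"
        by (simp add: fun_eq_iff cos_diff inner_commute[of b])
      finally have "(\<lambda>x. sin (c * (x \<bullet> b))) \<in> R"
        using b by (auto simp: R_def)
      moreover have "sin (c * (x \<bullet> b)) \<noteq> sin (c * (y \<bullet> b))"
      proof
        assume eq: "sin (c * (x \<bullet> b)) = sin (c * (y \<bullet> b))"
        have bd: "- (pi / 2) \<le> c * (z \<bullet> b)" "c * (z \<bullet> b) \<le> pi / 2" if "z \<in> S" for z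
          using abs_le_D1[OF range[OF that b(1)]] abs_le_D2[OF range[OF that b(1)]] by simp_all
        have "c * (x \<bullet> b) = c * (y \<bullet> b)"
          by (rule sin_inj_pi[OF bd(1,2)[OF xy(1)] bd(1,2)[OF xy(2)] eq])
        then show False using b c by simp
      qed
      ultimately show ?thesis
        by (intro bexI[of _ "\<lambda>x. sin (c * (x \<bullet> b))"])
    qed
  qed
  obtain q where q: "q \<in> R" "\<And>x. x \<in> S \<Longrightarrow> \<bar>g x - q x\<bar> < e"
    using Stone_Weierstrass_basic[OF continuous_on_subset[OF g subset_UNIV] e] by blast
  show thesis
  proof
    show "trig_function q" using q by (simp add: R_def)
    show "\<bar>g x - q x\<bar> \<le> e" if "norm x \<le> K" for x
      using q(2)[of x] that by (auto simp: S intro: less_imp_le order_trans[OF Basis_le_norm])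
    show "\<bar>q x\<bar> \<le> G + e" for x
    proof -
      \<comment> \<open>Folding every coordinate back by \<open>arcsin\<close> gives a point of the
        box with the same sines as \<open>x\<close>, hence with the same value of
        \<open>q\<close>.\<close>
      define y where "y = (\<Sum>b\<in>Basis. (arcsin (sin (c * (x \<bullet> b))) / c) *\<^sub>R b)"
      have yb: "y \<bullet> b = arcsin (sin (c * (x \<bullet> b))) / c" if "b \<in> Basis" for b
        unfolding y_def using that by (rule inner_sum_left_Basis)
      have "\<bar>arcsin (sin u)\<bar> \<le> pi / 2" for u
        using arcsin_bounded[of "sin u"] by (auto simp: abs_le_iff)
      then have "\<bar>arcsin (sin u) / c\<bar> \<le> K" for u
        using c K by (simp add: c_def field_simps abs_mult)
      then have "y \<in> S" by (simp add: S yb)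
      moreover have "q x = q y"
        using q(1) yb c unfolding R_def by auto
      ultimately show ?thesis
        using q(2)[of y] G[of y] by (simp add: abs_le_iff) linarith
    qed
  qed
qed

lemma prob_space_tight:
  fixes \<nu> :: "'a::real_normed_vector measure"
  assumes "prob_space \<nu>" and [measurable_cong]: "sets \<nu> = sets borel" and e: "0 < e"
  shows "\<exists>K. measure \<nu> {x. K < norm x} \<le> e"
proof -
  interpret prob_space \<nu> by fact
  have sp: "space \<nu> = UNIV" using sets_eq_imp_space_eq[OF assms(2)] by simp
  have "(\<lambda>k. measure \<nu> {x. real k < norm x}) \<longlonglongrightarrow> measure \<nu> (\<Inter>k. {x. real k < norm x})"
  proof (rule finite_Lim_measure_decseq)
    have "{x \<in> space \<nu>. real k < norm x} \<in> sets \<nu>" for k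
      by measurable
    then show "range (\<lambda>k. {x. real k < norm x}) \<subseteq> sets \<nu>" by (auto simp: sp)
    show "decseq (\<lambda>k. {x::'a. real k < norm x})"
      by (auto simp: decseq_def)
  qed
  also have "(\<Inter>k. {x::'a. real k < norm x}) = {}"
    using reals_Archimedean2 by (auto simp: not_less intro: less_imp_le) (metis not_less_iff_gr_or_eq reals_Archimedean2)
  finally have "(\<lambda>k. measure \<nu> {x. real k < norm x}) \<longlonglongrightarrow> 0" by simp
  then have "eventually (\<lambda>k. measure \<nu> {x. real k < norm x} < e) sequentially"
    using e by (rule order_tendstoD)
  then obtain k where "measure \<nu> {x. real k < norm x} < e"
    by (auto simp: eventually_sequentially)
  then show ?thesis by (intro exI[of _ "real k"]) simp
qed

text \<open>\<open>\<Phi> n\<close> is an abstract sublinear error functional. It is instantiated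
  once with the error of an expectation and once with the mean absolute error of a conditional
  expectation. The hypothesis \<open>bound\<close> lets the error outside a large ball be charged to
  the tails of \<open>\<mu> n\<close> and \<open>\<nu>\<close>.\<close>

lemma trig_test_convergence:
  fixes \<Phi> :: "nat \<Rightarrow> ('a::euclidean_space \<Rightarrow> real) \<Rightarrow> real"
    and \<mu> :: "nat \<Rightarrow> 'a measure" and \<nu> :: "'a measure"
  assumes \<mu>: "\<And>n. n \<ge> 1 \<Longrightarrow> prob_space (\<mu> n)" "\<And>n. n \<ge> 1 \<Longrightarrow> sets (\<mu> n) = sets borel"
    and \<nu>: "prob_space \<nu>" "sets \<nu> = sets borel"
    and tight: "\<And>e. 0 < e \<Longrightarrow> \<exists>K. eventually (\<lambda>n. measure (\<mu> n) {x. K < norm x} \<le> e) sequentially"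
    and nonneg: "\<And>n f. n \<ge> 1 \<Longrightarrow> 0 \<le> \<Phi> n f"
    and add: "\<And>n f h. n \<ge> 1 \<Longrightarrow> continuous_on UNIV f \<Longrightarrow> bounded (range f) \<Longrightarrow>
      continuous_on UNIV h \<Longrightarrow> bounded (range h) \<Longrightarrow> \<Phi> n (\<lambda>x. f x + h x) \<le> \<Phi> n f + \<Phi> n h"
    and scale: "\<And>n f c. n \<ge> 1 \<Longrightarrow> continuous_on UNIV f \<Longrightarrow> bounded (range f) \<Longrightarrow>
      \<Phi> n (\<lambda>x. c * f x) \<le> \<bar>c\<bar> * \<Phi> n f"
    and bound: "\<And>n f. n \<ge> 1 \<Longrightarrow> continuous_on UNIV f \<Longrightarrow> bounded (range f) \<Longrightarrow>
      \<Phi> n f \<le> (\<integral>x. \<bar>f x\<bar> \<partial>\<mu> n) + (\<integral>x. \<bar>f x\<bar> \<partial>\<nu>)"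
    and cos: "\<And>t s. (\<lambda>n. \<Phi> n (\<lambda>x. cos (t \<bullet> x + s))) \<longlonglongrightarrow> 0"
    and g: "continuous_on UNIV g" "bounded (range g)"
  shows "(\<lambda>n. \<Phi> n g) \<longlonglongrightarrow> 0"
proof -
  have ge1: "eventually (\<lambda>n::nat. n \<ge> 1) sequentially"
    by (rule eventually_ge_at_top)
  have squeeze: "f \<longlonglongrightarrow> 0"
    if "h \<longlonglongrightarrow> 0" "eventually (\<lambda>n. f n \<le> h n) sequentially" "eventually (\<lambda>n. 0 \<le> f n) sequentially"
    for f h :: "nat \<Rightarrow> real"
    using that by (intro tendsto_sandwich[OF that(3,2) tendsto_const that(1)])
  have trig: "(\<lambda>n. \<Phi> n q) \<longlonglongrightarrow> 0" if "trig_function q" for q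
    using that
  proof (induction rule: trig_function.induct)
    case (cos t s)
    then show ?case by (rule assms(10))
  next
    case (add f h)
    have "(\<lambda>n. \<Phi> n f + \<Phi> n h) \<longlonglongrightarrow> 0"
      using tendsto_add[OF add.IH] by simp
    moreover have "eventually (\<lambda>n. \<Phi> n (\<lambda>x. f x + h x) \<le> \<Phi> n f + \<Phi> n h) sequentially"
      using ge1 by eventually_elim
        (intro assms(7) trig_function_continuous trig_function_bounded add.hyps; simp)
    ultimately show ?case
      using eventually_mono[OF ge1 nonneg] by (rule squeeze)
  next
    case (scale f c)
    have "(\<lambda>n. \<bar>c\<bar> * \<Phi> n f) \<longlonglongrightarrow> 0"
      using tendsto_mult_left[OF scale.IH, of "\<bar>c\<bar>"] by simp
    moreover have "eventually (\<lambda>n. \<Phi> n (\<lambda>x. c * f x) \<le> \<bar>c\<bar> * \<Phi> n f) sequentially"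
      using ge1 by eventually_elim
        (intro assms(8) trig_function_continuous trig_function_bounded scale.hyps; simp)
    ultimately show ?case
      using eventually_mono[OF ge1 nonneg] by (rule squeeze)
  qed
  obtain G where G: "0 < G" "\<And>x. \<bar>g x\<bar> \<le> G"
    using g(2) unfolding bounded_pos by auto
  show ?thesis
  proof (rule order_tendstoI)
    fix e :: real assume "e < 0"
    show "eventually (\<lambda>n. e < \<Phi> n g) sequentially"
      by (rule eventually_mono[OF ge1]) (rule less_le_trans[OF \<open>e < 0\<close> nonneg])
  next
    fix e :: real assume e: "0 < e"
    \<comment> \<open>The remainder will cost \<open>(2 * G + 2) * d\<close> under each of the two
      laws, and \<open>d\<close> makes the total at most \<open>e / 2\<close>. The cap at 1 absorbs
      a term quadratic in \<open>d\<close>.\<close>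
    define d where "d = min 1 (e / (8 * (G + 1)))"
    have d: "0 < d" "d \<le> 1" and d_le: "(4 * G + 4) * d \<le> e / 2"
    proof -
      show "0 < d" "d \<le> 1" using e G by (auto simp: d_def)
      have "(4 * G + 4) * d \<le> (4 * G + 4) * (e / (8 * (G + 1)))"
        using G by (intro mult_left_mono) (auto simp: d_def)
      also have "\<dots> = e / 2" using G by (simp add: field_simps)
      finally show "(4 * G + 4) * d \<le> e / 2" .
    qed
    obtain K1 where K1: "eventually (\<lambda>n. measure (\<mu> n) {x. K1 < norm x} \<le> d) sequentially"
      using tight[OF d(1)] by blast
    obtain K2 where K2: "measure \<nu> {x. K2 < norm x} \<le> d"
      using prob_space_tight[OF \<nu> d(1)] by blast
    define K where "K = max 1 (max K1 K2)"
    obtain q where q: "trig_function q" "\<And>x. \<bar>q x\<bar> \<le> G + d" "\<And>x. norm x \<le> K \<Longrightarrow> \<bar>g x - q x\<bar> \<le> d"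
    proof (rule trig_function_approx[OF g(1) G(2) _ d(1)])
      show "0 < K" by (simp add: K_def)
    qed blast
    note qcont = trig_function_continuous[OF q(1)] and qbdd = trig_function_bounded[OF q(1)]
    define r where "r x = g x - q x" for x
    have r: "continuous_on UNIV r" "bounded (range r)"
      unfolding r_def using g qcont qbdd bounded_minus_comp[of g UNIV q]
      by (auto intro!: continuous_intros)
    \<comment> \<open>Inside the ball the approximation error is at most \<open>d\<close>; outside,
      \<open>g\<close> and \<open>q\<close> are bounded by \<open>G\<close> and
      \<open>G + d\<close>.\<close>
    have r_le: "\<bar>r x\<bar> \<le> d + (2 * G + d) * indicator {x. L < norm x} x" if "L \<le> K" for x L
      using q(2)[of x] q(3)[of x] G(2)[of x] d that by (auto simp: r_def indicator_def)
    have int_r: "(\<integral>x. \<bar>r x\<bar> \<partial>\<rho>) \<le> (2 * G + 2) * d"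
      if "prob_space \<rho>" "sets \<rho> = sets borel" "measure \<rho> {x. L < norm x} \<le> d" "L \<le> K"
      for \<rho> :: "'a measure" and L
    proof -
      interpret prob_space \<rho> by fact
      note [measurable_cong] = that(2)
      have sp: "space \<rho> = UNIV" using sets_eq_imp_space_eq[OF that(2)] by simp
      have "{x \<in> space \<rho>. L < norm x} \<in> sets \<rho>" by measurable
      then have m: "{x. L < norm x} \<in> sets \<rho>" by (simp add: sp)
      have ind: "integrable \<rho> (indicat_real {x. L < norm x})"
        using m by (intro integrable_real_indicator) (simp_all add: less_top[symmetric])
      have rm: "r \<in> borel_measurable \<rho>"
        using borel_measurable_continuous_onI[OF r(1)] by measurable
      have "(\<integral>x. \<bar>r x\<bar> \<partial>\<rho>) \<le> (\<integral>x. d + (2 * G + d) * indicator {x. L < norm x} x \<partial>\<rho>)"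
      proof (rule integral_mono)
        show "integrable \<rho> (\<lambda>x. \<bar>r x\<bar>)"
          by (rule integrable_const_bound[where B="d + (2 * G + d)"])
             (use r_le[OF that(4)] rm d G in \<open>auto intro!: AE_I2 order_trans[OF r_le[OF that(4)]] simp: indicator_def\<close>)
        show "integrable \<rho> (\<lambda>x. d + (2 * G + d) * indicator {x. L < norm x} x)"
          by (intro Bochner_Integration.integrable_add integrable_mult_right integrable_const ind)
        show "\<bar>r x\<bar> \<le> d + (2 * G + d) * indicator {x. L < norm x} x" for x by (rule r_le[OF that(4)])
      qed
      also have "\<dots> = d + (2 * G + d) * measure \<rho> {x. L < norm x}"
        using m ind by (subst Bochner_Integration.integral_add) (simp_all add: sp prob_space[unfolded sp])
      also have "\<dots> \<le> d + (2 * G + 1) * d"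
        using d G that(3) by (intro add_left_mono mult_mono) auto
      also have "\<dots> = (2 * G + 2) * d" by (simp add: algebra_simps)
      finally show ?thesis .
    qed
    have "eventually (\<lambda>n. \<Phi> n q < e / 2) sequentially"
      using trig[OF q(1)] e by (intro order_tendstoD) auto
    with K1 ge1 show "eventually (\<lambda>n. \<Phi> n g < e) sequentially"
    proof eventually_elim
      case (elim n)
      have "\<Phi> n g = \<Phi> n (\<lambda>x. q x + r x)" by (simp add: r_def)
      also have "\<dots> \<le> \<Phi> n q + \<Phi> n r"
        by (intro assms(7) r qcont qbdd elim)
      also have "\<Phi> n r \<le> (2 * G + 2) * d + (2 * G + 2) * d"
      proof -
        have "K1 \<le> K" "K2 \<le> K" by (simp_all add: K_def)
        then show ?thesis
          using bound[OF elim(2) r] int_r[OF \<mu>[OF elim(2)] elim(1)] int_r[OF \<nu> K2] by linarith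
      qed
      also have "\<dots> \<le> e / 2" using d_le by (simp add: algebra_simps)
      finally show ?case using elim by simp
    qed
  qed
qed

section \<open>Products of characteristic functions\<close>

text \<open>The i.i.d. central limit theorem for characteristic functions: the second-order
  expansion is raised to the power \<open>k\<close> and compared with
  \<open>(1 - r / (2 k)) ^ k\<close>. As only second moments are available, the remainder is handled
  by dominated convergence.\<close>

lemma (in real_distribution) char_power_tendsto:
  assumes sq: "integrable M (\<lambda>x. x\<^sup>2)" and mean: "expectation (\<lambda>x. x) = 0"
    and var: "expectation (\<lambda>x. x\<^sup>2) = r"
  shows "(\<lambda>k. char M (1 / sqrt (real k)) ^ k) \<longlonglongrightarrow> of_real (exp (- r / 2))"
proof -
  have int1: "integrable M (\<lambda>x. x)"
    by (rule square_integrable_imp_integrable[OF _ sq]) simp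
  have r: "0 \<le> r" unfolding var[symmetric] by simp
  \<comment> \<open>The remainder bound of \<open>char_approx3\<close>. The minimum keeps it
    dominated by \<open>6 * x\<^sup>2\<close>, while the cubic branch tends to 0 pointwise.\<close>
  define E where "E k = (\<integral>x. min (6 * x\<^sup>2) (\<bar>1 / sqrt (real k)\<bar> * \<bar>x\<bar> ^ 3) \<partial>M)" for k
  have "(\<lambda>k. E k) \<longlonglongrightarrow> (\<integral>x. 0 \<partial>M)"
    unfolding E_def
  proof (rule integral_dominated_convergence[where w="\<lambda>x. 6 * x\<^sup>2"])
    have "(\<lambda>k. min (6 * x\<^sup>2) (\<bar>1 / sqrt (real k)\<bar> * \<bar>x\<bar> ^ 3)) \<longlonglongrightarrow> min (6 * x\<^sup>2) (0 * \<bar>x\<bar> ^ 3)" for x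
    proof -
      have "(\<lambda>k. \<bar>1 / sqrt (real k)\<bar>) \<longlonglongrightarrow> \<bar>0\<bar>"
        by (intro tendsto_rabs tendsto_divide_0[OF tendsto_const] filterlim_at_top_imp_at_infinity
            filterlim_compose[OF sqrt_at_top filterlim_real_sequentially])
      then show ?thesis by (intro tendsto_intros) simp
    qed
    then show "AE x in M. (\<lambda>k. min (6 * x\<^sup>2) (\<bar>1 / sqrt (real k)\<bar> * \<bar>x\<bar> ^ 3)) \<longlonglongrightarrow> 0"
      by (simp add: min_absorb2)
  qed (use sq in auto)
  then have E: "E \<longlonglongrightarrow> 0" by simp
  have main: "eventually (\<lambda>k. norm (char M (1 / sqrt (real k)) ^ k - of_real ((1 + (- r / 2) / real k) ^ k)) \<le> E k / 6) sequentially"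
    using eventually_ge_at_top[of "Suc (nat \<lceil>r\<rceil>)"]
  proof eventually_elim
    case (elim k)
    then have k: "0 < real k" "r \<le> real k" by linarith+
    let ?w = "of_real (1 + (- r / 2) / real k) :: complex"
    have "(1 / sqrt (real k))\<^sup>2 = 1 / real k" using k by (simp add: power_divide)
    then have *: "norm (char M (1 / sqrt (real k)) - ?w) \<le> (1 / real k) / 6 * E k"
      using char_approx3[OF int1 mean sq, of r "1 / sqrt (real k)"] mean var
      by (simp add: E_def field_simps)
    \<comment> \<open>This is where \<open>r \<le> real k\<close> enters: the difference of two
      \<open>k\<close>-th powers is bounded by \<open>k\<close> times the difference of the bases
      for bases in the closed unit disc.\<close>
    have "\<bar>1 + (- r / 2) / real k\<bar> \<le> 1"
      using k r by (simp add: abs_le_iff field_simps)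
    then have "norm (char M (1 / sqrt (real k)) ^ k - ?w ^ k) \<le> k * norm (char M (1 / sqrt (real k)) - ?w)"
      by (intro norm_power_diff cmod_char_le_1) (simp only: norm_of_real)
    also have "\<dots> \<le> real k * ((1 / real k) / 6 * E k)"
      by (intro mult_left_mono *) simp
    also have "\<dots> = E k / 6" using k by simp
    finally show ?case by (simp only: of_real_power)
  qed
  have "(\<lambda>k. complex_of_real ((1 + (- r / 2) / real k) ^ k)) \<longlonglongrightarrow> of_real (exp (- r / 2))"
    by (intro tendsto_of_real tendsto_exp_limit_sequentially)
  moreover have "(\<lambda>k. E k / 6) \<longlonglongrightarrow> 0"
    using tendsto_divide[OF E tendsto_const, of 6] by simp
  ultimately show ?thesis
    using Lim_transform[OF _ Lim_null_comparison[OF main]] by blast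
qed

text \<open>Averaging \<open>char \<rho>\<close> over a random scale with law \<open>\<mu>\<close>
  gives the characteristic function of a product of independent variables. The factor with law
  \<open>\<rho>\<close> is centred, so the product has mean 0 and variance \<open>r * q\<close>
  whatever the mean of \<open>\<mu>\<close>.\<close>

lemma char_mixture_power_tendsto:
  assumes "real_distribution \<mu>" "real_distribution \<rho>"
    and \<mu>: "integrable \<mu> (\<lambda>x. x\<^sup>2)" "(\<integral>x. x\<^sup>2 \<partial>\<mu>) = r"
    and \<rho>: "integrable \<rho> (\<lambda>x. x\<^sup>2)" "(\<integral>x. x \<partial>\<rho>) = 0" "(\<integral>x. x\<^sup>2 \<partial>\<rho>) = q"
  shows "(\<lambda>k. (\<integral>x. char \<rho> (x / sqrt (real k)) \<partial>\<mu>) ^ k) \<longlonglongrightarrow> of_real (exp (- (r * q) / 2))"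
proof -
  interpret \<mu>: real_distribution \<mu> by fact
  interpret \<rho>: real_distribution \<rho> by fact
  interpret pair_prob_space \<mu> \<rho> ..
  define L where "L = distr (\<mu> \<Otimes>\<^sub>M \<rho>) borel (\<lambda>(x, y). x * y)"
  interpret L: real_distribution L
    unfolding L_def by (rule real_distribution_distr) measurable
  have sq_int: "integrable (\<mu> \<Otimes>\<^sub>M \<rho>) (\<lambda>(x, y). x\<^sup>2 * y\<^sup>2)"
  proof (rule Fubini_integrable)
    show "integrable \<mu> (\<lambda>x. \<integral>y. norm (case (x, y) of (x, y) \<Rightarrow> x\<^sup>2 * y\<^sup>2) \<partial>\<rho>)"
      using \<mu>(1) by (simp add: abs_mult)
    show "AE x in \<mu>. integrable \<rho> (\<lambda>y. case (x, y) of (x, y) \<Rightarrow> x\<^sup>2 * y\<^sup>2)"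
      using \<rho>(1) by simp
  qed measurable
  have int1: "integrable (\<mu> \<Otimes>\<^sub>M \<rho>) (\<lambda>(x, y). x * y)"
    by (rule square_integrable_imp_integrable)
       (use sq_int in \<open>simp_all add: case_prod_beta' power_mult_distrib\<close>)
  have "(\<lambda>k. char L (1 / sqrt (real k)) ^ k) \<longlonglongrightarrow> of_real (exp (- (r * q) / 2))"
  proof (rule L.char_power_tendsto)
    show "integrable L (\<lambda>x. x\<^sup>2)"
      unfolding L_def by (subst integrable_distr_eq)
        (use sq_int in \<open>simp_all add: case_prod_beta' power_mult_distrib\<close>)
    have "L.expectation (\<lambda>x. x) = (\<integral>z. (case z of (x, y) \<Rightarrow> x * y) \<partial>(\<mu> \<Otimes>\<^sub>M \<rho>))"
      unfolding L_def by (subst integral_distr) simp_all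
    also have "\<dots> = (\<integral>x. \<integral>y. x * y \<partial>\<rho> \<partial>\<mu>)"
      using int1 by (subst integral_fst'[symmetric]) simp_all
    finally show "L.expectation (\<lambda>x. x) = 0" using \<rho>(2) by simp
    have "L.expectation (\<lambda>x. x\<^sup>2) = (\<integral>z. (case z of (x, y) \<Rightarrow> x\<^sup>2 * y\<^sup>2) \<partial>(\<mu> \<Otimes>\<^sub>M \<rho>))"
      unfolding L_def by (subst integral_distr) (simp_all add: case_prod_beta' power_mult_distrib)
    also have "\<dots> = (\<integral>x. \<integral>y. x\<^sup>2 * y\<^sup>2 \<partial>\<rho> \<partial>\<mu>)"
      using sq_int by (subst integral_fst'[symmetric]) simp_all
    finally show "L.expectation (\<lambda>x. x\<^sup>2) = r * q"
      using \<rho>(3) \<mu>(2) by simp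
  qed
  moreover have "char L (1 / sqrt (real k)) = (\<integral>x. char \<rho> (x / sqrt (real k)) \<partial>\<mu>)" for k
  proof -
    have "char L (1 / sqrt (real k)) = (\<integral>z. (case z of (x, y) \<Rightarrow> iexp (x / sqrt (real k) * y)) \<partial>(\<mu> \<Otimes>\<^sub>M \<rho>))"
      unfolding L_def char_def by (subst integral_distr) (simp_all add: case_prod_beta')
    also have "\<dots> = (\<integral>x. \<integral>y. iexp (x / sqrt (real k) * y) \<partial>\<rho> \<partial>\<mu>)"
    proof (subst integral_fst'[symmetric])
      show "integrable (\<mu> \<Otimes>\<^sub>M \<rho>) (\<lambda>(x, y). iexp (x / sqrt (real k) * y))"
        by (rule integrable_const_bound[where B=1]) (auto simp: case_prod_beta')
    qed simp
    finally show ?thesis by (simp add: char_def)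
  qed
  ultimately show ?thesis by simp
qed

text \<open>Applied with \<open>\<rho>'\<close> the law of \<open>E - E'\<close>, for independent \<open>E, E'\<close> with law \<open>\<rho>\<close>: the second
  moment of the product of characteristic functions is then again a product of characteristic
  functions.\<close>

lemma char_product_L2:
  assumes "real_distribution \<mu>" "real_distribution \<rho>"
    and \<mu>: "integrable \<mu> (\<lambda>x. x\<^sup>2)" "(\<integral>x. x\<^sup>2 \<partial>\<mu>) = r"
    and \<rho>: "integrable \<rho> (\<lambda>x. x\<^sup>2)" "(\<integral>x. x \<partial>\<rho>) = 0" "(\<integral>x. x\<^sup>2 \<partial>\<rho>) = 1"
  shows "\<exists>Q. Q \<longlonglongrightarrow> 0 \<and> (\<forall>(M :: 'w measure) (I :: 'i set) \<xi>. prob_space M \<longrightarrow> finite I \<longrightarrow> I \<noteq> {} \<longrightarrow>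
    prob_space.indep_vars M (\<lambda>_. borel) \<xi> I \<longrightarrow> (\<forall>i\<in>I. distr M borel (\<xi> i) = \<mu>) \<longrightarrow>
    (\<integral>\<omega>. (cmod ((\<Prod>i\<in>I. char \<rho> (\<xi> i \<omega> / sqrt (real (card I)))) - of_real (exp (- r / 2))))\<^sup>2 \<partial>M) = Q (card I))"
proof -
  interpret \<mu>: real_distribution \<mu> by fact
  interpret \<rho>: real_distribution \<rho> by fact
  interpret \<rho>\<rho>: pair_prob_space \<rho> \<rho> ..
  define \<rho>' where "\<rho>' = distr (\<rho> \<Otimes>\<^sub>M \<rho>) borel (\<lambda>(x, y). x - y)"
  interpret \<rho>': real_distribution \<rho>'
    unfolding \<rho>'_def by (rule \<rho>\<rho>.real_distribution_distr) measurable
  have int1: "integrable \<rho> (\<lambda>x. x)"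
    by (rule \<rho>.square_integrable_imp_integrable[OF _ \<rho>(1)]) simp
  have fst_snd: "integrable (\<rho> \<Otimes>\<^sub>M \<rho>) (\<lambda>z. f (fst z) * g (snd z))"
      "(\<integral>z. f (fst z) * g (snd z) \<partial>(\<rho> \<Otimes>\<^sub>M \<rho>)) = (\<integral>x. f x \<partial>\<rho>) * (\<integral>y. g y \<partial>\<rho>)"
    if "integrable \<rho> f" "integrable \<rho> g" for f g :: "real \<Rightarrow> 'z :: {real_normed_field, banach, second_countable_topology}"
  proof -
    have [measurable]: "f \<in> borel_measurable \<rho>" "g \<in> borel_measurable \<rho>" using that by auto
    show int: "integrable (\<rho> \<Otimes>\<^sub>M \<rho>) (\<lambda>z. f (fst z) * g (snd z))"
    proof (rule \<rho>\<rho>.Fubini_integrable)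
      show "integrable \<rho> (\<lambda>x. \<integral>y. norm (f (fst (x, y)) * g (snd (x, y))) \<partial>\<rho>)"
        using that by (simp add: norm_mult)
      show "AE x in \<rho>. integrable \<rho> (\<lambda>y. f (fst (x, y)) * g (snd (x, y)))"
        using that by simp
    qed measurable
    show "(\<integral>z. f (fst z) * g (snd z) \<partial>(\<rho> \<Otimes>\<^sub>M \<rho>)) = (\<integral>x. f x \<partial>\<rho>) * (\<integral>y. g y \<partial>\<rho>)"
      using that by (subst \<rho>\<rho>.integral_fst'[OF int, symmetric]) simp
  qed
  have c1: "integrable \<rho> (\<lambda>x. 1 :: real)" by simp
  have p1: "(\<integral>x. 1 \<partial>\<rho>) = (1::real)" using \<rho>.prob_space by simp
  have \<rho>'_mean: "\<rho>'.expectation (\<lambda>x. x) = 0"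
  proof -
    have "\<rho>'.expectation (\<lambda>x. x) = (\<integral>z. fst z * 1 - 1 * snd z \<partial>(\<rho> \<Otimes>\<^sub>M \<rho>))"
      unfolding \<rho>'_def by (subst integral_distr) (simp_all add: case_prod_beta')
    also have "\<dots> = 0"
      by (subst Bochner_Integration.integral_diff)
         (use fst_snd[OF int1 c1] fst_snd[OF c1 int1] \<rho>(2) in simp_all)
    finally show ?thesis .
  qed
  have \<rho>'_sq: "integrable \<rho>' (\<lambda>x. x\<^sup>2)" "\<rho>'.expectation (\<lambda>x. x\<^sup>2) = 2"
  proof -
    let ?f = "\<lambda>z. (fst z)\<^sup>2 * 1 + 1 * (snd z)\<^sup>2 - 2 * (fst z * snd z) :: real"
    have eq: "(\<lambda>z. (case z of (x, y) \<Rightarrow> x - y)\<^sup>2) = ?f"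
      by (auto simp: fun_eq_iff power2_diff)
    note i = fst_snd[OF \<rho>(1) c1] fst_snd[OF c1 \<rho>(1)] fst_snd[OF int1 int1]
    have snd_sq: "(\<integral>z. (snd z)\<^sup>2 \<partial>(\<rho> \<Otimes>\<^sub>M \<rho>)) = 1"
      using fst_snd(2)[OF c1 \<rho>(1)] by (simp only: mult_1 p1 \<rho>(3))
    have f: "integrable (\<rho> \<Otimes>\<^sub>M \<rho>) ?f"
      by (intro Bochner_Integration.integrable_add Bochner_Integration.integrable_diff
          integrable_mult_right i)
    then show "integrable \<rho>' (\<lambda>x. x\<^sup>2)"
      unfolding \<rho>'_def by (subst integrable_distr_eq) (simp_all add: eq)
    have "\<rho>'.expectation (\<lambda>x. x\<^sup>2) = (\<integral>z. ?f z \<partial>(\<rho> \<Otimes>\<^sub>M \<rho>))"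
      unfolding \<rho>'_def by (subst integral_distr) (simp_all add: eq)
    also have "\<dots> = 2"
      by (simp only: Bochner_Integration.integral_diff Bochner_Integration.integral_add
          Bochner_Integration.integrable_add integrable_mult_right integral_mult_right_zero i \<rho> p1) (simp add: snd_sq)
    finally show "\<rho>'.expectation (\<lambda>x. x\<^sup>2) = 2" .
  qed
  have char': "char \<rho>' t = of_real ((cmod (char \<rho> t))\<^sup>2)" for t
  proof -
    have "char \<rho>' t = (\<integral>z. iexp (t * fst z) * iexp (- t * snd z) \<partial>(\<rho> \<Otimes>\<^sub>M \<rho>))"
      unfolding \<rho>'_def char_def
      by (subst integral_distr) (simp_all add: case_prod_beta' exp_add[symmetric] algebra_simps)
    also have "\<dots> = char \<rho> t * char \<rho> (- t)"
      unfolding char_def by (rule fst_snd) (rule \<rho>.integrable_iexp; simp)+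
    also have "char \<rho> (- t) = cnj (char \<rho> t)"
    proof -
      have "cnj (char \<rho> t) = (\<integral>x. cnj (iexp (t * x)) \<partial>\<rho>)"
        unfolding char_def by (simp only: Bochner_Integration.integral_cnj)
      then show ?thesis by (simp add: char_def exp_cnj)
    qed
    finally show ?thesis by (simp only: complex_norm_square)
  qed
  define c where "c = exp (- r / 2)"
  define F1 where "F1 k = (\<integral>x. char \<rho> (x / sqrt (real k)) \<partial>\<mu>) ^ k" for k
  define F2 where "F2 k = (\<integral>x. char \<rho>' (x / sqrt (real k)) \<partial>\<mu>) ^ k" for k
  \<comment> \<open>The expansion of the mean of \<open>|Z - c|^2\<close> for the random product
    \<open>Z\<close>: \<open>F2\<close> is its second absolute moment and \<open>F1\<close> its
    mean.\<close>
  define Q where "Q k = Re (F2 k) - 2 * c * Re (F1 k) + c\<^sup>2" for k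
  have "F1 \<longlonglongrightarrow> of_real (exp (- (r * 1) / 2))"
    unfolding F1_def by (rule char_mixture_power_tendsto) (fact assms)+
  moreover have "F2 \<longlonglongrightarrow> of_real (exp (- (r * 2) / 2))"
    unfolding F2_def by (rule char_mixture_power_tendsto) (fact assms \<rho>'_sq \<rho>'_mean \<rho>'.real_distribution_axioms)+
  \<comment> \<open>Since \<open>\<rho>'\<close> has variance 2, \<open>F2\<close> tends to
    \<open>c\<^sup>2\<close>, and the limit is
    \<open>c\<^sup>2 - 2 * c\<^sup>2 + c\<^sup>2\<close>.\<close>
  ultimately have "Q \<longlonglongrightarrow> Re (of_real (exp (- (r * 2) / 2))) - 2 * c * Re (of_real (exp (- (r * 1) / 2))) + c\<^sup>2"
    unfolding Q_def by (intro tendsto_intros)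
  moreover have "Re (of_real (exp (- (r * 2) / 2))) - 2 * c * Re (of_real (exp (- (r * 1) / 2))) + c\<^sup>2 = 0"
    by (simp add: c_def power2_eq_square exp_add[symmetric])
  ultimately have "Q \<longlonglongrightarrow> 0" by simp
  \<comment> \<open>By independence the two moments depend on the index set only through its
    cardinality, so one sequence \<open>Q\<close> serves all samples.\<close>
  moreover have "(\<integral>\<omega>. (cmod ((\<Prod>i\<in>I. char \<rho> (\<xi> i \<omega> / sqrt (real (card I)))) - of_real c))\<^sup>2 \<partial>M) = Q (card I)"
    if M: "prob_space M" and I: "finite I" "I \<noteq> {}"
      and ind: "prob_space.indep_vars M (\<lambda>_. borel) \<xi> I" and law: "\<And>i. i \<in> I \<Longrightarrow> distr M borel (\<xi> i) = \<mu>"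
    for M :: "'w measure" and I :: "'i set" and \<xi>
  proof -
    interpret prob_space M by fact
    have \<xi>[measurable]: "\<xi> i \<in> borel_measurable M" if "i \<in> I" for i
      using ind that by (auto simp: indep_vars_def2)
    have prod: "integrable M (\<lambda>\<omega>. \<Prod>i\<in>I. \<phi> (\<xi> i \<omega>))"
        "(\<integral>\<omega>. (\<Prod>i\<in>I. \<phi> (\<xi> i \<omega>)) \<partial>M) = (\<integral>x. \<phi> x \<partial>\<mu>) ^ card I"
      if \<phi> [measurable]: "\<phi> \<in> borel_measurable borel" and b: "\<And>x. cmod (\<phi> x) \<le> 1" for \<phi> :: "real \<Rightarrow> complex"
    proof -
      have ind': "indep_vars (\<lambda>_. borel) (\<lambda>i \<omega>. \<phi> (\<xi> i \<omega>)) I"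
        by (rule indep_vars_compose2[OF ind]) simp
      have int: "integrable M (\<lambda>\<omega>. \<phi> (\<xi> i \<omega>))" if "i \<in> I" for i
        by (rule integrable_const_bound[where B=1]) (use that b in auto)
      show "integrable M (\<lambda>\<omega>. \<Prod>i\<in>I. \<phi> (\<xi> i \<omega>))"
        by (rule indep_vars_integrable[OF I(1) ind' int])
      have "(\<integral>\<omega>. (\<Prod>i\<in>I. \<phi> (\<xi> i \<omega>)) \<partial>M) = (\<Prod>i\<in>I. \<integral>\<omega>. \<phi> (\<xi> i \<omega>) \<partial>M)"
        by (rule indep_vars_lebesgue_integral[OF I(1) ind' int])
      also have "\<dots> = (\<Prod>i\<in>I. \<integral>x. \<phi> x \<partial>\<mu>)"
      proof (rule prod.cong[OF refl])
        fix i assume i: "i \<in> I"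
        show "(\<integral>\<omega>. \<phi> (\<xi> i \<omega>) \<partial>M) = (\<integral>x. \<phi> x \<partial>\<mu>)"
          unfolding law[OF i, symmetric] by (rule integral_distr[symmetric]) (use i in simp_all)
      qed
      finally show "(\<integral>\<omega>. (\<Prod>i\<in>I. \<phi> (\<xi> i \<omega>)) \<partial>M) = (\<integral>x. \<phi> x \<partial>\<mu>) ^ card I" by simp
    qed
    define k where "k = card I"
    have m: "(\<lambda>x. char \<rho> (x / sqrt (real k))) \<in> borel_measurable borel"
      "(\<lambda>x. char \<rho>' (x / sqrt (real k))) \<in> borel_measurable borel"
      using \<rho>.char_measurable \<rho>'.char_measurable by measurable
    note p1 = prod[OF m(1) \<rho>.cmod_char_le_1] and p2 = prod[OF m(2) \<rho>'.cmod_char_le_1]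
    have expand: "(cmod (z - of_real c))\<^sup>2 = (cmod z)\<^sup>2 - 2 * c * Re z + c\<^sup>2" for z
      by (simp add: cmod_power2 power2_diff)
    have cm: "(cmod (\<Prod>i\<in>I. char \<rho> (\<xi> i \<omega> / sqrt (real k))))\<^sup>2
        = Re (\<Prod>i\<in>I. char \<rho>' (\<xi> i \<omega> / sqrt (real k)))" for \<omega>
      by (simp only: char' prod_norm[symmetric] prod_power_distrib[symmetric] of_real_prod[symmetric] Re_complex_of_real)
    have "(\<integral>\<omega>. (cmod ((\<Prod>i\<in>I. char \<rho> (\<xi> i \<omega> / sqrt (real k))) - of_real c))\<^sup>2 \<partial>M)
      = (\<integral>\<omega>. Re (\<Prod>i\<in>I. char \<rho>' (\<xi> i \<omega> / sqrt (real k))) - 2 * c * Re (\<Prod>i\<in>I. char \<rho> (\<xi> i \<omega> / sqrt (real k))) + c\<^sup>2 \<partial>M)"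
      by (simp only: expand cm)
    also have "\<dots> = (\<integral>\<omega>. Re (\<Prod>i\<in>I. char \<rho>' (\<xi> i \<omega> / sqrt (real k))) \<partial>M)
       - 2 * c * (\<integral>\<omega>. Re (\<Prod>i\<in>I. char \<rho> (\<xi> i \<omega> / sqrt (real k))) \<partial>M) + c\<^sup>2"
      using integrable_Re[OF p1(1)] integrable_Re[OF p2(1)] by (simp add: prob_space)
    also have "\<dots> = Q k"
      by (simp only: Q_def F1_def F2_def integral_Re[OF p1(1)] integral_Re[OF p2(1)] p1(2) p2(2) k_def[symmetric])
    finally show ?thesis by (simp only: k_def)
  qed
  ultimately show ?thesis
    unfolding c_def by (intro exI[of _ Q]) auto
qed

section \<open>Sums of independent variables\<close>

lemma (in prob_space) integral_abs_le_sqrt: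
  fixes f :: "'a \<Rightarrow> real"
  assumes [measurable]: "f \<in> borel_measurable M" and sq: "integrable M (\<lambda>x. (f x)\<^sup>2)"
  shows "(\<integral>x. \<bar>f x\<bar> \<partial>M) \<le> sqrt (\<integral>x. (f x)\<^sup>2 \<partial>M)"
proof (rule real_le_rsqrt)
  have i: "integrable M (\<lambda>x. \<bar>f x\<bar>)"
    by (rule integrable_abs[OF square_integrable_imp_integrable[OF _ sq]]) simp
  have "variance (\<lambda>x. \<bar>f x\<bar>) = (\<integral>x. (f x)\<^sup>2 \<partial>M) - (\<integral>x. \<bar>f x\<bar> \<partial>M)\<^sup>2"
    using variance_eq[OF i] sq by simp
  then show "(\<integral>x. \<bar>f x\<bar> \<partial>M)\<^sup>2 \<le> (\<integral>x. (f x)\<^sup>2 \<partial>M)"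
    using variance_positive[of "\<lambda>x. \<bar>f x\<bar>"] by linarith
qed

lemma integral_PiM_sum_square:
  fixes f :: "'a \<Rightarrow> real" and c :: "'i \<Rightarrow> real"
  assumes P: "prob_space P" and I: "finite I"
    and [measurable]: "f \<in> borel_measurable P"
    and sq: "integrable P (\<lambda>x. (f x)\<^sup>2)" and mean: "(\<integral>x. f x \<partial>P) = 0"
  shows "integrable (PiM I (\<lambda>_. P)) (\<lambda>x. (\<Sum>i\<in>I. c i * f (x i))\<^sup>2)"
    and "(\<integral>x. (\<Sum>i\<in>I. c i * f (x i))\<^sup>2 \<partial>PiM I (\<lambda>_. P)) = (\<Sum>i\<in>I. (c i)\<^sup>2) * (\<integral>x. (f x)\<^sup>2 \<partial>P)"
    and "(\<integral>x. (\<Sum>i\<in>I. c i * f (x i)) \<partial>PiM I (\<lambda>_. P)) = 0"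
proof -
  interpret P: prob_space P by fact
  interpret product_sigma_finite "\<lambda>_. P" ..
  have int1: "integrable P f"
    by (rule P.square_integrable_imp_integrable[OF _ sq]) simp
  \<comment> \<open>\<open>f (x i) * f (x j)\<close> becomes a product over all coordinates, with
    factor 1 elsewhere, so that one product rule covers the diagonal and the off-diagonal
    terms.\<close>
  define h where "h i j k x = (if k = i then f x else 1) * (if k = j then f x else 1)" for i j k :: 'i and x
  have h_int: "integrable P (h i j k)" for i j k
    unfolding h_def using int1 sq by (cases "k = i"; cases "k = j") (simp_all add: power2_eq_square)
  have h_prod: "(\<Prod>k\<in>I. h i j k (x k)) = f (x i) * f (x j)" if "i \<in> I" "j \<in> I" for i j x
    unfolding h_def prod.distrib using I that by simp
  have int: "integrable (PiM I (\<lambda>_. P)) (\<lambda>x. f (x i) * f (x j))" if "i \<in> I" "j \<in> I" for i j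
    using product_integrable_prod[OF I, of "h i j"] h_int by (simp add: h_prod[OF that])
  have val: "(\<integral>x. f (x i) * f (x j) \<partial>PiM I (\<lambda>_. P)) = (if i = j then \<integral>x. (f x)\<^sup>2 \<partial>P else 0)"
    if "i \<in> I" "j \<in> I" for i j
  proof -
    have "(\<integral>x. f (x i) * f (x j) \<partial>PiM I (\<lambda>_. P)) = (\<Prod>k\<in>I. \<integral>x. h i j k x \<partial>P)"
      using product_integral_prod[OF I, of "h i j"] h_int by (simp add: h_prod[OF that])
    also have "\<dots> = (if i = j then \<integral>x. (f x)\<^sup>2 \<partial>P else 0)"
    proof (cases "i = j")
      case True
      have "(\<integral>x. h i j k x \<partial>P) = (if k = i then \<integral>x. (f x)\<^sup>2 \<partial>P else 1)" for k
        using True by (simp add: h_def power2_eq_square P.prob_space)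
      then show ?thesis using True I that by simp
    next
      case False
      have "(\<integral>x. h i j i x \<partial>P) = 0"
        using False mean by (simp add: h_def)
      then show ?thesis using False I that by (simp add: prod_zero_iff) blast
    qed
    finally show ?thesis .
  qed
  have h1_prod: "(\<Prod>k\<in>I. if k = i then f (x k) else 1) = f (x i)" if "i \<in> I" for i x
    using I that by simp
  have h1_int: "integrable P (\<lambda>x. if k = i then f x else 1)" for i k :: 'i
    using int1 by (cases "k = i") simp_all
  have single: "integrable (PiM I (\<lambda>_. P)) (\<lambda>x. f (x i))" "(\<integral>x. f (x i) \<partial>PiM I (\<lambda>_. P)) = 0"
    if i: "i \<in> I" for i
  proof -
    show "integrable (PiM I (\<lambda>_. P)) (\<lambda>x. f (x i))"
      using product_integrable_prod[OF I, of "\<lambda>k x. if k = i then f x else 1"] h1_int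
      by (simp only: h1_prod[OF i])
    have "(\<integral>x. f (x i) \<partial>PiM I (\<lambda>_. P)) = (\<Prod>k\<in>I. \<integral>x. (if k = i then f x else 1) \<partial>P)"
      using product_integral_prod[OF I, of "\<lambda>k x. if k = i then f x else 1"] h1_int
      by (simp only: h1_prod[OF i])
    also have "\<dots> = 0"
      by (rule prod_zero[OF I]) (rule bexI[of _ i], simp_all add: mean i)
    finally show "(\<integral>x. f (x i) \<partial>PiM I (\<lambda>_. P)) = 0" .
  qed
  show "(\<integral>x. (\<Sum>i\<in>I. c i * f (x i)) \<partial>PiM I (\<lambda>_. P)) = 0"
    by (subst Bochner_Integration.integral_sum) (auto intro!: integrable_mult_right single sum.neutral simp: single)
  have expand: "(\<Sum>i\<in>I. c i * f (x i))\<^sup>2 = (\<Sum>i\<in>I. \<Sum>j\<in>I. (c i * c j) * (f (x i) * f (x j)))" for x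
    by (simp add: power2_eq_square sum_product mult.assoc mult.left_commute)
  show "integrable (PiM I (\<lambda>_. P)) (\<lambda>x. (\<Sum>i\<in>I. c i * f (x i))\<^sup>2)"
    unfolding expand by (intro Bochner_Integration.integrable_sum integrable_mult_right int)
  have "(\<integral>x. (\<Sum>i\<in>I. c i * f (x i))\<^sup>2 \<partial>PiM I (\<lambda>_. P))
      = (\<Sum>i\<in>I. \<Sum>j\<in>I. (c i * c j) * (\<integral>x. f (x i) * f (x j) \<partial>PiM I (\<lambda>_. P)))"
    unfolding expand
    by (subst Bochner_Integration.integral_sum)
       (auto intro!: Bochner_Integration.integrable_sum integrable_mult_right int
         simp: Bochner_Integration.integral_sum integrable_mult_right int)
  also have "\<dots> = (\<Sum>i\<in>I. \<Sum>j\<in>I. if j = i then (c i)\<^sup>2 * (\<integral>x. (f x)\<^sup>2 \<partial>P) else 0)"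
    by (intro sum.cong refl) (simp add: val power2_eq_square)
  also have "\<dots> = (\<Sum>i\<in>I. (c i)\<^sup>2) * (\<integral>x. (f x)\<^sup>2 \<partial>P)"
    using I by (simp add: sum_distrib_right)
  finally show "(\<integral>x. (\<Sum>i\<in>I. c i * f (x i))\<^sup>2 \<partial>PiM I (\<lambda>_. P)) = (\<Sum>i\<in>I. (c i)\<^sup>2) * (\<integral>x. (f x)\<^sup>2 \<partial>P)" .
qed

section \<open>Dirichlet weights as normalised exponential variables\<close>

definition exp_dist :: "real measure" where
  "exp_dist = density lborel (exponential_density 1)"

text \<open>For \<open>n \<ge> 1\<close> the Gamma law of shape \<open>n\<close>, that is, the law
  of a sum of \<open>n\<close> standard exponentials. \<open>erlang_density k\<close> has shape
  \<open>k + 1\<close>, hence the index \<open>n - 1\<close>.\<close>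

definition gamma_dist :: "nat \<Rightarrow> real measure" where
  "gamma_dist n = density lborel (erlang_density (n - 1) 1)"

definition scaled_weights :: "nat \<Rightarrow> (nat \<Rightarrow> real) \<Rightarrow> real \<Rightarrow> nat \<Rightarrow> real" where
  "scaled_weights n w T = (\<lambda>i\<in>{1..n}. T * w i)"

lemma sets_exp_dist [measurable_cong, simp]: "sets exp_dist = sets borel"
  and space_exp_dist [simp]: "space exp_dist = UNIV"
  and sets_gamma_dist [measurable_cong, simp]: "sets (gamma_dist n) = sets borel"
  and space_gamma_dist [simp]: "space (gamma_dist n) = UNIV"
  and sets_dirichlet [measurable_cong, simp]: "sets (dirichlet n \<alpha>) = sets (PiM {1..n} (\<lambda>_. borel))"
  by (simp_all add: exp_dist_def gamma_dist_def dirichlet_def)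

lemma prob_space_exp_dist: "prob_space exp_dist"
  unfolding exp_dist_def by (rule prob_space_erlang_density) simp

lemma prob_space_gamma_dist: "prob_space (gamma_dist n)"
  unfolding gamma_dist_def by (rule prob_space_erlang_density) simp

text \<open>The factor \<open>T ^ card I\<close> is the Jacobian of the dilation. The rescaled image
  measure is recognised as Lebesgue measure on rectangles, one coordinate at a time.\<close>

lemma nn_integral_PiM_lborel_scale:
  assumes I: "finite I" and T: "0 < T"
    and f [measurable]: "f \<in> borel_measurable (PiM I (\<lambda>_. borel))"
  shows "(\<integral>\<^sup>+u. ennreal (T ^ card I) * f (\<lambda>i\<in>I. T * u i) \<partial>PiM I (\<lambda>_. lborel)) = (\<integral>\<^sup>+u. f u \<partial>PiM I (\<lambda>_. lborel :: real measure))"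
proof -
  interpret product_sigma_finite "\<lambda>_. lborel :: real measure" ..
  let ?L = "PiM I (\<lambda>_. lborel :: real measure)"
  have [measurable]: "(\<lambda>u. \<lambda>i\<in>I. T * u i) \<in> ?L \<rightarrow>\<^sub>M ?L"
    by (intro measurable_restrict) measurable
  define Q where "Q = density (distr ?L ?L (\<lambda>u. \<lambda>i\<in>I. T * u i)) (\<lambda>_. ennreal (T ^ card I))"
  have "Q = ?L"
  proof (rule PiM_eqI[OF I])
    show "sets Q = sets ?L" by (simp add: Q_def)
    fix A :: "_ \<Rightarrow> real set" assume A: "\<And>i. i \<in> I \<Longrightarrow> A i \<in> sets lborel"
    then have PA [measurable]: "Pi\<^sub>E I A \<in> sets ?L" using I by (intro sets_PiM_I_finite) auto
    have "emeasure Q (Pi\<^sub>E I A) = ennreal (T ^ card I) * emeasure ?L ((\<lambda>u. \<lambda>i\<in>I. T * u i) -` Pi\<^sub>E I A \<inter> space ?L)"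
      unfolding Q_def by (simp add: emeasure_density_const emeasure_distr PA)
    also have "(\<lambda>u. \<lambda>i\<in>I. T * u i) -` Pi\<^sub>E I A \<inter> space ?L = Pi\<^sub>E I (\<lambda>i. (\<lambda>x. T * x) -` A i)"
      by (auto simp: space_PiM PiE_def Pi_iff)
    also have "emeasure ?L \<dots> = (\<Prod>i\<in>I. emeasure lborel ((\<lambda>x. T * x) -` A i))"
    proof (rule emeasure_PiM[OF I])
      fix i assume "i \<in> I"
      then have "(\<lambda>x. T * x) -` A i \<inter> space borel \<in> sets borel"
        using A[OF \<open>i \<in> I\<close>] by (intro measurable_sets[of _ borel borel]) auto
      then show "(\<lambda>x. T * x) -` A i \<in> sets lborel" by simp
    qed
    also have "ennreal (T ^ card I) * \<dots> = (\<Prod>i\<in>I. ennreal T * emeasure lborel ((\<lambda>x. T * x) -` A i))"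
      using T by (simp add: prod.distrib ennreal_power)
    also have "\<dots> = (\<Prod>i\<in>I. emeasure lborel (A i))"
    proof (rule prod.cong[OF refl])
      fix i assume i: "i \<in> I"
      have Ai [measurable]: "A i \<in> sets borel" using A[OF i] by simp
      have "emeasure lborel (A i) = (\<integral>\<^sup>+x. indicator (A i) x \<partial>lborel)" by simp
      also have "\<dots> = ennreal \<bar>T\<bar> * (\<integral>\<^sup>+x. indicator (A i) (0 + T * x) \<partial>lborel)"
        using T by (intro nn_integral_real_affine) auto
      also have "(\<integral>\<^sup>+x. indicator (A i) (0 + T * x) \<partial>lborel) = (\<integral>\<^sup>+x. indicator ((\<lambda>x. T * x) -` A i) x \<partial>lborel)"
        by (intro nn_integral_cong) (simp add: indicator_def)
      also have "\<dots> = emeasure lborel ((\<lambda>x. T * x) -` A i)"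
        using measurable_sets[of "\<lambda>x. T * x" borel borel "A i"] by (intro nn_integral_indicator) simp
      finally show "ennreal T * emeasure lborel ((\<lambda>x. T * x) -` A i) = emeasure lborel (A i)"
        using T by simp
    qed
    finally show "emeasure Q (Pi\<^sub>E I A) = (\<Prod>i\<in>I. emeasure lborel (A i))" .
  qed
  then have "(\<integral>\<^sup>+u. f u \<partial>?L) = (\<integral>\<^sup>+u. f u \<partial>Q)" by simp
  also have "\<dots> = (\<integral>\<^sup>+u. ennreal (T ^ card I) * f (\<lambda>i\<in>I. T * u i) \<partial>?L)"
    unfolding Q_def by (simp add: nn_integral_density nn_integral_distr)
  finally show ?thesis ..
qed

lemma measurable_simplex_point [measurable]:
  "simplex_point n \<in> PiM {1..<n} (\<lambda>_. borel) \<rightarrow>\<^sub>M PiM {1..n} (\<lambda>_. borel)"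
  unfolding simplex_point_def
proof (rule measurable_restrict)
  fix i assume i: "i \<in> {1..n}"
  show "(\<lambda>x :: nat \<Rightarrow> real. if i = n then 1 - sum x {1..<n} else x i) \<in> borel_measurable (PiM {1..<n} (\<lambda>_. borel))"
  proof (cases "i = n")
    case True
    have "(\<lambda>x. 1 - (\<Sum>j\<in>{1..<n}. x j) :: real) \<in> borel_measurable (PiM {1..<n} (\<lambda>_. borel))"
      by (intro borel_measurable_diff borel_measurable_const borel_measurable_sum measurable_component_singleton)
    then show ?thesis by (simp only: True if_True refl)
  next
    case False
    then show ?thesis
      using i measurable_component_singleton[of i "{1..<n}" "\<lambda>_. borel :: real measure"] by simp
  qed
qed

lemma sum_simplex_point: "n \<ge> 1 \<Longrightarrow> (\<Sum>i\<in>{1..n}. simplex_point n x i) = 1"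
proof -
  assume "n \<ge> 1"
  then have "{1..n} = insert n {1..<n}" by auto
  then show ?thesis by (simp add: simplex_point_def)
qed

lemma measurable_scaled_weights [measurable]:
  "(\<lambda>(w, T). scaled_weights n w T) \<in> PiM {1..n} (\<lambda>_. borel) \<Otimes>\<^sub>M borel \<rightarrow>\<^sub>M PiM {1..n} (\<lambda>_. borel)"
  unfolding scaled_weights_def case_prod_beta' by (rule measurable_restrict) simp

text \<open>Polar coordinates \<open>e = T w\<close> on the positive orthant; the Jacobian \<open>T ^ (n - 1)\<close> is that of
  scaling the first \<open>n - 1\<close> coordinates.\<close>

lemma nn_integral_dirichlet_gamma:
  assumes n: "n \<ge> 1" and f [measurable]: "f \<in> borel_measurable (PiM {1..n} (\<lambda>_. borel))"
  shows "(\<integral>\<^sup>+w. \<integral>\<^sup>+T. f (scaled_weights n w T) \<partial>gamma_dist n \<partial>dirichlet n (\<lambda>_. 1))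
    = (\<integral>\<^sup>+e. f e \<partial>PiM {1..n} (\<lambda>_. exp_dist))"
proof -
  note One_nat_def [simp del]
  let ?I = "{1..<n}"
  have I: "finite ?I" "n \<notin> ?I" "insert n ?I = {1..n}" "card ?I = n - 1" using n by auto
  interpret product_sigma_finite "\<lambda>_::nat. lborel :: real measure" ..
  interpret pair_sigma_finite "PiM ?I (\<lambda>_::nat. lborel :: real measure)" "lborel :: real measure"
    by (intro pair_sigma_finite.intro sigma_finite I lborel.sigma_finite_measure_axioms)
  let ?L = "PiM ?I (\<lambda>_. lborel :: real measure)"
  \<comment> \<open>The exponential density with value 0 at the origin. Its product is positive
    exactly on the open orthant, in agreement with the strict inequalities in
    \<open>dirichlet_density\<close>; it differs from \<open>exponential_density 1\<close> only at
    0.\<close>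
  define e1 where "e1 x = (if 0 < x then exp (- x) else 0 :: real)" for x
  have [measurable]: "e1 \<in> borel_measurable borel" unfolding e1_def by measurable
  have exp_dist_e1: "exp_dist = density lborel (\<lambda>x. ennreal (e1 x))"
    unfolding exp_dist_def
  proof (rule density_cong)
    show "AE x in lborel. ennreal (exponential_density 1 x) = ennreal (e1 x)"
      using AE_lborel_singleton[of 0] by eventually_elim (auto simp: e1_def erlang_density_def)
  qed auto
  \<comment> \<open>The last coordinate will be \<open>T\<close> minus the sum of the others.
    Inserting it extensionally makes the result agree with the point update that appears in the
    product integral.\<close>
  define ext where "ext y s = (\<lambda>i\<in>{1..n}. if i = n then s else (y i :: real))" for y s
  have ext_upd: "ext y s = y(n := s)" if "y \<in> space ?L" for y s
    using that n by (auto simp: ext_def space_PiM PiE_def extensional_def fun_eq_iff)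
  have ext_m [measurable]: "(\<lambda>(y, s). ext y s) \<in> ?L \<Otimes>\<^sub>M lborel \<rightarrow>\<^sub>M PiM {1..n} (\<lambda>_. borel)"
    unfolding ext_def case_prod_beta'
  proof (rule measurable_restrict)
    fix i assume "i \<in> {1..n}"
    then show "(\<lambda>x. if i = n then snd x else fst x i) \<in> borel_measurable (?L \<Otimes>\<^sub>M lborel)"
      by (cases "i = n") auto
  qed
  define pos where "pos y \<longleftrightarrow> (\<forall>i\<in>?I. 0 < (y i :: real))" for y
  have [measurable]: "Measurable.pred ?L pos" unfolding pos_def by measurable
  \<comment> \<open>With all parameters equal to 1 the Dirichlet density is the constant
    \<open>fact (n - 1)\<close> on the open simplex.\<close>
  define d where "d u = (if pos u \<and> 0 < 1 - (\<Sum>j\<in>?I. u j) then fact (n - 1) else 0 :: real)" for u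
  have d: "dirichlet_density n (\<lambda>_. 1) (simplex_point n u) = d u" for u
  proof -
    have "(\<forall>i\<in>{1..n}. 0 < simplex_point n u i) \<longleftrightarrow> pos u \<and> 0 < 1 - (\<Sum>j\<in>?I. u j)"
      unfolding I(3)[symmetric] using n by (auto simp: simplex_point_def pos_def)
    moreover have "Gamma (real n) = fact (n - 1)"
      using n Gamma_fact[of "n - 1", where 'a=real] by (simp add: of_nat_diff)
    ultimately show ?thesis
      unfolding dirichlet_density_def d_def by (auto intro!: prod.neutral)
  qed
  have [measurable]: "d \<in> borel_measurable ?L" unfolding d_def by measurable
  have sp [measurable]: "simplex_point n \<in> ?L \<rightarrow>\<^sub>M PiM {1..n} (\<lambda>_. borel)"
    using measurable_simplex_point by (simp cong: measurable_cong_sets sets_PiM_cong)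
  have sw [measurable]: "(\<lambda>u. scaled_weights n (simplex_point n (fst u)) (snd u)) \<in> ?L \<Otimes>\<^sub>M lborel \<rightarrow>\<^sub>M PiM {1..n} (\<lambda>_. borel)"
  proof -
    have "(\<lambda>u. (simplex_point n (fst u), snd u)) \<in> ?L \<Otimes>\<^sub>M lborel \<rightarrow>\<^sub>M PiM {1..n} (\<lambda>_. borel) \<Otimes>\<^sub>M borel"
      by measurable
    from measurable_compose[OF this measurable_scaled_weights] show ?thesis by simp
  qed
  have gm: "(\<lambda>w. \<integral>\<^sup>+T. f (scaled_weights n w T) \<partial>gamma_dist n) \<in> borel_measurable (PiM {1..n} (\<lambda>_. borel))"
  proof -
    interpret G: prob_space "gamma_dist n" by (rule prob_space_gamma_dist)
    have "(\<lambda>(w, T). f (scaled_weights n w T)) \<in> borel_measurable (PiM {1..n} (\<lambda>_. borel) \<Otimes>\<^sub>M gamma_dist n)"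
      using measurable_compose[OF measurable_scaled_weights f] by (simp add: case_prod_beta' cong: measurable_cong_sets)
    then show ?thesis by (rule G.borel_measurable_nn_integral)
  qed
  have "(\<integral>\<^sup>+w. \<integral>\<^sup>+T. f (scaled_weights n w T) \<partial>gamma_dist n \<partial>dirichlet n (\<lambda>_. 1))
    = (\<integral>\<^sup>+u. ennreal (d u) * (\<integral>\<^sup>+T. f (scaled_weights n (simplex_point n u) T) \<partial>gamma_dist n) \<partial>?L)"
    unfolding dirichlet_def using gm sp measurable_compose[OF sp gm]
    by (subst nn_integral_distr) (simp_all add: d nn_integral_density)
  also have "\<dots> = (\<integral>\<^sup>+u. \<integral>\<^sup>+T. ennreal (d u) * (ennreal (erlang_density (n - 1) 1 T) * f (scaled_weights n (simplex_point n u) T)) \<partial>lborel \<partial>?L)"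
    unfolding gamma_dist_def
  proof (rule nn_integral_cong)
    fix u assume u: "u \<in> space ?L"
    have "(\<lambda>T. scaled_weights n (simplex_point n u) T) \<in> lborel \<rightarrow>\<^sub>M PiM {1..n} (\<lambda>_. borel)"
      using measurable_compose[OF measurable_Pair1'[OF u] sw] by simp
    then have [measurable]: "(\<lambda>T. f (scaled_weights n (simplex_point n u) T)) \<in> borel_measurable lborel"
      by (rule measurable_compose[OF _ f])
    show "ennreal (d u) * (\<integral>\<^sup>+T. f (scaled_weights n (simplex_point n u) T) \<partial>density lborel (erlang_density (n - 1) 1))
      = (\<integral>\<^sup>+T. ennreal (d u) * (ennreal (erlang_density (n - 1) 1 T) * f (scaled_weights n (simplex_point n u) T)) \<partial>lborel)"
      by (subst nn_integral_density) (simp_all add: nn_integral_cmult)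
  qed
  \<comment> \<open>\<open>T\<close> becomes the outer variable, so that it is constant while the
    first \<open>n - 1\<close> coordinates are dilated.\<close>
  also have "\<dots> = (\<integral>\<^sup>+T. \<integral>\<^sup>+u. ennreal (d u) * (ennreal (erlang_density (n - 1) 1 T) * f (scaled_weights n (simplex_point n u) T)) \<partial>?L \<partial>lborel)"
  proof (rule Fubini'[symmetric])
    have "(\<lambda>z. f (scaled_weights n (simplex_point n (fst z)) (snd z))) \<in> borel_measurable (?L \<Otimes>\<^sub>M lborel)"
      by (rule measurable_compose[OF sw f])
    then show "(\<lambda>(u, T). ennreal (d u) * (ennreal (erlang_density (n - 1) 1 T) * f (scaled_weights n (simplex_point n u) T)))
        \<in> borel_measurable (?L \<Otimes>\<^sub>M lborel)"
      unfolding case_prod_beta' by measurable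
  qed
  also have "\<dots> = (\<integral>\<^sup>+T. \<integral>\<^sup>+y. (if 0 < T \<and> pos y \<and> 0 < T - (\<Sum>j\<in>?I. y j) then ennreal (exp (- T)) else 0) * f (ext y (T - (\<Sum>j\<in>?I. y j))) \<partial>?L \<partial>lborel)"
    (is "_ = (\<integral>\<^sup>+T. \<integral>\<^sup>+y. ?g T y \<partial>?L \<partial>lborel)")
  proof (rule nn_integral_cong_AE, rule AE_mp[OF AE_lborel_singleton[of 0]], rule AE_I2, rule impI)
    fix T :: real assume "T \<noteq> 0"
    show "(\<integral>\<^sup>+u. ennreal (d u) * (ennreal (erlang_density (n - 1) 1 T) * f (scaled_weights n (simplex_point n u) T)) \<partial>?L) = (\<integral>\<^sup>+y. ?g T y \<partial>?L)"
    proof (cases "0 < T")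
      case False
      then show ?thesis using \<open>T \<noteq> 0\<close> by (simp add: erlang_density_def)
    next
      case T: True
      have extT: "(\<lambda>y. ext y (T - (\<Sum>j\<in>?I. y j))) \<in> ?L \<rightarrow>\<^sub>M PiM {1..n} (\<lambda>_. borel)"
        using measurable_compose[OF _ ext_m, of "\<lambda>y. (y, T - (\<Sum>j\<in>?I. y j))" ?L] by simp
      have gmeas: "?g T \<in> borel_measurable (PiM ?I (\<lambda>_. borel))"
      proof -
        have "?g T \<in> borel_measurable ?L"
          using measurable_compose[OF extT f] by measurable
        then show ?thesis by (simp cong: measurable_cong_sets sets_PiM_cong)
      qed
      have "(\<integral>\<^sup>+y. ?g T y \<partial>?L) = (\<integral>\<^sup>+u. ennreal (T ^ card ?I) * ?g T (\<lambda>i\<in>?I. T * u i) \<partial>?L)"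
        by (rule nn_integral_PiM_lborel_scale[OF I(1) T gmeas, symmetric])
      also have "\<dots> = (\<integral>\<^sup>+u. ennreal (d u) * (ennreal (erlang_density (n - 1) 1 T) * f (scaled_weights n (simplex_point n u) T)) \<partial>?L)"
      proof (rule nn_integral_cong)
        fix u
        have s: "(\<Sum>j\<in>?I. T * u j) = T * (\<Sum>j\<in>?I. u j)" by (simp add: sum_distrib_left)
        have "ext (\<lambda>i\<in>?I. T * u i) (T - (\<Sum>j\<in>?I. (\<lambda>i\<in>?I. T * u i) j)) = scaled_weights n (simplex_point n u) T"
          by (auto simp: ext_def scaled_weights_def simplex_point_def fun_eq_iff s algebra_simps)
        moreover have "pos (\<lambda>i\<in>?I. T * u i) \<longleftrightarrow> pos u"
          using T by (auto simp: pos_def zero_less_mult_iff)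
        moreover have "0 < T - (\<Sum>j\<in>?I. (\<lambda>i\<in>?I. T * u i) j) \<longleftrightarrow> 0 < 1 - (\<Sum>j\<in>?I. u j)"
          using T mult_less_cancel_left_pos[of T "\<Sum>j\<in>?I. u j" 1] by (simp add: s)
        \<comment> \<open>The Erlang normalisation cancels the simplex density and the power of
          \<open>T\<close> is the Jacobian, so only \<open>exp (- T)\<close> remains in the new
          coordinates.\<close>
        moreover have "ennreal (T ^ (n - 1)) * ennreal (exp (- T)) = ennreal (fact (n - 1)) * ennreal (erlang_density (n - 1) 1 T)"
          using T by (simp add: erlang_density_def flip: ennreal_mult)
        ultimately show "ennreal (T ^ card ?I) * ?g T (\<lambda>i\<in>?I. T * u i) = ennreal (d u) * (ennreal (erlang_density (n - 1) 1 T) * f (scaled_weights n (simplex_point n u) T))"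
          using T by (auto simp: d_def I(4) mult.assoc[symmetric])
      qed
      finally show ?thesis ..
    qed
  qed
  also have "\<dots> = (\<integral>\<^sup>+y. \<integral>\<^sup>+T. ?g T y \<partial>lborel \<partial>?L)"
  proof (rule Fubini')
    have 1: "(\<lambda>z. ext (fst z) (snd z - (\<Sum>j\<in>?I. fst z j))) \<in> ?L \<Otimes>\<^sub>M lborel \<rightarrow>\<^sub>M PiM {1..n} (\<lambda>_. borel)"
      using measurable_compose[OF _ ext_m, of "\<lambda>z. (fst z, snd z - (\<Sum>j\<in>?I. fst z j))" "?L \<Otimes>\<^sub>M lborel"]
      by simp
    show "(\<lambda>(y, T). ?g T y) \<in> borel_measurable (?L \<Otimes>\<^sub>M lborel)"
      using measurable_compose[OF 1 f] unfolding case_prod_beta' by measurable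
  qed
  \<comment> \<open>For fixed \<open>y\<close> the total is translated to the last coordinate
    \<open>s\<close>; \<open>exp (- T)\<close> then splits into one exponential factor per
    coordinate.\<close>
  also have "\<dots> = (\<integral>\<^sup>+y. \<integral>\<^sup>+s. ennreal (\<Prod>i\<in>{1..n}. e1 (ext y s i)) * f (ext y s) \<partial>lborel \<partial>?L)"
  proof (rule nn_integral_cong)
    fix y assume y: "y \<in> space ?L"
    let ?S = "\<Sum>j\<in>?I. y j"
    have 1: "(\<lambda>T. ext y (T - ?S)) \<in> lborel \<rightarrow>\<^sub>M PiM {1..n} (\<lambda>_. borel)"
      using measurable_compose[OF _ ext_m, of "\<lambda>T. (y, T - ?S)" lborel] y by simp
    have "(\<lambda>T. ?g T y) \<in> borel_measurable borel"
      using measurable_compose[OF 1 f] by simp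
    then have "(\<integral>\<^sup>+T. ?g T y \<partial>lborel) = (\<integral>\<^sup>+s. ?g (?S + s) y \<partial>lborel)"
      by (subst nn_integral_real_affine[of _ 1 ?S])
        (simp_all only: abs_one ennreal_1 mult_1 one_neq_zero simp_thms)
    also have "\<dots> = (\<integral>\<^sup>+s. ennreal (\<Prod>i\<in>{1..n}. e1 (ext y s i)) * f (ext y s) \<partial>lborel)"
    proof (rule nn_integral_cong)
      fix s :: real
      have ext_simps: "ext y s n = s" "\<And>i. i \<in> ?I \<Longrightarrow> ext y s i = y i"
        using n by (auto simp: ext_def)
      have "(\<Prod>i\<in>{1..n}. e1 (ext y s i)) = e1 s * (\<Prod>i\<in>?I. e1 (y i))"
        unfolding I(3)[symmetric] using I(1,2) by (simp add: ext_simps)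
      also have "\<dots> = (if 0 < ?S + s \<and> pos y \<and> 0 < ?S + s - ?S then exp (- (?S + s)) else 0)"
      proof (cases "pos y")
        case True
        then have "(\<Prod>i\<in>?I. e1 (y i)) = exp (- ?S)"
          by (simp add: e1_def pos_def exp_sum[symmetric] sum_negf)
        moreover have "0 \<le> ?S"
          using True by (intro sum_nonneg) (auto simp: pos_def intro: less_imp_le)
        ultimately show ?thesis
          using True by (auto simp: e1_def mult_exp_exp add.commute)
      next
        case False
        then obtain i where "i \<in> ?I" "e1 (y i) = 0" by (auto simp: pos_def e1_def)
        then have "(\<Prod>i\<in>?I. e1 (y i)) = 0" by (intro prod_zero) auto
        then show ?thesis using False by simp
      qed
      finally show "?g (?S + s) y = ennreal (\<Prod>i\<in>{1..n}. e1 (ext y s i)) * f (ext y s)"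
        by simp
    qed
    finally show "(\<integral>\<^sup>+T. ?g T y \<partial>lborel) = (\<integral>\<^sup>+s. ennreal (\<Prod>i\<in>{1..n}. e1 (ext y s i)) * f (ext y s) \<partial>lborel)" .
  qed
  also have "\<dots> = (\<integral>\<^sup>+z. ennreal (\<Prod>i\<in>{1..n}. e1 (z i)) * f z \<partial>PiM {1..n} (\<lambda>_. lborel))"
  proof -
    have [measurable]: "f \<in> borel_measurable (PiM {1..n} (\<lambda>_. lborel))"
      using f by (simp cong: measurable_cong_sets sets_PiM_cong)
    have "(\<lambda>z. ennreal (\<Prod>i\<in>{1..n}. e1 (z i)) * f z) \<in> borel_measurable (PiM (insert n ?I) (\<lambda>_. lborel))"
      unfolding I(3) by measurable
    from product_nn_integral_insert[OF I(1,2) this]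
    show ?thesis unfolding I(3) by (simp add: ext_upd cong: nn_integral_cong)
  qed
  also have "\<dots> = (\<integral>\<^sup>+e. f e \<partial>PiM {1..n} (\<lambda>_. exp_dist))"
  proof -
    have "PiM {1..n} (\<lambda>_. exp_dist) = density (PiM {1..n} (\<lambda>_. lborel)) (\<lambda>x. ennreal (\<Prod>i\<in>{1..n}. e1 (x i)))"
      unfolding exp_dist_e1
    proof (rule density_PiM[symmetric])
      show "sigma_finite_measure (density lborel (\<lambda>x. ennreal (e1 x)))"
        using prob_space_imp_sigma_finite[OF prob_space_exp_dist] by (simp add: exp_dist_e1)
    qed (auto simp: e1_def lborel.sigma_finite_measure_axioms)
    then show ?thesis
      using f by (simp add: nn_integral_density cong: measurable_cong_sets sets_PiM_cong)
  qed
  finally show ?thesis .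
qed

text \<open>The total mass is the polar formula at the constant function 1, so it is inherited from
  the Gamma and exponential laws.\<close>

lemma prob_space_dirichlet:
  assumes n: "n \<ge> 1"
  shows "prob_space (dirichlet n (\<lambda>_. 1))"
proof
  interpret G: prob_space "gamma_dist n" by (rule prob_space_gamma_dist)
  interpret E: prob_space "PiM {1..n} (\<lambda>_. exp_dist)"
    by (intro prob_space_PiM prob_space_exp_dist)
  show "emeasure (dirichlet n (\<lambda>_. 1)) (space (dirichlet n (\<lambda>_. 1))) = 1"
    using nn_integral_dirichlet_gamma[OF n, of "\<lambda>_. 1"] by (simp add: G.emeasure_space_1[simplified] E.emeasure_space_1 del: One_nat_def)
qed

lemma AE_dirichlet_sum:
  assumes n: "n \<ge> 1"
  shows "AE w in dirichlet n (\<lambda>_. 1). (\<Sum>i\<in>{1..n}. w i) = 1"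
proof -
  have "simplex_point n \<in> PiM {1..<n} (\<lambda>_. lborel) \<rightarrow>\<^sub>M PiM {1..n} (\<lambda>_. borel)"
    using measurable_simplex_point[of n] by (simp cong: measurable_cong_sets sets_PiM_cong)
  then show ?thesis
    unfolding dirichlet_def using sum_simplex_point[OF n] by (subst AE_distr_iff) simp_all
qed

text \<open>Turns the integral identity into an equality of laws, which couples the weights and
  independent exponentials on one space.\<close>

lemma distr_scaled_weights:
  assumes n: "n \<ge> 1"
  shows "distr (dirichlet n (\<lambda>_. 1) \<Otimes>\<^sub>M gamma_dist n) (PiM {1..n} (\<lambda>_. borel)) (\<lambda>(w, T). scaled_weights n w T)
    = PiM {1..n} (\<lambda>_. exp_dist)"
proof (rule measure_eqI)
  interpret G: prob_space "gamma_dist n" by (rule prob_space_gamma_dist)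
  have sw: "(\<lambda>(w, T). scaled_weights n w T) \<in> dirichlet n (\<lambda>_. 1) \<Otimes>\<^sub>M gamma_dist n \<rightarrow>\<^sub>M PiM {1..n} (\<lambda>_. borel)"
    using measurable_scaled_weights[of n] by (simp cong: measurable_cong_sets)
  show "sets (distr (dirichlet n (\<lambda>_. 1) \<Otimes>\<^sub>M gamma_dist n) (PiM {1..n} (\<lambda>_. borel)) (\<lambda>(w, T). scaled_weights n w T))
    = sets (PiM {1..n} (\<lambda>_. exp_dist))"
    by (simp cong: sets_PiM_cong)
  fix A assume "A \<in> sets (distr (dirichlet n (\<lambda>_. 1) \<Otimes>\<^sub>M gamma_dist n) (PiM {1..n} (\<lambda>_. borel)) (\<lambda>(w, T). scaled_weights n w T))"
  then have A [measurable]: "A \<in> sets (PiM {1..n} (\<lambda>_. borel))" by simp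
  have iA: "(indicator A :: _ \<Rightarrow> ennreal) \<in> borel_measurable (PiM {1..n} (\<lambda>_. borel))"
    using A by (rule borel_measurable_indicator)
  have A': "A \<in> sets (PiM {1..n} (\<lambda>_. exp_dist))" using A by (simp cong: sets_PiM_cong)
  have "emeasure (distr (dirichlet n (\<lambda>_. 1) \<Otimes>\<^sub>M gamma_dist n) (PiM {1..n} (\<lambda>_. borel)) (\<lambda>(w, T). scaled_weights n w T)) A
      = (\<integral>\<^sup>+e. indicator A e \<partial>distr (dirichlet n (\<lambda>_. 1) \<Otimes>\<^sub>M gamma_dist n) (PiM {1..n} (\<lambda>_. borel)) (\<lambda>(w, T). scaled_weights n w T))"
    by (rule nn_integral_indicator[symmetric]) (simp only: sets_distr A)
  also have "\<dots> = (\<integral>\<^sup>+z. indicator A (case z of (w, T) \<Rightarrow> scaled_weights n w T) \<partial>(dirichlet n (\<lambda>_. 1) \<Otimes>\<^sub>M gamma_dist n))"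
    by (rule nn_integral_distr[OF sw]) (simp only: measurable_distr_eq1 iA)
  also have "\<dots> = (\<integral>\<^sup>+w. \<integral>\<^sup>+T. indicator A (scaled_weights n w T) \<partial>gamma_dist n \<partial>dirichlet n (\<lambda>_. 1))"
    using measurable_compose[OF sw borel_measurable_indicator[OF A]]
    by (subst G.nn_integral_fst[symmetric]) simp_all
  also have "\<dots> = (\<integral>\<^sup>+e. indicator A e \<partial>PiM {1..n} (\<lambda>_. exp_dist))"
    by (rule nn_integral_dirichlet_gamma[OF n iA])
  finally show "emeasure (distr (dirichlet n (\<lambda>_. 1) \<Otimes>\<^sub>M gamma_dist n) (PiM {1..n} (\<lambda>_. borel)) (\<lambda>(w, T). scaled_weights n w T)) A
      = emeasure (PiM {1..n} (\<lambda>_. exp_dist)) A"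
    using A' by simp
qed

lemma erlang_moments:
  assumes "D = density lborel (erlang_density k 1)"
  shows "integrable D (\<lambda>x. x ^ i)" and "(\<integral>x. x ^ i \<partial>D) = fact (k + i) / fact k"
proof -
  have "has_bochner_integral lborel (\<lambda>x. erlang_density k 1 x * x ^ i) (fact (k + i) / fact k)"
  proof (rule has_bochner_integral_nn_integral)
    show "AE x in lborel. 0 \<le> erlang_density k 1 x * x ^ i"
      by (auto simp: erlang_density_def)
    show "(\<integral>\<^sup>+x. ennreal (erlang_density k 1 x * x ^ i) \<partial>lborel) = ennreal (fact (k + i) / fact k)"
      by (subst nn_integral_erlang_ith_moment) simp_all
  qed auto
  then show "integrable D (\<lambda>x. x ^ i)" "(\<integral>x. x ^ i \<partial>D) = fact (k + i) / fact k"
    unfolding assms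
    by (subst integrable_real_density integral_real_density;
        simp add: has_bochner_integral_iff mult.commute)+
qed

lemma exp_dist_moments:
  shows "integrable exp_dist (\<lambda>x. (x - 1)\<^sup>2)" "(\<integral>x. x - 1 \<partial>exp_dist) = 0" "(\<integral>x. (x - 1)\<^sup>2 \<partial>exp_dist) = 1"
proof -
  interpret prob_space exp_dist by (rule prob_space_exp_dist)
  note m = erlang_moments[OF exp_dist_def]
  have i: "integrable exp_dist (\<lambda>x. x)" "(\<integral>x. x \<partial>exp_dist) = 1" "integrable exp_dist (\<lambda>x. x\<^sup>2)" "(\<integral>x. x\<^sup>2 \<partial>exp_dist) = 2"
    using m[of 1] m[of 2] by (simp_all add: numeral_2_eq_2)
  have p: "measure exp_dist UNIV = 1" using prob_space by simp
  show "integrable exp_dist (\<lambda>x. (x - 1)\<^sup>2)" "(\<integral>x. x - 1 \<partial>exp_dist) = 0" "(\<integral>x. (x - 1)\<^sup>2 \<partial>exp_dist) = 1"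
    using i p by (simp_all add: power2_diff)
qed

lemma gamma_dist_moments:
  assumes n: "n \<ge> 1"
  shows "integrable (gamma_dist n) (\<lambda>T. T\<^sup>2)" "(\<integral>T. T\<^sup>2 \<partial>gamma_dist n) = real n * (real n + 1)"
    "integrable (gamma_dist n) (\<lambda>T. (real n - T)\<^sup>2)" "(\<integral>T. (real n - T)\<^sup>2 \<partial>gamma_dist n) = real n"
proof -
  interpret prob_space "gamma_dist n" by (rule prob_space_gamma_dist)
  obtain k where k: "n = Suc k" using n by (cases n) auto
  note m = erlang_moments[OF gamma_dist_def]
  show i2: "integrable (gamma_dist n) (\<lambda>T. T\<^sup>2)" using m(1)[of n 2] .
  show v2: "(\<integral>T. T\<^sup>2 \<partial>gamma_dist n) = real n * (real n + 1)"
  proof -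
    have "fact (n - 1 + 2) / fact (n - 1) = real n * (real n + 1)"
      unfolding k by (simp add: numeral_2_eq_2 divide_simps)
    then show ?thesis using m(2)[of n 2] by simp
  qed
  have i1: "integrable (gamma_dist n) (\<lambda>T. T)" using m(1)[of n 1] by simp
  have v1: "(\<integral>T. T \<partial>gamma_dist n) = real n"
    using m(2)[of n 1] unfolding k by simp
  have p: "measure (gamma_dist n) UNIV = 1" using prob_space by simp
  show "integrable (gamma_dist n) (\<lambda>T. (real n - T)\<^sup>2)"
    using i1 i2 by (simp add: power2_diff)
  show "(\<integral>T. (real n - T)\<^sup>2 \<partial>gamma_dist n) = real n"
    using i1 i2 v1 v2 p by (simp add: power2_diff) (simp add: power2_eq_square algebra_simps)
qed

text \<open>Variance plus squared mean: the coordinates are independent with mean 1 and variance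
  1.\<close>

lemma exp_dist_second_moment:
  assumes I: "finite I"
  shows "integrable (PiM I (\<lambda>_. exp_dist)) (\<lambda>e. (\<Sum>i\<in>I. e i * b i)\<^sup>2)"
    and "(\<integral>e. (\<Sum>i\<in>I. e i * b i)\<^sup>2 \<partial>PiM I (\<lambda>_. exp_dist)) = (\<Sum>i\<in>I. (b i)\<^sup>2) + (\<Sum>i\<in>I. b i)\<^sup>2"
proof -
  interpret E: prob_space "PiM I (\<lambda>_. exp_dist)"
    by (intro prob_space_PiM prob_space_exp_dist)
  let ?X = "\<lambda>e. \<Sum>i\<in>I. b i * (e i - 1)" and ?s = "\<Sum>i\<in>I. b i"
  have m: "(\<lambda>x::real. x - 1) \<in> borel_measurable exp_dist" by simp
  note sq = integral_PiM_sum_square[OF prob_space_exp_dist I m exp_dist_moments(1,2), of b, unfolded exp_dist_moments(3)]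
  have "?X \<in> borel_measurable (PiM I (\<lambda>_. exp_dist))"
    by (intro borel_measurable_sum borel_measurable_times borel_measurable_const borel_measurable_diff) simp
  then have X: "integrable (PiM I (\<lambda>_. exp_dist)) ?X"
    by (rule E.square_integrable_imp_integrable) (rule sq)
  have expand: "(\<Sum>i\<in>I. e i * b i)\<^sup>2 = (?X e)\<^sup>2 + (2 * ?s) * ?X e + ?s\<^sup>2" for e
  proof -
    have "(\<Sum>i\<in>I. e i * b i) = ?X e + ?s"
      by (simp add: sum.distrib[symmetric] algebra_simps)
    then show ?thesis by (simp add: power2_sum algebra_simps)
  qed
  show "integrable (PiM I (\<lambda>_. exp_dist)) (\<lambda>e. (\<Sum>i\<in>I. e i * b i)\<^sup>2)"
    unfolding expand by (intro Bochner_Integration.integrable_add integrable_mult_right sq X E.integrable_const)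
  show "(\<integral>e. (\<Sum>i\<in>I. e i * b i)\<^sup>2 \<partial>PiM I (\<lambda>_. exp_dist)) = (\<Sum>i\<in>I. (b i)\<^sup>2) + (\<Sum>i\<in>I. b i)\<^sup>2"
    unfolding expand using sq X
    by (subst Bochner_Integration.integral_add; (intro Bochner_Integration.integrable_add integrable_mult_right sq X E.integrable_const)?)+
       (simp add: E.prob_space)
qed

text \<open>The exponential sum is \<open>T\<close> times the Dirichlet sum with \<open>T\<close>
  independent of the weights, so its second moment is that of the Dirichlet sum times the second
  moment \<open>n (n + 1)\<close> of \<open>T\<close>.\<close>

lemma dirichlet_second_moment:
  assumes n: "n \<ge> 1"
  shows "(\<integral>\<^sup>+w. ennreal ((\<Sum>i\<in>{1..n}. w i * b i)\<^sup>2) \<partial>dirichlet n (\<lambda>_. 1))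
    = ennreal (((\<Sum>i\<in>{1..n}. (b i)\<^sup>2) + (\<Sum>i\<in>{1..n}. b i)\<^sup>2) / (real n * (real n + 1)))"
    (is "?D = ennreal (?s / ?c)")
proof -
  have c: "0 < ?c" using n by simp
  have [measurable]: "(\<lambda>w. (\<Sum>i\<in>{1..n}. w i * b i)\<^sup>2) \<in> borel_measurable (PiM {1..n} (\<lambda>_. borel))"
    by measurable
  have "ennreal ?s = (\<integral>\<^sup>+e. ennreal ((\<Sum>i\<in>{1..n}. e i * b i)\<^sup>2) \<partial>PiM {1..n} (\<lambda>_. exp_dist))"
    using exp_dist_second_moment[of "{1..n}" b] by (subst nn_integral_eq_integral) simp_all
  also have "\<dots> = (\<integral>\<^sup>+w. \<integral>\<^sup>+T. ennreal ((\<Sum>i\<in>{1..n}. scaled_weights n w T i * b i)\<^sup>2) \<partial>gamma_dist n \<partial>dirichlet n (\<lambda>_. 1))"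
    by (rule nn_integral_dirichlet_gamma[OF n, symmetric]) measurable
  also have "\<dots> = (\<integral>\<^sup>+w. ennreal ?c * ennreal ((\<Sum>i\<in>{1..n}. w i * b i)\<^sup>2) \<partial>dirichlet n (\<lambda>_. 1))"
  proof (rule nn_integral_cong)
    fix w
    have "(\<Sum>i\<in>{1..n}. scaled_weights n w T i * b i)\<^sup>2 = T\<^sup>2 * (\<Sum>i\<in>{1..n}. w i * b i)\<^sup>2" for T
      by (simp add: scaled_weights_def sum_distrib_left[symmetric] mult.assoc power_mult_distrib)
    then have "(\<integral>\<^sup>+T. ennreal ((\<Sum>i\<in>{1..n}. scaled_weights n w T i * b i)\<^sup>2) \<partial>gamma_dist n)
      = (\<integral>\<^sup>+T. ennreal (T\<^sup>2) * ennreal ((\<Sum>i\<in>{1..n}. w i * b i)\<^sup>2) \<partial>gamma_dist n)"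
      by (simp add: ennreal_mult)
    also have "\<dots> = (\<integral>\<^sup>+T. ennreal (T\<^sup>2) \<partial>gamma_dist n) * ennreal ((\<Sum>i\<in>{1..n}. w i * b i)\<^sup>2)"
      by (rule nn_integral_multc) simp
    also have "(\<integral>\<^sup>+T. ennreal (T\<^sup>2) \<partial>gamma_dist n) = ennreal ?c"
      using gamma_dist_moments[OF n] by (subst nn_integral_eq_integral) simp_all
    finally show "(\<integral>\<^sup>+T. ennreal ((\<Sum>i\<in>{1..n}. scaled_weights n w T i * b i)\<^sup>2) \<partial>gamma_dist n)
      = ennreal ?c * ennreal ((\<Sum>i\<in>{1..n}. w i * b i)\<^sup>2)" .
  qed
  also have "\<dots> = ennreal ?c * ?D"
    by (rule nn_integral_cmult) measurable
  finally have "ennreal (1 / ?c) * ennreal ?s = ennreal (1 / ?c) * (ennreal ?c * ?D)" by simp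
  also have "\<dots> = (ennreal (1 / ?c) * ennreal ?c) * ?D" by (simp only: mult.assoc)
  also have "ennreal (1 / ?c) * ennreal ?c = 1"
    using c n by (simp flip: ennreal_mult)
  finally have "?D = ennreal (1 / ?c) * ennreal ?s" by simp
  also have "\<dots> = ennreal (1 / ?c * ?s)"
    using c by (intro ennreal_mult[symmetric]) (simp_all add: sum_nonneg)
  finally show ?thesis by simp
qed

text \<open>The weights sum to 1 almost surely, so centring them by \<open>1 / n\<close> amounts to
  centring \<open>b\<close> by its mean, and the squared-sum term drops out.\<close>

lemma dirichlet_centered_second_moment:
  assumes n: "n \<ge> 1"
  shows "(\<integral>\<^sup>+w. ennreal ((\<Sum>i\<in>{1..n}. (w i - 1 / real n) * b i)\<^sup>2) \<partial>dirichlet n (\<lambda>_. 1))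
    \<le> ennreal ((\<Sum>i\<in>{1..n}. (b i)\<^sup>2) / (real n)\<^sup>2)"
proof -
  let ?m = "(\<Sum>i\<in>{1..n}. b i) / real n"
  have n0: "0 < real n" using n by simp
  have s0: "(\<Sum>i\<in>{1..n}. b i - ?m) = 0" using n by (simp add: sum_subtractf)
  have "(\<integral>\<^sup>+w. ennreal ((\<Sum>i\<in>{1..n}. (w i - 1 / real n) * b i)\<^sup>2) \<partial>dirichlet n (\<lambda>_. 1))
    = (\<integral>\<^sup>+w. ennreal ((\<Sum>i\<in>{1..n}. w i * (b i - ?m))\<^sup>2) \<partial>dirichlet n (\<lambda>_. 1))"
  proof (rule nn_integral_cong_AE, use AE_dirichlet_sum[OF n] in eventually_elim)
    case (elim w)
    have "(\<Sum>i\<in>{1..n}. w i * (b i - ?m)) = (\<Sum>i\<in>{1..n}. w i * b i) - (\<Sum>i\<in>{1..n}. w i) * ?m"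
      by (simp add: sum_subtractf algebra_simps sum_distrib_right sum_divide_distrib)
    also have "\<dots> = (\<Sum>i\<in>{1..n}. (w i - 1 / real n) * b i)"
      unfolding elim by (simp add: sum_subtractf algebra_simps sum_divide_distrib)
    finally show ?case by simp
  qed
  also have "\<dots> = ennreal ((\<Sum>i\<in>{1..n}. (b i - ?m)\<^sup>2) / (real n * (real n + 1)))"
    by (subst dirichlet_second_moment[OF n]) (simp only: s0, simp)
  also have "\<dots> \<le> ennreal ((\<Sum>i\<in>{1..n}. (b i)\<^sup>2) / (real n)\<^sup>2)"
  proof (intro ennreal_leI frac_le)
    have "(\<Sum>i\<in>{1..n}. (b i - m)\<^sup>2) = (\<Sum>i\<in>{1..n}. (b i)\<^sup>2) - 2 * m * (\<Sum>i\<in>{1..n}. b i) + real n * m\<^sup>2" for m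
      by (simp add: power2_diff sum.distrib sum_subtractf sum_distrib_left algebra_simps)
    from this[of ?m] have "(\<Sum>i\<in>{1..n}. (b i - ?m)\<^sup>2)
      = (\<Sum>i\<in>{1..n}. (b i)\<^sup>2) - 2 * ?m * (\<Sum>i\<in>{1..n}. b i) + real n * ?m\<^sup>2" .
    also have "\<dots> = (\<Sum>i\<in>{1..n}. (b i)\<^sup>2) - real n * ?m\<^sup>2"
      using n0 by (simp add: power2_eq_square field_simps)
    finally show "(\<Sum>i\<in>{1..n}. (b i - ?m)\<^sup>2) \<le> (\<Sum>i\<in>{1..n}. (b i)\<^sup>2)" by simp
    show "(real n)\<^sup>2 \<le> real n * (real n + 1)" by (simp add: power2_eq_square mult_left_mono)
  qed (use n0 in \<open>auto simp: sum_nonneg\<close>)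
  finally show ?thesis .
qed

definition centered_exp :: "real measure" where
  "centered_exp = distr exp_dist borel (\<lambda>x. x - 1)"

lemma centered_exp:
  shows "real_distribution centered_exp" "integrable centered_exp (\<lambda>x. x\<^sup>2)"
    "(\<integral>x. x \<partial>centered_exp) = 0" "(\<integral>x. x\<^sup>2 \<partial>centered_exp) = 1"
proof -
  interpret prob_space exp_dist by (rule prob_space_exp_dist)
  show "real_distribution centered_exp"
    unfolding centered_exp_def by (rule real_distribution_distr) simp
  show "integrable centered_exp (\<lambda>x. x\<^sup>2)"
    "(\<integral>x. x \<partial>centered_exp) = 0" "(\<integral>x. x\<^sup>2 \<partial>centered_exp) = 1"
    unfolding centered_exp_def using exp_dist_moments
    by (simp_all add: integrable_distr_eq integral_distr)
qed

lemma char_centered_exp: "char centered_exp t = (\<integral>x. iexp (t * (x - 1)) \<partial>exp_dist)"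
  unfolding char_def centered_exp_def by (subst integral_distr) simp_all

text \<open>Weights and exponentials are coupled through an independent total \<open>T\<close>, so
  that the two exponents differ by \<open>n - T\<close> times the weighted sum. Imaginary
  exponentials are 1-Lipschitz, and the second moment of this difference bounds the error. The bound
  is small on average when \<open>b\<close> comes from centred scores divided by a multiple of
  \<open>sqrt n\<close>.\<close>

lemma dirichlet_char_approx:
  assumes n: "n \<ge> 1"
  shows "cmod ((\<integral>w. iexp (real n * (\<Sum>i\<in>{1..n}. (w i - 1 / real n) * b i)) \<partial>dirichlet n (\<lambda>_. 1))
      - (\<Prod>i\<in>{1..n}. char centered_exp (b i)))
    \<le> sqrt (((\<Sum>i\<in>{1..n}. (b i)\<^sup>2) + (\<Sum>i\<in>{1..n}. b i)\<^sup>2) / real n)"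
proof -
  let ?D = "dirichlet n (\<lambda>_. 1)" and ?E = "PiM {1..n} (\<lambda>_. exp_dist)"
  interpret D: prob_space ?D by (rule prob_space_dirichlet[OF n])
  interpret G: prob_space "gamma_dist n" by (rule prob_space_gamma_dist)
  interpret E1: prob_space exp_dist by (rule prob_space_exp_dist)
  interpret DG: pair_prob_space ?D "gamma_dist n" ..
  interpret product_sigma_finite "\<lambda>_::nat. exp_dist" ..
  let ?DG = "?D \<Otimes>\<^sub>M gamma_dist n"
  have E_int: "integrable exp_dist (\<lambda>x. iexp (t * (x - 1)))" for t
    by (rule E1.integrable_iexp) simp_all
  have wm: "(\<lambda>w. w i) \<in> borel_measurable ?D" if "i \<in> {1..n}" for i
    using measurable_component_singleton[OF that, of "\<lambda>_. borel"] by (simp cong: measurable_cong_sets)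
  have sw: "(\<lambda>z. scaled_weights n (fst z) (snd z)) \<in> ?DG \<rightarrow>\<^sub>M PiM {1..n} (\<lambda>_. borel)"
    using measurable_scaled_weights[of n] by (simp add: case_prod_beta' cong: measurable_cong_sets)
  let ?x = "\<lambda>z :: (nat \<Rightarrow> real) \<times> real. real n * (\<Sum>i\<in>{1..n}. (fst z i - 1 / real n) * b i)"
  let ?y = "\<lambda>z :: (nat \<Rightarrow> real) \<times> real. \<Sum>i\<in>{1..n}. b i * (scaled_weights n (fst z) (snd z) i - 1)"
  let ?q = "\<lambda>z :: (nat \<Rightarrow> real) \<times> real. (real n - snd z) * (\<Sum>i\<in>{1..n}. fst z i * b i)"
  have xm [measurable]: "?x \<in> borel_measurable ?DG" by (intro borel_measurable_times borel_measurable_sum borel_measurable_diff borel_measurable_const measurable_compose[OF measurable_fst wm])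
  have wb [measurable]: "(\<lambda>w. \<Sum>i\<in>{1..n}. w i * b i) \<in> borel_measurable ?D"
    by (intro borel_measurable_times borel_measurable_sum borel_measurable_const wm)
  have ym [measurable]: "?y \<in> borel_measurable ?DG"
    using measurable_compose[OF sw, of "\<lambda>e. \<Sum>i\<in>{1..n}. b i * (e i - 1)" borel] by simp
  have qm [measurable]: "?q \<in> borel_measurable ?DG"
    by (intro borel_measurable_times borel_measurable_diff borel_measurable_const measurable_compose[OF measurable_fst wb]
        measurable_compose[OF measurable_snd]) simp
  have xy: "?x z - ?y z = ?q z" for z
    using n by (simp add: scaled_weights_def sum_distrib_left sum_subtractf[symmetric] algebra_simps)
  have lhs: "(\<integral>w. iexp (real n * (\<Sum>i\<in>{1..n}. (w i - 1 / real n) * b i)) \<partial>?D) = (\<integral>z. iexp (?x z) \<partial>?DG)"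
  proof -
    have "integrable ?DG (\<lambda>z. iexp (?x z))"
      by (rule DG.integrable_iexp) simp_all
    from DG.integral_fst'[OF this] show ?thesis by (simp add: G.prob_space[simplified])
  qed
  have rhs: "(\<Prod>i\<in>{1..n}. char centered_exp (b i)) = (\<integral>z. iexp (?y z) \<partial>?DG)"
  proof -
    have "(\<integral>z. iexp (?y z) \<partial>?DG) = (\<integral>e. iexp (\<Sum>i\<in>{1..n}. b i * (e i - 1)) \<partial>?E)"
      unfolding distr_scaled_weights[OF n, symmetric]
      using sw by (subst integral_distr) (simp_all add: case_prod_beta')
    also have "\<dots> = (\<integral>e. (\<Prod>i\<in>{1..n}. iexp (b i * (e i - 1))) \<partial>?E)"
      by (simp add: exp_sum sum_distrib_left)
    also have "\<dots> = (\<Prod>i\<in>{1..n}. \<integral>x. iexp (b i * (x - 1)) \<partial>exp_dist)"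
      by (rule product_integral_prod) (simp, rule E_int)
    finally show ?thesis by (simp only: char_centered_exp)
  qed
  \<comment> \<open>The second moment factors by independence of \<open>T\<close> and the weights.
    The factor \<open>n\<close> is the variance of \<open>T\<close>, against the denominator
    \<open>n (n + 1)\<close> of the Dirichlet moment.\<close>
  have q2: "(\<integral>\<^sup>+z. ennreal ((?q z)\<^sup>2) \<partial>?DG) = ennreal (((\<Sum>i\<in>{1..n}. (b i)\<^sup>2) + (\<Sum>i\<in>{1..n}. b i)\<^sup>2) / (real n + 1))"
  proof -
    have "(\<integral>\<^sup>+z. ennreal ((?q z)\<^sup>2) \<partial>?DG) = (\<integral>\<^sup>+w. \<integral>\<^sup>+T. ennreal ((?q (w, T))\<^sup>2) \<partial>gamma_dist n \<partial>?D)"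
      by (rule G.nn_integral_fst[symmetric]) measurable
    also have "\<dots> = (\<integral>\<^sup>+w. ennreal (real n) * ennreal ((\<Sum>i\<in>{1..n}. w i * b i)\<^sup>2) \<partial>?D)"
    proof (rule nn_integral_cong)
      fix w
      have "(\<integral>\<^sup>+T. ennreal ((?q (w, T))\<^sup>2) \<partial>gamma_dist n)
        = (\<integral>\<^sup>+T. ennreal ((real n - T)\<^sup>2) * ennreal ((\<Sum>i\<in>{1..n}. w i * b i)\<^sup>2) \<partial>gamma_dist n)"
        by (simp add: power_mult_distrib ennreal_mult)
      also have "\<dots> = (\<integral>\<^sup>+T. ennreal ((real n - T)\<^sup>2) \<partial>gamma_dist n) * ennreal ((\<Sum>i\<in>{1..n}. w i * b i)\<^sup>2)"
        by (rule nn_integral_multc) simp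
      also have "(\<integral>\<^sup>+T. ennreal ((real n - T)\<^sup>2) \<partial>gamma_dist n) = ennreal (real n)"
        using gamma_dist_moments[OF n] by (subst nn_integral_eq_integral) simp_all
      finally show "(\<integral>\<^sup>+T. ennreal ((?q (w, T))\<^sup>2) \<partial>gamma_dist n) = ennreal (real n) * ennreal ((\<Sum>i\<in>{1..n}. w i * b i)\<^sup>2)" .
    qed
    also have "\<dots> = ennreal (real n) * (\<integral>\<^sup>+w. ennreal ((\<Sum>i\<in>{1..n}. w i * b i)\<^sup>2) \<partial>?D)"
      by (rule nn_integral_cmult) measurable
    also have "\<dots> = ennreal (real n * (((\<Sum>i\<in>{1..n}. (b i)\<^sup>2) + (\<Sum>i\<in>{1..n}. b i)\<^sup>2) / (real n * (real n + 1))))"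
      unfolding dirichlet_second_moment[OF n] by (rule ennreal_mult[symmetric]) (simp_all add: sum_nonneg)
    finally show ?thesis using n by simp
  qed
  have q2_int: "integrable ?DG (\<lambda>z. (?q z)\<^sup>2)"
    by (rule integrableI_nonneg) (rule borel_measurable_power[OF qm], simp, unfold q2, simp)
  have q1_int: "integrable ?DG ?q"
    by (rule DG.square_integrable_imp_integrable[OF qm q2_int])
  have diff: "(\<integral>z. iexp (?x z) \<partial>?DG) - (\<integral>z. iexp (?y z) \<partial>?DG) = (\<integral>z. iexp (?x z) - iexp (?y z) \<partial>?DG)"
    by (rule Bochner_Integration.integral_diff[symmetric]) (rule DG.integrable_iexp; simp)+
  have "cmod ((\<integral>z. iexp (?x z) \<partial>?DG) - (\<integral>z. iexp (?y z) \<partial>?DG)) \<le> (\<integral>z. cmod (iexp (?x z) - iexp (?y z)) \<partial>?DG)"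
    unfolding diff by (rule integral_norm_bound)
  also have "\<dots> \<le> (\<integral>z. \<bar>?q z\<bar> \<partial>?DG)"
  proof (rule integral_mono)
    show "integrable ?DG (\<lambda>z. cmod (iexp (?x z) - iexp (?y z)))"
      by (intro integrable_norm Bochner_Integration.integrable_diff) (rule DG.integrable_iexp; simp)+
    show "integrable ?DG (\<lambda>z. \<bar>?q z\<bar>)" using q1_int by simp
    fix z
    have "iexp (?x z) - iexp (?y z) = iexp (?y z) * (iexp (?x z - ?y z) - 1)"
      by (simp add: algebra_simps exp_add[symmetric])
    then have "cmod (iexp (?x z) - iexp (?y z)) = cmod (iexp (?x z - ?y z) - 1)"
      by (simp only: norm_mult norm_exp_i_times mult_1)
    also have "\<dots> \<le> \<bar>?x z - ?y z\<bar>"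
      using iexp_approx1[of "?x z - ?y z" 0] by simp
    finally show "cmod (iexp (?x z) - iexp (?y z)) \<le> \<bar>?q z\<bar>" by (simp only: xy)
  qed
  also have "\<dots> \<le> sqrt (\<integral>z. (?q z)\<^sup>2 \<partial>?DG)"
    by (rule DG.integral_abs_le_sqrt[OF qm q2_int])
  also have "(\<integral>z. (?q z)\<^sup>2 \<partial>?DG) = ((\<Sum>i\<in>{1..n}. (b i)\<^sup>2) + (\<Sum>i\<in>{1..n}. b i)\<^sup>2) / (real n + 1)"
    unfolding integral_eq_nn_integral[OF borel_measurable_power[OF qm] AE_I2[OF zero_le_power2]] q2
    by (simp add: sum_nonneg)
  also have "sqrt \<dots> \<le> sqrt (((\<Sum>i\<in>{1..n}. (b i)\<^sup>2) + (\<Sum>i\<in>{1..n}. b i)\<^sup>2) / real n)"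
    using n by (intro real_sqrt_le_mono divide_left_mono) (auto simp: sum_nonneg)
  finally show ?thesis unfolding lhs rhs .
qed

section \<open>Convergence and boundedness in probability\<close>

text \<open>Convergence to 0 in probability. Measurability is demanded for \<open>n \<ge> 1\<close>,
  the range in which the estimators and the weights are specified.\<close>

definition tends_zero :: "'w measure \<Rightarrow> (nat \<Rightarrow> 'w \<Rightarrow> 'a::euclidean_space) \<Rightarrow> bool" where
  "tends_zero M R \<longleftrightarrow> (\<forall>n\<ge>1. R n \<in> borel_measurable M) \<and>
     (\<forall>e>0. (\<lambda>n. measure M {\<omega> \<in> space M. e < norm (R n \<omega>)}) \<longlonglongrightarrow> 0)"

text \<open>Tightness. The tail bound is required only eventually in \<open>n\<close>, so that
  convergence to 0 in probability implies it with one constant \<open>K\<close>.\<close>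

definition bdd_prob :: "'w measure \<Rightarrow> (nat \<Rightarrow> 'w \<Rightarrow> 'a::euclidean_space) \<Rightarrow> bool" where
  "bdd_prob M Y \<longleftrightarrow> (\<forall>n\<ge>1. Y n \<in> borel_measurable M) \<and>
     (\<forall>e>0. \<exists>K. eventually (\<lambda>n. measure M {\<omega> \<in> space M. K < norm (Y n \<omega>)} \<le> e) sequentially)"

lemma eventually_ge_1: "eventually (\<lambda>n::nat. n \<ge> 1) sequentially"
  by (rule eventually_ge_at_top)

lemma tends_zero_measurable: "tends_zero M R \<Longrightarrow> n \<ge> 1 \<Longrightarrow> R n \<in> borel_measurable M"
  by (simp add: tends_zero_def)

lemma bdd_prob_measurable: "bdd_prob M Y \<Longrightarrow> n \<ge> 1 \<Longrightarrow> Y n \<in> borel_measurable M"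
  by (simp add: bdd_prob_def)

context prob_space
begin

lemma tends_zeroI:
  fixes R :: "nat \<Rightarrow> 'a \<Rightarrow> 'b::euclidean_space"
  assumes m: "\<And>n. n \<ge> 1 \<Longrightarrow> R n \<in> borel_measurable M"
    and e: "\<And>e d. 0 < e \<Longrightarrow> 0 < d \<Longrightarrow> eventually (\<lambda>n. prob {\<omega> \<in> space M. e < norm (R n \<omega>)} \<le> d) sequentially"
  shows "tends_zero M R"
  unfolding tends_zero_def
proof (intro conjI allI impI m)
  fix e :: real assume e0: "0 < e"
  show "(\<lambda>n. prob {\<omega> \<in> space M. e < norm (R n \<omega>)}) \<longlonglongrightarrow> 0"
  proof (rule tendstoI)
    fix d :: real assume "0 < d"
    then have "eventually (\<lambda>n. prob {\<omega> \<in> space M. e < norm (R n \<omega>)} \<le> d / 2) sequentially"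
      using e[OF e0, of "d / 2"] by simp
    then show "eventually (\<lambda>n. dist (prob {\<omega> \<in> space M. e < norm (R n \<omega>)}) 0 < d) sequentially"
      by eventually_elim (use \<open>0 < d\<close> in simp)
  qed
qed

lemma tends_zeroD:
  assumes "tends_zero M R" "0 < e" "0 < d"
  shows "eventually (\<lambda>n. prob {\<omega> \<in> space M. e < norm (R n \<omega>)} \<le> d) sequentially"
proof -
  have "(\<lambda>n. prob {\<omega> \<in> space M. e < norm (R n \<omega>)}) \<longlonglongrightarrow> 0"
    using assms by (simp add: tends_zero_def)
  then have "eventually (\<lambda>n. prob {\<omega> \<in> space M. e < norm (R n \<omega>)} < d) sequentially"
    using assms(3) by (rule order_tendstoD)
  then show ?thesis by (rule eventually_mono) simp
qed

text \<open>Measurability concerns the two bounding events, and the inclusion may fail on a null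
  set; the estimating equations hold only almost surely.\<close>

lemma prob_le_add:
  assumes "Measurable.pred M B" "Measurable.pred M C"
    and "AE \<omega> in M. A \<omega> \<longrightarrow> B \<omega> \<or> C \<omega>"
  shows "prob {\<omega> \<in> space M. A \<omega>} \<le> prob {\<omega> \<in> space M. B \<omega>} + prob {\<omega> \<in> space M. C \<omega>}"
proof -
  have s: "{\<omega> \<in> space M. B \<omega>} \<in> sets M" "{\<omega> \<in> space M. C \<omega>} \<in> sets M"
    using assms(1,2) by measurable
  have "prob {\<omega> \<in> space M. A \<omega>} \<le> prob ({\<omega> \<in> space M. B \<omega>} \<union> {\<omega> \<in> space M. C \<omega>})"
    by (rule finite_measure_mono_AE) (use assms(3) s in auto)
  also have "\<dots> \<le> prob {\<omega> \<in> space M. B \<omega>} + prob {\<omega> \<in> space M. C \<omega>}"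
    by (rule measure_Un_le[OF s])
  finally show ?thesis .
qed

lemma tends_zero_add:
  fixes R S :: "nat \<Rightarrow> 'a \<Rightarrow> 'b::euclidean_space"
  assumes R: "tends_zero M R" and S: "tends_zero M S"
  shows "tends_zero M (\<lambda>n \<omega>. R n \<omega> + S n \<omega>)"
proof (rule tends_zeroI)
  note m = tends_zero_measurable[OF R] tends_zero_measurable[OF S]
  show "(\<lambda>\<omega>. R n \<omega> + S n \<omega>) \<in> borel_measurable M" if "n \<ge> 1" for n
    using m that by simp
  fix e d :: real assume ed: "0 < e" "0 < d"
  show "eventually (\<lambda>n. prob {\<omega> \<in> space M. e < norm (R n \<omega> + S n \<omega>)} \<le> d) sequentially"
    using eventually_ge_1 tends_zeroD[OF R half_gt_zero[OF ed(1)] half_gt_zero[OF ed(2)]]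
      tends_zeroD[OF S half_gt_zero[OF ed(1)] half_gt_zero[OF ed(2)]]
  proof eventually_elim
    case (elim n)
    have [measurable]: "R n \<in> borel_measurable M" "S n \<in> borel_measurable M" using m elim by auto
    have "prob {\<omega> \<in> space M. e < norm (R n \<omega> + S n \<omega>)}
      \<le> prob {\<omega> \<in> space M. e / 2 < norm (R n \<omega>)} + prob {\<omega> \<in> space M. e / 2 < norm (S n \<omega>)}"
    proof (rule prob_le_add)
      show "AE \<omega> in M. e < norm (R n \<omega> + S n \<omega>) \<longrightarrow> e / 2 < norm (R n \<omega>) \<or> e / 2 < norm (S n \<omega>)"
      proof (intro AE_I2 impI)
        fix \<omega> assume "e < norm (R n \<omega> + S n \<omega>)"
        then show "e / 2 < norm (R n \<omega>) \<or> e / 2 < norm (S n \<omega>)"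
          using norm_triangle_ineq[of "R n \<omega>" "S n \<omega>"] by linarith
      qed
    qed measurable
    then show ?case using elim ed by simp
  qed
qed

lemma tends_zero_bound:
  fixes R :: "nat \<Rightarrow> 'a \<Rightarrow> 'b::euclidean_space" and S :: "nat \<Rightarrow> 'a \<Rightarrow> 'c::euclidean_space"
  assumes S: "tends_zero M S" and m: "\<And>n. n \<ge> 1 \<Longrightarrow> R n \<in> borel_measurable M"
    and c: "\<And>n. n \<ge> 1 \<Longrightarrow> AE \<omega> in M. norm (R n \<omega>) \<le> c * norm (S n \<omega>)"
  shows "tends_zero M R"
proof (rule tends_zeroI)
  fix e d :: real assume ed: "0 < e" "0 < d"
  define c' where "c' = \<bar>c\<bar> + 1"
  have c': "0 < c'" by (simp add: c'_def)
  then have "0 < e / c'" using ed by simp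
  from tends_zeroD[OF S this ed(2)] eventually_ge_1
  show "eventually (\<lambda>n. prob {\<omega> \<in> space M. e < norm (R n \<omega>)} \<le> d) sequentially"
  proof eventually_elim
    case (elim n)
    have [measurable]: "S n \<in> borel_measurable M" using tends_zero_measurable[OF S] elim by simp
    have "prob {\<omega> \<in> space M. e < norm (R n \<omega>)} \<le> prob {\<omega> \<in> space M. e / c' < norm (S n \<omega>)}"
    proof (rule finite_measure_mono_AE)
      show "AE \<omega> in M. \<omega> \<in> {\<omega> \<in> space M. e < norm (R n \<omega>)} \<longrightarrow> \<omega> \<in> {\<omega> \<in> space M. e / c' < norm (S n \<omega>)}"
        using c[OF elim(2)]
      proof eventually_elim
        case (elim \<omega>)
        have "c * norm (S n \<omega>) \<le> c' * norm (S n \<omega>)" by (intro mult_right_mono) (auto simp: c'_def)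
        then show ?case using elim c' by (auto simp: field_simps)
      qed
    qed measurable
    then show ?case using elim by simp
  qed
qed (rule m)

lemma tends_zero_scaleR:
  fixes R :: "nat \<Rightarrow> 'a \<Rightarrow> 'b::euclidean_space"
  assumes R: "tends_zero M R"
  shows "tends_zero M (\<lambda>n \<omega>. c *\<^sub>R R n \<omega>)"
  by (rule tends_zero_bound[OF R, of _ "\<bar>c\<bar>"]) (use tends_zero_measurable[OF R] in auto)

lemma tends_zero_diff:
  fixes R S :: "nat \<Rightarrow> 'a \<Rightarrow> 'b::euclidean_space"
  assumes "tends_zero M R" "tends_zero M S"
  shows "tends_zero M (\<lambda>n \<omega>. R n \<omega> - S n \<omega>)"
  using tends_zero_add[OF assms(1) tends_zero_scaleR[OF assms(2), of "-1"]] by simp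

lemma tends_zero_matrix:
  fixes R :: "nat \<Rightarrow> 'a \<Rightarrow> real ^ 'n" and J :: "real ^ 'n ^ 'm"
  assumes R: "tends_zero M R"
  shows "tends_zero M (\<lambda>n \<omega>. J *v R n \<omega>)"
  by (rule tends_zero_bound[OF R, of _ "norm J"])
     (use tends_zero_measurable[OF R] norm_matrix_vector_mult_le in auto)

text \<open>Chebyshev, with the second moment as a nonnegative integral because the bounds for
  cross-fitted sums arrive in that form.\<close>

lemma prob_norm_gt_le:
  fixes R :: "'a \<Rightarrow> 'b::euclidean_space"
  assumes [measurable]: "R \<in> borel_measurable M" and e: "0 < e" and c: "0 \<le> c"
    and b: "(\<integral>\<^sup>+\<omega>. ennreal ((norm (R \<omega>))\<^sup>2) \<partial>M) \<le> ennreal c"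
  shows "prob {\<omega> \<in> space M. e < norm (R \<omega>)} \<le> c / e\<^sup>2"
proof -
  have "emeasure M {\<omega> \<in> space M. e < norm (R \<omega>)} = (\<integral>\<^sup>+\<omega>. indicator {\<omega> \<in> space M. e < norm (R \<omega>)} \<omega> \<partial>M)"
    by simp
  also have "\<dots> \<le> (\<integral>\<^sup>+\<omega>. ennreal (1 / e\<^sup>2) * ennreal ((norm (R \<omega>))\<^sup>2) \<partial>M)"
  proof (rule nn_integral_mono)
    fix \<omega>
    have "1 \<le> 1 / e\<^sup>2 * (norm (R \<omega>))\<^sup>2" if "e < norm (R \<omega>)"
      using e that power_mono[of e "norm (R \<omega>)" 2] by (simp add: field_simps)
    then show "indicator {\<omega> \<in> space M. e < norm (R \<omega>)} \<omega> \<le> ennreal (1 / e\<^sup>2) * ennreal ((norm (R \<omega>))\<^sup>2)"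
      using e by (auto simp: indicator_def ennreal_mult[symmetric] simp flip: ennreal_1 intro!: ennreal_leI)
  qed
  also have "\<dots> = ennreal (1 / e\<^sup>2) * (\<integral>\<^sup>+\<omega>. ennreal ((norm (R \<omega>))\<^sup>2) \<partial>M)"
    by (rule nn_integral_cmult) measurable
  also have "\<dots> \<le> ennreal (1 / e\<^sup>2) * ennreal c"
    by (intro mult_left_mono b) simp
  also have "\<dots> = ennreal (c / e\<^sup>2)"
    using c by (simp add: ennreal_mult[symmetric])
  finally show ?thesis
    using c by (simp add: emeasure_eq_measure)
qed

lemma tends_zero_L2:
  fixes R :: "nat \<Rightarrow> 'a \<Rightarrow> 'b::euclidean_space"
  assumes m: "\<And>n. n \<ge> 1 \<Longrightarrow> R n \<in> borel_measurable M"
    and b: "\<And>n. n \<ge> 1 \<Longrightarrow> (\<integral>\<^sup>+\<omega>. ennreal ((norm (R n \<omega>))\<^sup>2) \<partial>M) \<le> ennreal (c n)"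
    and c: "\<And>n. n \<ge> 1 \<Longrightarrow> 0 \<le> c n" "c \<longlonglongrightarrow> 0"
  shows "tends_zero M R"
proof (rule tends_zeroI)
  fix e d :: real assume ed: "0 < e" "0 < d"
  have "eventually (\<lambda>n. c n < d * e\<^sup>2) sequentially"
    using c(2) ed by (intro order_tendstoD) auto
  with eventually_ge_1 show "eventually (\<lambda>n. prob {\<omega> \<in> space M. e < norm (R n \<omega>)} \<le> d) sequentially"
  proof eventually_elim
    case (elim n)
    have "c n / e\<^sup>2 \<le> d" using elim ed by (simp add: field_simps)
    then show ?case
      using prob_norm_gt_le[OF m ed(1) c(1) b, OF elim(1) elim(1) elim(1)] by linarith
  qed
qed (rule m)

lemma bdd_prob_L2:
  fixes Y :: "nat \<Rightarrow> 'a \<Rightarrow> 'b::euclidean_space"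
  assumes m: "\<And>n. n \<ge> 1 \<Longrightarrow> Y n \<in> borel_measurable M" and c: "0 \<le> c"
    and b: "\<And>n. n \<ge> 1 \<Longrightarrow> (\<integral>\<^sup>+\<omega>. ennreal ((norm (Y n \<omega>))\<^sup>2) \<partial>M) \<le> ennreal c"
  shows "bdd_prob M Y"
  unfolding bdd_prob_def
proof (intro conjI allI impI m)
  fix e :: real assume e: "0 < e"
  \<comment> \<open>\<open>sqrt (c / e)\<close> already meets the bound; adding 1 keeps
    \<open>K\<close> positive when \<open>c = 0\<close>.\<close>
  define K where "K = sqrt (c / e) + 1"
  have K: "0 < K" using c e by (simp add: K_def add_nonneg_pos)
  have "c / e \<le> K\<^sup>2"
    using real_sqrt_le_iff[of "c / e" "K\<^sup>2"] K by (simp add: K_def)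
  then have "c / K\<^sup>2 \<le> e" using K e by (simp add: field_simps)
  then have "prob {\<omega> \<in> space M. K < norm (Y n \<omega>)} \<le> e" if "n \<ge> 1" for n
    using prob_norm_gt_le[OF m K c b, OF that that] by linarith
  then show "\<exists>K. eventually (\<lambda>n. prob {\<omega> \<in> space M. K < norm (Y n \<omega>)} \<le> e) sequentially"
    by (intro exI[of _ K] eventually_mono[OF eventually_ge_1])
qed

lemma bdd_prob_add:
  fixes R S :: "nat \<Rightarrow> 'a \<Rightarrow> 'b::euclidean_space"
  assumes R: "bdd_prob M R" and S: "bdd_prob M S"
  shows "bdd_prob M (\<lambda>n \<omega>. R n \<omega> + S n \<omega>)"
  unfolding bdd_prob_def
proof (intro conjI allI impI)
  note m = bdd_prob_measurable[OF R] bdd_prob_measurable[OF S]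
  show "(\<lambda>\<omega>. R n \<omega> + S n \<omega>) \<in> borel_measurable M" if "n \<ge> 1" for n
    using m that by simp
  fix e :: real assume e: "0 < e"
  obtain K where K: "eventually (\<lambda>n. prob {\<omega> \<in> space M. K < norm (R n \<omega>)} \<le> e / 2) sequentially"
    using R e unfolding bdd_prob_def by (meson half_gt_zero)
  obtain L where L: "eventually (\<lambda>n. prob {\<omega> \<in> space M. L < norm (S n \<omega>)} \<le> e / 2) sequentially"
    using S e unfolding bdd_prob_def by (meson half_gt_zero)
  from K L eventually_ge_1
  have "eventually (\<lambda>n. prob {\<omega> \<in> space M. K + L < norm (R n \<omega> + S n \<omega>)} \<le> e) sequentially"
  proof eventually_elim
    case (elim n)
    have [measurable]: "R n \<in> borel_measurable M" "S n \<in> borel_measurable M" using m elim by auto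
    have "prob {\<omega> \<in> space M. K + L < norm (R n \<omega> + S n \<omega>)}
      \<le> prob {\<omega> \<in> space M. K < norm (R n \<omega>)} + prob {\<omega> \<in> space M. L < norm (S n \<omega>)}"
    proof (rule prob_le_add)
      show "AE \<omega> in M. K + L < norm (R n \<omega> + S n \<omega>) \<longrightarrow> K < norm (R n \<omega>) \<or> L < norm (S n \<omega>)"
      proof (intro AE_I2 impI)
        fix \<omega> assume "K + L < norm (R n \<omega> + S n \<omega>)"
        then show "K < norm (R n \<omega>) \<or> L < norm (S n \<omega>)"
          using norm_triangle_ineq[of "R n \<omega>" "S n \<omega>"] by linarith
      qed
    qed measurable
    then show ?case using elim by simp
  qed
  then show "\<exists>K. eventually (\<lambda>n. prob {\<omega> \<in> space M. K < norm (R n \<omega> + S n \<omega>)} \<le> e) sequentially" ..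
qed

lemma tends_zero_imp_bdd_prob:
  assumes "tends_zero M R"
  shows "bdd_prob M R"
  unfolding bdd_prob_def
  using tends_zero_measurable[OF assms] tends_zeroD[OF assms, of 1] by auto

text \<open>\<open>A D = - q\<close> with \<open>A\<close> close to an invertible \<open>K\<close>: write \<open>D + J q = - J (A - K) D\<close>, which
  first gives \<open>norm D \<le> 2 norm (J q)\<close> and then smallness of the right-hand side.\<close>

lemma tends_zero_linear_equation:
  fixes D q :: "nat \<Rightarrow> 'a \<Rightarrow> real ^ 'n" and A :: "nat \<Rightarrow> 'a \<Rightarrow> real ^ 'n ^ 'n" and K J :: "real ^ 'n ^ 'n"
  assumes A: "tends_zero M (\<lambda>n \<omega>. A n \<omega> - K)" and q: "bdd_prob M q"
    and D: "\<And>n. n \<ge> 1 \<Longrightarrow> D n \<in> borel_measurable M"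
    and eq: "\<And>n. n \<ge> 1 \<Longrightarrow> AE \<omega> in M. A n \<omega> *v D n \<omega> = - q n \<omega>"
    and J: "J ** K = mat 1"
  shows "tends_zero M (\<lambda>n \<omega>. D n \<omega> + J *v q n \<omega>)"
proof (rule tends_zeroI)
  note qm = bdd_prob_measurable[OF q]
  show "(\<lambda>\<omega>. D n \<omega> + J *v q n \<omega>) \<in> borel_measurable M" if "n \<ge> 1" for n
    using D[OF that] qm[OF that] by measurable
  fix e d :: real assume ed: "0 < e" "0 < d"
  obtain B0 where B0: "eventually (\<lambda>n. prob {\<omega> \<in> space M. B0 < norm (q n \<omega>)} \<le> d / 2) sequentially"
    using q ed unfolding bdd_prob_def by (meson half_gt_zero)
  \<comment> \<open>\<open>B\<close> and \<open>j\<close> are positive enlargements of the two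
    bounds, since both will be divided by and \<open>B0\<close> may be negative.\<close>
  define B where "B = \<bar>B0\<bar> + 1"
  define j where "j = norm J + 1"
  have B: "0 < B" "B0 \<le> B" and j: "0 < j" "norm J \<le> j" by (auto simp: B_def j_def add_nonneg_pos)
  \<comment> \<open>The first entry gives \<open>r * j \<le> 1 / 2\<close>, which absorbs half of
    \<open>norm x\<close>; the second makes the final bound \<open>2 * r * j * j * B\<close> at most
    \<open>e\<close>.\<close>
  define r where "r = min (1 / (2 * j)) (e / (2 * j * j * B))"
  have r: "0 < r" "r * j \<le> 1 / 2" "r * (2 * j * j * B) \<le> e"
  proof -
    show "0 < r" using B j ed by (simp add: r_def)
    have "r * j \<le> 1 / (2 * j) * j" using j by (intro mult_right_mono) (auto simp: r_def)
    then show "r * j \<le> 1 / 2" using j by simp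
    have "r * (2 * j * j * B) \<le> e / (2 * j * j * B) * (2 * j * j * B)"
      using j B by (intro mult_right_mono) (auto simp: r_def)
    then show "r * (2 * j * j * B) \<le> e" using j B by simp
  qed
  from B0 tends_zeroD[OF A r(1) half_gt_zero[OF ed(2)]] eventually_ge_1
  show "eventually (\<lambda>n. prob {\<omega> \<in> space M. e < norm (D n \<omega> + J *v q n \<omega>)} \<le> d) sequentially"
  proof eventually_elim
    case (elim n)
    have [measurable]: "q n \<in> borel_measurable M" "(\<lambda>\<omega>. A n \<omega> - K) \<in> borel_measurable M"
      using qm tends_zero_measurable[OF A] elim by auto
    have "prob {\<omega> \<in> space M. e < norm (D n \<omega> + J *v q n \<omega>)}
      \<le> prob {\<omega> \<in> space M. B0 < norm (q n \<omega>)} + prob {\<omega> \<in> space M. r < norm (A n \<omega> - K)}"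
    proof (rule prob_le_add)
      show "AE \<omega> in M. e < norm (D n \<omega> + J *v q n \<omega>) \<longrightarrow> B0 < norm (q n \<omega>) \<or> r < norm (A n \<omega> - K)"
      proof (rule AE_mp[OF eq[OF elim(3)] AE_I2], intro impI, rule ccontr)
        fix \<omega> assume eq: "A n \<omega> *v D n \<omega> = - q n \<omega>" and gt: "e < norm (D n \<omega> + J *v q n \<omega>)"
          and "\<not> (B0 < norm (q n \<omega>) \<or> r < norm (A n \<omega> - K))"
        then have qB: "norm (q n \<omega>) \<le> B" and Ar: "norm (A n \<omega> - K) \<le> r" using B by auto
        define x where "x = D n \<omega>"
        define y where "y = (A n \<omega> - K) *v x"
        have "K *v x = - q n \<omega> - y"
          using eq by (simp add: y_def x_def matrix_vector_mult_diff_rdistrib)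
        then have "J *v (K *v x) = J *v (- q n \<omega> - y)" by simp
        then have x: "x = - (J *v q n \<omega>) - J *v y"
          by (simp only: matrix_vector_mul_assoc J matrix_vector_mul_lid
              linear_diff[OF matrix_vector_mul_linear] linear_neg[OF matrix_vector_mul_linear])
        have "norm (J *v y) \<le> norm J * norm y" by (rule norm_matrix_vector_mult_le)
        also have "\<dots> \<le> j * (norm (A n \<omega> - K) * norm x)"
          unfolding y_def using j by (intro mult_mono norm_matrix_vector_mult_le) auto
        also have "\<dots> \<le> j * (r * norm x)"
          using j Ar by (intro mult_left_mono mult_right_mono) auto
        finally have Jy: "norm (J *v y) \<le> r * j * norm x" by (simp add: mult.commute mult.left_commute)
        have "norm (J *v q n \<omega>) \<le> norm J * norm (q n \<omega>)" by (rule norm_matrix_vector_mult_le)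
        also have "\<dots> \<le> j * B" using j qB by (intro mult_mono) auto
        finally have Jq: "norm (J *v q n \<omega>) \<le> j * B" .
        have "norm x \<le> norm (J *v q n \<omega>) + norm (J *v y)"
          using norm_triangle_ineq4[of "- (J *v q n \<omega>)" "J *v y"] x by simp
        also have "\<dots> \<le> j * B + 1 / 2 * norm x"
          using Jq Jy mult_right_mono[OF r(2), of "norm x"] by simp
        finally have nx: "norm x \<le> 2 * (j * B)" by simp
        have "norm (D n \<omega> + J *v q n \<omega>) = norm (J *v y)"
          using x unfolding x_def[symmetric] by simp
        also have "\<dots> \<le> r * j * (2 * (j * B))"
          using order_trans[OF Jy mult_left_mono[OF nx, of "r * j"]] r(1) j by simp
        also have "\<dots> \<le> e" using r(3) by (simp add: mult_ac)
        finally show False using gt by simp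
      qed
    qed measurable
    then show ?case using elim by simp
  qed
qed

end

section \<open>Second moments of cross-fitted sums\<close>

lemma norm_power2_euclidean: "(norm (x :: 'a::euclidean_space))\<^sup>2 = (\<Sum>b\<in>Basis. (x \<bullet> b)\<^sup>2)"
  unfolding power2_norm_eq_inner by (subst euclidean_inner) (simp add: power2_eq_square)

lemma ennreal_norm_power2: "ennreal ((norm (x :: 'a::euclidean_space))\<^sup>2) = (\<Sum>b\<in>Basis. ennreal ((x \<bullet> b)\<^sup>2))"
  by (simp add: norm_power2_euclidean sum_ennreal)

lemma integrable_of_nn_integral_square:
  fixes f :: "'a \<Rightarrow> 'b::euclidean_space"
  assumes "prob_space P" and [measurable]: "f \<in> borel_measurable P"
    and fin: "(\<integral>\<^sup>+x. ennreal ((norm (f x))\<^sup>2) \<partial>P) < \<infinity>"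
  shows "integrable P f" "integrable P (\<lambda>x. (norm (f x))\<^sup>2)" "integrable P (\<lambda>x. (f x \<bullet> b)\<^sup>2)"
proof -
  interpret prob_space P by fact
  show sq: "integrable P (\<lambda>x. (norm (f x))\<^sup>2)"
    using fin by (intro integrableI_nonneg) auto
  have "integrable P (\<lambda>x. norm (f x))"
    by (rule square_integrable_imp_integrable[OF _ sq]) simp
  then show "integrable P f" by (simp add: integrable_norm_iff)
  show "integrable P (\<lambda>x. (f x \<bullet> b)\<^sup>2)"
  proof (rule Bochner_Integration.integrable_bound)
    show "integrable P (\<lambda>x. (norm b)\<^sup>2 * (norm (f x))\<^sup>2)" using sq by simp
    show "AE x in P. norm ((f x \<bullet> b)\<^sup>2) \<le> norm ((norm b)\<^sup>2 * (norm (f x))\<^sup>2)"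
    proof (rule AE_I2)
      fix x
      have "\<bar>f x \<bullet> b\<bar>\<^sup>2 \<le> (norm (f x) * norm b)\<^sup>2"
        by (intro power_mono Cauchy_Schwarz_ineq2) simp
      then show "norm ((f x \<bullet> b)\<^sup>2) \<le> norm ((norm b)\<^sup>2 * (norm (f x))\<^sup>2)"
        by (simp add: power_mult_distrib mult.commute)
    qed
  qed measurable
qed

text \<open>In each coordinate the variance of an i.i.d. sum is additive, and a variance is at most
  the second moment. The coordinates add up to the squared norm without a dimension factor.\<close>

lemma nn_integral_PiM_centered_sum:
  fixes f :: "'a \<Rightarrow> 'b::euclidean_space"
  assumes P: "prob_space P" and I: "finite I" and [measurable]: "f \<in> borel_measurable P"
    and fin: "(\<integral>\<^sup>+x. ennreal ((norm (f x))\<^sup>2) \<partial>P) < \<infinity>"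
  shows "(\<integral>\<^sup>+x. ennreal ((norm (\<Sum>i\<in>I. f (x i) - (\<integral>x. f x \<partial>P)))\<^sup>2) \<partial>PiM I (\<lambda>_. P))
    \<le> of_nat (card I) * (\<integral>\<^sup>+x. ennreal ((norm (f x))\<^sup>2) \<partial>P)"
proof -
  interpret P: prob_space P by fact
  note int = integrable_of_nn_integral_square[OF P _ fin]
  define g where "g b x = (f x - (\<integral>x. f x \<partial>P)) \<bullet> b" for b x
  have f_int: "integrable P f" by (rule int) simp
  have fb_int: "integrable P (\<lambda>x. f x \<bullet> b)" for b using f_int by simp
  have [measurable]: "g b \<in> borel_measurable P" for b unfolding g_def by measurable
  have g_eq: "g b x = f x \<bullet> b - (\<integral>x. f x \<bullet> b \<partial>P)" for b x
    using f_int by (simp add: g_def inner_diff_left)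
  have sq_int: "integrable P (\<lambda>x. (f x \<bullet> b)\<^sup>2)" for b by (rule int) simp
  have g_sq: "integrable P (\<lambda>x. (g b x)\<^sup>2)" for b
    unfolding g_eq power2_diff
    by (intro Bochner_Integration.integrable_add Bochner_Integration.integrable_diff sq_int
        P.integrable_const integrable_mult_left integrable_mult_right fb_int)
  have g_mean: "(\<integral>x. g b x \<partial>P) = 0" for b
    unfolding g_eq using fb_int[of b] by (simp add: P.prob_space)
  have g_le: "(\<integral>x. (g b x)\<^sup>2 \<partial>P) \<le> (\<integral>x. (f x \<bullet> b)\<^sup>2 \<partial>P)" for b
    using P.variance_eq[OF fb_int sq_int, of b] by (simp add: g_eq)
  note sum_sq = integral_PiM_sum_square[OF P I _ g_sq g_mean, of _ "\<lambda>_. 1", simplified]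
  have gm: "(\<lambda>x. \<Sum>i\<in>I. g b (x i)) \<in> borel_measurable (PiM I (\<lambda>_. P))" for b by measurable
  have "(\<integral>\<^sup>+x. ennreal ((norm (\<Sum>i\<in>I. f (x i) - (\<integral>x. f x \<partial>P)))\<^sup>2) \<partial>PiM I (\<lambda>_. P))
    = (\<integral>\<^sup>+x. (\<Sum>b\<in>Basis. ennreal ((\<Sum>i\<in>I. g b (x i))\<^sup>2)) \<partial>PiM I (\<lambda>_. P))"
    by (simp add: ennreal_norm_power2 inner_sum_left g_def)
  also have "\<dots> = (\<Sum>b\<in>Basis. \<integral>\<^sup>+x. ennreal ((\<Sum>i\<in>I. g b (x i))\<^sup>2) \<partial>PiM I (\<lambda>_. P))"
    using gm by (intro nn_integral_sum) auto
  also have "\<dots> = (\<Sum>b\<in>Basis. ennreal (real (card I) * (\<integral>x. (g b x)\<^sup>2 \<partial>P)))"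
    using sum_sq by (intro sum.cong refl) (subst nn_integral_eq_integral, auto)
  also have "\<dots> \<le> (\<Sum>b\<in>Basis. ennreal (real (card I)) * ennreal (\<integral>x. (f x \<bullet> b)\<^sup>2 \<partial>P))"
    by (intro sum_mono) (simp add: ennreal_mult[symmetric] ennreal_leI mult_left_mono g_le)
  also have "\<dots> = ennreal (real (card I)) * (\<Sum>b\<in>Basis. \<integral>\<^sup>+x. ennreal ((f x \<bullet> b)\<^sup>2) \<partial>P)"
    by (simp only: sum_distrib_left nn_integral_eq_integral[OF sq_int AE_I2[OF zero_le_power2]])
  also have "(\<Sum>b\<in>Basis. \<integral>\<^sup>+x. ennreal ((f x \<bullet> b)\<^sup>2) \<partial>P) = (\<integral>\<^sup>+x. ennreal ((norm (f x))\<^sup>2) \<partial>P)"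
    unfolding ennreal_norm_power2 by (rule nn_integral_sum[symmetric]) measurable
  finally show ?thesis by (simp add: ennreal_of_nat_eq_real_of_nat)
qed

lemma nn_integral_PiM_component:
  assumes P: "prob_space P" and i: "i \<in> I" and f: "f \<in> borel_measurable P"
  shows "(\<integral>\<^sup>+x. f (x i) \<partial>PiM I (\<lambda>_. P)) = (\<integral>\<^sup>+x. f x \<partial>P)"
proof -
  have "(\<integral>\<^sup>+x. f x \<partial>P) = (\<integral>\<^sup>+x. f x \<partial>distr (PiM I (\<lambda>_. P)) P (\<lambda>x. x i))"
    using distr_PiM_component[of I "\<lambda>_. P" i] P i by simp
  also have "\<dots> = (\<integral>\<^sup>+x. f (x i) \<partial>PiM I (\<lambda>_. P))"
    using f i by (intro nn_integral_distr) simp_all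
  finally show ?thesis ..
qed

lemma dirichlet_centered_second_moment_vec:
  fixes y :: "nat \<Rightarrow> 'b::euclidean_space"
  assumes n: "n \<ge> 1"
  shows "(\<integral>\<^sup>+w. ennreal ((norm (\<Sum>i\<in>{1..n}. (w i - 1 / real n) *\<^sub>R y i))\<^sup>2) \<partial>dirichlet n (\<lambda>_. 1))
    \<le> ennreal (1 / (real n)\<^sup>2) * (\<Sum>i\<in>{1..n}. ennreal ((norm (y i))\<^sup>2))"
proof -
  let ?D = "dirichlet n (\<lambda>_. 1)"
  have "(\<integral>\<^sup>+w. ennreal ((norm (\<Sum>i\<in>{1..n}. (w i - 1 / real n) *\<^sub>R y i))\<^sup>2) \<partial>?D)
    = (\<integral>\<^sup>+w. (\<Sum>b\<in>Basis. ennreal ((\<Sum>i\<in>{1..n}. (w i - 1 / real n) * (y i \<bullet> b))\<^sup>2)) \<partial>?D)"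
    by (simp add: ennreal_norm_power2 inner_sum_left)
  also have "\<dots> = (\<Sum>b\<in>Basis. \<integral>\<^sup>+w. ennreal ((\<Sum>i\<in>{1..n}. (w i - 1 / real n) * (y i \<bullet> b))\<^sup>2) \<partial>?D)"
  proof (rule nn_integral_sum)
    fix b
    have "(\<lambda>w. \<Sum>i\<in>{1..n}. (w i - 1 / real n) * (y i \<bullet> b)) \<in> borel_measurable (PiM {1..n} (\<lambda>_. borel))"
      by measurable
    then show "(\<lambda>w. ennreal ((\<Sum>i\<in>{1..n}. (w i - 1 / real n) * (y i \<bullet> b))\<^sup>2)) \<in> borel_measurable ?D"
      by (simp cong: measurable_cong_sets)
  qed
  also have "\<dots> \<le> (\<Sum>b\<in>Basis. ennreal ((\<Sum>i\<in>{1..n}. (y i \<bullet> b)\<^sup>2) / (real n)\<^sup>2))"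
    by (intro sum_mono dirichlet_centered_second_moment n)
  also have "\<dots> = ennreal (\<Sum>b\<in>Basis. (\<Sum>i\<in>{1..n}. (y i \<bullet> b)\<^sup>2) / (real n)\<^sup>2)"
    by (rule sum_ennreal) (simp add: sum_nonneg)
  also have "(\<Sum>b\<in>Basis. (\<Sum>i\<in>{1..n}. (y i \<bullet> b)\<^sup>2) / (real n)\<^sup>2) = 1 / (real n)\<^sup>2 * (\<Sum>i\<in>{1..n}. (norm (y i))\<^sup>2)"
    unfolding norm_power2_euclidean sum_divide_distrib[symmetric] by (subst sum.swap) simp
  also have "ennreal \<dots> = ennreal (1 / (real n)\<^sup>2) * (\<Sum>i\<in>{1..n}. ennreal ((norm (y i))\<^sup>2))"
  proof -
    have "(\<Sum>i\<in>{1..n}. ennreal ((norm (y i))\<^sup>2)) = ennreal (\<Sum>i\<in>{1..n}. (norm (y i))\<^sup>2)"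
      by (rule sum_ennreal) simp
    then show ?thesis by (simp only:) (rule ennreal_mult; simp add: sum_nonneg)
  qed
  finally show ?thesis .
qed

lemma measurable_section:
  assumes "(\<lambda>(x, h). F x h) \<in> borel_measurable (P \<Otimes>\<^sub>M HS)" "h \<in> space HS"
  shows "(\<lambda>x. F x h) \<in> borel_measurable P"
  using measurable_compose[OF measurable_Pair2'[OF assms(2)] assms(1)] by simp

text \<open>This is what cross-fitting buys: \<open>Z\<close> is independent of the evaluation
  sample \<open>\<xi>\<close>, so by Fubini it can be frozen at a value \<open>h\<close>, for which
  the summands are i.i.d. The moment bound holds along \<open>Z\<close> almost surely and is
  therefore applied after the outer integral is pulled back to \<open>M\<close>.\<close>

lemma (in prob_space) crossfit_mean_L2:
  fixes F :: "'o \<Rightarrow> 'h \<Rightarrow> 'b::euclidean_space"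
  assumes P: "prob_space P" and n: "n \<ge> 1"
    and F: "(\<lambda>(x, h). F x h) \<in> borel_measurable (P \<Otimes>\<^sub>M HS)"
    and \<xi>: "\<xi> \<in> M \<rightarrow>\<^sub>M PiM {1..n} (\<lambda>_. P)" and Z: "Z \<in> M \<rightarrow>\<^sub>M HS"
    and law: "distr M (PiM {1..n} (\<lambda>_. P) \<Otimes>\<^sub>M HS) (\<lambda>\<omega>. (\<xi> \<omega>, Z \<omega>)) = PiM {1..n} (\<lambda>_. P) \<Otimes>\<^sub>M distr M HS Z"
    and c: "0 \<le> c" and bound: "AE \<omega> in M. (\<integral>\<^sup>+x. ennreal ((norm (F x (Z \<omega>)))\<^sup>2) \<partial>P) \<le> ennreal c"
  shows "(\<integral>\<^sup>+\<omega>. ennreal ((norm ((1 / real n) *\<^sub>R (\<Sum>i\<in>{1..n}. F (\<xi> \<omega> i) (Z \<omega>) - (\<integral>x. F x (Z \<omega>) \<partial>P))))\<^sup>2) \<partial>M)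
    \<le> ennreal (c / real n)"
proof -
  interpret P: prob_space P by fact
  let ?Pn = "PiM {1..n} (\<lambda>_. P)"
  interpret Pn: prob_space ?Pn by (intro prob_space_PiM P)
  interpret Z: prob_space "distr M HS Z" by (rule prob_space_distr[OF Z])
  interpret PZ: pair_prob_space ?Pn "distr M HS Z" ..
  define G where "G x h = (1 / real n) *\<^sub>R (\<Sum>i\<in>{1..n}. F (x i) h - (\<integral>x. F x h \<partial>P))" for x h
  have Fint: "(\<lambda>h. \<integral>x. F x h \<partial>P) \<in> borel_measurable HS"
  proof -
    have "(\<lambda>(h, x). F x h) \<in> borel_measurable (HS \<Otimes>\<^sub>M P)"
      using measurable_compose[OF measurable_pair_swap' F] by (simp add: case_prod_beta')
    then show ?thesis by (rule P.borel_measurable_lebesgue_integral)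
  qed
  have Gm: "(\<lambda>z. G (fst z) (snd z)) \<in> borel_measurable (?Pn \<Otimes>\<^sub>M HS)"
  proof -
    have "(\<lambda>z. F (fst z i) (snd z)) \<in> borel_measurable (?Pn \<Otimes>\<^sub>M HS)" if "i \<in> {1..n}" for i
    proof -
      have "(\<lambda>z. (fst z i, snd z)) \<in> ?Pn \<Otimes>\<^sub>M HS \<rightarrow>\<^sub>M P \<Otimes>\<^sub>M HS" using that by measurable
      from measurable_compose[OF this F] show ?thesis by simp
    qed
    then show ?thesis
      unfolding G_def
      by (intro borel_measurable_scaleR borel_measurable_const borel_measurable_sum borel_measurable_diff
          measurable_compose[OF measurable_snd Fint])
  qed
  have Gm': "(\<lambda>z. ennreal ((norm (G (fst z) (snd z)))\<^sup>2)) \<in> borel_measurable (?Pn \<Otimes>\<^sub>M HS)"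
    using Gm by measurable
  have Gm'': "(\<lambda>z. ennreal ((norm (G (fst z) (snd z)))\<^sup>2)) \<in> borel_measurable (?Pn \<Otimes>\<^sub>M distr M HS Z)"
    using Gm' by (simp cong: measurable_cong_sets)
  have \<xi>Z: "(\<lambda>\<omega>. (\<xi> \<omega>, Z \<omega>)) \<in> M \<rightarrow>\<^sub>M ?Pn \<Otimes>\<^sub>M HS" using \<xi> Z by simp
  have inner: "(\<integral>\<^sup>+x. ennreal ((norm (G x h))\<^sup>2) \<partial>?Pn) \<le> ennreal (c / real n)"
    if h: "h \<in> space HS" and b: "(\<integral>\<^sup>+x. ennreal ((norm (F x h))\<^sup>2) \<partial>P) \<le> ennreal c" for h
  proof -
    have Fh: "(\<lambda>x. F x h) \<in> borel_measurable P" by (rule measurable_section[OF F h])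
    have sm: "(\<lambda>x. ennreal ((norm (\<Sum>i\<in>{1..n}. F (x i) h - (\<integral>x. F x h \<partial>P)))\<^sup>2)) \<in> borel_measurable ?Pn"
      using Fh by measurable
    have "(\<integral>\<^sup>+x. ennreal ((norm (G x h))\<^sup>2) \<partial>?Pn)
      = (\<integral>\<^sup>+x. ennreal (1 / (real n)\<^sup>2) * ennreal ((norm (\<Sum>i\<in>{1..n}. F (x i) h - (\<integral>x. F x h \<partial>P)))\<^sup>2) \<partial>?Pn)"
      by (simp add: G_def power_divide ennreal_mult[symmetric])
    also have "\<dots> = ennreal (1 / (real n)\<^sup>2) * (\<integral>\<^sup>+x. ennreal ((norm (\<Sum>i\<in>{1..n}. F (x i) h - (\<integral>x. F x h \<partial>P)))\<^sup>2) \<partial>?Pn)"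
      by (rule nn_integral_cmult[OF sm])
    also have "\<dots> \<le> ennreal (1 / (real n)\<^sup>2) * (of_nat (card {1..n}) * (\<integral>\<^sup>+x. ennreal ((norm (F x h))\<^sup>2) \<partial>P))"
      using le_less_trans[OF b] by (intro mult_left_mono nn_integral_PiM_centered_sum P Fh) auto
    also have "\<dots> \<le> ennreal (1 / (real n)\<^sup>2) * (ennreal (real n) * ennreal c)"
      using b by (intro mult_left_mono mult_mono) (auto simp: ennreal_of_nat_eq_real_of_nat)
    also have "\<dots> = ennreal (c / real n)"
      using n c by (simp add: ennreal_mult[symmetric] power2_eq_square)
    finally show ?thesis .
  qed
  have "(\<integral>\<^sup>+\<omega>. ennreal ((norm (G (\<xi> \<omega>) (Z \<omega>)))\<^sup>2) \<partial>M)
    = (\<integral>\<^sup>+z. ennreal ((norm (G (fst z) (snd z)))\<^sup>2) \<partial>distr M (?Pn \<Otimes>\<^sub>M HS) (\<lambda>\<omega>. (\<xi> \<omega>, Z \<omega>)))"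
    using \<xi>Z Gm' by (subst nn_integral_distr) simp_all
  also have "\<dots> = (\<integral>\<^sup>+h. \<integral>\<^sup>+x. ennreal ((norm (G x h))\<^sup>2) \<partial>?Pn \<partial>distr M HS Z)"
    unfolding law using PZ.nn_integral_snd[OF Gm''] by simp
  also have "\<dots> = (\<integral>\<^sup>+\<omega>. \<integral>\<^sup>+x. ennreal ((norm (G x (Z \<omega>)))\<^sup>2) \<partial>?Pn \<partial>M)"
  proof (rule nn_integral_distr[OF Z])
    have "(\<lambda>(h, x). ennreal ((norm (G x h))\<^sup>2)) \<in> borel_measurable (HS \<Otimes>\<^sub>M ?Pn)"
      using measurable_compose[OF measurable_pair_swap' Gm'] by (simp add: case_prod_beta')
    from Pn.borel_measurable_nn_integral[OF this]
    show "(\<lambda>h. \<integral>\<^sup>+x. ennreal ((norm (G x h))\<^sup>2) \<partial>?Pn) \<in> borel_measurable (distr M HS Z)" by simp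
  qed
  also have "\<dots> \<le> (\<integral>\<^sup>+\<omega>. ennreal (c / real n) \<partial>M)"
    by (rule nn_integral_mono_AE, use bound AE_space in eventually_elim)
       (rule inner, use measurable_space[OF Z] in auto)
  also have "\<dots> = ennreal (c / real n)" by (simp add: emeasure_space_1)
  finally show ?thesis unfolding G_def .
qed

text \<open>The weights are integrated first, with data and nuisance frozen. As the weights are
  centred, this leaves a sum of squared norms, so an uncentred \<open>F\<close> is allowed.
  Independence of \<open>\<xi>\<close> and \<open>Z\<close> then bounds each summand.\<close>

lemma (in prob_space) crossfit_weighted_L2:
  fixes F :: "'o \<Rightarrow> 'h \<Rightarrow> 'b::euclidean_space"
  assumes P: "prob_space P" and n: "n \<ge> 1"
    and F: "(\<lambda>(x, h). F x h) \<in> borel_measurable (P \<Otimes>\<^sub>M HS)"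
    and \<xi>: "\<xi> \<in> M \<rightarrow>\<^sub>M PiM {1..n} (\<lambda>_. P)" and Z: "Z \<in> M \<rightarrow>\<^sub>M HS"
    and w: "w \<in> M \<rightarrow>\<^sub>M PiM {1..n} (\<lambda>_. borel)"
    and law: "distr M (PiM {1..n} (\<lambda>_. P) \<Otimes>\<^sub>M HS) (\<lambda>\<omega>. (\<xi> \<omega>, Z \<omega>)) = PiM {1..n} (\<lambda>_. P) \<Otimes>\<^sub>M distr M HS Z"
    and joint: "distr M ((PiM {1..n} (\<lambda>_. P) \<Otimes>\<^sub>M HS) \<Otimes>\<^sub>M PiM {1..n} (\<lambda>_. borel)) (\<lambda>\<omega>. ((\<xi> \<omega>, Z \<omega>), w \<omega>))
      = distr M (PiM {1..n} (\<lambda>_. P) \<Otimes>\<^sub>M HS) (\<lambda>\<omega>. (\<xi> \<omega>, Z \<omega>)) \<Otimes>\<^sub>M dirichlet n (\<lambda>_. 1)"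
    and c: "0 \<le> c" and bound: "AE \<omega> in M. (\<integral>\<^sup>+x. ennreal ((norm (F x (Z \<omega>)))\<^sup>2) \<partial>P) \<le> ennreal c"
  shows "(\<integral>\<^sup>+\<omega>. ennreal ((norm (\<Sum>i\<in>{1..n}. (w \<omega> i - 1 / real n) *\<^sub>R F (\<xi> \<omega> i) (Z \<omega>)))\<^sup>2) \<partial>M)
    \<le> ennreal (c / real n)"
proof -
  interpret P: prob_space P by fact
  let ?Pn = "PiM {1..n} (\<lambda>_. P)" and ?B = "PiM {1..n} (\<lambda>_. borel :: real measure)" and ?D = "dirichlet n (\<lambda>_. 1)"
  let ?Q = "distr M (?Pn \<Otimes>\<^sub>M HS) (\<lambda>\<omega>. (\<xi> \<omega>, Z \<omega>))"
  have \<xi>Z: "(\<lambda>\<omega>. (\<xi> \<omega>, Z \<omega>)) \<in> M \<rightarrow>\<^sub>M ?Pn \<Otimes>\<^sub>M HS" using \<xi> Z by simp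
  interpret Pn: prob_space ?Pn by (intro prob_space_PiM P)
  interpret Z: prob_space "distr M HS Z" by (rule prob_space_distr[OF Z])
  interpret PZ: pair_prob_space ?Pn "distr M HS Z" ..
  interpret D: prob_space ?D by (rule prob_space_dirichlet[OF n])
  have Fm: "(\<lambda>z. F (fst z i) (snd z)) \<in> borel_measurable (?Pn \<Otimes>\<^sub>M HS)" if "i \<in> {1..n}" for i
  proof -
    have "(\<lambda>z. (fst z i, snd z)) \<in> ?Pn \<Otimes>\<^sub>M HS \<rightarrow>\<^sub>M P \<Otimes>\<^sub>M HS" using that by measurable
    from measurable_compose[OF this F] show ?thesis by simp
  qed
  define G where "G z u = ennreal ((norm (\<Sum>i\<in>{1..n}. (u i - 1 / real n) *\<^sub>R F (fst z i) (snd z)))\<^sup>2)" for z u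
  have Gm: "(\<lambda>y. G (fst y) (snd y)) \<in> borel_measurable ((?Pn \<Otimes>\<^sub>M HS) \<Otimes>\<^sub>M ?B)"
  proof -
    have "(\<lambda>y. \<Sum>i\<in>{1..n}. (snd y i - 1 / real n) *\<^sub>R F (fst (fst y) i) (snd (fst y)))
        \<in> borel_measurable ((?Pn \<Otimes>\<^sub>M HS) \<Otimes>\<^sub>M ?B)"
      by (intro borel_measurable_sum borel_measurable_scaleR borel_measurable_diff borel_measurable_const
          measurable_compose[OF measurable_fst Fm] measurable_compose[OF measurable_snd measurable_component_singleton])
    then show ?thesis unfolding G_def by measurable
  qed
  have "(\<integral>\<^sup>+\<omega>. G (\<xi> \<omega>, Z \<omega>) (w \<omega>) \<partial>M) = (\<integral>\<^sup>+y. G (fst y) (snd y) \<partial>distr M ((?Pn \<Otimes>\<^sub>M HS) \<Otimes>\<^sub>M ?B) (\<lambda>\<omega>. ((\<xi> \<omega>, Z \<omega>), w \<omega>)))"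
    using \<xi>Z w Gm by (subst nn_integral_distr) simp_all
  also have "\<dots> = (\<integral>\<^sup>+z. \<integral>\<^sup>+u. G z u \<partial>?D \<partial>?Q)"
    unfolding joint using Gm by (subst D.nn_integral_fst[symmetric]) (simp_all cong: measurable_cong_sets)
  also have "\<dots> \<le> (\<integral>\<^sup>+z. ennreal (1 / (real n)\<^sup>2) * (\<Sum>i\<in>{1..n}. ennreal ((norm (F (fst z i) (snd z)))\<^sup>2)) \<partial>?Q)"
    unfolding G_def by (intro nn_integral_mono dirichlet_centered_second_moment_vec n)
  also have "\<dots> = ennreal (1 / (real n)\<^sup>2) * (\<Sum>i\<in>{1..n}. \<integral>\<^sup>+z. ennreal ((norm (F (fst z i) (snd z)))\<^sup>2) \<partial>?Q)"
  proof -
    have m: "(\<lambda>z. ennreal ((norm (F (fst z i) (snd z)))\<^sup>2)) \<in> borel_measurable ?Q" if "i \<in> {1..n}" for i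
      using Fm[OF that] by measurable
    show ?thesis
      by (simp only: nn_integral_cmult[OF borel_measurable_sum[OF m]] nn_integral_sum[OF m])
  qed
  also have "\<dots> \<le> ennreal (1 / (real n)\<^sup>2) * (\<Sum>i\<in>{1..n}. ennreal c)"
  proof (intro mult_left_mono sum_mono)
    fix i assume i: "i \<in> {1..n}"
    have m: "(\<lambda>z. ennreal ((norm (F (fst z i) (snd z)))\<^sup>2)) \<in> borel_measurable (?Pn \<Otimes>\<^sub>M distr M HS Z)"
      using Fm[OF i] by (simp cong: measurable_cong_sets)
    have m': "(\<lambda>h. \<integral>\<^sup>+x. ennreal ((norm (F x h))\<^sup>2) \<partial>P) \<in> borel_measurable HS"
    proof -
      have "(\<lambda>z. ennreal ((norm (case z of (x, h) \<Rightarrow> F x h))\<^sup>2)) \<in> borel_measurable (P \<Otimes>\<^sub>M HS)" using F by measurable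
      from measurable_compose[OF measurable_pair_swap' this]
      have "(\<lambda>(h, x). ennreal ((norm (F x h))\<^sup>2)) \<in> borel_measurable (HS \<Otimes>\<^sub>M P)"
        by (simp add: case_prod_beta')
      then show ?thesis by (rule P.borel_measurable_nn_integral)
    qed
    have "(\<integral>\<^sup>+z. ennreal ((norm (F (fst z i) (snd z)))\<^sup>2) \<partial>?Q)
      = (\<integral>\<^sup>+h. \<integral>\<^sup>+x. ennreal ((norm (F (x i) h))\<^sup>2) \<partial>?Pn \<partial>distr M HS Z)"
      unfolding law using PZ.nn_integral_snd[OF m] by simp
    also have "\<dots> = (\<integral>\<^sup>+h. \<integral>\<^sup>+x. ennreal ((norm (F x h))\<^sup>2) \<partial>P \<partial>distr M HS Z)"
    proof (rule nn_integral_cong)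
      fix h assume "h \<in> space (distr M HS Z)"
      then have "(\<lambda>x. F x h) \<in> borel_measurable P" by (intro measurable_section[OF F]) simp
      then show "(\<integral>\<^sup>+x. ennreal ((norm (F (x i) h))\<^sup>2) \<partial>?Pn) = (\<integral>\<^sup>+x. ennreal ((norm (F x h))\<^sup>2) \<partial>P)"
        by (intro nn_integral_PiM_component[OF P i, of "\<lambda>x. ennreal ((norm (F x h))\<^sup>2)"]) measurable
    qed
    also have "\<dots> = (\<integral>\<^sup>+\<omega>. \<integral>\<^sup>+x. ennreal ((norm (F x (Z \<omega>)))\<^sup>2) \<partial>P \<partial>M)"
      using m' by (intro nn_integral_distr[OF Z]) simp
    also have "\<dots> \<le> (\<integral>\<^sup>+\<omega>. ennreal c \<partial>M)"
      by (rule nn_integral_mono_AE) (rule bound)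
    finally show "(\<integral>\<^sup>+z. ennreal ((norm (F (fst z i) (snd z)))\<^sup>2) \<partial>?Q) \<le> ennreal c"
      by (simp add: emeasure_space_1)
  qed simp
  also have "\<dots> = ennreal (c / real n)"
    using n c by (simp add: ennreal_mult[symmetric] ennreal_of_nat_eq_real_of_nat power2_eq_square)
  finally show ?thesis unfolding G_def by simp
qed

section \<open>Linear expansion of the cross-fitted estimators\<close>

lemma matrix_sum_vector_mult:
  fixes A :: "'i \<Rightarrow> real ^ 'n ^ 'm"
  shows "(\<Sum>i\<in>I. u i *\<^sub>R A i) *v v = (\<Sum>i\<in>I. u i *\<^sub>R (A i *v v))"
  by (induction I rule: infinite_finite_induct)
     (simp_all add: matrix_vector_mult_add_rdistrib scaleR_matrix_vector_assoc)

text \<open>The score is affine in the parameter, so the equation for \<open>t\<close> becomes a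
  linear system whose right-hand side involves only the true value. The weights \<open>u\<close>
  will be \<open>1 / n\<close> for the plain estimator and Dirichlet for the bootstrap.\<close>

lemma weighted_score_equation:
  fixes A :: "'o \<Rightarrow> 'h \<Rightarrow> real ^ 'p ^ 'p" and B :: "'o \<Rightarrow> 'h \<Rightarrow> real ^ 'p"
  assumes "(\<Sum>i\<in>I. u i *\<^sub>R score A B (x i) t h) = 0"
  shows "(\<Sum>i\<in>I. u i *\<^sub>R A (x i) h) *v (s *\<^sub>R (t - t0)) = - (s *\<^sub>R (\<Sum>i\<in>I. u i *\<^sub>R score A B (x i) t0 h))"
proof -
  have eq: "(\<Sum>i\<in>I. u i *\<^sub>R score A B (x i) v h) = (\<Sum>i\<in>I. u i *\<^sub>R A (x i) h) *v v + (\<Sum>i\<in>I. u i *\<^sub>R B (x i) h)" for v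
    by (simp add: matrix_sum_vector_mult score_def scaleR_add_right sum.distrib)
  let ?T = "\<Sum>i\<in>I. u i *\<^sub>R A (x i) h" and ?b = "\<Sum>i\<in>I. u i *\<^sub>R B (x i) h"
  have t: "?T *v t = - ?b"
    using assms unfolding eq by (simp add: eq_neg_iff_add_eq_0)
  have "?T *v (s *\<^sub>R (t - t0)) = s *\<^sub>R (?T *v t - ?T *v t0)"
    by (simp only: linear_scale[OF matrix_vector_mul_linear] linear_diff[OF matrix_vector_mul_linear])
  also have "\<dots> = - (s *\<^sub>R (?T *v t0 + ?b))"
    unfolding t by (simp add: scaleR_add_right scaleR_diff_right)
  finally show ?thesis unfolding eq .
qed

lemma (in prob_space) tends_zero_AE_le:
  fixes R :: "nat \<Rightarrow> 'a \<Rightarrow> 'b::euclidean_space"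
  assumes m: "\<And>n. n \<ge> 1 \<Longrightarrow> R n \<in> borel_measurable M"
    and e: "\<And>e. 0 < e \<Longrightarrow> eventually (\<lambda>n. AE \<omega> in M. norm (R n \<omega>) \<le> e) sequentially"
  shows "tends_zero M R"
proof (rule tends_zeroI[OF m])
  fix e d :: real assume ed: "0 < e" "0 < d"
  show "eventually (\<lambda>n. prob {\<omega> \<in> space M. e < norm (R n \<omega>)} \<le> d) sequentially"
    using e[OF ed(1)]
  proof eventually_elim
    case (elim n)
    have "prob {\<omega> \<in> space M. e < norm (R n \<omega>)} \<le> prob {}"
      by (rule finite_measure_mono_AE) (use elim in \<open>auto elim!: eventually_mono\<close>)
    then show ?case using ed by simp
  qed
qed

lemma sum_minus_const: "(\<Sum>i\<in>{1..n}. f i - v) = (\<Sum>i\<in>{1..n}. f i) - real n *\<^sub>R (v :: 'b::real_vector)"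
  by (simp add: sum_subtractf sum_constant_scaleR del: sum_constant)

section \<open>One half of the cross-fit: expansions of its plain and bootstrapped
  estimators\<close>

text \<open>\<open>\<xi>\<close> are the \<open>n\<close> observations of this half, indexed from 1,
  \<open>Z\<close> is the nuisance estimate from the other half and \<open>w\<close> the weights.
  Independence enters only through the laws \<open>law\<close> and \<open>joint\<close>, so one
  argument serves both halves.\<close>

locale crossfit_half = prob_space M for M :: "'w measure" +
  fixes P :: "'o measure" and A :: "'o \<Rightarrow> 'h::real_normed_vector \<Rightarrow> real ^ 'p ^ 'p"
    and B :: "'o \<Rightarrow> 'h \<Rightarrow> real ^ 'p" and HS :: "'h measure" and HN :: "nat \<Rightarrow> 'h set" and h0 :: 'h
    and \<theta>0 :: "real ^ 'p" and a \<delta> :: "nat \<Rightarrow> real" and C :: real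
    and \<xi> :: "nat \<Rightarrow> 'w \<Rightarrow> nat \<Rightarrow> 'o" and Z :: "nat \<Rightarrow> 'w \<Rightarrow> 'h" and w :: "nat \<Rightarrow> 'w \<Rightarrow> nat \<Rightarrow> real"
    and th thBB :: "nat \<Rightarrow> 'w \<Rightarrow> real ^ 'p"
  assumes P: "prob_space P"
    and h0: "h0 \<in> space HS" and HN: "\<And>N. N \<ge> 1 \<Longrightarrow> HN N \<subseteq> space HS"
    and A_meas: "(\<lambda>(x, h). A x h) \<in> borel_measurable (P \<Otimes>\<^sub>M HS)"
    and B_meas: "(\<lambda>(x, h). B x h) \<in> borel_measurable (P \<Otimes>\<^sub>M HS)"
    and score_mean: "(\<integral>x. score A B x \<theta>0 h0 \<partial>P) = 0"
    and A_inv: "invertible (\<integral>x. A x h0 \<partial>P)"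
    and score_L2: "integrable P (\<lambda>x. (norm (score A B x \<theta>0 h0))\<^sup>2)"
    and \<xi>: "\<And>n. n \<ge> 1 \<Longrightarrow> \<xi> n \<in> M \<rightarrow>\<^sub>M PiM {1..n} (\<lambda>_. P)"
    and Z: "\<And>n. n \<ge> 1 \<Longrightarrow> Z n \<in> M \<rightarrow>\<^sub>M HS"
    and w: "\<And>n. n \<ge> 1 \<Longrightarrow> w n \<in> M \<rightarrow>\<^sub>M PiM {1..n} (\<lambda>_. borel)"
    and law: "\<And>n. n \<ge> 1 \<Longrightarrow> distr M (PiM {1..n} (\<lambda>_. P) \<Otimes>\<^sub>M HS) (\<lambda>\<omega>. (\<xi> n \<omega>, Z n \<omega>))
      = PiM {1..n} (\<lambda>_. P) \<Otimes>\<^sub>M distr M HS (Z n)"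
    and joint: "\<And>n. n \<ge> 1 \<Longrightarrow> distr M ((PiM {1..n} (\<lambda>_. P) \<Otimes>\<^sub>M HS) \<Otimes>\<^sub>M PiM {1..n} (\<lambda>_. borel)) (\<lambda>\<omega>. ((\<xi> n \<omega>, Z n \<omega>), w n \<omega>))
      = distr M (PiM {1..n} (\<lambda>_. P) \<Otimes>\<^sub>M HS) (\<lambda>\<omega>. (\<xi> n \<omega>, Z n \<omega>)) \<Otimes>\<^sub>M dirichlet n (\<lambda>_. 1)"
    and Z_in: "\<And>n. n \<ge> 1 \<Longrightarrow> AE \<omega> in M. Z n \<omega> \<in> HN (2*n)"
    and th_meas: "\<And>n. n \<ge> 1 \<Longrightarrow> th n \<in> borel_measurable M" "\<And>n. n \<ge> 1 \<Longrightarrow> thBB n \<in> borel_measurable M"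
    and th: "\<And>n. n \<ge> 1 \<Longrightarrow> AE \<omega> in M. (1 / real n) *\<^sub>R (\<Sum>i\<in>{1..n}. score A B (\<xi> n \<omega> i) (th n \<omega>) (Z n \<omega>)) = 0"
    and thBB: "\<And>n. n \<ge> 1 \<Longrightarrow> AE \<omega> in M. (\<Sum>i\<in>{1..n}. w n \<omega> i *\<^sub>R score A B (\<xi> n \<omega> i) (thBB n \<omega>) (Z n \<omega>)) = 0"
    and a: "a \<longlonglongrightarrow> 0"
    and i: "\<And>N h. N \<ge> 1 \<Longrightarrow> h \<in> HN N \<Longrightarrow> norm ((\<integral>x. A x h \<partial>P) - (\<integral>x. A x h0 \<partial>P)) \<le> a N"
    and C: "C > 0"
    and ii: "\<And>N h. N \<ge> 1 \<Longrightarrow> h \<in> HN N \<Longrightarrow> (\<integral>\<^sup>+x. ennreal ((norm (A x h))\<^sup>2) \<partial>P) \<le> ennreal C"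
    and \<delta>: "\<delta> \<longlonglongrightarrow> 0"
    and iii: "\<And>N h. N \<ge> 1 \<Longrightarrow> h \<in> HN N \<Longrightarrow>
      (\<integral>\<^sup>+x. ennreal ((norm (score A B x \<theta>0 h - score A B x \<theta>0 h0))\<^sup>2) \<partial>P) \<le> ennreal ((\<delta> N)\<^sup>2)"
    and score_integrable: "\<And>N h. N \<ge> 1 \<Longrightarrow> h \<in> HN N \<Longrightarrow> integrable P (\<lambda>x. score A B x \<theta>0 h)"
    and bias: "(\<lambda>n. SUP h\<in>HN (2*n). ennreal (norm (sqrt (real n) *\<^sub>R (\<integral>x. score A B x \<theta>0 h \<partial>P)))) \<longlonglongrightarrow> 0"
begin

abbreviation m0 where "m0 x \<equiv> score A B x \<theta>0 h0"
abbreviation J where "J \<equiv> matrix_inv (\<integral>x. A x h0 \<partial>P)"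

text \<open>The mean is left unsimplified inside so that the term matches the conclusions of
  \<open>mean_L2\<close>.\<close>

definition U where "U n \<omega> = sqrt (real n) *\<^sub>R ((1 / real n) *\<^sub>R (\<Sum>i\<in>{1..n}. m0 (\<xi> n \<omega> i)))"
definition V where "V n \<omega> = sqrt (real n) *\<^sub>R (\<Sum>i\<in>{1..n}. (w n \<omega> i - 1 / real n) *\<^sub>R m0 (\<xi> n \<omega> i))"

lemma score_meas: "(\<lambda>(x, h). score A B x \<theta>0 h) \<in> borel_measurable (P \<Otimes>\<^sub>M HS)"
  using A_meas B_meas unfolding score_def case_prod_beta' by measurable

lemma m0_meas: "m0 \<in> borel_measurable P"
  by (rule measurable_section[OF score_meas h0])

lemma m0_meas': "(\<lambda>(x, h :: 'h). m0 x) \<in> borel_measurable (P \<Otimes>\<^sub>M HS)"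
  using measurable_compose[OF measurable_fst m0_meas] by (simp add: case_prod_beta')

lemma diff_meas: "(\<lambda>(x, h). score A B x \<theta>0 h - m0 x) \<in> borel_measurable (P \<Otimes>\<^sub>M HS)"
  using score_meas m0_meas' unfolding case_prod_beta' by measurable

lemma F_meas:
  fixes F :: "'o \<Rightarrow> 'h \<Rightarrow> 'b::euclidean_space"
  assumes F: "(\<lambda>(x, h). F x h) \<in> borel_measurable (P \<Otimes>\<^sub>M HS)" and n: "n \<ge> 1" and j: "j \<in> {1..n}"
  shows "(\<lambda>\<omega>. F (\<xi> n \<omega> j) (Z n \<omega>)) \<in> borel_measurable M"
proof -
  have "(\<lambda>\<omega>. (\<xi> n \<omega> j, Z n \<omega>)) \<in> M \<rightarrow>\<^sub>M P \<Otimes>\<^sub>M HS"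
    using measurable_compose[OF \<xi>[OF n] measurable_component_singleton[OF j]] Z[OF n] by measurable
  from measurable_compose[OF this F] show ?thesis by simp
qed

lemma F_int_meas:
  fixes F :: "'o \<Rightarrow> 'h \<Rightarrow> 'b::euclidean_space"
  assumes F: "(\<lambda>(x, h). F x h) \<in> borel_measurable (P \<Otimes>\<^sub>M HS)" and n: "n \<ge> 1"
  shows "(\<lambda>\<omega>. \<integral>x. F x (Z n \<omega>) \<partial>P) \<in> borel_measurable M"
proof -
  interpret P: prob_space P by (rule P)
  have "(\<lambda>(h, x). F x h) \<in> borel_measurable (HS \<Otimes>\<^sub>M P)"
    using measurable_compose[OF measurable_pair_swap' F] by (simp add: case_prod_beta')
  then have "(\<lambda>h. \<integral>x. F x h \<partial>P) \<in> borel_measurable HS"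
    by (rule P.borel_measurable_lebesgue_integral)
  from measurable_compose[OF Z[OF n] this] show ?thesis .
qed

lemma w_meas: "n \<ge> 1 \<Longrightarrow> j \<in> {1..n} \<Longrightarrow> (\<lambda>\<omega>. w n \<omega> j) \<in> borel_measurable M"
  using measurable_compose[OF w measurable_component_singleton] by simp

lemma mean_L2:
  fixes F :: "'o \<Rightarrow> 'h \<Rightarrow> 'b::euclidean_space"
  assumes F: "(\<lambda>(x, h). F x h) \<in> borel_measurable (P \<Otimes>\<^sub>M HS)"
    and c: "\<And>n. 0 \<le> c n" "\<And>n. n \<ge> 1 \<Longrightarrow> AE \<omega> in M. (\<integral>\<^sup>+x. ennreal ((norm (F x (Z n \<omega>)))\<^sup>2) \<partial>P) \<le> ennreal (c n)"
  defines "R \<equiv> \<lambda>n \<omega>. (1 / real n) *\<^sub>R (\<Sum>i\<in>{1..n}. F (\<xi> n \<omega> i) (Z n \<omega>) - (\<integral>x. F x (Z n \<omega>) \<partial>P))"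
  shows "n \<ge> 1 \<Longrightarrow> R n \<in> borel_measurable M"
    and "n \<ge> 1 \<Longrightarrow> (\<integral>\<^sup>+\<omega>. ennreal ((norm (R n \<omega>))\<^sup>2) \<partial>M) \<le> ennreal (c n / real n)"
    and "n \<ge> 1 \<Longrightarrow> (\<integral>\<^sup>+\<omega>. ennreal ((norm (sqrt (real n) *\<^sub>R R n \<omega>))\<^sup>2) \<partial>M) \<le> ennreal (c n)"
    and "n \<ge> 1 \<Longrightarrow> (\<lambda>\<omega>. sqrt (real n) *\<^sub>R R n \<omega>) \<in> borel_measurable M"
proof -
  assume n: "n \<ge> 1"
  show m: "R n \<in> borel_measurable M"
    unfolding R_def
    by (intro borel_measurable_scaleR borel_measurable_const borel_measurable_sum borel_measurable_diff
        F_meas[OF F n] F_int_meas[OF F n])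
  show "(\<lambda>\<omega>. sqrt (real n) *\<^sub>R R n \<omega>) \<in> borel_measurable M"
    by (intro borel_measurable_scaleR borel_measurable_const m)
  show b: "(\<integral>\<^sup>+\<omega>. ennreal ((norm (R n \<omega>))\<^sup>2) \<partial>M) \<le> ennreal (c n / real n)"
    unfolding R_def by (rule crossfit_mean_L2[OF P n F \<xi>[OF n] Z[OF n] law[OF n] c(1) c(2)[OF n]])
  have "(\<integral>\<^sup>+\<omega>. ennreal ((norm (sqrt (real n) *\<^sub>R R n \<omega>))\<^sup>2) \<partial>M) = (\<integral>\<^sup>+\<omega>. ennreal (real n) * ennreal ((norm (R n \<omega>))\<^sup>2) \<partial>M)"
    by (simp add: power_mult_distrib ennreal_mult)
  also have "\<dots> = ennreal (real n) * (\<integral>\<^sup>+\<omega>. ennreal ((norm (R n \<omega>))\<^sup>2) \<partial>M)"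
    by (rule nn_integral_cmult) (use m in measurable)
  also have "\<dots> \<le> ennreal (real n) * ennreal (c n / real n)"
    by (intro mult_left_mono b) simp
  also have "\<dots> = ennreal (c n)"
    using n c(1)[of n] by (simp add: ennreal_mult[symmetric])
  finally show "(\<integral>\<^sup>+\<omega>. ennreal ((norm (sqrt (real n) *\<^sub>R R n \<omega>))\<^sup>2) \<partial>M) \<le> ennreal (c n)" .
qed

lemma weighted_L2:
  fixes F :: "'o \<Rightarrow> 'h \<Rightarrow> 'b::euclidean_space"
  assumes F: "(\<lambda>(x, h). F x h) \<in> borel_measurable (P \<Otimes>\<^sub>M HS)"
    and c: "\<And>n. 0 \<le> c n" "\<And>n. n \<ge> 1 \<Longrightarrow> AE \<omega> in M. (\<integral>\<^sup>+x. ennreal ((norm (F x (Z n \<omega>)))\<^sup>2) \<partial>P) \<le> ennreal (c n)"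
  defines "R \<equiv> \<lambda>n \<omega>. \<Sum>i\<in>{1..n}. (w n \<omega> i - 1 / real n) *\<^sub>R F (\<xi> n \<omega> i) (Z n \<omega>)"
  shows "n \<ge> 1 \<Longrightarrow> R n \<in> borel_measurable M"
    and "n \<ge> 1 \<Longrightarrow> (\<integral>\<^sup>+\<omega>. ennreal ((norm (R n \<omega>))\<^sup>2) \<partial>M) \<le> ennreal (c n / real n)"
    and "n \<ge> 1 \<Longrightarrow> (\<integral>\<^sup>+\<omega>. ennreal ((norm (sqrt (real n) *\<^sub>R R n \<omega>))\<^sup>2) \<partial>M) \<le> ennreal (c n)"
    and "n \<ge> 1 \<Longrightarrow> (\<lambda>\<omega>. sqrt (real n) *\<^sub>R R n \<omega>) \<in> borel_measurable M"
proof -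
  assume n: "n \<ge> 1"
  show m: "R n \<in> borel_measurable M"
    unfolding R_def
    by (intro borel_measurable_scaleR borel_measurable_const borel_measurable_sum borel_measurable_diff
        F_meas[OF F n] w_meas[OF n])
  show "(\<lambda>\<omega>. sqrt (real n) *\<^sub>R R n \<omega>) \<in> borel_measurable M"
    by (intro borel_measurable_scaleR borel_measurable_const m)
  show b: "(\<integral>\<^sup>+\<omega>. ennreal ((norm (R n \<omega>))\<^sup>2) \<partial>M) \<le> ennreal (c n / real n)"
    unfolding R_def by (rule crossfit_weighted_L2[OF P n F \<xi>[OF n] Z[OF n] w[OF n] law[OF n] joint[OF n] c(1) c(2)[OF n]])
  have "(\<integral>\<^sup>+\<omega>. ennreal ((norm (sqrt (real n) *\<^sub>R R n \<omega>))\<^sup>2) \<partial>M) = (\<integral>\<^sup>+\<omega>. ennreal (real n) * ennreal ((norm (R n \<omega>))\<^sup>2) \<partial>M)"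
    by (simp add: power_mult_distrib ennreal_mult)
  also have "\<dots> = ennreal (real n) * (\<integral>\<^sup>+\<omega>. ennreal ((norm (R n \<omega>))\<^sup>2) \<partial>M)"
    by (rule nn_integral_cmult) (use m in measurable)
  also have "\<dots> \<le> ennreal (real n) * ennreal (c n / real n)"
    by (intro mult_left_mono b) simp
  also have "\<dots> = ennreal (c n)"
    using n c(1)[of n] by (simp add: ennreal_mult[symmetric])
  finally show "(\<integral>\<^sup>+\<omega>. ennreal ((norm (sqrt (real n) *\<^sub>R R n \<omega>))\<^sup>2) \<partial>M) \<le> ennreal (c n)" .
qed

lemma subseq_double: "f \<longlonglongrightarrow> (l :: real) \<Longrightarrow> (\<lambda>n. f (2 * n)) \<longlonglongrightarrow> l"
  using LIMSEQ_subseq_LIMSEQ[of f l "\<lambda>n. 2 * n"] by (simp add: strict_mono_def comp_def)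

lemma m0_bound: "AE \<omega> in M. (\<integral>\<^sup>+x. ennreal ((norm (m0 x))\<^sup>2) \<partial>P) \<le> ennreal (\<integral>x. (norm (m0 x))\<^sup>2 \<partial>P)"
  by (subst nn_integral_eq_integral[OF score_L2]) simp_all

lemma m0_bound_nonneg: "0 \<le> (\<integral>x. (norm (m0 x))\<^sup>2 \<partial>P)"
  by simp

lemma bdd_U: "bdd_prob M U"
proof -
  note L = mean_L2[OF m0_meas', of "\<lambda>_. \<integral>x. (norm (m0 x))\<^sup>2 \<partial>P", OF m0_bound_nonneg m0_bound, unfolded score_mean diff_0_right]
  show ?thesis
    unfolding U_def by (rule bdd_prob_L2) (rule L(4), assumption, rule m0_bound_nonneg, rule L(3), assumption)
qed

lemma bdd_V: "bdd_prob M V"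
proof -
  note L = weighted_L2[OF m0_meas', of "\<lambda>_. \<integral>x. (norm (m0 x))\<^sup>2 \<partial>P", OF m0_bound_nonneg m0_bound]
  show ?thesis
    unfolding V_def by (rule bdd_prob_L2) (rule L(4), assumption, rule m0_bound_nonneg, rule L(3), assumption)
qed

lemma diff_bound:
  assumes n: "n \<ge> 1"
  shows "AE \<omega> in M. (\<integral>\<^sup>+x. ennreal ((norm (score A B x \<theta>0 (Z n \<omega>) - m0 x))\<^sup>2) \<partial>P) \<le> ennreal ((\<delta> (2*n))\<^sup>2)"
  using Z_in[OF n] by eventually_elim (rule iii, use n in simp_all)

lemma A_bound:
  assumes n: "n \<ge> 1"
  shows "AE \<omega> in M. (\<integral>\<^sup>+x. ennreal ((norm (A x (Z n \<omega>)))\<^sup>2) \<partial>P) \<le> ennreal C"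
  using Z_in[OF n] by eventually_elim (rule ii[of "2*n"], use n in simp_all)

lemma delta_lim: "(\<lambda>n. (\<delta> (2*n))\<^sup>2) \<longlonglongrightarrow> 0"
  using tendsto_power[OF subseq_double[OF \<delta>], of 2] by simp

lemma C_lim: "(\<lambda>n. C / real n) \<longlonglongrightarrow> 0"
  by (rule lim_const_over_n)

text \<open>The difference is a fluctuation \<open>R1\<close> plus a bias \<open>R2\<close>. The
  fluctuation is a centred cross-fitted sum with second moment at most
  \<open>(\<delta> (2*n))\<^sup>2\<close>; the bias is small uniformly over the neighbourhood that
  contains \<open>Z n\<close>.\<close>

lemma score_sum_expansion:
  "tends_zero M (\<lambda>n \<omega>. sqrt (real n) *\<^sub>R ((1 / real n) *\<^sub>R (\<Sum>i\<in>{1..n}. score A B (\<xi> n \<omega> i) \<theta>0 (Z n \<omega>))) - U n \<omega>)"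
proof -
  define R1 where "R1 n \<omega> = sqrt (real n) *\<^sub>R ((1 / real n) *\<^sub>R (\<Sum>i\<in>{1..n}.
      (score A B (\<xi> n \<omega> i) \<theta>0 (Z n \<omega>) - m0 (\<xi> n \<omega> i)) - (\<integral>x. score A B x \<theta>0 (Z n \<omega>) - m0 x \<partial>P)))" for n \<omega>
  define R2 where "R2 n \<omega> = sqrt (real n) *\<^sub>R (\<integral>x. score A B x \<theta>0 (Z n \<omega>) \<partial>P)" for n \<omega>
  note L = mean_L2[OF diff_meas, of "\<lambda>n. (\<delta> (2*n))\<^sup>2", OF zero_le_power2 diff_bound]
  have R1: "tends_zero M R1"
    unfolding R1_def by (rule tends_zero_L2[OF _ _ _ delta_lim]) (rule L(4), assumption+, rule L(3), assumption+, rule zero_le_power2)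
  have R2: "tends_zero M R2"
  proof (rule tends_zero_AE_le)
    show "R2 n \<in> borel_measurable M" if "n \<ge> 1" for n
      unfolding R2_def using F_int_meas[OF score_meas that] by measurable
    fix e :: real assume e: "0 < e"
    have "eventually (\<lambda>n. (SUP h\<in>HN (2*n). ennreal (norm (sqrt (real n) *\<^sub>R (\<integral>x. score A B x \<theta>0 h \<partial>P)))) < ennreal e) sequentially"
      using bias e by (intro order_tendstoD) auto
    with eventually_ge_1 show "eventually (\<lambda>n. AE \<omega> in M. norm (R2 n \<omega>) \<le> e) sequentially"
    proof eventually_elim
      case (elim n)
      show ?case
        using Z_in[OF elim(1)]
      proof eventually_elim
        case (elim \<omega>)
        have "ennreal (norm (R2 n \<omega>)) \<le> (SUP h\<in>HN (2*n). ennreal (norm (sqrt (real n) *\<^sub>R (\<integral>x. score A B x \<theta>0 h \<partial>P))))"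
          unfolding R2_def by (rule SUP_upper[OF elim])
        also have "\<dots> \<le> ennreal e" using \<open>_ < ennreal e\<close> by simp
        finally show ?case using e by simp
      qed
    qed
  qed
  show ?thesis
  proof (rule tends_zero_bound[OF tends_zero_add[OF R1 R2], of _ 1])
    fix n :: nat assume n: "n \<ge> 1"
    show "(\<lambda>\<omega>. sqrt (real n) *\<^sub>R ((1 / real n) *\<^sub>R (\<Sum>i\<in>{1..n}. score A B (\<xi> n \<omega> i) \<theta>0 (Z n \<omega>))) - U n \<omega>) \<in> borel_measurable M"
      by (intro borel_measurable_diff borel_measurable_scaleR borel_measurable_const borel_measurable_sum
          F_meas[OF score_meas n] bdd_prob_measurable[OF bdd_U n])
    show "AE \<omega> in M. norm (sqrt (real n) *\<^sub>R ((1 / real n) *\<^sub>R (\<Sum>i\<in>{1..n}. score A B (\<xi> n \<omega> i) \<theta>0 (Z n \<omega>))) - U n \<omega>)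
        \<le> 1 * norm (R1 n \<omega> + R2 n \<omega>)"
      using Z_in[OF n]
    proof eventually_elim
      case (elim \<omega>)
      have "integrable P (\<lambda>x. score A B x \<theta>0 (Z n \<omega>))"
        using score_integrable[OF _ elim] n by simp
      moreover have "integrable P m0"
      proof -
        have "(\<integral>\<^sup>+x. ennreal ((norm (m0 x))\<^sup>2) \<partial>P) < \<infinity>"
          by (subst nn_integral_eq_integral[OF score_L2]) simp_all
        then show ?thesis by (rule integrable_of_nn_integral_square[OF P m0_meas])
      qed
      ultimately have I: "(\<integral>x. score A B x \<theta>0 (Z n \<omega>) - m0 x \<partial>P) = (\<integral>x. score A B x \<theta>0 (Z n \<omega>) \<partial>P)"
        by (simp add: score_mean)
      have "sqrt (real n) *\<^sub>R ((1 / real n) *\<^sub>R (\<Sum>i\<in>{1..n}. score A B (\<xi> n \<omega> i) \<theta>0 (Z n \<omega>))) - U n \<omega> = R1 n \<omega> + R2 n \<omega>"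
        unfolding R1_def R2_def U_def unfolding sum_minus_const unfolding I sum_subtractf
        using n by (simp add: scaleR_diff_right)
      then show ?case by simp
    qed
  qed
qed

text \<open>Each weight is \<open>1 / n\<close> plus a centred part. The first part is the
  unweighted expansion; the centred part, applied to the score differences, again has second moment
  at most \<open>(\<delta> (2*n))\<^sup>2\<close> and adds no bias.\<close>

lemma weighted_score_sum_expansion:
  "tends_zero M (\<lambda>n \<omega>. sqrt (real n) *\<^sub>R (\<Sum>i\<in>{1..n}. w n \<omega> i *\<^sub>R score A B (\<xi> n \<omega> i) \<theta>0 (Z n \<omega>)) - (U n \<omega> + V n \<omega>))"
proof -
  define R3 where "R3 n \<omega> = sqrt (real n) *\<^sub>R (\<Sum>i\<in>{1..n}. (w n \<omega> i - 1 / real n) *\<^sub>R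
      (score A B (\<xi> n \<omega> i) \<theta>0 (Z n \<omega>) - m0 (\<xi> n \<omega> i)))" for n \<omega>
  note L = weighted_L2[OF diff_meas, of "\<lambda>n. (\<delta> (2*n))\<^sup>2", OF zero_le_power2 diff_bound]
  have R3: "tends_zero M R3"
    unfolding R3_def by (rule tends_zero_L2[OF _ _ _ delta_lim]) (rule L(4), assumption+, rule L(3), assumption+, rule zero_le_power2)
  have eq: "sqrt (real n) *\<^sub>R (\<Sum>i\<in>{1..n}. w n \<omega> i *\<^sub>R score A B (\<xi> n \<omega> i) \<theta>0 (Z n \<omega>)) - (U n \<omega> + V n \<omega>)
    = (sqrt (real n) *\<^sub>R ((1 / real n) *\<^sub>R (\<Sum>i\<in>{1..n}. score A B (\<xi> n \<omega> i) \<theta>0 (Z n \<omega>))) - U n \<omega>) + R3 n \<omega>" for n \<omega>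
  proof -
    have "(\<Sum>i\<in>{1..n}. (w n \<omega> i - 1 / real n) *\<^sub>R (score A B (\<xi> n \<omega> i) \<theta>0 (Z n \<omega>) - m0 (\<xi> n \<omega> i)))
      = (\<Sum>i\<in>{1..n}. w n \<omega> i *\<^sub>R score A B (\<xi> n \<omega> i) \<theta>0 (Z n \<omega>))
        - (1 / real n) *\<^sub>R (\<Sum>i\<in>{1..n}. score A B (\<xi> n \<omega> i) \<theta>0 (Z n \<omega>))
        - (\<Sum>i\<in>{1..n}. (w n \<omega> i - 1 / real n) *\<^sub>R m0 (\<xi> n \<omega> i))"
      unfolding scaleR_sum_right sum_subtractf[symmetric]
      by (rule sum.cong) (simp_all add: scaleR_diff_left scaleR_diff_right)
    then show ?thesis
      unfolding R3_def V_def by (simp only: scaleR_diff_right) simp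
  qed
  show ?thesis
    unfolding eq by (rule tends_zero_add[OF score_sum_expansion R3])
qed

text \<open>Around the random mean at \<open>Z n\<close> the average fluctuates with second moment
  at most \<open>C / n\<close>; hypothesis \<open>i\<close> then moves that mean to the one at
  \<open>h0\<close>.\<close>

lemma A_mean_lim: "tends_zero M (\<lambda>n \<omega>. (1 / real n) *\<^sub>R (\<Sum>i\<in>{1..n}. A (\<xi> n \<omega> i) (Z n \<omega>)) - (\<integral>x. A x h0 \<partial>P))"
proof -
  note L = mean_L2[OF A_meas, of "\<lambda>n. C", OF less_imp_le[OF C] A_bound]
  have 1: "tends_zero M (\<lambda>n \<omega>. (1 / real n) *\<^sub>R (\<Sum>i\<in>{1..n}. A (\<xi> n \<omega> i) (Z n \<omega>) - (\<integral>x. A x (Z n \<omega>) \<partial>P)))"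
    by (rule tends_zero_L2[OF _ _ _ C_lim]) (rule L(1), assumption+, rule L(2), assumption+, use C in simp)
  have 2: "tends_zero M (\<lambda>n \<omega>. (\<integral>x. A x (Z n \<omega>) \<partial>P) - (\<integral>x. A x h0 \<partial>P))"
  proof (rule tends_zero_AE_le)
    show "(\<lambda>\<omega>. (\<integral>x. A x (Z n \<omega>) \<partial>P) - (\<integral>x. A x h0 \<partial>P)) \<in> borel_measurable M" if "n \<ge> 1" for n
      using F_int_meas[OF A_meas that] by measurable
    fix e :: real assume e: "0 < e"
    have "eventually (\<lambda>n. a (2*n) < e) sequentially"
      using subseq_double[OF a] e by (rule order_tendstoD)
    with eventually_ge_1 show "eventually (\<lambda>n. AE \<omega> in M. norm ((\<integral>x. A x (Z n \<omega>) \<partial>P) - (\<integral>x. A x h0 \<partial>P)) \<le> e) sequentially"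
    proof eventually_elim
      case (elim n)
      show ?case
        using Z_in[OF elim(1)]
      proof eventually_elim
        case (elim \<omega>)
        have "norm ((\<integral>x. A x (Z n \<omega>) \<partial>P) - (\<integral>x. A x h0 \<partial>P)) \<le> a (2*n)"
          using \<open>1 \<le> n\<close> by (intro i[OF _ elim]) simp
        then show ?case using \<open>a (2*n) < e\<close> by simp
      qed
    qed
  qed
  show ?thesis
  proof (rule tends_zero_bound[OF tends_zero_add[OF 1 2], of _ 1])
    fix n :: nat assume n: "n \<ge> 1"
    show "(\<lambda>\<omega>. (1 / real n) *\<^sub>R (\<Sum>i\<in>{1..n}. A (\<xi> n \<omega> i) (Z n \<omega>)) - (\<integral>x. A x h0 \<partial>P)) \<in> borel_measurable M"
      by (intro borel_measurable_diff borel_measurable_scaleR borel_measurable_const borel_measurable_sum F_meas[OF A_meas n])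
    show "AE \<omega> in M. norm ((1 / real n) *\<^sub>R (\<Sum>i\<in>{1..n}. A (\<xi> n \<omega> i) (Z n \<omega>)) - (\<integral>x. A x h0 \<partial>P))
      \<le> 1 * norm ((1 / real n) *\<^sub>R (\<Sum>i\<in>{1..n}. A (\<xi> n \<omega> i) (Z n \<omega>) - (\<integral>x. A x (Z n \<omega>) \<partial>P)) + ((\<integral>x. A x (Z n \<omega>) \<partial>P) - (\<integral>x. A x h0 \<partial>P)))"
      unfolding sum_minus_const using n by (intro AE_I2) (simp add: scaleR_diff_right)
  qed
qed

lemma A_weighted_lim: "tends_zero M (\<lambda>n \<omega>. (\<Sum>i\<in>{1..n}. w n \<omega> i *\<^sub>R A (\<xi> n \<omega> i) (Z n \<omega>)) - (\<integral>x. A x h0 \<partial>P))"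
proof -
  note L = weighted_L2[OF A_meas, of "\<lambda>n. C", OF less_imp_le[OF C] A_bound]
  have W: "tends_zero M (\<lambda>n \<omega>. \<Sum>i\<in>{1..n}. (w n \<omega> i - 1 / real n) *\<^sub>R A (\<xi> n \<omega> i) (Z n \<omega>))"
    by (rule tends_zero_L2[OF _ _ _ C_lim]) (rule L(1), assumption+, rule L(2), assumption+, use C in simp)
  have eq: "(\<Sum>i\<in>{1..n}. w n \<omega> i *\<^sub>R A (\<xi> n \<omega> i) (Z n \<omega>)) - K
    = ((1 / real n) *\<^sub>R (\<Sum>i\<in>{1..n}. A (\<xi> n \<omega> i) (Z n \<omega>)) - K)
      + (\<Sum>i\<in>{1..n}. (w n \<omega> i - 1 / real n) *\<^sub>R A (\<xi> n \<omega> i) (Z n \<omega>))" for n \<omega> K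
    by (simp add: scaleR_diff_left sum_subtractf scaleR_sum_right)
  show ?thesis
    unfolding eq by (rule tends_zero_add[OF A_mean_lim W])
qed

lemma J_inv: "J ** (\<integral>x. A x h0 \<partial>P) = mat 1"
  using someI_ex[OF A_inv[unfolded invertible_def]] unfolding matrix_inv_def by blast

lemma tends_zero_shift:
  fixes D q u :: "nat \<Rightarrow> 'w \<Rightarrow> real ^ 'p"
  assumes "tends_zero M (\<lambda>n \<omega>. D n \<omega> + J *v q n \<omega>)" "tends_zero M (\<lambda>n \<omega>. q n \<omega> - u n \<omega>)"
  shows "tends_zero M (\<lambda>n \<omega>. D n \<omega> + J *v u n \<omega>)"
  using tends_zero_diff[OF assms(1) tends_zero_matrix[OF assms(2), of J]]
  by (simp add: matrix_vector_mult_diff_distrib)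

lemma estimator_expansion: "tends_zero M (\<lambda>n \<omega>. sqrt (real n) *\<^sub>R (th n \<omega> - \<theta>0) + J *v U n \<omega>)"
proof (rule tends_zero_shift[OF _ score_sum_expansion])
  show "tends_zero M (\<lambda>n \<omega>. sqrt (real n) *\<^sub>R (th n \<omega> - \<theta>0) + J *v
      (sqrt (real n) *\<^sub>R ((1 / real n) *\<^sub>R (\<Sum>i\<in>{1..n}. score A B (\<xi> n \<omega> i) \<theta>0 (Z n \<omega>)))))"
  proof (rule tends_zero_linear_equation[OF A_mean_lim _ _ _ J_inv])
    show "bdd_prob M (\<lambda>n \<omega>. sqrt (real n) *\<^sub>R ((1 / real n) *\<^sub>R (\<Sum>i\<in>{1..n}. score A B (\<xi> n \<omega> i) \<theta>0 (Z n \<omega>))))"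
      using bdd_prob_add[OF tends_zero_imp_bdd_prob[OF score_sum_expansion] bdd_U] by simp
    fix n :: nat assume n: "n \<ge> 1"
    show "(\<lambda>\<omega>. sqrt (real n) *\<^sub>R (th n \<omega> - \<theta>0)) \<in> borel_measurable M"
      using th_meas(1)[OF n] by measurable
    show "AE \<omega> in M. ((1 / real n) *\<^sub>R (\<Sum>i\<in>{1..n}. A (\<xi> n \<omega> i) (Z n \<omega>))) *v (sqrt (real n) *\<^sub>R (th n \<omega> - \<theta>0))
      = - (sqrt (real n) *\<^sub>R ((1 / real n) *\<^sub>R (\<Sum>i\<in>{1..n}. score A B (\<xi> n \<omega> i) \<theta>0 (Z n \<omega>))))"
      using th[OF n]
    proof eventually_elim
      case (elim \<omega>)
      show ?case
        using weighted_score_equation[of "\<lambda>_. 1 / real n" A B "\<xi> n \<omega>" "th n \<omega>" "Z n \<omega>" "{1..n}" "sqrt (real n)" \<theta>0] elim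
        by (simp only: scaleR_sum_right)
    qed
  qed
qed

lemma bootstrap_expansion: "tends_zero M (\<lambda>n \<omega>. sqrt (real n) *\<^sub>R (thBB n \<omega> - \<theta>0) + J *v (U n \<omega> + V n \<omega>))"
proof (rule tends_zero_shift[OF _ weighted_score_sum_expansion])
  show "tends_zero M (\<lambda>n \<omega>. sqrt (real n) *\<^sub>R (thBB n \<omega> - \<theta>0) + J *v
      (sqrt (real n) *\<^sub>R (\<Sum>i\<in>{1..n}. w n \<omega> i *\<^sub>R score A B (\<xi> n \<omega> i) \<theta>0 (Z n \<omega>))))"
  proof (rule tends_zero_linear_equation[OF A_weighted_lim _ _ _ J_inv])
    show "bdd_prob M (\<lambda>n \<omega>. sqrt (real n) *\<^sub>R (\<Sum>i\<in>{1..n}. w n \<omega> i *\<^sub>R score A B (\<xi> n \<omega> i) \<theta>0 (Z n \<omega>)))"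
      using bdd_prob_add[OF tends_zero_imp_bdd_prob[OF weighted_score_sum_expansion] bdd_prob_add[OF bdd_U bdd_V]] by simp
    fix n :: nat assume n: "n \<ge> 1"
    show "(\<lambda>\<omega>. sqrt (real n) *\<^sub>R (thBB n \<omega> - \<theta>0)) \<in> borel_measurable M"
      using th_meas(2)[OF n] by measurable
    show "AE \<omega> in M. (\<Sum>i\<in>{1..n}. w n \<omega> i *\<^sub>R A (\<xi> n \<omega> i) (Z n \<omega>)) *v (sqrt (real n) *\<^sub>R (thBB n \<omega> - \<theta>0))
      = - (sqrt (real n) *\<^sub>R (\<Sum>i\<in>{1..n}. w n \<omega> i *\<^sub>R score A B (\<xi> n \<omega> i) \<theta>0 (Z n \<omega>)))"
      using thBB[OF n] by eventually_elim (rule weighted_score_equation)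
  qed
qed

text \<open>The common term \<open>U\<close> cancels, so the leading term vanishes when the weights
  are uniform and, given the data, varies only with the weights.\<close>

lemma bootstrap_difference_expansion:
  "tends_zero M (\<lambda>n \<omega>. sqrt (real n) *\<^sub>R (thBB n \<omega> - th n \<omega>) + J *v V n \<omega>)"
  using tends_zero_diff[OF bootstrap_expansion estimator_expansion]
  by (simp add: matrix_vector_right_distrib scaleR_diff_right algebra_simps)

end

section \<open>Weak convergence from trigonometric test functions\<close>

lemma bounded_rangeE:
  fixes g :: "'a \<Rightarrow> real"
  assumes "bounded (range g)"
  obtains G where "0 < G" "\<And>x. \<bar>g x\<bar> \<le> G"
  using assms unfolding bounded_pos by auto

lemma abs_cos_diff_le: "\<bar>cos x - cos y\<bar> \<le> \<bar>x - y :: real\<bar>"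
proof -
  have "\<bar>cos x - cos y\<bar> = 2 * (\<bar>sin ((x + y) / 2)\<bar> * \<bar>sin ((y - x) / 2)\<bar>)"
    by (simp add: cos_diff_cos abs_mult)
  also have "\<dots> \<le> 2 * (1 * \<bar>(y - x) / 2\<bar>)"
    by (intro mult_left_mono mult_mono abs_sin_x_le_abs_x) auto
  finally show ?thesis by simp
qed

context prob_space
begin

lemma integrable_bounded_comp:
  fixes Y :: "'a \<Rightarrow> 'b::euclidean_space" and g :: "'b \<Rightarrow> real"
  assumes Y [measurable]: "Y \<in> borel_measurable M" and g: "continuous_on UNIV g" "bounded (range g)"
  shows "integrable M (\<lambda>\<omega>. g (Y \<omega>))"
proof -
  obtain G where G: "\<And>x. \<bar>g x\<bar> \<le> G" using bounded_rangeE[OF g(2)] by metis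
  have [measurable]: "g \<in> borel_measurable borel" by (rule borel_measurable_continuous_onI[OF g(1)])
  show ?thesis by (rule integrable_const_bound[where B=G]) (use G in auto)
qed

lemma integral_abs_bounded_comp:
  fixes Y :: "'a \<Rightarrow> 'b::euclidean_space" and g :: "'b \<Rightarrow> real"
  assumes Y [measurable]: "Y \<in> borel_measurable M" and g: "continuous_on UNIV g"
  shows "(\<integral>x. g x \<partial>distr M borel Y) = (\<integral>\<omega>. g (Y \<omega>) \<partial>M)"
proof -
  have [measurable]: "g \<in> borel_measurable borel" by (rule borel_measurable_continuous_onI[OF g])
  show ?thesis by (rule integral_distr) measurable
qed

lemma trig_cos_props:
  fixes t :: "'b::euclidean_space"
  shows "continuous_on UNIV (\<lambda>x. cos (t \<bullet> x + s))" "bounded (range (\<lambda>x. cos (t \<bullet> x + s)))"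
  by (rule trig_function_continuous trig_function_bounded, rule trig_function.cos)+

text \<open>The limit is in L1 because this difference will later be conditioned, and conditional
  expectation contracts the L1 norm.\<close>

lemma cos_difference_lim:
  fixes Y L :: "nat \<Rightarrow> 'a \<Rightarrow> 'b::euclidean_space"
  assumes Y: "\<And>n. n \<ge> 1 \<Longrightarrow> Y n \<in> borel_measurable M" and L: "\<And>n. n \<ge> 1 \<Longrightarrow> L n \<in> borel_measurable M"
    and R: "tends_zero M (\<lambda>n \<omega>. Y n \<omega> - L n \<omega>)"
  shows "(\<lambda>n. \<integral>\<omega>. \<bar>cos (t \<bullet> Y n \<omega> + s) - cos (t \<bullet> L n \<omega> + s)\<bar> \<partial>M) \<longlonglongrightarrow> 0"
proof (rule tendstoI)
  fix e :: real assume e: "0 < e"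
  \<comment> \<open>On the good event the Lipschitz bound gives \<open>e / 4\<close>, and the bad
    event costs \<open>2 * (e / 8)\<close>. The 1 in \<open>u\<close> allows for
    \<open>t = 0\<close>.\<close>
  define u where "u = norm t + 1"
  define d where "d = e / (4 * u)"
  have u: "0 < u" "norm t \<le> u" by (simp_all add: u_def add_nonneg_pos)
  then have d: "0 < d" using e by (simp add: d_def)
  have td: "norm t * d \<le> e / 4"
    using mult_right_mono[OF u(2), of d] d u(1) by (simp add: d_def)
  have "eventually (\<lambda>n. prob {\<omega> \<in> space M. d < norm (Y n \<omega> - L n \<omega>)} \<le> e / 8) sequentially"
    using tends_zeroD[OF R d, of "e / 8"] e by simp
  with eventually_ge_1
  show "eventually (\<lambda>n. dist (\<integral>\<omega>. \<bar>cos (t \<bullet> Y n \<omega> + s) - cos (t \<bullet> L n \<omega> + s)\<bar> \<partial>M) 0 < e) sequentially"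
  proof eventually_elim
    case (elim n)
    have [measurable]: "Y n \<in> borel_measurable M" "L n \<in> borel_measurable M" using Y L elim by auto
    let ?B = "{\<omega> \<in> space M. d < norm (Y n \<omega> - L n \<omega>)}"
    have B: "?B \<in> sets M" by measurable
    have ind: "integrable M (indicat_real ?B)"
      using B by (intro integrable_real_indicator) (simp_all add: less_top[symmetric])
    have "(\<integral>\<omega>. \<bar>cos (t \<bullet> Y n \<omega> + s) - cos (t \<bullet> L n \<omega> + s)\<bar> \<partial>M) \<le> (\<integral>\<omega>. e / 4 + 2 * indicator ?B \<omega> \<partial>M)"
    proof (rule integral_mono)
      show "integrable M (\<lambda>\<omega>. \<bar>cos (t \<bullet> Y n \<omega> + s) - cos (t \<bullet> L n \<omega> + s)\<bar>)"
        by (intro integrable_abs Bochner_Integration.integrable_diff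
            integrable_bounded_comp[OF _ trig_cos_props]) measurable
      show "integrable M (\<lambda>\<omega>. e / 4 + 2 * indicator ?B \<omega> :: real)"
        by (intro Bochner_Integration.integrable_add integrable_mult_right integrable_const ind)
      fix \<omega> assume \<omega>: "\<omega> \<in> space M"
      show "\<bar>cos (t \<bullet> Y n \<omega> + s) - cos (t \<bullet> L n \<omega> + s)\<bar> \<le> e / 4 + 2 * indicator ?B \<omega>"
      proof (cases "\<omega> \<in> ?B")
        case True
        have "\<bar>cos (t \<bullet> Y n \<omega> + s) - cos (t \<bullet> L n \<omega> + s)\<bar> \<le> 1 + 1"
          by (rule order_trans[OF abs_triangle_ineq4]) (intro add_mono abs_cos_le_one)
        then show ?thesis using True e by simp
      next
        case False
        have "\<bar>cos (t \<bullet> Y n \<omega> + s) - cos (t \<bullet> L n \<omega> + s)\<bar> \<le> \<bar>t \<bullet> (Y n \<omega> - L n \<omega>)\<bar>"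
          using abs_cos_diff_le[of "t \<bullet> Y n \<omega> + s" "t \<bullet> L n \<omega> + s"] by (simp add: inner_diff_right)
        also have "\<dots> \<le> norm t * norm (Y n \<omega> - L n \<omega>)" by (rule Cauchy_Schwarz_ineq2)
        also have "\<dots> \<le> norm t * d" using False \<omega> by (intro mult_left_mono) auto
        finally show ?thesis using td False by simp
      qed
    qed
    also have "\<dots> = e / 4 + 2 * prob ?B"
      using ind B by (subst Bochner_Integration.integral_add) (simp_all add: prob_space)
    also have "\<dots> < e" using elim e by simp
    finally show ?case by (simp add: integral_nonneg_AE abs_of_nonneg)
  qed
qed

lemma bdd_prob_tight:
  fixes Y :: "nat \<Rightarrow> 'a \<Rightarrow> 'b::euclidean_space"
  assumes Y: "bdd_prob M Y" and e: "0 < e"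
  shows "\<exists>K. eventually (\<lambda>n. measure (distr M borel (Y n)) {x. K < norm x} \<le> e) sequentially"
proof -
  obtain K where "eventually (\<lambda>n. prob {\<omega> \<in> space M. K < norm (Y n \<omega>)} \<le> e) sequentially"
    using Y e unfolding bdd_prob_def by blast
  with eventually_ge_1 have "eventually (\<lambda>n. measure (distr M borel (Y n)) {x. K < norm x} \<le> e) sequentially"
  proof eventually_elim
    case (elim n)
    have "{x \<in> space borel. K < norm (x :: 'b)} \<in> sets borel" by measurable
    then have "{x. K < norm (x :: 'b)} \<in> sets borel" by simp
    from measure_distr[OF bdd_prob_measurable[OF Y elim(1)] this]
    have "measure (distr M borel (Y n)) {x. K < norm x} = prob (Y n -` {x. K < norm x} \<inter> space M)" .
    moreover have "Y n -` {x. K < norm x} \<inter> space M = {\<omega> \<in> space M. K < norm (Y n \<omega>)}" by auto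
    ultimately show ?case using elim(2) by (simp only:)
  qed
  then show ?thesis by (intro exI[of _ K])
qed

text \<open>The remainder \<open>Y - L\<close> is removed only inside cosines, which are Lipschitz.
  Other test functions are reached afterwards through \<open>trig_test_convergence\<close> and the
  tightness of \<open>Y\<close>.\<close>

lemma converges_in_distribution_trig:
  fixes Y L :: "nat \<Rightarrow> 'a \<Rightarrow> 'b::euclidean_space"
  assumes Y: "bdd_prob M Y" and L: "\<And>n. n \<ge> 1 \<Longrightarrow> L n \<in> borel_measurable M"
    and R: "tends_zero M (\<lambda>n \<omega>. Y n \<omega> - L n \<omega>)"
    and \<nu>: "prob_space \<nu>" "sets \<nu> = sets borel"
    and cos: "\<And>t s. (\<lambda>n. \<integral>\<omega>. cos (t \<bullet> L n \<omega> + s) \<partial>M) \<longlonglongrightarrow> (\<integral>x. cos (t \<bullet> x + s) \<partial>\<nu>)"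
  shows "converges_in_distribution M Y \<nu>"
  unfolding converges_in_distribution_def weakly_converges_def
proof (intro allI impI)
  fix g :: "'b \<Rightarrow> real" assume g: "continuous_on UNIV g" "bounded (range g)"
  interpret \<nu>: prob_space \<nu> by fact
  note Ym = bdd_prob_measurable[OF Y]
  have id: "(\<lambda>x. x) \<in> borel_measurable \<nu>" unfolding measurable_cong_sets[OF \<nu>(2) refl] by simp
  note \<nu>_int = \<nu>.integrable_bounded_comp[OF id]
  define \<Phi> where "\<Phi> n f = \<bar>(\<integral>\<omega>. f (Y n \<omega>) \<partial>M) - (\<integral>x. f x \<partial>\<nu>)\<bar>" for n and f :: "'b \<Rightarrow> real"
  have "(\<lambda>n. \<Phi> n g) \<longlonglongrightarrow> 0"
  proof (rule trig_test_convergence[where \<mu>="\<lambda>n. distr M borel (Y n)" and \<nu>=\<nu>])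
    show "prob_space (distr M borel (Y n))" if "n \<ge> 1" for n
      by (rule prob_space_distr[OF Ym[OF that]])
    show "\<exists>K. eventually (\<lambda>n. measure (distr M borel (Y n)) {x. K < norm x} \<le> e) sequentially" if "0 < e" for e
      by (rule bdd_prob_tight[OF Y that])
    show "0 \<le> \<Phi> n f" for n f by (simp add: \<Phi>_def)
    show "\<Phi> n (\<lambda>x. f x + h x) \<le> \<Phi> n f + \<Phi> n h"
      if n: "n \<ge> 1" and f: "continuous_on UNIV f" "bounded (range f)" and h: "continuous_on UNIV h" "bounded (range h)" for n f h
      using integrable_bounded_comp[OF Ym[OF n] f] integrable_bounded_comp[OF Ym[OF n] h] \<nu>_int[OF f] \<nu>_int[OF h]
      by (simp add: \<Phi>_def)
    show "\<Phi> n (\<lambda>x. c * f x) \<le> \<bar>c\<bar> * \<Phi> n f" for n f c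
      by (simp add: \<Phi>_def abs_mult[symmetric] right_diff_distrib)
    show "\<Phi> n f \<le> (\<integral>x. \<bar>f x\<bar> \<partial>distr M borel (Y n)) + (\<integral>x. \<bar>f x\<bar> \<partial>\<nu>)"
      if n: "n \<ge> 1" and f: "continuous_on UNIV f" for n f
    proof -
      have "(\<integral>x. \<bar>f x\<bar> \<partial>distr M borel (Y n)) = (\<integral>\<omega>. \<bar>f (Y n \<omega>)\<bar> \<partial>M)"
        by (rule integral_abs_bounded_comp[OF Ym[OF n]]) (intro continuous_intros f)
      then show ?thesis
        unfolding \<Phi>_def
        using integral_abs_bound[of M "\<lambda>\<omega>. f (Y n \<omega>)"] integral_abs_bound[of \<nu> f] by linarith
    qed
    show "(\<lambda>n. \<Phi> n (\<lambda>x. cos (t \<bullet> x + s))) \<longlonglongrightarrow> 0" for t s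
    proof (rule Lim_null_comparison)
      have "(\<lambda>n. \<bar>(\<integral>\<omega>. cos (t \<bullet> L n \<omega> + s) \<partial>M) - (\<integral>x. cos (t \<bullet> x + s) \<partial>\<nu>)\<bar>) \<longlonglongrightarrow> 0"
        using cos[of t s] by (simp add: LIM_zero_iff tendsto_rabs_zero)
      from tendsto_add[OF cos_difference_lim[OF Ym L R, of t s] this]
      show "(\<lambda>n. (\<integral>\<omega>. \<bar>cos (t \<bullet> Y n \<omega> + s) - cos (t \<bullet> L n \<omega> + s)\<bar> \<partial>M) + \<bar>(\<integral>\<omega>. cos (t \<bullet> L n \<omega> + s) \<partial>M) - (\<integral>x. cos (t \<bullet> x + s) \<partial>\<nu>)\<bar>) \<longlonglongrightarrow> 0"
        by simp
      show "eventually (\<lambda>n. norm (\<Phi> n (\<lambda>x. cos (t \<bullet> x + s))) \<le> (\<integral>\<omega>. \<bar>cos (t \<bullet> Y n \<omega> + s) - cos (t \<bullet> L n \<omega> + s)\<bar> \<partial>M) + \<bar>(\<integral>\<omega>. cos (t \<bullet> L n \<omega> + s) \<partial>M) - (\<integral>x. cos (t \<bullet> x + s) \<partial>\<nu>)\<bar>) sequentially"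
        using eventually_ge_1
      proof eventually_elim
        case (elim n)
        have "(\<integral>\<omega>. cos (t \<bullet> Y n \<omega> + s) \<partial>M) - (\<integral>\<omega>. cos (t \<bullet> L n \<omega> + s) \<partial>M) = (\<integral>\<omega>. cos (t \<bullet> Y n \<omega> + s) - cos (t \<bullet> L n \<omega> + s) \<partial>M)"
          by (rule Bochner_Integration.integral_diff[symmetric])
             (rule integrable_bounded_comp[OF Ym[OF elim] trig_cos_props] integrable_bounded_comp[OF L[OF elim] trig_cos_props])+
        then show ?case
          unfolding \<Phi>_def real_norm_def abs_abs
          using integral_abs_bound[of M "\<lambda>\<omega>. cos (t \<bullet> Y n \<omega> + s) - cos (t \<bullet> L n \<omega> + s)"]
          by linarith
      qed
    qed
  qed (use \<nu> g in auto)
  then have "(\<lambda>n. (\<integral>\<omega>. g (Y n \<omega>) \<partial>M) - (\<integral>x. g x \<partial>\<nu>)) \<longlonglongrightarrow> 0"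
    unfolding \<Phi>_def by (rule tendsto_rabs_zero_cancel)
  then have "(\<lambda>n. \<integral>\<omega>. g (Y n \<omega>) \<partial>M) \<longlonglongrightarrow> (\<integral>x. g x \<partial>\<nu>)"
    by (simp add: LIM_zero_iff)
  moreover have "eventually (\<lambda>n. (\<integral>\<omega>. g (Y n \<omega>) \<partial>M) = (\<integral>x. g x \<partial>distr M borel (Y n))) sequentially"
    using eventually_ge_1 by eventually_elim (simp add: integral_abs_bounded_comp[OF Ym g(1)])
  ultimately show "(\<lambda>n. \<integral>x. g x \<partial>distr M borel (Y n)) \<longlonglongrightarrow> (\<integral>x. g x \<partial>\<nu>)"
    by (rule Lim_transform_eventually)
qed

section \<open>Convergence of conditional laws\<close>

text \<open>Conditional expectation is monotone, so that of \<open>f\<close> lies between those of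
  \<open>- \<bar>f\<bar>\<close> and \<open>\<bar>f\<bar>\<close>.\<close>

lemma integral_real_cond_exp_abs_le:
  assumes F: "subalgebra M F" and f: "integrable M f"
  shows "(\<integral>\<omega>. \<bar>real_cond_exp M F f \<omega>\<bar> \<partial>M) \<le> (\<integral>\<omega>. \<bar>f \<omega>\<bar> \<partial>M)"
proof -
  interpret finite_measure_subalgebra M F by standard (rule F)
  have fa: "integrable M (\<lambda>\<omega>. \<bar>f \<omega>\<bar>)" using f by simp
  have fm: "integrable M (\<lambda>\<omega>. - \<bar>f \<omega>\<bar>)" using f by simp
  have neg: "AE \<omega> in M. real_cond_exp M F (\<lambda>\<omega>. - \<bar>f \<omega>\<bar>) \<omega> = - real_cond_exp M F (\<lambda>\<omega>. \<bar>f \<omega>\<bar>) \<omega>"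
    using real_cond_exp_cmult[OF fa, of "-1"] by simp
  have "(\<integral>\<omega>. \<bar>real_cond_exp M F f \<omega>\<bar> \<partial>M) \<le> (\<integral>\<omega>. real_cond_exp M F (\<lambda>\<omega>. \<bar>f \<omega>\<bar>) \<omega> \<partial>M)"
  proof (rule integral_mono_AE)
    show "integrable M (\<lambda>\<omega>. \<bar>real_cond_exp M F f \<omega>\<bar>)" by (intro integrable_abs real_cond_exp_int(1) f)
    show "integrable M (\<lambda>\<omega>. real_cond_exp M F (\<lambda>\<omega>. \<bar>f \<omega>\<bar>) \<omega>)" by (rule real_cond_exp_int(1)[OF fa])
    have "AE \<omega> in M. real_cond_exp M F f \<omega> \<le> real_cond_exp M F (\<lambda>\<omega>. \<bar>f \<omega>\<bar>) \<omega>"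
      by (rule real_cond_exp_mono) (use f fa in auto)
    moreover have "AE \<omega> in M. real_cond_exp M F (\<lambda>\<omega>. - \<bar>f \<omega>\<bar>) \<omega> \<le> real_cond_exp M F f \<omega>"
      by (rule real_cond_exp_mono[OF _ fm f]) (auto intro!: AE_I2)
    ultimately show "AE \<omega> in M. \<bar>real_cond_exp M F f \<omega>\<bar> \<le> real_cond_exp M F (\<lambda>\<omega>. \<bar>f \<omega>\<bar>) \<omega>"
      using neg by eventually_elim auto
  qed
  also have "\<dots> = (\<integral>\<omega>. \<bar>f \<omega>\<bar> \<partial>M)" by (rule real_cond_exp_int(2)[OF fa])
  finally show ?thesis .
qed

text \<open>The error functional is the mean absolute deviation of the conditional expectation from
  the limit. It is controlled by the tails of the unconditional laws of \<open>Y\<close>, so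
  ordinary tightness applies, and Markov's inequality turns the L1 limit into convergence in
  probability.\<close>

lemma cond_converges_in_distribution_trig:
  fixes Y L :: "nat \<Rightarrow> 'a \<Rightarrow> 'b::euclidean_space"
  assumes F: "\<And>n. n \<ge> 1 \<Longrightarrow> subalgebra M (F n)"
    and Y: "bdd_prob M Y" and L: "\<And>n. n \<ge> 1 \<Longrightarrow> L n \<in> borel_measurable M"
    and R: "tends_zero M (\<lambda>n \<omega>. Y n \<omega> - L n \<omega>)"
    and \<nu>: "prob_space \<nu>" "sets \<nu> = sets borel"
    and cos: "\<And>t s. (\<lambda>n. \<integral>\<omega>. \<bar>real_cond_exp M (F n) (\<lambda>\<omega>. cos (t \<bullet> L n \<omega> + s)) \<omega> - (\<integral>x. cos (t \<bullet> x + s) \<partial>\<nu>)\<bar> \<partial>M) \<longlonglongrightarrow> 0"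
  shows "cond_converges_in_distribution M F Y \<nu>"
  unfolding cond_converges_in_distribution_def converges_in_probability_def
proof (intro allI impI)
  fix g :: "'b \<Rightarrow> real" and e :: real
  assume g: "continuous_on UNIV g" "bounded (range g)" and e: "0 < e"
  interpret \<nu>: prob_space \<nu> by fact
  note Ym = bdd_prob_measurable[OF Y]
  have id: "(\<lambda>x. x) \<in> borel_measurable \<nu>" unfolding measurable_cong_sets[OF \<nu>(2) refl] by simp
  note \<nu>_int = \<nu>.integrable_bounded_comp[OF id]
  note Y_int = integrable_bounded_comp[OF Ym]
  define E where "E n f = real_cond_exp M (F n) (\<lambda>\<omega>. f (Y n \<omega>))" for n and f :: "'b \<Rightarrow> real"
  define \<Phi> where "\<Phi> n f = (\<integral>\<omega>. \<bar>E n f \<omega> - (\<integral>x. f x \<partial>\<nu>)\<bar> \<partial>M)" for n and f :: "'b \<Rightarrow> real"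
  have E_int: "integrable M (E n f)" if n: "n \<ge> 1" and f: "continuous_on UNIV f" "bounded (range f)" for n f
  proof -
    interpret finite_measure_subalgebra M "F n" by standard (rule F[OF n])
    show ?thesis unfolding E_def by (rule real_cond_exp_int(1)[OF Y_int[OF n f]])
  qed
  have \<Phi>_int: "integrable M (\<lambda>\<omega>. \<bar>E n f \<omega> - c\<bar>)" if n: "n \<ge> 1" and f: "continuous_on UNIV f" "bounded (range f)" for n f c
    using E_int[OF that] by simp
  have lim: "(\<lambda>n. \<Phi> n g) \<longlonglongrightarrow> 0"
  proof (rule trig_test_convergence[where \<mu>="\<lambda>n. distr M borel (Y n)" and \<nu>=\<nu>])
    show "prob_space (distr M borel (Y n))" if "n \<ge> 1" for n
      by (rule prob_space_distr[OF Ym[OF that]])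
    show "\<exists>K. eventually (\<lambda>n. measure (distr M borel (Y n)) {x. K < norm x} \<le> e) sequentially" if "0 < e" for e
      by (rule bdd_prob_tight[OF Y that])
    show "0 \<le> \<Phi> n f" for n f by (simp add: \<Phi>_def)
    show "\<Phi> n (\<lambda>x. f x + h x) \<le> \<Phi> n f + \<Phi> n h"
      if n: "n \<ge> 1" and f: "continuous_on UNIV f" "bounded (range f)" and h: "continuous_on UNIV h" "bounded (range h)" for n f h
    proof -
      interpret finite_measure_subalgebra M "F n" by standard (rule F[OF n])
      have fh: "continuous_on UNIV (\<lambda>x. f x + h x)" "bounded (range (\<lambda>x. f x + h x))"
        using f h by (auto intro!: continuous_intros bounded_plus_comp)
      have "\<Phi> n (\<lambda>x. f x + h x) \<le> (\<integral>\<omega>. \<bar>E n f \<omega> - (\<integral>x. f x \<partial>\<nu>)\<bar> + \<bar>E n h \<omega> - (\<integral>x. h x \<partial>\<nu>)\<bar> \<partial>M)"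
        unfolding \<Phi>_def
      proof (rule integral_mono_AE)
        show "AE \<omega> in M. \<bar>E n (\<lambda>x. f x + h x) \<omega> - (\<integral>x. f x + h x \<partial>\<nu>)\<bar> \<le> \<bar>E n f \<omega> - (\<integral>x. f x \<partial>\<nu>)\<bar> + \<bar>E n h \<omega> - (\<integral>x. h x \<partial>\<nu>)\<bar>"
          using real_cond_exp_add[OF Y_int[OF n f] Y_int[OF n h]]
          by eventually_elim (simp add: E_def \<nu>_int[OF f] \<nu>_int[OF h])
      qed (intro Bochner_Integration.integrable_add \<Phi>_int n f h fh)+
      also have "\<dots> = \<Phi> n f + \<Phi> n h"
        unfolding \<Phi>_def by (intro Bochner_Integration.integral_add \<Phi>_int n f h)
      finally show ?thesis .
    qed
    show "\<Phi> n (\<lambda>x. c * f x) \<le> \<bar>c\<bar> * \<Phi> n f" if n: "n \<ge> 1" and f: "continuous_on UNIV f" "bounded (range f)" for n f c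
    proof -
      interpret finite_measure_subalgebra M "F n" by standard (rule F[OF n])
      have "\<Phi> n (\<lambda>x. c * f x) = (\<integral>\<omega>. \<bar>c\<bar> * \<bar>E n f \<omega> - (\<integral>x. f x \<partial>\<nu>)\<bar> \<partial>M)"
        unfolding \<Phi>_def
      proof (rule integral_cong_AE)
        show "AE \<omega> in M. \<bar>E n (\<lambda>x. c * f x) \<omega> - (\<integral>x. c * f x \<partial>\<nu>)\<bar> = \<bar>c\<bar> * \<bar>E n f \<omega> - (\<integral>x. f x \<partial>\<nu>)\<bar>"
          using real_cond_exp_cmult[OF Y_int[OF n f], of c]
          by eventually_elim (simp add: E_def abs_mult[symmetric] right_diff_distrib)
      qed (simp_all add: E_def)
      then show ?thesis by (simp add: \<Phi>_def)
    qed
    show "\<Phi> n f \<le> (\<integral>x. \<bar>f x\<bar> \<partial>distr M borel (Y n)) + (\<integral>x. \<bar>f x\<bar> \<partial>\<nu>)"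
      if n: "n \<ge> 1" and f: "continuous_on UNIV f" "bounded (range f)" for n f
    proof -
      have eq: "(\<integral>x. \<bar>f x\<bar> \<partial>distr M borel (Y n)) = (\<integral>\<omega>. \<bar>f (Y n \<omega>)\<bar> \<partial>M)"
        by (rule integral_abs_bounded_comp[OF Ym[OF n]]) (intro continuous_intros f)
      have "\<Phi> n f \<le> (\<integral>\<omega>. \<bar>E n f \<omega>\<bar> + \<bar>\<integral>x. f x \<partial>\<nu>\<bar> \<partial>M)"
        unfolding \<Phi>_def using E_int[OF n f] by (intro integral_mono \<Phi>_int n f) auto
      also have "\<dots> = (\<integral>\<omega>. \<bar>E n f \<omega>\<bar> \<partial>M) + \<bar>\<integral>x. f x \<partial>\<nu>\<bar>"
        using E_int[OF n f] by (simp add: prob_space)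
      also have "(\<integral>\<omega>. \<bar>E n f \<omega>\<bar> \<partial>M) \<le> (\<integral>\<omega>. \<bar>f (Y n \<omega>)\<bar> \<partial>M)"
        unfolding E_def by (rule integral_real_cond_exp_abs_le[OF F[OF n] Y_int[OF n f]])
      also have "\<dots> = (\<integral>x. \<bar>f x\<bar> \<partial>distr M borel (Y n))" by (rule eq[symmetric])
      finally show ?thesis
        using integral_abs_bound[of \<nu> f] by linarith
    qed
    show "(\<lambda>n. \<Phi> n (\<lambda>x. cos (t \<bullet> x + s))) \<longlonglongrightarrow> 0" for t s
    proof (rule Lim_null_comparison)
      let ?c = "\<integral>x. cos (t \<bullet> x + s) \<partial>\<nu>"
      from tendsto_add[OF cos_difference_lim[OF Ym L R, of t s] cos[of t s]]
      show "(\<lambda>n. (\<integral>\<omega>. \<bar>cos (t \<bullet> Y n \<omega> + s) - cos (t \<bullet> L n \<omega> + s)\<bar> \<partial>M)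
          + (\<integral>\<omega>. \<bar>real_cond_exp M (F n) (\<lambda>\<omega>. cos (t \<bullet> L n \<omega> + s)) \<omega> - ?c\<bar> \<partial>M)) \<longlonglongrightarrow> 0"
        by simp
      show "eventually (\<lambda>n. norm (\<Phi> n (\<lambda>x. cos (t \<bullet> x + s))) \<le> (\<integral>\<omega>. \<bar>cos (t \<bullet> Y n \<omega> + s) - cos (t \<bullet> L n \<omega> + s)\<bar> \<partial>M)
          + (\<integral>\<omega>. \<bar>real_cond_exp M (F n) (\<lambda>\<omega>. cos (t \<bullet> L n \<omega> + s)) \<omega> - ?c\<bar> \<partial>M)) sequentially"
        using eventually_ge_1
      proof eventually_elim
        case (elim n)
        interpret finite_measure_subalgebra M "F n" by standard (rule F[OF elim])
        note yi = Y_int[OF elim trig_cos_props, of t s] and li = integrable_bounded_comp[OF L[OF elim] trig_cos_props, of t s]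
        let ?D = "\<lambda>\<omega>. cos (t \<bullet> Y n \<omega> + s) - cos (t \<bullet> L n \<omega> + s)"
        have di: "integrable M ?D" using yi li by simp
        \<comment> \<open>\<open>Y\<close> is replaced by \<open>L\<close> under the conditional
          expectation, at the price of the conditional expectation of the cosine difference.\<close>
        have "\<Phi> n (\<lambda>x. cos (t \<bullet> x + s)) \<le> (\<integral>\<omega>. \<bar>real_cond_exp M (F n) ?D \<omega>\<bar> + \<bar>real_cond_exp M (F n) (\<lambda>\<omega>. cos (t \<bullet> L n \<omega> + s)) \<omega> - ?c\<bar> \<partial>M)"
          unfolding \<Phi>_def
        proof (rule integral_mono_AE)
          show "integrable M (\<lambda>\<omega>. \<bar>E n (\<lambda>x. cos (t \<bullet> x + s)) \<omega> - ?c\<bar>)"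
            by (rule \<Phi>_int[OF elim trig_cos_props])
          show "integrable M (\<lambda>\<omega>. \<bar>real_cond_exp M (F n) ?D \<omega>\<bar> + \<bar>real_cond_exp M (F n) (\<lambda>\<omega>. cos (t \<bullet> L n \<omega> + s)) \<omega> - ?c\<bar>)"
            by (intro Bochner_Integration.integrable_add integrable_abs Bochner_Integration.integrable_diff
                real_cond_exp_int(1) di li integrable_const)
          show "AE \<omega> in M. \<bar>E n (\<lambda>x. cos (t \<bullet> x + s)) \<omega> - ?c\<bar> \<le> \<bar>real_cond_exp M (F n) ?D \<omega>\<bar> + \<bar>real_cond_exp M (F n) (\<lambda>\<omega>. cos (t \<bullet> L n \<omega> + s)) \<omega> - ?c\<bar>"
            using real_cond_exp_diff[OF yi li] by eventually_elim (simp add: E_def)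
        qed
        also have "\<dots> = (\<integral>\<omega>. \<bar>real_cond_exp M (F n) ?D \<omega>\<bar> \<partial>M) + (\<integral>\<omega>. \<bar>real_cond_exp M (F n) (\<lambda>\<omega>. cos (t \<bullet> L n \<omega> + s)) \<omega> - ?c\<bar> \<partial>M)"
          by (intro Bochner_Integration.integral_add integrable_abs Bochner_Integration.integrable_diff
                real_cond_exp_int(1) di li integrable_const)
        also have "(\<integral>\<omega>. \<bar>real_cond_exp M (F n) ?D \<omega>\<bar> \<partial>M) \<le> (\<integral>\<omega>. \<bar>?D \<omega>\<bar> \<partial>M)"
          by (rule integral_real_cond_exp_abs_le[OF F[OF elim] di])
        finally show ?case by (simp add: \<Phi>_def)
      qed
    qed
  qed (use \<nu> g in auto)
  show "(\<lambda>n. prob {\<omega> \<in> space M. \<bar>real_cond_exp M (F n) (\<lambda>\<omega>. g (Y n \<omega>)) \<omega> - (\<integral>x. g x \<partial>\<nu>)\<bar> > e}) \<longlonglongrightarrow> 0"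
  proof (rule Lim_null_comparison)
    show "(\<lambda>n. \<Phi> n g / e) \<longlonglongrightarrow> 0" using tendsto_divide[OF lim tendsto_const, of e] e by simp
    show "eventually (\<lambda>n. norm (prob {\<omega> \<in> space M. \<bar>real_cond_exp M (F n) (\<lambda>\<omega>. g (Y n \<omega>)) \<omega> - (\<integral>x. g x \<partial>\<nu>)\<bar> > e}) \<le> \<Phi> n g / e) sequentially"
      using eventually_ge_1
    proof eventually_elim
      case (elim n)
      have i: "integrable M (\<lambda>\<omega>. \<bar>E n g \<omega> - (\<integral>x. g x \<partial>\<nu>)\<bar>)" by (rule \<Phi>_int[OF elim g])
      then have m: "(\<lambda>\<omega>. \<bar>E n g \<omega> - (\<integral>x. g x \<partial>\<nu>)\<bar>) \<in> borel_measurable M" by simp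
      have "prob {\<omega> \<in> space M. \<bar>E n g \<omega> - (\<integral>x. g x \<partial>\<nu>)\<bar> > e} \<le> prob {\<omega> \<in> space M. e \<le> \<bar>E n g \<omega> - (\<integral>x. g x \<partial>\<nu>)\<bar>}"
        using m by (intro finite_measure_mono) auto
      also have "\<dots> \<le> \<Phi> n g / e"
        unfolding \<Phi>_def by (rule integral_Markov_inequality_measure[OF i sets.empty_sets _ e]) simp
      finally show ?case by (simp add: E_def)
    qed
  qed
qed

text \<open>Freezing: given \<open>S\<close>, the independent variable \<open>T\<close> is
  integrated out with \<open>S\<close> held fixed. Independence is taken as a product law, the form
  in which Fubini verifies the defining property of the conditional expectation.\<close>

lemma real_cond_exp_indep:
  assumes S: "S \<in> M \<rightarrow>\<^sub>M N" and T: "T \<in> M \<rightarrow>\<^sub>M K"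
    and joint: "distr M (N \<Otimes>\<^sub>M K) (\<lambda>\<omega>. (S \<omega>, T \<omega>)) = distr M N S \<Otimes>\<^sub>M distr M K T"
    and f: "(\<lambda>(x, u). f x u) \<in> borel_measurable (N \<Otimes>\<^sub>M K)" and b: "\<And>x u. \<bar>f x u :: real\<bar> \<le> b"
  shows "AE \<omega> in M. real_cond_exp M (vimage_algebra (space M) S N) (\<lambda>\<omega>. f (S \<omega>) (T \<omega>)) \<omega> = (\<integral>u. f (S \<omega>) u \<partial>distr M K T)"
proof -
  let ?F = "vimage_algebra (space M) S N" and ?\<kappa> = "distr M K T" and ?\<sigma> = "distr M N S"
  interpret K: prob_space ?\<kappa> by (rule prob_space_distr[OF T])
  interpret S: prob_space ?\<sigma> by (rule prob_space_distr[OF S])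
  interpret SK: pair_prob_space ?\<sigma> ?\<kappa> ..
  have ST: "(\<lambda>\<omega>. (S \<omega>, T \<omega>)) \<in> M \<rightarrow>\<^sub>M N \<Otimes>\<^sub>M K" using S T by simp
  have Ssp: "S \<in> space M \<rightarrow> space N" using measurable_space[OF S] by auto
  have sub: "subalgebra M ?F"
    unfolding subalgebra_def using S Ssp by (auto simp: sets_vimage_algebra2 intro: measurable_sets)
  interpret finite_measure_subalgebra M ?F by standard (rule sub)
  define h where "h x = (\<integral>u. f x u \<partial>?\<kappa>)" for x
  have hm: "h \<in> borel_measurable N"
  proof -
    have "(\<lambda>(x, u). f x u) \<in> borel_measurable (N \<Otimes>\<^sub>M ?\<kappa>)" using f by (simp cong: measurable_cong_sets)
    then show ?thesis unfolding h_def by (rule K.borel_measurable_lebesgue_integral)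
  qed
  have SF: "S \<in> ?F \<rightarrow>\<^sub>M N" by (rule measurable_vimage_algebra1[OF Ssp])
  have fx: "(\<lambda>u. f x u) \<in> borel_measurable ?\<kappa>" if "x \<in> space N" for x
    using measurable_compose[OF measurable_Pair1'[OF that] f] by simp
  have hb: "\<bar>h x\<bar> \<le> b" if "x \<in> space N" for x
  proof -
    have fi: "integrable ?\<kappa> (\<lambda>u. f x u)"
      by (rule K.integrable_const_bound[of _ b]) (use b fx[OF that] in auto)
    have "\<bar>h x\<bar> \<le> (\<integral>u. \<bar>f x u\<bar> \<partial>?\<kappa>)" unfolding h_def by (rule integral_abs_bound)
    also have "\<dots> \<le> (\<integral>u. b \<partial>?\<kappa>)" using fi b by (intro integral_mono) auto
    finally show ?thesis using K.prob_space by simp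
  qed
  have fm: "(\<lambda>\<omega>. f (S \<omega>) (T \<omega>)) \<in> borel_measurable M"
    using measurable_compose[OF ST f] by simp
  have "AE \<omega> in M. real_cond_exp M ?F (\<lambda>\<omega>. f (S \<omega>) (T \<omega>)) \<omega> = h (S \<omega>)"
  proof (rule real_cond_exp_charact)
    show "integrable M (\<lambda>\<omega>. f (S \<omega>) (T \<omega>))"
      by (rule integrable_const_bound[of _ b]) (use b fm in auto)
    show "integrable M (\<lambda>\<omega>. h (S \<omega>))"
      by (rule integrable_const_bound[of _ b])
         (use hb Ssp measurable_compose[OF S hm] in \<open>auto intro!: AE_I2\<close>)
    show "(\<lambda>\<omega>. h (S \<omega>)) \<in> borel_measurable ?F" by (rule measurable_compose[OF SF hm])
    fix A assume "A \<in> sets ?F"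
    then obtain B where B: "B \<in> sets N" "A = S -` B \<inter> space M"
      using Ssp by (auto simp: sets_vimage_algebra2)
    have ind: "indicator A \<omega> = (indicator B (S \<omega>) :: real)" if "\<omega> \<in> space M" for \<omega>
      using that B by (simp add: indicator_def)
    have gm: "(\<lambda>z. indicator B (fst z) * f (fst z) (snd z)) \<in> borel_measurable (N \<Otimes>\<^sub>M K)"
      using f B by (simp add: case_prod_beta')
    have gm': "(\<lambda>z. indicator B (fst z) * f (fst z) (snd z)) \<in> borel_measurable (?\<sigma> \<Otimes>\<^sub>M ?\<kappa>)"
      using gm by (simp cong: measurable_cong_sets)
    have b0: "0 \<le> b" using b order_trans[OF abs_ge_zero] by blast
    have gi: "integrable (?\<sigma> \<Otimes>\<^sub>M ?\<kappa>) (\<lambda>z. indicator B (fst z) * f (fst z) (snd z))"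
      by (rule SK.integrable_const_bound[of _ b]) (use gm' b b0 in \<open>auto simp: indicator_def intro!: AE_I2\<close>)
    have "(\<integral>\<omega>\<in>A. f (S \<omega>) (T \<omega>) \<partial>M) = (\<integral>\<omega>. indicator B (S \<omega>) * f (S \<omega>) (T \<omega>) \<partial>M)"
      unfolding set_lebesgue_integral_def by (rule Bochner_Integration.integral_cong) (simp_all add: ind)
    also have "\<dots> = (\<integral>z. indicator B (fst z) * f (fst z) (snd z) \<partial>distr M (N \<Otimes>\<^sub>M K) (\<lambda>\<omega>. (S \<omega>, T \<omega>)))"
      using integral_distr[OF ST gm] by simp
    also have "\<dots> = (\<integral>x. \<integral>u. indicator B x * f x u \<partial>?\<kappa> \<partial>?\<sigma>)"
      unfolding joint using SK.integral_fst'[OF gi] by simp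
    also have "\<dots> = (\<integral>x. indicator B x * h x \<partial>?\<sigma>)" by (simp add: h_def)
    also have "\<dots> = (\<integral>\<omega>. indicator B (S \<omega>) * h (S \<omega>) \<partial>M)"
      by (rule integral_distr[OF S]) (use hm B in simp)
    also have "\<dots> = (\<integral>\<omega>\<in>A. h (S \<omega>) \<partial>M)"
      unfolding set_lebesgue_integral_def by (rule Bochner_Integration.integral_cong) (simp_all add: ind)
    finally show "(\<integral>\<omega>\<in>A. f (S \<omega>) (T \<omega>) \<partial>M) = (\<integral>\<omega>\<in>A. h (S \<omega>) \<partial>M)" .
  qed
  then show ?thesis by (simp add: h_def)
qed

end

section \<open>Conditional characteristic function of the weighted sums\<close>

lemma (in pair_prob_space) integral_mult_fst_snd:
  fixes f :: "'a \<Rightarrow> 'z :: {real_normed_field, banach, second_countable_topology}" and g :: "'b \<Rightarrow> 'z"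
  assumes f: "integrable M1 f" and g: "integrable M2 g"
  shows "integrable (M1 \<Otimes>\<^sub>M M2) (\<lambda>z. f (fst z) * g (snd z))"
    and "(\<integral>z. f (fst z) * g (snd z) \<partial>(M1 \<Otimes>\<^sub>M M2)) = (\<integral>x. f x \<partial>M1) * (\<integral>y. g y \<partial>M2)"
proof -
  have [measurable]: "f \<in> borel_measurable M1" "g \<in> borel_measurable M2" using f g by auto
  show int: "integrable (M1 \<Otimes>\<^sub>M M2) (\<lambda>z. f (fst z) * g (snd z))"
  proof (rule Fubini_integrable)
    show "integrable M1 (\<lambda>x. \<integral>y. norm (f (fst (x, y)) * g (snd (x, y))) \<partial>M2)"
      using f by (simp add: norm_mult)
    show "AE x in M1. integrable M2 (\<lambda>y. f (fst (x, y)) * g (snd (x, y)))"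
      using g by simp
  qed measurable
  show "(\<integral>z. f (fst z) * g (snd z) \<partial>(M1 \<Otimes>\<^sub>M M2)) = (\<integral>x. f x \<partial>M1) * (\<integral>y. g y \<partial>M2)"
    by (subst integral_fst'[OF int, symmetric]) simp
qed

lemma char_product_L2E:
  assumes "real_distribution \<mu>" "real_distribution \<rho>"
    and "integrable \<mu> (\<lambda>x. x\<^sup>2)" "(\<integral>x. x\<^sup>2 \<partial>\<mu>) = r"
    and "integrable \<rho> (\<lambda>x. x\<^sup>2)" "(\<integral>x. x \<partial>\<rho>) = 0" "(\<integral>x. x\<^sup>2 \<partial>\<rho>) = 1"
    and M: "prob_space (M :: 'w measure)"
  obtains Q where "Q \<longlonglongrightarrow> 0"
    "\<And>(I :: 'i set) \<xi>. finite I \<Longrightarrow> I \<noteq> {} \<Longrightarrow> prob_space.indep_vars M (\<lambda>_. borel) \<xi> I \<Longrightarrow>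
      (\<forall>i\<in>I. distr M borel (\<xi> i) = \<mu>) \<Longrightarrow>
      (\<integral>\<omega>. (cmod ((\<Prod>i\<in>I. char \<rho> (\<xi> i \<omega> / sqrt (real (card I)))) - of_real (exp (- r / 2))))\<^sup>2 \<partial>M) = Q (card I)"
proof -
  obtain Q where Q: "Q \<longlonglongrightarrow> 0" and QI: "\<forall>(M :: 'w measure) (I :: 'i set) \<xi>. prob_space M \<longrightarrow> finite I \<longrightarrow> I \<noteq> {} \<longrightarrow>
    prob_space.indep_vars M (\<lambda>_. borel) \<xi> I \<longrightarrow> (\<forall>i\<in>I. distr M borel (\<xi> i) = \<mu>) \<longrightarrow>
    (\<integral>\<omega>. (cmod ((\<Prod>i\<in>I. char \<rho> (\<xi> i \<omega> / sqrt (real (card I)))) - of_real (exp (- r / 2))))\<^sup>2 \<partial>M) = Q (card I)"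
    using char_product_L2[OF assms(1-7)] by (elim exE conjE)
  show thesis
    by (rule that[OF Q], rule QI[rule_format, OF M], assumption+, blast)
qed

context prob_space
begin

lemma char_iid_sum:
  assumes I: "finite I" "I \<noteq> {}" and ind: "indep_vars (\<lambda>_. borel) \<zeta> I"
    and law: "\<And>i. i \<in> I \<Longrightarrow> distr M borel (\<zeta> i) = \<mu>"
  shows "(\<integral>\<omega>. iexp (t * (\<Sum>i\<in>I. \<zeta> i \<omega>)) \<partial>M) = char \<mu> t ^ card I"
proof -
  have \<zeta> [measurable]: "\<zeta> i \<in> borel_measurable M" if "i \<in> I" for i
    using ind that by (auto simp: indep_vars_def2)
  have "(\<integral>\<omega>. iexp (t * (\<Sum>i\<in>I. \<zeta> i \<omega>)) \<partial>M) = char (distr M borel (\<lambda>\<omega>. \<Sum>i\<in>I. \<zeta> i \<omega>)) t"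
    unfolding char_def by (subst integral_distr) simp_all
  also have "\<dots> = (\<Prod>i\<in>I. char (distr M borel (\<zeta> i)) t)" by (rule char_distr_sum[OF ind])
  also have "\<dots> = char \<mu> t ^ card I" by (simp add: law)
  finally show ?thesis .
qed

text \<open>This quantity is the numerator of the bound in \<open>dirichlet_char_approx\<close>,
  averaged over centred i.i.d. data. Each of its two terms contributes
  \<open>card I * r\<close>.\<close>

lemma iid_second_moments:
  assumes I: "finite I" "I \<noteq> {}" and ind: "indep_vars (\<lambda>_. borel) \<zeta> I"
    and law: "\<And>i. i \<in> I \<Longrightarrow> distr M borel (\<zeta> i) = \<mu>"
    and \<mu>: "integrable \<mu> (\<lambda>x. x\<^sup>2)" "(\<integral>x. x \<partial>\<mu>) = 0" "(\<integral>x. x\<^sup>2 \<partial>\<mu>) = r"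
  shows "integrable M (\<lambda>\<omega>. (\<Sum>i\<in>I. (\<zeta> i \<omega>)\<^sup>2) + (\<Sum>i\<in>I. \<zeta> i \<omega>)\<^sup>2)"
    and "(\<integral>\<omega>. (\<Sum>i\<in>I. (\<zeta> i \<omega>)\<^sup>2) + (\<Sum>i\<in>I. \<zeta> i \<omega>)\<^sup>2 \<partial>M) = 2 * real (card I) * r"
proof -
  have \<zeta> [measurable]: "\<zeta> i \<in> borel_measurable M" if "i \<in> I" for i
    using ind that by (auto simp: indep_vars_def2)
  obtain i0 where i0: "i0 \<in> I" using I by auto
  have \<mu>_prob: "prob_space \<mu>" unfolding law[OF i0, symmetric] by (rule prob_space_distr[OF \<zeta>[OF i0]])
  have \<mu>_sets: "sets \<mu> = sets borel" unfolding law[OF i0, symmetric] by simp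
  have sq: "integrable M (\<lambda>\<omega>. (\<zeta> i \<omega>)\<^sup>2)" "(\<integral>\<omega>. (\<zeta> i \<omega>)\<^sup>2 \<partial>M) = r" if "i \<in> I" for i
    using \<mu>(1,3) unfolding law[OF that, symmetric] using \<zeta>[OF that]
    by (simp_all add: integrable_distr_eq integral_distr)
  have vec: "(\<lambda>\<omega>. \<lambda>i\<in>I. \<zeta> i \<omega>) \<in> M \<rightarrow>\<^sub>M PiM I (\<lambda>_. borel)" by (rule measurable_restrict) (rule \<zeta>)
  have joint: "distr M (PiM I (\<lambda>_. borel)) (\<lambda>\<omega>. \<lambda>i\<in>I. \<zeta> i \<omega>) = PiM I (\<lambda>_. \<mu>)"
  proof -
    have "distr M (PiM I (\<lambda>_. borel)) (\<lambda>\<omega>. \<lambda>i\<in>I. \<zeta> i \<omega>) = PiM I (\<lambda>i. distr M borel (\<zeta> i))"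
      using indep_vars_iff_distr_eq_PiM'[OF I(2), of \<zeta> "\<lambda>_. borel"] ind \<zeta> by simp
    also have "\<dots> = PiM I (\<lambda>_. \<mu>)" by (rule PiM_cong) (simp_all add: law)
    finally show ?thesis .
  qed
  have idm: "(\<lambda>x::real. x) \<in> borel_measurable \<mu>" unfolding measurable_cong_sets[OF \<mu>_sets refl] by simp
  note S = integral_PiM_sum_square[OF \<mu>_prob I(1) idm \<mu>(1,2), of "\<lambda>_. 1", unfolded joint[symmetric] \<mu>(3)]
  have sum_sq: "integrable M (\<lambda>\<omega>. (\<Sum>i\<in>I. \<zeta> i \<omega>)\<^sup>2)" "(\<integral>\<omega>. (\<Sum>i\<in>I. \<zeta> i \<omega>)\<^sup>2 \<partial>M) = real (card I) * r"
  proof -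
    have m: "(\<lambda>x :: _ \<Rightarrow> real. (\<Sum>i\<in>I. 1 * x i)\<^sup>2) \<in> borel_measurable (PiM I (\<lambda>_. borel))" by measurable
    show "integrable M (\<lambda>\<omega>. (\<Sum>i\<in>I. \<zeta> i \<omega>)\<^sup>2)"
      using S(1) unfolding integrable_distr_eq[OF vec m] by (simp cong: sum.cong)
    show "(\<integral>\<omega>. (\<Sum>i\<in>I. \<zeta> i \<omega>)\<^sup>2 \<partial>M) = real (card I) * r"
      using S(2) unfolding integral_distr[OF vec m] by (simp cong: sum.cong)
  qed
  show "integrable M (\<lambda>\<omega>. (\<Sum>i\<in>I. (\<zeta> i \<omega>)\<^sup>2) + (\<Sum>i\<in>I. \<zeta> i \<omega>)\<^sup>2)"
    by (intro Bochner_Integration.integrable_add Bochner_Integration.integrable_sum sq(1) sum_sq(1))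
  show "(\<integral>\<omega>. (\<Sum>i\<in>I. (\<zeta> i \<omega>)\<^sup>2) + (\<Sum>i\<in>I. \<zeta> i \<omega>)\<^sup>2 \<partial>M) = 2 * real (card I) * r"
    using sum_sq by (subst Bochner_Integration.integral_add)
      (auto intro!: Bochner_Integration.integrable_sum sq(1) simp: Bochner_Integration.integral_sum sq)
qed

end

text \<open>The characteristic function at \<open>b\<close> of the centred Dirichlet vector
  multiplied by \<open>n\<close>. That factor brings each weight to the scale of a standard
  exponential.\<close>

definition dirichlet_cf :: "nat \<Rightarrow> (nat \<Rightarrow> real) \<Rightarrow> complex" where
  "dirichlet_cf n b = (\<integral>w. iexp (real n * (\<Sum>i\<in>{1..n}. (w i - 1 / real n) * b i)) \<partial>dirichlet n (\<lambda>_. 1))"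

lemma dirichlet_cf_le_1: "n \<ge> 1 \<Longrightarrow> cmod (dirichlet_cf n b) \<le> 1"
proof -
  assume n: "n \<ge> 1"
  interpret D: prob_space "dirichlet n (\<lambda>_. 1)" by (rule prob_space_dirichlet[OF n])
  have "cmod (dirichlet_cf n b) \<le> (\<integral>w. cmod (iexp (real n * (\<Sum>i\<in>{1..n}. (w i - 1 / real n) * b i))) \<partial>dirichlet n (\<lambda>_. 1))"
    unfolding dirichlet_cf_def by (rule integral_norm_bound)
  also have "\<dots> = 1" by (simp only: norm_exp_i_times) (simp add: D.prob_space)
  finally show ?thesis .
qed

context prob_space
begin

lemma dirichlet_cf_measurable:
  assumes n: "n \<ge> 1" and b: "\<And>i. i \<in> {1..n} \<Longrightarrow> b i \<in> borel_measurable M"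
  shows "(\<lambda>\<omega>. dirichlet_cf n (\<lambda>i. b i \<omega>)) \<in> borel_measurable M"
proof -
  interpret D: prob_space "dirichlet n (\<lambda>_. 1)" by (rule prob_space_dirichlet[OF n])
  have w: "(\<lambda>w. w i) \<in> borel_measurable (dirichlet n (\<lambda>_. 1))" if "i \<in> {1..n}" for i
    using measurable_component_singleton[OF that, of "\<lambda>_. borel"] by (simp cong: measurable_cong_sets)
  have "(\<lambda>z. \<Sum>i\<in>{1..n}. (snd z i - 1 / real n) * b i (fst z)) \<in> borel_measurable (M \<Otimes>\<^sub>M dirichlet n (\<lambda>_. 1))"
    by (intro borel_measurable_sum borel_measurable_times borel_measurable_diff borel_measurable_const
        measurable_compose[OF measurable_fst b] measurable_compose[OF measurable_snd w])
  then have "(\<lambda>(\<omega>, w). iexp (real n * (\<Sum>i\<in>{1..n}. (w i - 1 / real n) * b i \<omega>))) \<in> borel_measurable (M \<Otimes>\<^sub>M dirichlet n (\<lambda>_. 1))"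
    unfolding case_prod_beta' by measurable
  then show ?thesis unfolding dirichlet_cf_def by (rule D.borel_measurable_lebesgue_integral)
qed

text \<open>The pointwise bound of \<open>dirichlet_char_approx\<close> has mean square
  \<open>2 * r / c\<^sup>2\<close> over the data. The scale \<open>c\<close> will be
  \<open>sqrt n\<close> or \<open>sqrt (2 n)\<close>, so the error disappears.\<close>

lemma dirichlet_cf_approx:
  assumes n: "n \<ge> 1" and ind: "indep_vars (\<lambda>_. borel) \<zeta> {1..n}"
    and law: "\<And>i. i \<in> {1..n} \<Longrightarrow> distr M borel (\<zeta> i) = \<mu>"
    and \<mu>: "integrable \<mu> (\<lambda>x. x\<^sup>2)" "(\<integral>x. x \<partial>\<mu>) = 0" "(\<integral>x. x\<^sup>2 \<partial>\<mu>) = r"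
    and c: "0 < c"
  shows "integrable M (\<lambda>\<omega>. cmod (dirichlet_cf n (\<lambda>i. \<zeta> i \<omega> / c) - (\<Prod>i\<in>{1..n}. char centered_exp (\<zeta> i \<omega> / c))))"
    and "(\<integral>\<omega>. cmod (dirichlet_cf n (\<lambda>i. \<zeta> i \<omega> / c) - (\<Prod>i\<in>{1..n}. char centered_exp (\<zeta> i \<omega> / c))) \<partial>M) \<le> sqrt (2 * r) / c"
proof -
  interpret E: real_distribution centered_exp by (rule centered_exp)
  have \<zeta>: "\<zeta> i \<in> borel_measurable M" if "i \<in> {1..n}" for i
    using ind that by (auto simp: indep_vars_def2)
  have I: "finite {1..n}" "{1..n} \<noteq> {}" using n by auto
  note mom = iid_second_moments[OF I ind law \<mu>]
  let ?S = "\<lambda>\<omega>. (\<Sum>i\<in>{1..n}. (\<zeta> i \<omega>)\<^sup>2) + (\<Sum>i\<in>{1..n}. \<zeta> i \<omega>)\<^sup>2"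
  let ?f = "\<lambda>\<omega>. cmod (dirichlet_cf n (\<lambda>i. \<zeta> i \<omega> / c) - (\<Prod>i\<in>{1..n}. char centered_exp (\<zeta> i \<omega> / c)))"
  let ?g = "\<lambda>\<omega>. sqrt (?S \<omega> / (c\<^sup>2 * real n))"
  have S0: "0 \<le> ?S \<omega>" for \<omega> by (simp add: sum_nonneg)
  have fg: "?f \<omega> \<le> ?g \<omega>" for \<omega>
  proof -
    have "?f \<omega> \<le> sqrt (((\<Sum>i\<in>{1..n}. (\<zeta> i \<omega> / c)\<^sup>2) + (\<Sum>i\<in>{1..n}. \<zeta> i \<omega> / c)\<^sup>2) / real n)"
      unfolding dirichlet_cf_def by (rule dirichlet_char_approx[OF n])
    also have "((\<Sum>i\<in>{1..n}. (\<zeta> i \<omega> / c)\<^sup>2) + (\<Sum>i\<in>{1..n}. \<zeta> i \<omega> / c)\<^sup>2) / real n = ?S \<omega> / (c\<^sup>2 * real n)"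
      by (simp add: power_divide sum_divide_distrib[symmetric] add_divide_distrib[symmetric])
    finally show ?thesis .
  qed
  have Sm: "?S \<in> borel_measurable M"
    by (intro borel_measurable_add borel_measurable_sum borel_measurable_power \<zeta>)
  then have gm: "?g \<in> borel_measurable M" by measurable
  have fm: "?f \<in> borel_measurable M"
  proof (rule measurable_compose[OF _ borel_measurable_norm], rule borel_measurable_diff)
    show "(\<lambda>\<omega>. dirichlet_cf n (\<lambda>i. \<zeta> i \<omega> / c)) \<in> borel_measurable M"
      by (rule dirichlet_cf_measurable[OF n]) (use \<zeta> in measurable)
    show "(\<lambda>\<omega>. \<Prod>i\<in>{1..n}. char centered_exp (\<zeta> i \<omega> / c)) \<in> borel_measurable M"
      by (intro borel_measurable_prod measurable_compose[OF _ E.char_measurable] borel_measurable_divide \<zeta> borel_measurable_const)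
  qed
  have g2: "(?g \<omega>)\<^sup>2 = ?S \<omega> / (c\<^sup>2 * real n)" for \<omega> using S0 by simp
  have g2_int: "integrable M (\<lambda>\<omega>. (?g \<omega>)\<^sup>2)" unfolding g2 using mom(1) by (rule integrable_divide)
  have g_int: "integrable M ?g" by (rule square_integrable_imp_integrable[OF gm g2_int])
  show f_int: "integrable M ?f"
    by (rule Bochner_Integration.integrable_bound[OF g_int fm]) (use fg S0 in \<open>auto intro!: AE_I2\<close>)
  have "(\<integral>\<omega>. ?f \<omega> \<partial>M) \<le> (\<integral>\<omega>. \<bar>?g \<omega>\<bar> \<partial>M)"
  proof (rule integral_mono[OF f_int])
    show "integrable M (\<lambda>\<omega>. \<bar>?g \<omega>\<bar>)" by (rule integrable_abs[OF g_int])
    show "?f \<omega> \<le> \<bar>?g \<omega>\<bar>" for \<omega> by (rule order_trans[OF fg abs_ge_self])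
  qed
  also have "\<dots> \<le> sqrt (\<integral>\<omega>. (?g \<omega>)\<^sup>2 \<partial>M)" by (rule integral_abs_le_sqrt[OF gm g2_int])
  also have "(\<integral>\<omega>. (?g \<omega>)\<^sup>2 \<partial>M) = 2 * r / c\<^sup>2"
    unfolding g2 using mom(2) n by simp
  also have "sqrt \<dots> = sqrt (2 * r) / c" using c by (simp add: real_sqrt_divide)
  finally show "(\<integral>\<omega>. ?f \<omega> \<partial>M) \<le> sqrt (2 * r) / c" .
qed

lemma char_product_L1:
  assumes Q: "(\<integral>\<omega>. (cmod ((\<Prod>i\<in>I. char centered_exp (\<zeta> i \<omega> / c)) - z))\<^sup>2 \<partial>M) = q"
    and I: "finite I" and \<zeta>: "\<And>i. i \<in> I \<Longrightarrow> \<zeta> i \<in> borel_measurable M"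
  shows "integrable M (\<lambda>\<omega>. cmod ((\<Prod>i\<in>I. char centered_exp (\<zeta> i \<omega> / c)) - z))"
    and "(\<integral>\<omega>. cmod ((\<Prod>i\<in>I. char centered_exp (\<zeta> i \<omega> / c)) - z) \<partial>M) \<le> sqrt q"
proof -
  interpret E: real_distribution centered_exp by (rule centered_exp)
  let ?f = "\<lambda>\<omega>. cmod ((\<Prod>i\<in>I. char centered_exp (\<zeta> i \<omega> / c)) - z)"
  have m: "?f \<in> borel_measurable M"
    by (rule measurable_compose[OF _ borel_measurable_norm], intro borel_measurable_diff borel_measurable_prod measurable_compose[OF _ E.char_measurable]
        borel_measurable_divide \<zeta> borel_measurable_const)
  have le: "?f \<omega> \<le> 1 + cmod z" for \<omega>
  proof -
    have "cmod (\<Prod>i\<in>I. char centered_exp (\<zeta> i \<omega> / c)) \<le> 1"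
      unfolding prod_norm[symmetric] by (intro prod_le_1) (simp add: E.cmod_char_le_1)
    then show ?thesis using norm_triangle_ineq4[of "\<Prod>i\<in>I. char centered_exp (\<zeta> i \<omega> / c)" z] by linarith
  qed
  show "integrable M ?f" by (rule integrable_const_bound[OF _ m, of "1 + cmod z"]) (use le in auto)
  have "integrable M (\<lambda>\<omega>. (?f \<omega>)\<^sup>2)"
  proof (rule integrable_const_bound[where B="(1 + cmod z)\<^sup>2"])
    show "AE \<omega> in M. norm ((?f \<omega>)\<^sup>2) \<le> (1 + cmod z)\<^sup>2"
      using power_mono[OF le norm_ge_zero, of _ 2] by (intro AE_I2) simp
  qed (rule borel_measurable_power[OF m])
  from integral_abs_le_sqrt[OF m this] show "(\<integral>\<omega>. ?f \<omega> \<partial>M) \<le> sqrt q" by (simp add: Q)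
qed

end

section \<open>The two couplings of the weights\<close>

text \<open>The data together with the weights of both halves. Independence between the weights and
  the data is supplied separately, at the point where the data are conditioned on.\<close>

locale bootstrap_sample = prob_space M for M :: "'w measure" +
  fixes P :: "'o measure" and X :: "nat \<Rightarrow> 'w \<Rightarrow> 'o" and W V :: "nat \<Rightarrow> 'w \<Rightarrow> nat \<Rightarrow> real"
  assumes X_indep: "indep_vars (\<lambda>_. P) X {1..}"
    and X_distr: "\<And>i. i \<ge> 1 \<Longrightarrow> distr M P (X i) = P"
    and W_meas: "\<And>n. n \<ge> 1 \<Longrightarrow> W n \<in> measurable M (PiM {1..n} (\<lambda>_. borel))"
    and V_meas: "\<And>n. n \<ge> 1 \<Longrightarrow> V n \<in> measurable M (PiM {1..n} (\<lambda>_. borel))"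
    and W_distr: "\<And>n. n \<ge> 1 \<Longrightarrow> distr M (PiM {1..n} (\<lambda>_. borel)) (W n) = dirichlet n (\<lambda>_. 1)"
    and V_distr: "\<And>n. n \<ge> 1 \<Longrightarrow> distr M (PiM {1..n} (\<lambda>_. borel)) (V n) = dirichlet n (\<lambda>_. 1)"
    and WV: "(\<forall>n\<ge>1. indep_var (PiM {1..n} (\<lambda>_. borel)) (W n) (PiM {1..n} (\<lambda>_. borel)) (V n)) \<or>
             (\<forall>n\<ge>1. AE \<omega> in M. \<forall>j\<in>{1..n}. V n \<omega> j = W n \<omega> j)"
begin

lemma X_meas: "i \<ge> 1 \<Longrightarrow> X i \<in> M \<rightarrow>\<^sub>M P"
  using X_indep by (auto simp: indep_vars_def2)

definition WV_law :: "nat \<Rightarrow> ((nat \<Rightarrow> real) \<times> (nat \<Rightarrow> real)) measure" where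
  "WV_law n = distr M (PiM {1..n} (\<lambda>_. borel) \<Otimes>\<^sub>M PiM {1..n} (\<lambda>_. borel)) (\<lambda>\<omega>. (W n \<omega>, V n \<omega>))"

text \<open>At normalised scores of the data, \<open>b\<close> from the first half and
  \<open>b'\<close> from the second, this is the conditional characteristic function of the
  bootstrap sum given the data.\<close>

definition weights_cf :: "nat \<Rightarrow> (nat \<Rightarrow> real) \<Rightarrow> (nat \<Rightarrow> real) \<Rightarrow> complex" where
  "weights_cf n b b' = (\<integral>u. iexp (real n * ((\<Sum>i\<in>{1..n}. (fst u i - 1 / real n) * b i) + (\<Sum>i\<in>{1..n}. (snd u i - 1 / real n) * b' i))) \<partial>WV_law n)"

lemma WV_meas: "n \<ge> 1 \<Longrightarrow> (\<lambda>\<omega>. (W n \<omega>, V n \<omega>)) \<in> M \<rightarrow>\<^sub>M PiM {1..n} (\<lambda>_. borel) \<Otimes>\<^sub>M PiM {1..n} (\<lambda>_. borel)"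
  using W_meas V_meas by simp

lemma lin_meas: "(\<lambda>w. real n * (\<Sum>i\<in>{1..n}. (w i - 1 / real n) * b i)) \<in> borel_measurable (PiM {1..n} (\<lambda>_. borel))"
  by (intro borel_measurable_sum borel_measurable_times borel_measurable_diff borel_measurable_const measurable_component_singleton)

lemma weights_cf_indep:
  assumes n: "n \<ge> 1" and ind: "indep_var (PiM {1..n} (\<lambda>_. borel)) (W n) (PiM {1..n} (\<lambda>_. borel)) (V n)"
  shows "weights_cf n b b' = dirichlet_cf n b * dirichlet_cf n b'"
proof -
  let ?D = "dirichlet n (\<lambda>_. 1)"
  interpret D: prob_space ?D by (rule prob_space_dirichlet[OF n])
  interpret DD: pair_prob_space ?D ?D ..
  have law: "WV_law n = ?D \<Otimes>\<^sub>M ?D"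
    using ind unfolding indep_var_distribution_eq WV_law_def W_distr[OF n] V_distr[OF n] by simp
  have i: "integrable ?D (\<lambda>w. iexp (real n * (\<Sum>i\<in>{1..n}. (w i - 1 / real n) * b i)))" for b
  proof -
    have "(\<lambda>w. real n * (\<Sum>i\<in>{1..n}. (w i - 1 / real n) * b i)) \<in> borel_measurable ?D"
      using lin_meas[of n b] by (simp cong: measurable_cong_sets)
    from measurable_compose[OF this borel_measurable_of_real] show ?thesis by (rule D.integrable_iexp) simp
  qed
  show ?thesis
    unfolding weights_cf_def dirichlet_cf_def law DD.integral_mult_fst_snd(2)[OF i i, symmetric]
    by (simp add: distrib_left exp_add)
qed

text \<open>A shared weight multiplies the sum of its two coefficients, so a single Dirichlet vector
  remains.\<close>

lemma weights_cf_identical: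
  assumes n: "n \<ge> 1" and eq: "AE \<omega> in M. \<forall>j\<in>{1..n}. V n \<omega> j = W n \<omega> j"
  shows "weights_cf n b b' = dirichlet_cf n (\<lambda>i. b i + b' i)"
proof -
  let ?B = "PiM {1..n} (\<lambda>_. borel :: real measure)"
  have lin2: "(\<lambda>u. iexp (real n * ((\<Sum>i\<in>{1..n}. (fst u i - 1 / real n) * b i) + (\<Sum>i\<in>{1..n}. (snd u i - 1 / real n) * b' i)))) \<in> borel_measurable (?B \<Otimes>\<^sub>M ?B)"
    using measurable_compose[OF measurable_fst lin_meas[of n b]] measurable_compose[OF measurable_snd lin_meas[of n b']]
    unfolding distrib_left by measurable
  have lin1: "(\<lambda>w. iexp (real n * (\<Sum>i\<in>{1..n}. (w i - 1 / real n) * (b i + b' i)))) \<in> borel_measurable ?B"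
    using lin_meas[of n "\<lambda>i. b i + b' i"] by measurable
  have "weights_cf n b b' = (\<integral>\<omega>. iexp (real n * ((\<Sum>i\<in>{1..n}. (W n \<omega> i - 1 / real n) * b i) + (\<Sum>i\<in>{1..n}. (V n \<omega> i - 1 / real n) * b' i))) \<partial>M)"
    unfolding weights_cf_def WV_law_def using integral_distr[OF WV_meas[OF n] lin2] by simp
  also have "\<dots> = (\<integral>\<omega>. iexp (real n * (\<Sum>i\<in>{1..n}. (W n \<omega> i - 1 / real n) * (b i + b' i))) \<partial>M)"
  proof (rule integral_cong_AE)
    show "(\<lambda>\<omega>. iexp (real n * ((\<Sum>i\<in>{1..n}. (W n \<omega> i - 1 / real n) * b i) + (\<Sum>i\<in>{1..n}. (V n \<omega> i - 1 / real n) * b' i)))) \<in> borel_measurable M"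
      using measurable_compose[OF WV_meas[OF n] lin2] by simp
    show "(\<lambda>\<omega>. iexp (real n * (\<Sum>i\<in>{1..n}. (W n \<omega> i - 1 / real n) * (b i + b' i)))) \<in> borel_measurable M"
      using measurable_compose[OF W_meas[OF n] lin1] by simp
    show "AE \<omega> in M. iexp (real n * ((\<Sum>i\<in>{1..n}. (W n \<omega> i - 1 / real n) * b i) + (\<Sum>i\<in>{1..n}. (V n \<omega> i - 1 / real n) * b' i)))
      = iexp (real n * (\<Sum>i\<in>{1..n}. (W n \<omega> i - 1 / real n) * (b i + b' i)))"
      using eq
    proof eventually_elim
      case (elim \<omega>)
      have "(\<Sum>i\<in>{1..n}. (W n \<omega> i - 1 / real n) * b i) + (\<Sum>i\<in>{1..n}. (V n \<omega> i - 1 / real n) * b' i)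
         = (\<Sum>i\<in>{1..n}. (W n \<omega> i - 1 / real n) * (b i + b' i))"
        unfolding sum.distrib[symmetric] by (rule sum.cong) (use elim in \<open>simp_all add: distrib_left\<close>)
      then show ?case by simp
    qed
  qed
  also have "\<dots> = dirichlet_cf n (\<lambda>i. b i + b' i)"
    unfolding dirichlet_cf_def W_distr[OF n, symmetric] using integral_distr[OF W_meas[OF n] lin1] by simp
  finally show ?thesis .
qed

text \<open>With independent weights the joint function is a product over the halves, compared with
  \<open>2 n\<close> exponentials at scale \<open>sqrt (2 n)\<close>. With identical weights the
  observations \<open>i\<close> and \<open>n + i\<close> share a weight and are merged into one
  variable of variance \<open>r\<close> at scale \<open>sqrt n\<close>. Both arrays lead to
  \<open>exp (- r / 2)\<close>.\<close>

lemma bootstrap_cf_lim: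
  fixes \<beta> :: "'o \<Rightarrow> real"
  assumes \<beta>: "\<beta> \<in> borel_measurable P" and mean: "(\<integral>x. \<beta> x \<partial>P) = 0"
    and sq: "integrable P (\<lambda>x. (\<beta> x)\<^sup>2)" and r: "(\<integral>x. (\<beta> x)\<^sup>2 \<partial>P) = r"
  shows "(\<lambda>n. \<integral>\<omega>. cmod (weights_cf n (\<lambda>i. \<beta> (X i \<omega>) / sqrt (real (2*n))) (\<lambda>i. \<beta> (X (n + i) \<omega>) / sqrt (real (2*n)))
      - of_real (exp (- r / 2))) \<partial>M) \<longlonglongrightarrow> 0"
proof -
  have P: "prob_space P"
    using prob_space_distr[OF X_meas[OF order_refl]] unfolding X_distr[OF order_refl] .
  interpret P: prob_space P by (rule P)
  interpret E: real_distribution centered_exp by (rule centered_exp)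
  define \<mu> where "\<mu> = distr P borel \<beta>"
  have \<mu>: "real_distribution \<mu>" "integrable \<mu> (\<lambda>x. x\<^sup>2)" "(\<integral>x. x \<partial>\<mu>) = 0" "(\<integral>x. x\<^sup>2 \<partial>\<mu>) = r"
    unfolding \<mu>_def using P.real_distribution_distr[OF \<beta>] \<beta> sq mean r
    by (simp_all add: integrable_distr_eq integral_distr)
  interpret \<mu>: real_distribution \<mu> by (rule \<mu>)
  interpret \<mu>\<mu>: pair_prob_space \<mu> \<mu> ..
  have law: "distr M borel (\<lambda>\<omega>. \<beta> (X i \<omega>)) = \<mu>" if "i \<ge> 1" for i
    using distr_distr[OF \<beta> X_meas[OF that]] by (simp add: \<mu>_def X_distr[OF that] comp_def)
  have ind: "indep_vars (\<lambda>_. borel) (\<lambda>i \<omega>. \<beta> (X i \<omega>)) {1..}"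
    by (rule indep_vars_compose2[OF X_indep \<beta>])
  have \<beta>X: "(\<lambda>\<omega>. \<beta> (X i \<omega>)) \<in> borel_measurable M" if "i \<ge> 1" for i
    by (rule measurable_compose[OF X_meas[OF that] \<beta>])
  let ?e = "of_real (exp (- r / 2)) :: complex"
  let ?G = "\<lambda>n \<omega>. weights_cf n (\<lambda>i. \<beta> (X i \<omega>) / sqrt (real (2*n))) (\<lambda>i. \<beta> (X (n + i) \<omega>) / sqrt (real (2*n)))"
  \<comment> \<open>\<open>d\<close> is 2 for independent and 1 for identical weights;
    \<open>k\<close> counts the Dirichlet approximations made.\<close>
  have sqrt_lim: "(\<lambda>n. k * (sqrt (2 * r) / sqrt (real (d * n)))) \<longlonglongrightarrow> 0" if "d \<ge> 1" for k :: real and d :: nat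
  proof -
    have "filterlim (\<lambda>n. real (d * n)) at_top sequentially"
      using filterlim_compose[OF filterlim_real_sequentially mult_nat_left_at_top[of d]] that by simp
    then have "(\<lambda>n. sqrt (2 * r) / sqrt (real (d * n))) \<longlonglongrightarrow> 0"
      by (intro tendsto_divide_0[OF tendsto_const] filterlim_at_top_imp_at_infinity filterlim_compose[OF sqrt_at_top])
    from tendsto_mult_left[OF this, of k] show ?thesis by simp
  qed
  from WV show ?thesis
  proof
    assume W: "\<forall>n\<ge>1. indep_var (PiM {1..n} (\<lambda>_. borel)) (W n) (PiM {1..n} (\<lambda>_. borel)) (V n)"
    obtain Q where Q: "Q \<longlonglongrightarrow> 0" and QI: "\<And>(I :: nat set) (\<xi> :: nat \<Rightarrow> 'w \<Rightarrow> real). finite I \<Longrightarrow> I \<noteq> {} \<Longrightarrow> indep_vars (\<lambda>_. borel) \<xi> I \<Longrightarrow>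
      (\<forall>i\<in>I. distr M borel (\<xi> i) = \<mu>) \<Longrightarrow>
      (\<integral>\<omega>. (cmod ((\<Prod>i\<in>I. char centered_exp (\<xi> i \<omega> / sqrt (real (card I)))) - ?e))\<^sup>2 \<partial>M) = Q (card I)"
      by (rule char_product_L2E[OF \<mu>(1) centered_exp(1) \<mu>(2,4) centered_exp(2,3,4) prob_space_axioms]) (rule that, assumption+)
    have bound: "(\<integral>\<omega>. cmod (?G n \<omega> - ?e) \<partial>M) \<le> 2 * (sqrt (2 * r) / sqrt (real (2 * n))) + sqrt (Q (2 * n))"
      if n: "n \<ge> 1" for n
    proof -
      let ?c = "sqrt (real (2 * n))"
      have c: "0 < ?c" using n by simp
      let ?P = "\<lambda>\<omega> I. \<Prod>i\<in>I. char centered_exp (\<beta> (X i \<omega>) / ?c)"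
      let ?P2 = "\<lambda>\<omega>. \<Prod>i\<in>{1..n}. char centered_exp (\<beta> (X (n + i) \<omega>) / ?c)"
      let ?d1 = "\<lambda>\<omega>. dirichlet_cf n (\<lambda>i. \<beta> (X i \<omega>) / ?c)"
      let ?d2 = "\<lambda>\<omega>. dirichlet_cf n (\<lambda>i. \<beta> (X (n + i) \<omega>) / ?c)"
      have ind1: "indep_vars (\<lambda>_. borel) (\<lambda>i \<omega>. \<beta> (X i \<omega>)) {1..n}"
        by (rule indep_vars_subset[OF ind]) auto
      have ind2: "indep_vars (\<lambda>_. borel) (\<lambda>i \<omega>. \<beta> (X (n + i) \<omega>)) {1..n}"
      proof -
        \<comment> \<open>Singleton blocks serve to reindex the independent family by
          \<open>{1..n}\<close>.\<close>
        have "indep_vars (\<lambda>j. PiM {n + j} (\<lambda>_. borel)) (\<lambda>j \<omega>. restrict (\<lambda>i. \<beta> (X i \<omega>)) {n + j}) {1..n}"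
          by (rule indep_vars_restrict[OF ind]) (auto simp: disjoint_family_on_def)
        then have "indep_vars (\<lambda>_. borel) (\<lambda>j \<omega>. (\<lambda>f. f (n + j)) (restrict (\<lambda>i. \<beta> (X i \<omega>)) {n + j})) {1..n}"
          by (rule indep_vars_compose2) (intro measurable_component_singleton; simp)
        then show ?thesis by simp
      qed
      have ind3: "indep_vars (\<lambda>_. borel) (\<lambda>i \<omega>. \<beta> (X i \<omega>)) {1..2*n}"
        by (rule indep_vars_subset[OF ind]) auto
      note A1 = dirichlet_cf_approx[OF n ind1 law \<mu>(2,3,4) c]
      note A2 = dirichlet_cf_approx[OF n ind2 law \<mu>(2,3,4) c]
      have A3: "(\<integral>\<omega>. (cmod (?P \<omega> {1..2*n} - ?e))\<^sup>2 \<partial>M) = Q (2 * n)"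
        using QI[of "{1..2*n}", OF _ _ ind3] n law by simp
      note A3' = char_product_L1[OF A3 finite_atLeastAtMost \<beta>X]
      have split: "?P \<omega> {1..2*n} = ?P \<omega> {1..n} * ?P2 \<omega>" for \<omega>
      proof -
        have A: "{1..2*n} = {1..n} \<union> (\<lambda>i. n + i) ` {1..n}"
          by (auto simp: image_iff Bex_def)
        have B: "{1..n} \<inter> (\<lambda>i. n + i) ` {1..n} = {}" by auto
        have "?P \<omega> {1..2*n} = ?P \<omega> {1..n} * ?P \<omega> ((\<lambda>i. n + i) ` {1..n})"
          unfolding A by (rule prod.union_disjoint[OF _ _ B]) simp_all
        also have "?P \<omega> ((\<lambda>i. n + i) ` {1..n}) = ?P2 \<omega>"
          by (rule prod.reindex[THEN trans]) (simp_all only: inj_on_def comp_def, simp)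
        finally show ?thesis .
      qed
      have P_le: "cmod (?P \<omega> {1..n}) \<le> 1" for \<omega>
        unfolding prod_norm[symmetric] by (intro prod_le_1) (simp add: E.cmod_char_le_1)
      have le: "cmod (?G n \<omega> - ?e) \<le> cmod (?d1 \<omega> - ?P \<omega> {1..n}) + cmod (?d2 \<omega> - ?P2 \<omega>) + cmod (?P \<omega> {1..2*n} - ?e)" for \<omega>
      proof -
        \<comment> \<open>Telescoping: one Dirichlet factor is replaced at a time, and the factor
          left beside it has modulus at most 1.\<close>
        have "?G n \<omega> - ?e = (?d1 \<omega> - ?P \<omega> {1..n}) * ?d2 \<omega> + ?P \<omega> {1..n} * (?d2 \<omega> - ?P2 \<omega>) + (?P \<omega> {1..2*n} - ?e)"
          unfolding weights_cf_indep[OF n W[rule_format, OF n]] split by (simp add: algebra_simps)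
        then have "cmod (?G n \<omega> - ?e) \<le> cmod ((?d1 \<omega> - ?P \<omega> {1..n}) * ?d2 \<omega>) + cmod (?P \<omega> {1..n} * (?d2 \<omega> - ?P2 \<omega>)) + cmod (?P \<omega> {1..2*n} - ?e)"
          by (simp only:) (rule norm_triangle_le, rule add_mono[OF norm_triangle_ineq order_refl])
        moreover have "cmod ((?d1 \<omega> - ?P \<omega> {1..n}) * ?d2 \<omega>) \<le> cmod (?d1 \<omega> - ?P \<omega> {1..n}) * 1"
          unfolding norm_mult by (intro mult_left_mono dirichlet_cf_le_1 n) simp
        moreover have "cmod (?P \<omega> {1..n} * (?d2 \<omega> - ?P2 \<omega>)) \<le> 1 * cmod (?d2 \<omega> - ?P2 \<omega>)"
          unfolding norm_mult by (intro mult_right_mono P_le) simp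
        ultimately show ?thesis by linarith
      qed
      have i1: "integrable M (\<lambda>\<omega>. cmod (?d1 \<omega> - ?P \<omega> {1..n}))" by (rule A1) simp_all
      have i2: "integrable M (\<lambda>\<omega>. cmod (?d2 \<omega> - ?P2 \<omega>))" by (rule A2) simp_all
      have i3: "integrable M (\<lambda>\<omega>. cmod (?P \<omega> {1..2*n} - ?e))" by (rule A3') simp_all
      have Gm: "(\<lambda>\<omega>. cmod (?G n \<omega> - ?e)) \<in> borel_measurable M"
        unfolding weights_cf_indep[OF n W[rule_format, OF n]]
        by (rule measurable_compose[OF _ borel_measurable_norm], intro borel_measurable_diff borel_measurable_times dirichlet_cf_measurable[OF n]
            borel_measurable_const borel_measurable_divide \<beta>X) auto
      have "(\<integral>\<omega>. cmod (?G n \<omega> - ?e) \<partial>M) \<le> (\<integral>\<omega>. cmod (?d1 \<omega> - ?P \<omega> {1..n}) + cmod (?d2 \<omega> - ?P2 \<omega>) + cmod (?P \<omega> {1..2*n} - ?e) \<partial>M)"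
      proof (rule integral_mono)
        show *: "integrable M (\<lambda>\<omega>. cmod (?d1 \<omega> - ?P \<omega> {1..n}) + cmod (?d2 \<omega> - ?P2 \<omega>) + cmod (?P \<omega> {1..2*n} - ?e))"
          by (intro Bochner_Integration.integrable_add i1 i2 i3)
        show "integrable M (\<lambda>\<omega>. cmod (?G n \<omega> - ?e))"
          by (rule Bochner_Integration.integrable_bound[OF * Gm]) (intro AE_I2, use le in \<open>simp add: order_trans[OF le]\<close>)
      qed (rule le)
      also have "\<dots> = (\<integral>\<omega>. cmod (?d1 \<omega> - ?P \<omega> {1..n}) \<partial>M) + (\<integral>\<omega>. cmod (?d2 \<omega> - ?P2 \<omega>) \<partial>M) + (\<integral>\<omega>. cmod (?P \<omega> {1..2*n} - ?e) \<partial>M)"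
        by (simp only: Bochner_Integration.integral_add Bochner_Integration.integrable_add i1 i2 i3)
      also have "\<dots> \<le> sqrt (2 * r) / ?c + sqrt (2 * r) / ?c + sqrt (Q (2 * n))"
      proof (intro add_mono)
        show "(\<integral>\<omega>. cmod (?d1 \<omega> - ?P \<omega> {1..n}) \<partial>M) \<le> sqrt (2 * r) / ?c" by (rule A1(2)) simp_all
        show "(\<integral>\<omega>. cmod (?d2 \<omega> - ?P2 \<omega>) \<partial>M) \<le> sqrt (2 * r) / ?c" by (rule A2(2)) simp_all
        show "(\<integral>\<omega>. cmod (?P \<omega> {1..2*n} - ?e) \<partial>M) \<le> sqrt (Q (2 * n))" by (rule A3'(2)) simp_all
      qed
      finally show ?thesis by simp
    qed
    have Q2: "(\<lambda>n. sqrt (Q (2 * n))) \<longlonglongrightarrow> 0"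
      using tendsto_real_sqrt[OF LIMSEQ_subseq_LIMSEQ[OF Q, of "\<lambda>n. 2 * n"]] by (simp add: strict_mono_def comp_def)
    show ?thesis
    proof (rule Lim_null_comparison)
      show "(\<lambda>n. 2 * (sqrt (2 * r) / sqrt (real (2 * n))) + sqrt (Q (2 * n))) \<longlonglongrightarrow> 0"
        using tendsto_add[OF sqrt_lim[of 2 2] Q2] by simp
      show "eventually (\<lambda>n. norm (\<integral>\<omega>. cmod (?G n \<omega> - ?e) \<partial>M) \<le> 2 * (sqrt (2 * r) / sqrt (real (2 * n))) + sqrt (Q (2 * n))) sequentially"
        using eventually_ge_1 by eventually_elim (use bound in simp)
    qed
  next
    assume W: "\<forall>n\<ge>1. AE \<omega> in M. \<forall>j\<in>{1..n}. V n \<omega> j = W n \<omega> j"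
    \<comment> \<open>The law of a merged pair of scores; dividing by \<open>sqrt 2\<close> restores
      the variance \<open>r\<close>.\<close>
    define \<mu>2 where "\<mu>2 = distr (\<mu> \<Otimes>\<^sub>M \<mu>) borel (\<lambda>z. (fst z + snd z) / sqrt 2)"
    have \<mu>2: "real_distribution \<mu>2" "integrable \<mu>2 (\<lambda>x. x\<^sup>2)" "(\<integral>x. x \<partial>\<mu>2) = 0" "(\<integral>x. x\<^sup>2 \<partial>\<mu>2) = r"
    proof -
      have m: "(\<lambda>z. (fst z + snd z) / sqrt 2) \<in> borel_measurable (\<mu> \<Otimes>\<^sub>M \<mu>)" by measurable
      show "real_distribution \<mu>2" unfolding \<mu>2_def by (rule \<mu>\<mu>.real_distribution_distr[OF m])
      have int1: "integrable \<mu> (\<lambda>x. x)" by (rule \<mu>.square_integrable_imp_integrable[OF _ \<mu>(2)]) simp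
      have c1: "integrable \<mu> (\<lambda>x. 1 :: real)" by simp
      have p1: "(\<integral>x. 1 \<partial>\<mu>) = (1::real)" using \<mu>.prob_space by simp
      note i = \<mu>\<mu>.integral_mult_fst_snd[OF int1 c1] \<mu>\<mu>.integral_mult_fst_snd[OF c1 int1] \<mu>\<mu>.integral_mult_fst_snd[OF int1 int1]
        \<mu>\<mu>.integral_mult_fst_snd[OF \<mu>(2) c1] \<mu>\<mu>.integral_mult_fst_snd[OF c1 \<mu>(2)]
      have snd1: "(\<integral>z. snd z \<partial>(\<mu> \<Otimes>\<^sub>M \<mu>)) = 0"
        using \<mu>\<mu>.integral_mult_fst_snd(2)[OF c1 int1] by (simp only: mult_1 \<mu>(3) mult_zero_right)
      have snd2: "(\<integral>z. (snd z)\<^sup>2 \<partial>(\<mu> \<Otimes>\<^sub>M \<mu>)) = r"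
        using \<mu>\<mu>.integral_mult_fst_snd(2)[OF c1 \<mu>(2)] by (simp only: mult_1 p1 \<mu>(4))
      have e1: "(fst z + snd z) / sqrt 2 = (1 / sqrt 2) * (fst z * 1 + 1 * snd z)" for z :: "real \<times> real"
        by simp
      have e2: "((fst z + snd z) / sqrt 2)\<^sup>2 = (1 / 2) * ((fst z)\<^sup>2 * 1 + 2 * (fst z * snd z) + 1 * (snd z)\<^sup>2)" for z :: "real \<times> real"
        by (simp add: power_divide power2_sum)
      show "(\<integral>x. x \<partial>\<mu>2) = 0"
        unfolding \<mu>2_def
        by (subst integral_distr[OF m]) (simp, unfold e1,
            simp only: integral_mult_right_zero Bochner_Integration.integral_add i \<mu>(3), simp add: snd1)
      show "integrable \<mu>2 (\<lambda>x. x\<^sup>2)"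
        unfolding \<mu>2_def by (subst integrable_distr_eq[OF m]) (simp, unfold e2,
          intro integrable_mult_right Bochner_Integration.integrable_add i)
      show "(\<integral>x. x\<^sup>2 \<partial>\<mu>2) = r"
        unfolding \<mu>2_def
        by (subst integral_distr[OF m]) (simp, unfold e2,
            simp only: integral_mult_right_zero Bochner_Integration.integral_add Bochner_Integration.integrable_add
              integrable_mult_right i \<mu>(3,4) p1, simp add: snd2)
    qed
    obtain Q where Q: "Q \<longlonglongrightarrow> 0" and QI: "\<And>(I :: nat set) (\<xi> :: nat \<Rightarrow> 'w \<Rightarrow> real). finite I \<Longrightarrow> I \<noteq> {} \<Longrightarrow> indep_vars (\<lambda>_. borel) \<xi> I \<Longrightarrow>
      (\<forall>i\<in>I. distr M borel (\<xi> i) = \<mu>2) \<Longrightarrow>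
      (\<integral>\<omega>. (cmod ((\<Prod>i\<in>I. char centered_exp (\<xi> i \<omega> / sqrt (real (card I)))) - ?e))\<^sup>2 \<partial>M) = Q (card I)"
      by (rule char_product_L2E[OF \<mu>2(1) centered_exp(1) \<mu>2(2,4) centered_exp(2,3,4) prob_space_axioms]) (rule that, assumption+)
    have bound: "(\<integral>\<omega>. cmod (?G n \<omega> - ?e) \<partial>M) \<le> 1 * (sqrt (2 * r) / sqrt (real (1 * n))) + sqrt (Q n)"
      if n: "n \<ge> 1" for n
    proof -
      let ?c = "sqrt (real n)"
      have c: "0 < ?c" using n by simp
      define \<zeta> where "\<zeta> i \<omega> = (\<beta> (X i \<omega>) + \<beta> (X (n + i) \<omega>)) / sqrt 2" for i \<omega>
      have ind\<zeta>: "indep_vars (\<lambda>_. borel) \<zeta> {1..n}"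
      proof -
        \<comment> \<open>The blocks \<open>{j, n + j}\<close> are disjoint for \<open>j\<close> in
          \<open>{1..n}\<close>, so the merged variables remain independent.\<close>
        have "indep_vars (\<lambda>j. PiM {j, n + j} (\<lambda>_. borel)) (\<lambda>j \<omega>. restrict (\<lambda>i. \<beta> (X i \<omega>)) {j, n + j}) {1..n}"
          by (rule indep_vars_restrict[OF ind]) (auto simp: disjoint_family_on_def)
        then have "indep_vars (\<lambda>_. borel) (\<lambda>j \<omega>. (\<lambda>f. (f j + f (n + j)) / sqrt 2) (restrict (\<lambda>i. \<beta> (X i \<omega>)) {j, n + j})) {1..n}"
          by (rule indep_vars_compose2) (intro borel_measurable_divide borel_measurable_add borel_measurable_const measurable_component_singleton; simp)
        then show ?thesis by (simp add: \<zeta>_def[abs_def])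
      qed
      have law\<zeta>: "distr M borel (\<zeta> j) = \<mu>2" if j: "j \<in> {1..n}" for j
      proof -
        have "indep_var (PiM {j} (\<lambda>_. borel)) (\<lambda>\<omega>. restrict (\<lambda>i. \<beta> (X i \<omega>)) {j}) (PiM {n + j} (\<lambda>_. borel)) (\<lambda>\<omega>. restrict (\<lambda>i. \<beta> (X i \<omega>)) {n + j})"
          by (rule indep_var_restrict[OF ind]) (use j in auto)
        from indep_var_compose[OF this, of "\<lambda>f. f j" borel "\<lambda>f. f (n + j)" borel]
        have "indep_var borel (\<lambda>\<omega>. \<beta> (X j \<omega>)) borel (\<lambda>\<omega>. \<beta> (X (n + j) \<omega>))"
          by (simp add: comp_def)
        then have J: "distr M (borel \<Otimes>\<^sub>M borel) (\<lambda>\<omega>. (\<beta> (X j \<omega>), \<beta> (X (n + j) \<omega>))) = \<mu> \<Otimes>\<^sub>M \<mu>"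
          unfolding indep_var_distribution_eq using law[of j] law[of "n + j"] j by simp
        show ?thesis
          unfolding \<mu>2_def J[symmetric]
          by (subst distr_distr) (use \<beta>X[of j] \<beta>X[of "n + j"] j in \<open>simp_all add: comp_def \<zeta>_def[abs_def]\<close>)
      qed
      let ?P = "\<lambda>\<omega>. \<Prod>i\<in>{1..n}. char centered_exp (\<zeta> i \<omega> / ?c)"
      let ?d = "\<lambda>\<omega>. dirichlet_cf n (\<lambda>i. \<zeta> i \<omega> / ?c)"
      \<comment> \<open>The normalisation \<open>sqrt (2 n)\<close> splits into the
        \<open>sqrt 2\<close> inside \<open>\<zeta>\<close> and the outer scale
        \<open>sqrt n\<close>.\<close>
      have G: "?G n \<omega> = ?d \<omega>" for \<omega>
        unfolding weights_cf_identical[OF n W[rule_format, OF n]]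
        by (simp add: \<zeta>_def real_sqrt_mult add_divide_distrib)
      note A1 = dirichlet_cf_approx[OF n ind\<zeta> law\<zeta> \<mu>2(2,3,4) c]
      have A3: "(\<integral>\<omega>. (cmod (?P \<omega> - ?e))\<^sup>2 \<partial>M) = Q n"
        using QI[of "{1..n}", OF _ _ ind\<zeta>] n law\<zeta> by simp
      have \<zeta>m: "\<zeta> i \<in> borel_measurable M" if "i \<in> {1..n}" for i
        using ind\<zeta> that by (auto simp: indep_vars_def2)
      note A3' = char_product_L1[OF A3 finite_atLeastAtMost \<zeta>m]
      have i1: "integrable M (\<lambda>\<omega>. cmod (?d \<omega> - ?P \<omega>))" by (rule A1) simp_all
      have i3: "integrable M (\<lambda>\<omega>. cmod (?P \<omega> - ?e))" by (rule A3') simp_all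
      have le: "cmod (?d \<omega> - ?e) \<le> cmod (?d \<omega> - ?P \<omega>) + cmod (?P \<omega> - ?e)" for \<omega>
        using norm_triangle_ineq[of "?d \<omega> - ?P \<omega>" "?P \<omega> - ?e"] by simp
      have dm: "(\<lambda>\<omega>. cmod (?d \<omega> - ?e)) \<in> borel_measurable M"
        by (rule measurable_compose[OF _ borel_measurable_norm], intro borel_measurable_diff dirichlet_cf_measurable[OF n]
            borel_measurable_const borel_measurable_divide \<zeta>m)
      have "(\<integral>\<omega>. cmod (?d \<omega> - ?e) \<partial>M) \<le> (\<integral>\<omega>. cmod (?d \<omega> - ?P \<omega>) + cmod (?P \<omega> - ?e) \<partial>M)"
      proof (rule integral_mono)
        show *: "integrable M (\<lambda>\<omega>. cmod (?d \<omega> - ?P \<omega>) + cmod (?P \<omega> - ?e))"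
          by (intro Bochner_Integration.integrable_add i1 i3)
        show "integrable M (\<lambda>\<omega>. cmod (?d \<omega> - ?e))"
          by (rule Bochner_Integration.integrable_bound[OF * dm]) (intro AE_I2, use le in simp)
      qed (rule le)
      also have "\<dots> = (\<integral>\<omega>. cmod (?d \<omega> - ?P \<omega>) \<partial>M) + (\<integral>\<omega>. cmod (?P \<omega> - ?e) \<partial>M)"
        by (simp only: Bochner_Integration.integral_add i1 i3)
      also have "\<dots> \<le> sqrt (2 * r) / ?c + sqrt (Q n)"
      proof (intro add_mono)
        show "(\<integral>\<omega>. cmod (?d \<omega> - ?P \<omega>) \<partial>M) \<le> sqrt (2 * r) / ?c" by (rule A1(2)) simp_all
        show "(\<integral>\<omega>. cmod (?P \<omega> - ?e) \<partial>M) \<le> sqrt (Q n)" by (rule A3'(2)) simp_all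
      qed
      finally show ?thesis by (simp only: G mult_1)
    qed
    show ?thesis
    proof (rule Lim_null_comparison)
      show "(\<lambda>n. 1 * (sqrt (2 * r) / sqrt (real (1 * n))) + sqrt (Q n)) \<longlonglongrightarrow> 0"
        using tendsto_add[OF sqrt_lim[of 1 1] tendsto_real_sqrt[OF Q]] by simp
      show "eventually (\<lambda>n. norm (\<integral>\<omega>. cmod (?G n \<omega> - ?e) \<partial>M) \<le> 1 * (sqrt (2 * r) / sqrt (real (1 * n))) + sqrt (Q n)) sequentially"
        using eventually_ge_1 by eventually_elim (use bound in simp)
    qed
  qed
qed

end

section \<open>Joint laws\<close>

text \<open>Evaluation samples, nuisance estimates and single weight vectors are functions of the
  data or of the weight pair; this passes independence on to them.\<close>

lemma (in prob_space) joint_law_map: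
  assumes S: "S \<in> M \<rightarrow>\<^sub>M N" and T: "T \<in> M \<rightarrow>\<^sub>M K"
    and joint: "distr M (N \<Otimes>\<^sub>M K) (\<lambda>\<omega>. (S \<omega>, T \<omega>)) = distr M N S \<Otimes>\<^sub>M distr M K T"
    and f: "f \<in> N \<rightarrow>\<^sub>M N'" and g: "g \<in> K \<rightarrow>\<^sub>M K'"
  shows "distr M (N' \<Otimes>\<^sub>M K') (\<lambda>\<omega>. (f (S \<omega>), g (T \<omega>))) = distr M N' (\<lambda>\<omega>. f (S \<omega>)) \<Otimes>\<^sub>M distr M K' (\<lambda>\<omega>. g (T \<omega>))"
proof -
  have ST: "(\<lambda>\<omega>. (S \<omega>, T \<omega>)) \<in> M \<rightarrow>\<^sub>M N \<Otimes>\<^sub>M K" using S T by simp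
  have fg: "(\<lambda>(x, y). (f x, g y)) \<in> N \<Otimes>\<^sub>M K \<rightarrow>\<^sub>M N' \<Otimes>\<^sub>M K'"
    using f g unfolding case_prod_beta' by measurable
  have gT: "(\<lambda>\<omega>. g (T \<omega>)) \<in> M \<rightarrow>\<^sub>M K'" by (rule measurable_compose[OF T g])
  have fS: "distr M N' (\<lambda>\<omega>. f (S \<omega>)) = distr (distr M N S) N' f"
    using distr_distr[OF f S] by (simp add: comp_def)
  have gT': "distr M K' (\<lambda>\<omega>. g (T \<omega>)) = distr (distr M K T) K' g"
    using distr_distr[OF g T] by (simp add: comp_def)
  have "distr M (N' \<Otimes>\<^sub>M K') (\<lambda>\<omega>. (f (S \<omega>), g (T \<omega>))) = distr (distr M N S \<Otimes>\<^sub>M distr M K T) (N' \<Otimes>\<^sub>M K') (\<lambda>(x, y). (f x, g y))"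
    unfolding joint[symmetric] using distr_distr[OF fg ST] by (simp add: comp_def)
  also have "\<dots> = distr (distr M N S) N' f \<Otimes>\<^sub>M distr (distr M K T) K' g"
  proof (rule pair_measure_distr[symmetric])
    show "sigma_finite_measure (distr (distr M K T) K' g)"
      unfolding gT'[symmetric] by (rule prob_space_imp_sigma_finite[OF prob_space_distr[OF gT]])
  qed (use f g in simp_all)
  finally show ?thesis by (simp only: fS gT')
qed

text \<open>Converts independence of the generated algebras, with that of \<open>T\<close> first,
  into the product law used by the Fubini arguments.\<close>

lemma (in prob_space) joint_law_indep_set:
  assumes S: "S \<in> M \<rightarrow>\<^sub>M N" and T: "T \<in> M \<rightarrow>\<^sub>M K"
    and ind: "indep_set (sets (vimage_algebra (space M) T K)) (sets (vimage_algebra (space M) S N))"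
  shows "distr M (N \<Otimes>\<^sub>M K) (\<lambda>\<omega>. (S \<omega>, T \<omega>)) = distr M N S \<Otimes>\<^sub>M distr M K T"
proof (rule pair_measure_eqI[symmetric])
  show "sigma_finite_measure (distr M N S)" "sigma_finite_measure (distr M K T)"
    by (intro prob_space_imp_sigma_finite prob_space_distr S T)+
  show "sets (distr M N S \<Otimes>\<^sub>M distr M K T) = sets (distr M (N \<Otimes>\<^sub>M K) (\<lambda>\<omega>. (S \<omega>, T \<omega>)))"
    by (simp cong: sets_pair_measure_cong)
  fix A B assume "A \<in> sets (distr M N S)" "B \<in> sets (distr M K T)"
  then have A: "A \<in> sets N" and B: "B \<in> sets K" by simp_all
  have ST: "(\<lambda>\<omega>. (S \<omega>, T \<omega>)) \<in> M \<rightarrow>\<^sub>M N \<Otimes>\<^sub>M K" using S T by simp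
  have AB: "A \<times> B \<in> sets (N \<Otimes>\<^sub>M K)" using A B by simp
  have "T -` B \<inter> space M \<in> sets (vimage_algebra (space M) T K)" "S -` A \<inter> space M \<in> sets (vimage_algebra (space M) S N)"
    using A B by (auto intro: in_vimage_algebra)
  then have "prob ((T -` B \<inter> space M) \<inter> (S -` A \<inter> space M)) = prob (T -` B \<inter> space M) * prob (S -` A \<inter> space M)"
    by (rule indep_setD[OF ind])
  moreover have "(\<lambda>\<omega>. (S \<omega>, T \<omega>)) -` (A \<times> B) \<inter> space M = (T -` B \<inter> space M) \<inter> (S -` A \<inter> space M)"
    by auto
  ultimately have "prob ((\<lambda>\<omega>. (S \<omega>, T \<omega>)) -` (A \<times> B) \<inter> space M) = prob (S -` A \<inter> space M) * prob (T -` B \<inter> space M)"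
    by (simp add: mult.commute)
  then show "emeasure (distr M N S) A * emeasure (distr M K T) B = emeasure (distr M (N \<Otimes>\<^sub>M K) (\<lambda>\<omega>. (S \<omega>, T \<omega>))) (A \<times> B)"
    unfolding emeasure_distr[OF S A] emeasure_distr[OF T B] emeasure_distr[OF ST AB]
    by (simp add: emeasure_eq_measure ennreal_mult)
qed

section \<open>The sandwich variance\<close>

definition outer :: "real ^ 'p \<Rightarrow> real ^ 'p ^ 'p" where
  "outer m = (\<chi> i j. m $ i * m $ j)"

text \<open>Square integrability of a vector thereby gives integrability of its outer product as a
  matrix.\<close>

lemma norm_outer: "norm (outer m) = (norm m)\<^sup>2"
proof -
  have "outer m $ i = m $ i *\<^sub>R m" for i
    by (simp add: outer_def vec_eq_iff)
  then have "norm (outer m) = L2_set (\<lambda>i. norm (m $ i) * norm m) UNIV"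
    by (simp add: norm_vec_def[of "outer m"])
  also have "\<dots> = norm m * norm m"
    by (simp add: L2_set_left_distrib [symmetric] norm_vec_def[of m])
  finally show ?thesis by (simp add: power2_eq_square)
qed

text \<open>The quadratic form is the second moment of the scalar influence
  \<open>t \<bullet> (J *v m x)\<close>. This yields positive semidefiniteness and identifies the
  variance of each one-dimensional limit with that of the normal law.\<close>

lemma sandwich_quadratic_form:
  fixes m :: "'o \<Rightarrow> real ^ 'p" and J :: "real ^ 'p ^ 'p"
  assumes m: "m \<in> borel_measurable P" and sq: "integrable P (\<lambda>x. (norm (m x))\<^sup>2)"
  defines "S \<equiv> J ** (\<integral>x. outer (m x) \<partial>P) ** transpose J"
  shows "transpose S = S" and "t \<bullet> (S *v t) = (\<integral>x. (t \<bullet> (J *v m x))\<^sup>2 \<partial>P)"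
proof -
  let ?O = "\<integral>x. outer (m x) \<partial>P"
  have om: "(\<lambda>x. outer (m x)) \<in> borel_measurable P"
    by (rule measurable_compose[OF m borel_measurable_continuous_onI])
       (unfold outer_def, intro continuous_intros)
  have O: "integrable P (\<lambda>x. outer (m x))"
    using sq om by (subst integrable_norm_iff[symmetric]) (simp_all add: norm_outer)
  have comp: "?O $ i $ j = (\<integral>x. m x $ i * m x $ j \<partial>P)" for i j
  proof -
    have "bounded_linear (\<lambda>K :: real ^ 'p ^ 'p. K $ i $ j)"
      by (rule bounded_linear_compose[OF bounded_linear_vec_nth bounded_linear_vec_nth])
    from integral_bounded_linear[OF this O] show ?thesis by (simp add: outer_def)
  qed
  have "transpose ?O = ?O"
    by (simp add: vec_eq_iff transpose_def comp mult.commute)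
  then show "transpose S = S"
    by (simp add: S_def matrix_transpose_mul matrix_mul_assoc)
  define u where "u = transpose J *v t"
  have u: "t \<bullet> (J *v v) = u \<bullet> v" for v
    unfolding u_def by (simp add: dot_lmul_matrix[symmetric])
  have lin: "bounded_linear (\<lambda>K :: real ^ 'p ^ 'p. u \<bullet> (K *v u))"
    unfolding linear_conv_bounded_linear[symmetric]
    by (rule linearI) (simp_all add: matrix_vector_mult_add_rdistrib inner_add_right scaleR_matrix_vector_assoc[symmetric])
  have "t \<bullet> (S *v t) = u \<bullet> (?O *v u)"
    by (simp only: S_def matrix_vector_mul_assoc[symmetric] u_def[symmetric] u)
  also have "\<dots> = (\<integral>x. u \<bullet> (outer (m x) *v u) \<partial>P)"
    by (rule integral_bounded_linear[OF lin O, symmetric])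
  also have "\<dots> = (\<integral>x. (t \<bullet> (J *v m x))\<^sup>2 \<partial>P)"
  proof (rule Bochner_Integration.integral_cong[OF refl])
    fix x
    have "outer (m x) *v u = (m x \<bullet> u) *\<^sub>R m x"
      by (simp add: vec_eq_iff outer_def matrix_vector_mult_def inner_vec_def sum_distrib_left mult_ac)
    then show "u \<bullet> (outer (m x) *v u) = (t \<bullet> (J *v m x))\<^sup>2"
      by (simp add: u power2_eq_square inner_commute)
  qed
  finally show "t \<bullet> (S *v t) = (\<integral>x. (t \<bullet> (J *v m x))\<^sup>2 \<partial>P)" .
qed

lemma (in prob_space) bdd_prob_matrix:
  fixes R :: "nat \<Rightarrow> 'a \<Rightarrow> real ^ 'n" and J :: "real ^ 'n ^ 'm"
  assumes R: "bdd_prob M R"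
  shows "bdd_prob M (\<lambda>n \<omega>. J *v R n \<omega>)"
  unfolding bdd_prob_def
proof (intro conjI allI impI)
  note m = bdd_prob_measurable[OF R]
  show "(\<lambda>\<omega>. J *v R n \<omega>) \<in> borel_measurable M" if "n \<ge> 1" for n
    using m[OF that] by measurable
  fix e :: real assume "0 < e"
  then obtain K where K: "eventually (\<lambda>n. prob {\<omega> \<in> space M. K < norm (R n \<omega>)} \<le> e) sequentially"
    using R unfolding bdd_prob_def by blast
  \<comment> \<open>\<open>K\<close> may be negative, hence the absolute value in the new bound; its
    strictness excludes \<open>norm J = 0\<close>.\<close>
  from K eventually_ge_1
  have "eventually (\<lambda>n. prob {\<omega> \<in> space M. norm J * \<bar>K\<bar> < norm (J *v R n \<omega>)} \<le> e) sequentially"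
  proof eventually_elim
    case (elim n)
    have [measurable]: "R n \<in> borel_measurable M" by (rule m[OF elim(2)])
    have "prob {\<omega> \<in> space M. norm J * \<bar>K\<bar> < norm (J *v R n \<omega>)} \<le> prob {\<omega> \<in> space M. K < norm (R n \<omega>)}"
    proof (rule finite_measure_mono)
      show "{\<omega> \<in> space M. norm J * \<bar>K\<bar> < norm (J *v R n \<omega>)} \<subseteq> {\<omega> \<in> space M. K < norm (R n \<omega>)}"
      proof safe
        fix \<omega> assume "norm J * \<bar>K\<bar> < norm (J *v R n \<omega>)"
        then have "norm J * \<bar>K\<bar> < norm J * norm (R n \<omega>)"
          using norm_matrix_vector_mult_le by (rule less_le_trans)
        then have "\<bar>K\<bar> < norm (R n \<omega>)" by (rule mult_left_less_imp_less) simp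
        then show "K < norm (R n \<omega>)" by simp
      qed
    qed measurable
    then show ?case using elim by simp
  qed
  then show "\<exists>K. eventually (\<lambda>n. prob {\<omega> \<in> space M. K < norm (J *v R n \<omega>)} \<le> e) sequentially"
    by (intro exI[of _ "norm J * \<bar>K\<bar>"])
qed

section \<open>Limits of cosine expectations, plain and conditional on the data\<close>

context bootstrap_sample
begin

lemma weights_cf_integrable:
  assumes n: "n \<ge> 1" and b: "\<And>i. i \<in> {1..n} \<Longrightarrow> b i \<in> borel_measurable M" "\<And>i. i \<in> {1..n} \<Longrightarrow> b' i \<in> borel_measurable M"
  shows "integrable M (\<lambda>\<omega>. cmod (weights_cf n (\<lambda>i. b i \<omega>) (\<lambda>i. b' i \<omega>) - z))"
proof -
  have "(\<lambda>\<omega>. weights_cf n (\<lambda>i. b i \<omega>) (\<lambda>i. b' i \<omega>)) \<in> borel_measurable M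
      \<and> (\<forall>\<omega>. cmod (weights_cf n (\<lambda>i. b i \<omega>) (\<lambda>i. b' i \<omega>)) \<le> 1)"
    using WV
  proof
    assume "\<forall>n\<ge>1. indep_var (PiM {1..n} (\<lambda>_. borel)) (W n) (PiM {1..n} (\<lambda>_. borel)) (V n)"
    note eq = weights_cf_indep[OF n this[rule_format, OF n]]
    show ?thesis
      unfolding eq norm_mult
      by (intro conjI allI mult_le_one dirichlet_cf_le_1 n norm_ge_zero borel_measurable_times dirichlet_cf_measurable b)
  next
    assume "\<forall>n\<ge>1. AE \<omega> in M. \<forall>j\<in>{1..n}. V n \<omega> j = W n \<omega> j"
    note eq = weights_cf_identical[OF n this[rule_format, OF n]]
    show ?thesis
      unfolding eq by (intro conjI allI dirichlet_cf_le_1 n dirichlet_cf_measurable borel_measurable_add b)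
  qed
  then have m: "(\<lambda>\<omega>. weights_cf n (\<lambda>i. b i \<omega>) (\<lambda>i. b' i \<omega>)) \<in> borel_measurable M"
    and le: "\<And>\<omega>. cmod (weights_cf n (\<lambda>i. b i \<omega>) (\<lambda>i. b' i \<omega>)) \<le> 1" by blast+
  show ?thesis
  proof (rule integrable_const_bound[where B="1 + cmod z"])
    show "AE \<omega> in M. norm (cmod (weights_cf n (\<lambda>i. b i \<omega>) (\<lambda>i. b' i \<omega>) - z)) \<le> 1 + cmod z"
      using le by (intro AE_I2) (simp add: order_trans[OF norm_triangle_ineq4 add_right_mono])
    show "(\<lambda>\<omega>. cmod (weights_cf n (\<lambda>i. b i \<omega>) (\<lambda>i. b' i \<omega>) - z)) \<in> borel_measurable M"
      using m by measurable
  qed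
qed

lemma sample_measurable:
  assumes "I \<subseteq> {1..}"
  shows "sample X I \<in> M \<rightarrow>\<^sub>M PiM I (\<lambda>_. P)"
  unfolding sample_def by (rule measurable_restrict) (use assms X_meas in auto)

lemma sample_law:
  assumes I: "I \<subseteq> {1..}" "I \<noteq> {}"
  shows "distr M (PiM I (\<lambda>_. P)) (sample X I) = PiM I (\<lambda>_. P)"
proof -
  have Xm: "X i \<in> M \<rightarrow>\<^sub>M P" if "i \<in> I" for i using I that X_meas by auto
  have "distr M (PiM I (\<lambda>_. P)) (\<lambda>\<omega>. \<lambda>i\<in>I. X i \<omega>) = PiM I (\<lambda>i. distr M P (X i))"
    using indep_vars_iff_distr_eq_PiM'[OF I(2), of X "\<lambda>_. P"] indep_vars_subset[OF X_indep I(1)] Xm by simp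
  also have "\<dots> = PiM I (\<lambda>_. P)" by (rule PiM_cong) (use I X_distr in auto)
  finally show ?thesis unfolding sample_def .
qed

lemma sample_joint_law:
  assumes "I \<subseteq> {1..}" "K \<subseteq> {1..}" "I \<inter> K = {}"
  shows "distr M (PiM I (\<lambda>_. P) \<Otimes>\<^sub>M PiM K (\<lambda>_. P)) (\<lambda>\<omega>. (sample X I \<omega>, sample X K \<omega>))
    = distr M (PiM I (\<lambda>_. P)) (sample X I) \<Otimes>\<^sub>M distr M (PiM K (\<lambda>_. P)) (sample X K)"
  using indep_var_restrict[OF X_indep assms(3,1,2)]
  unfolding indep_var_distribution_eq sample_def by simp

lemma mean_cos_lim:
  fixes \<beta> :: "'o \<Rightarrow> real"
  assumes \<beta>: "\<beta> \<in> borel_measurable P" and mean: "(\<integral>x. \<beta> x \<partial>P) = 0"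
    and sq: "integrable P (\<lambda>x. (\<beta> x)\<^sup>2)" and r: "(\<integral>x. (\<beta> x)\<^sup>2 \<partial>P) = r"
  shows "(\<lambda>n. \<integral>\<omega>. cos (1 / sqrt (real (2*n)) * (\<Sum>i\<in>{1..2*n}. \<beta> (X i \<omega>)) + s) \<partial>M) \<longlonglongrightarrow> cos s * exp (- r / 2)"
proof -
  have P: "prob_space P"
    using prob_space_distr[OF X_meas[OF order_refl]] unfolding X_distr[OF order_refl] .
  interpret P: prob_space P by (rule P)
  define \<mu> where "\<mu> = distr P borel \<beta>"
  have \<mu>: "real_distribution \<mu>" "integrable \<mu> (\<lambda>x. x\<^sup>2)" "(\<integral>x. x \<partial>\<mu>) = 0" "(\<integral>x. x\<^sup>2 \<partial>\<mu>) = r"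
    unfolding \<mu>_def using P.real_distribution_distr[OF \<beta>] \<beta> sq mean r
    by (simp_all add: integrable_distr_eq integral_distr)
  interpret \<mu>: real_distribution \<mu> by (rule \<mu>)
  have law: "distr M borel (\<lambda>\<omega>. \<beta> (X i \<omega>)) = \<mu>" if "i \<ge> 1" for i
    using distr_distr[OF \<beta> X_meas[OF that]] by (simp add: \<mu>_def X_distr[OF that] comp_def)
  have ind: "indep_vars (\<lambda>_. borel) (\<lambda>i \<omega>. \<beta> (X i \<omega>)) {1..}"
    by (rule indep_vars_compose2[OF X_indep \<beta>])
  have \<beta>X: "(\<lambda>\<omega>. \<beta> (X i \<omega>)) \<in> borel_measurable M" if "i \<ge> 1" for i
    by (rule measurable_compose[OF X_meas[OF that] \<beta>])
  have eq: "(\<integral>\<omega>. cos (1 / sqrt (real (2*n)) * (\<Sum>i\<in>{1..2*n}. \<beta> (X i \<omega>)) + s) \<partial>M) = Re (iexp s * char \<mu> (1 / sqrt (real (2*n))) ^ (2*n))"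
    if n: "n \<ge> 1" for n
  proof -
    let ?L = "\<lambda>\<omega>. 1 / sqrt (real (2*n)) * (\<Sum>i\<in>{1..2*n}. \<beta> (X i \<omega>))"
    have Lm: "?L \<in> borel_measurable M"
      by (intro borel_measurable_times borel_measurable_const borel_measurable_sum \<beta>X) simp
    have i: "integrable M (\<lambda>\<omega>. iexp (?L \<omega>))"
      using measurable_compose[OF Lm borel_measurable_of_real] by (rule integrable_iexp) simp
    have "(\<integral>\<omega>. cos (?L \<omega> + s) \<partial>M) = (\<integral>\<omega>. Re (iexp s * iexp (?L \<omega>)) \<partial>M)"
      by (simp only: cos_add_eq_Re_iexp)
    also have "\<dots> = Re (iexp s * (\<integral>\<omega>. iexp (?L \<omega>) \<partial>M))"
      using integral_Re[OF integrable_mult_right[OF i, of "iexp s"]] by (simp only: integral_mult_right_zero)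
    also have "(\<integral>\<omega>. iexp (?L \<omega>) \<partial>M) = char \<mu> (1 / sqrt (real (2*n))) ^ card {1..2*n}"
      by (rule char_iid_sum) (use n law indep_vars_subset[OF ind] in auto)
    finally show ?thesis by simp
  qed
  have "(\<lambda>n. char \<mu> (1 / sqrt (real (2*n))) ^ (2*n)) \<longlonglongrightarrow> of_real (exp (- r / 2))"
    using LIMSEQ_subseq_LIMSEQ[OF \<mu>.char_power_tendsto[OF \<mu>(2,3,4)], of "\<lambda>n. 2 * n"] by (simp add: strict_mono_def comp_def)
  then have "(\<lambda>n. Re (iexp s * char \<mu> (1 / sqrt (real (2*n))) ^ (2*n))) \<longlonglongrightarrow> Re (iexp s * of_real (exp (- r / 2)))"
    by (intro tendsto_intros)
  also have "Re (iexp s * of_real (exp (- r / 2))) = cos s * exp (- r / 2)"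
    by (simp add: Re_exp)
  finally show ?thesis
    by (rule Lim_transform_eventually) (use eventually_ge_1 in \<open>eventually_elim, simp only: eq\<close>)
qed

text \<open>Given the data, the expectation of the cosine is the real part of \<open>iexp s\<close>
  times \<open>weights_cf\<close> at the observed scores. As \<open>iexp s\<close> has modulus 1,
  the L1 error is dominated by that in \<open>bootstrap_cf_lim\<close>.\<close>

lemma conditional_cos_lim:
  fixes \<beta> :: "'o \<Rightarrow> real"
  assumes \<beta>: "\<beta> \<in> borel_measurable P" and mean: "(\<integral>x. \<beta> x \<partial>P) = 0"
    and sq: "integrable P (\<lambda>x. (\<beta> x)\<^sup>2)" and r: "(\<integral>x. (\<beta> x)\<^sup>2 \<partial>P) = r"
    and indep: "\<And>n. n \<ge> 1 \<Longrightarrow> indep_set (sets (weight_algebra M W V n)) (sets (sample_algebra M P X {1..2*n}))"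
  shows "(\<lambda>n. \<integral>\<omega>. \<bar>real_cond_exp M (sample_algebra M P X {1..2*n})
      (\<lambda>\<omega>. cos (real n * ((\<Sum>i\<in>{1..n}. (W n \<omega> i - 1 / real n) * (\<beta> (X i \<omega>) / sqrt (real (2*n))))
        + (\<Sum>i\<in>{1..n}. (V n \<omega> i - 1 / real n) * (\<beta> (X (n + i) \<omega>) / sqrt (real (2*n))))) + s)) \<omega>
      - cos s * exp (- r / 2)\<bar> \<partial>M) \<longlonglongrightarrow> 0"
    (is "?lim \<longlonglongrightarrow> 0")
proof (rule Lim_null_comparison[OF _ bootstrap_cf_lim[OF \<beta> mean sq r]])
  let ?e = "of_real (exp (- r / 2)) :: complex"
  let ?G = "\<lambda>n \<omega>. weights_cf n (\<lambda>i. \<beta> (X i \<omega>) / sqrt (real (2*n))) (\<lambda>i. \<beta> (X (n + i) \<omega>) / sqrt (real (2*n)))"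
  have \<beta>X: "(\<lambda>\<omega>. \<beta> (X i \<omega>)) \<in> borel_measurable M" if "i \<ge> 1" for i
    by (rule measurable_compose[OF X_meas[OF that] \<beta>])
  show "eventually (\<lambda>n. norm (?lim n) \<le> (\<integral>\<omega>. cmod (?G n \<omega> - ?e) \<partial>M)) sequentially"
    using eventually_ge_1
  proof eventually_elim
    case (elim n)
    note n = elim
    let ?B = "PiM {1..n} (\<lambda>_. borel :: real measure)" and ?N = "PiM {1..2*n} (\<lambda>_. P)"
    \<comment> \<open>The exponent as a function of the data vector and the weight pair separately,
      as \<open>real_cond_exp_indep\<close> requires.\<close>
    define ph where "ph x u = real n * ((\<Sum>i\<in>{1..n}. (fst u i - 1 / real n) * (\<beta> (x i) / sqrt (real (2*n))))
        + (\<Sum>i\<in>{1..n}. (snd u i - 1 / real n) * (\<beta> (x (n + i)) / sqrt (real (2*n)))))" for x u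
    define T where "T \<omega> = (W n \<omega>, V n \<omega>)" for \<omega>
    have S: "sample X {1..2*n} \<in> M \<rightarrow>\<^sub>M ?N" by (rule sample_measurable) auto
    have T: "T \<in> M \<rightarrow>\<^sub>M ?B \<Otimes>\<^sub>M ?B" unfolding T_def by (rule WV_meas[OF n])
    have joint: "distr M (?N \<Otimes>\<^sub>M (?B \<Otimes>\<^sub>M ?B)) (\<lambda>\<omega>. (sample X {1..2*n} \<omega>, T \<omega>)) = distr M ?N (sample X {1..2*n}) \<Otimes>\<^sub>M distr M (?B \<Otimes>\<^sub>M ?B) T"
      using joint_law_indep_set[OF S T] indep[OF n] unfolding weight_algebra_def sample_algebra_def T_def by simp
    have phm: "(\<lambda>z. ph (fst z) (snd z)) \<in> borel_measurable (?N \<Otimes>\<^sub>M (?B \<Otimes>\<^sub>M ?B))"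
    proof -
      have "(\<lambda>z. \<beta> (fst z i)) \<in> borel_measurable (?N \<Otimes>\<^sub>M (?B \<Otimes>\<^sub>M ?B))" if "i \<in> {1..2*n}" for i
        by (rule measurable_compose[OF measurable_compose[OF measurable_fst measurable_component_singleton[OF that]] \<beta>])
      moreover have "(\<lambda>z. fst (snd z) i) \<in> borel_measurable (?N \<Otimes>\<^sub>M (?B \<Otimes>\<^sub>M ?B))" if "i \<in> {1..n}" for i
        by (rule measurable_compose[OF measurable_compose[OF measurable_snd measurable_fst] measurable_component_singleton[OF that]])
      moreover have "(\<lambda>z. snd (snd z) i) \<in> borel_measurable (?N \<Otimes>\<^sub>M (?B \<Otimes>\<^sub>M ?B))" if "i \<in> {1..n}" for i
        by (rule measurable_compose[OF measurable_compose[OF measurable_snd measurable_snd] measurable_component_singleton[OF that]])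
      ultimately show ?thesis
        unfolding ph_def
        by (intro borel_measurable_times borel_measurable_const borel_measurable_add borel_measurable_sum
            borel_measurable_diff borel_measurable_divide) auto
    qed
    have fm: "(\<lambda>(x, u). cos (ph x u + s)) \<in> borel_measurable (?N \<Otimes>\<^sub>M (?B \<Otimes>\<^sub>M ?B))"
      using phm unfolding case_prod_beta' by measurable
    have ph_sample: "ph (sample X {1..2*n} \<omega>) u = real n * ((\<Sum>i\<in>{1..n}. (fst u i - 1 / real n) * (\<beta> (X i \<omega>) / sqrt (real (2*n))))
        + (\<Sum>i\<in>{1..n}. (snd u i - 1 / real n) * (\<beta> (X (n + i) \<omega>) / sqrt (real (2*n)))))" for \<omega> u
      unfolding ph_def sample_def by (intro arg_cong2[where f="(*)"] arg_cong2[where f="(+)"] sum.cong refl) auto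
    let ?E = "real_cond_exp M (sample_algebra M P X {1..2*n}) (\<lambda>\<omega>. cos (ph (sample X {1..2*n} \<omega>) (T \<omega>) + s))"
    have ce: "AE \<omega> in M. ?E \<omega> = (\<integral>u. cos (ph (sample X {1..2*n} \<omega>) u + s) \<partial>WV_law n)"
      using real_cond_exp_indep[OF S T joint fm, of 1] unfolding sample_algebra_def WV_law_def T_def by simp
    have re: "(\<integral>u. cos (ph (sample X {1..2*n} \<omega>) u + s) \<partial>WV_law n) = Re (iexp s * ?G n \<omega>)" if \<omega>: "\<omega> \<in> space M" for \<omega>
    proof -
      interpret WV: prob_space "WV_law n" unfolding WV_law_def by (rule prob_space_distr[OF WV_meas[OF n]])
      have "(\<lambda>u. ph (sample X {1..2*n} \<omega>) u) \<in> borel_measurable (?B \<Otimes>\<^sub>M ?B)"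
        using measurable_compose[OF measurable_Pair1'[OF measurable_space[OF S \<omega>]] phm] by simp
      then have "(\<lambda>u. ph (sample X {1..2*n} \<omega>) u) \<in> borel_measurable (WV_law n)"
        unfolding WV_law_def by simp
      from measurable_compose[OF this borel_measurable_of_real]
      have i: "integrable (WV_law n) (\<lambda>u. iexp (ph (sample X {1..2*n} \<omega>) u))" by (rule WV.integrable_iexp) simp
      have "(\<integral>u. cos (ph (sample X {1..2*n} \<omega>) u + s) \<partial>WV_law n) = (\<integral>u. Re (iexp s * iexp (ph (sample X {1..2*n} \<omega>) u)) \<partial>WV_law n)"
        by (simp only: cos_add_eq_Re_iexp)
      also have "\<dots> = Re (iexp s * (\<integral>u. iexp (ph (sample X {1..2*n} \<omega>) u) \<partial>WV_law n))"
        using integral_Re[OF integrable_mult_right[OF i, of "iexp s"]] by (simp only: integral_mult_right_zero)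
      finally show ?thesis by (simp only: weights_cf_def ph_sample)
    qed
    have "?lim n = (\<integral>\<omega>. \<bar>?E \<omega> - cos s * exp (- r / 2)\<bar> \<partial>M)"
      by (simp only: ph_sample T_def fst_conv snd_conv)
    also have "\<dots> \<le> (\<integral>\<omega>. cmod (?G n \<omega> - ?e) \<partial>M)"
    proof (rule integral_mono_AE')
      show "integrable M (\<lambda>\<omega>. cmod (?G n \<omega> - ?e))"
        by (rule weights_cf_integrable[OF n]) (intro borel_measurable_divide \<beta>X borel_measurable_const; use n in auto)+
      show "AE \<omega> in M. \<bar>?E \<omega> - cos s * exp (- r / 2)\<bar> \<le> cmod (?G n \<omega> - ?e)"
        using ce AE_space
      proof eventually_elim
        case (elim \<omega>)
        have re_diff: "Re (iexp s * ?G n \<omega>) - cos s * exp (- r / 2) = Re (iexp s * (?G n \<omega> - ?e))"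
          by (simp add: Re_exp right_diff_distrib)
        have "\<bar>Re (iexp s * ?G n \<omega>) - cos s * exp (- r / 2)\<bar> \<le> cmod (iexp s * (?G n \<omega> - ?e))"
          unfolding re_diff by (rule abs_Re_le_cmod)
        then show ?case
          unfolding elim(1) re[OF elim(2)] by (simp only: norm_mult norm_exp_i_times mult_1)
      qed
    qed simp
    finally show ?case by (simp add: integral_nonneg_AE abs_of_nonneg)
  qed
qed

end

section \<open>Both halves combined: the two limit theorems\<close>

theorem theorem2:
  fixes M :: "'w measure" and P :: "'o measure"
    and A :: "'o \<Rightarrow> 'h::real_normed_vector \<Rightarrow> real ^ 'p ^ 'p"
    and B :: "'o \<Rightarrow> 'h \<Rightarrow> real ^ 'p"
    and H :: "'h set" and HS :: "'h measure" and HN :: "nat \<Rightarrow> 'h set" and h0 :: 'h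
    and \<Theta> :: "(real ^ 'p) set" and \<theta>0 :: "real ^ 'p"
    and X :: "nat \<Rightarrow> 'w \<Rightarrow> 'o"
    and hhat1 hhat2 :: "nat \<Rightarrow> (nat \<Rightarrow> 'o) \<Rightarrow> 'h"
    and W V :: "nat \<Rightarrow> 'w \<Rightarrow> nat \<Rightarrow> real"
    and th1 th1BB th2 th2BB :: "nat \<Rightarrow> 'w \<Rightarrow> real ^ 'p"
    and a \<delta> :: "nat \<Rightarrow> real" and C :: real
  assumes M: "prob_space M" and P: "prob_space P"
    and H: "convex H" "h0 \<in> H" "space HS = H"
    and HN: "shrinking_neighborhoods H h0 HN"
    and theta0: "\<theta>0 \<in> \<Theta>"
    and A_meas: "(\<lambda>(x, h). A x h) \<in> borel_measurable (P \<Otimes>\<^sub>M HS)"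
    and B_meas: "(\<lambda>(x, h). B x h) \<in> borel_measurable (P \<Otimes>\<^sub>M HS)"
    and score_mean: "(\<integral>x. score A B x \<theta>0 h0 \<partial>P) = 0"
    and A_inv: "invertible (\<integral>x. A x h0 \<partial>P)"
    and score_L2: "integrable P (\<lambda>x. (norm (score A B x \<theta>0 h0))\<^sup>2)"
    and X_indep: "prob_space.indep_vars M (\<lambda>_. P) X {1..}"
    and X_distr: "\<And>i. i \<ge> 1 \<Longrightarrow> distr M P (X i) = P"
    and hhat1_meas: "\<And>n. n \<ge> 1 \<Longrightarrow> hhat1 n \<in> measurable (PiM {1..n} (\<lambda>_. P)) HS"
    and hhat2_meas: "\<And>n. n \<ge> 1 \<Longrightarrow> hhat2 n \<in> measurable (PiM {n+1..2*n} (\<lambda>_. P)) HS"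
    and hhat1_in: "\<And>n. n \<ge> 1 \<Longrightarrow> AE \<omega> in M. hhat1 n (sample X {1..n} \<omega>) \<in> HN (2*n)"
    and hhat2_in: "\<And>n. n \<ge> 1 \<Longrightarrow> AE \<omega> in M. hhat2 n (sample X {n+1..2*n} \<omega>) \<in> HN (2*n)"
    and W_meas: "\<And>n. n \<ge> 1 \<Longrightarrow> W n \<in> measurable M (PiM {1..n} (\<lambda>_. borel))"
    and V_meas: "\<And>n. n \<ge> 1 \<Longrightarrow> V n \<in> measurable M (PiM {1..n} (\<lambda>_. borel))"
    and W_distr: "\<And>n. n \<ge> 1 \<Longrightarrow>
      distr M (PiM {1..n} (\<lambda>_. borel)) (W n) = dirichlet n (\<lambda>_. 1)"
    and V_distr: "\<And>n. n \<ge> 1 \<Longrightarrow>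
      distr M (PiM {1..n} (\<lambda>_. borel)) (V n) = dirichlet n (\<lambda>_. 1)"
    and WV_indep_data: "\<And>n. n \<ge> 1 \<Longrightarrow>
      prob_space.indep_set M (sets (weight_algebra M W V n)) (sets (sample_algebra M P X {1..2*n}))"
    and WV: "(\<forall>n\<ge>1. prob_space.indep_var M (PiM {1..n} (\<lambda>_. borel)) (W n)
                                            (PiM {1..n} (\<lambda>_. borel)) (V n)) \<or>
             (\<forall>n\<ge>1. AE \<omega> in M. \<forall>j\<in>{1..n}. V n \<omega> j = W n \<omega> j)"
    and th_meas: "\<And>n. n \<ge> 1 \<Longrightarrow> th1 n \<in> borel_measurable M"
      "\<And>n. n \<ge> 1 \<Longrightarrow> th1BB n \<in> borel_measurable M"
      "\<And>n. n \<ge> 1 \<Longrightarrow> th2 n \<in> borel_measurable M"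
      "\<And>n. n \<ge> 1 \<Longrightarrow> th2BB n \<in> borel_measurable M"
    and th1: "\<And>n. n \<ge> 1 \<Longrightarrow> AE \<omega> in M.
      (1 / real n) *\<^sub>R (\<Sum>i\<in>{1..n}.
        score A B (X i \<omega>) (th1 n \<omega>) (hhat2 n (sample X {n+1..2*n} \<omega>))) = 0"
    and th1BB: "\<And>n. n \<ge> 1 \<Longrightarrow> AE \<omega> in M.
      (\<Sum>i\<in>{1..n}. W n \<omega> i *\<^sub>R
        score A B (X i \<omega>) (th1BB n \<omega>) (hhat2 n (sample X {n+1..2*n} \<omega>))) = 0"
    and th2: "\<And>n. n \<ge> 1 \<Longrightarrow> AE \<omega> in M.
      (1 / real n) *\<^sub>R (\<Sum>i\<in>{1..n}.
        score A B (X (n + i) \<omega>) (th2 n \<omega>) (hhat1 n (sample X {1..n} \<omega>))) = 0"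
    and th2BB: "\<And>n. n \<ge> 1 \<Longrightarrow> AE \<omega> in M.
      (\<Sum>i\<in>{1..n}. V n \<omega> i *\<^sub>R
        score A B (X (n + i) \<omega>) (th2BB n \<omega>) (hhat1 n (sample X {1..n} \<omega>))) = 0"
    and a: "\<And>N. N \<ge> 1 \<Longrightarrow> a N > 0" "a \<longlonglongrightarrow> 0"
    and i: "\<And>N h. N \<ge> 1 \<Longrightarrow> h \<in> HN N \<Longrightarrow>
      norm ((\<integral>x. A x h \<partial>P) - (\<integral>x. A x h0 \<partial>P)) \<le> a N"
    and C: "C > 0"
    and ii: "\<And>N h. N \<ge> 1 \<Longrightarrow> h \<in> HN N \<Longrightarrow>
      (\<integral>\<^sup>+x. ennreal ((norm (A x h))\<^sup>2) \<partial>P) \<le> ennreal C"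
    and \<delta>: "\<And>N. N \<ge> 1 \<Longrightarrow> \<delta> N > 0" "\<delta> \<longlonglongrightarrow> 0"
    and iii: "\<And>N h. N \<ge> 1 \<Longrightarrow> h \<in> HN N \<Longrightarrow>
      (\<integral>\<^sup>+x. ennreal ((norm (score A B x \<theta>0 h - score A B x \<theta>0 h0))\<^sup>2) \<partial>P)
        \<le> ennreal ((\<delta> N)\<^sup>2)"
    and iv_integrable: "\<And>N h t. N \<ge> 1 \<Longrightarrow> h \<in> HN N \<Longrightarrow> t \<in> {0..1} \<Longrightarrow>
      integrable P (\<lambda>x. score A B x \<theta>0 (h0 + t *\<^sub>R (h - h0)))"
    and iv_twice_diff: "\<And>N h. N \<ge> 1 \<Longrightarrow> h \<in> HN N \<Longrightarrow>
      twice_differentiable_on_unit (mean_score_path P A B \<theta>0 h0 h)"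
    and iv_deriv0: "\<And>N h. N \<ge> 1 \<Longrightarrow> h \<in> HN N \<Longrightarrow>
      (mean_score_path P A B \<theta>0 h0 h has_vector_derivative 0) (at 0 within {0..1})"
    and iv_deriv2: "(\<lambda>n. SUP h\<in>HN (2*n). ennreal (sqrt (real n)) *
      (\<integral>\<^sup>+t\<in>{0<..<1}. ennreal (norm (deriv2 (mean_score_path P A B \<theta>0 h0 h) t)) \<partial>lborel))
        \<longlonglongrightarrow> 0"
    and iv_bias: "(\<lambda>n. SUP h\<in>HN (2*n).
      ennreal (norm (sqrt (real n) *\<^sub>R (\<integral>x. score A B x \<theta>0 h \<partial>P)))) \<longlonglongrightarrow> 0"
  defines "thetahat \<equiv> \<lambda>n \<omega>. (1/2) *\<^sub>R (th1 n \<omega> + th2 n \<omega>)"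
    and "thetahatBB \<equiv> \<lambda>n \<omega>. (1/2) *\<^sub>R (th1BB n \<omega> + th2BB n \<omega>)"
    and "\<Sigma> \<equiv> sandwich_variance P A B \<theta>0 h0"
  shows "converges_in_distribution M
           (\<lambda>n \<omega>. sqrt (real (2*n)) *\<^sub>R (thetahat n \<omega> - \<theta>0)) (mv_normal 0 \<Sigma>)
       \<and> cond_converges_in_distribution M (\<lambda>n. sample_algebra M P X {1..2*n})
           (\<lambda>n \<omega>. sqrt (real (2*n)) *\<^sub>R (thetahatBB n \<omega> - thetahat n \<omega>)) (mv_normal 0 \<Sigma>)"
proof -
  interpret prob_space M by (rule M)
  interpret P: prob_space P by (rule P)
  interpret BS: bootstrap_sample M P X W V
    by (intro bootstrap_sample.intro bootstrap_sample_axioms.intro M X_indep X_distr W_meas V_meas W_distr V_distr WV)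
  let ?B = "\<lambda>n. PiM {1..n} (\<lambda>_. borel :: real measure)" and ?Pi = "\<lambda>I :: nat set. PiM I (\<lambda>_. P)"
  define J where "J = matrix_inv (\<integral>x. A x h0 \<partial>P)"
  define m0 where "m0 x = score A B x \<theta>0 h0" for x
  have h0: "h0 \<in> space HS" using H by simp
  have HN_sub: "HN N \<subseteq> space HS" if "N \<ge> 1" for N
    using HN H(3) that unfolding shrinking_neighborhoods_def by auto
  \<comment> \<open>The path from \<open>h0\<close> ends in \<open>h\<close> at
    \<open>t = 1\<close>.\<close>
  have score_int: "integrable P (\<lambda>x. score A B x \<theta>0 h)" if "N \<ge> 1" "h \<in> HN N" for N h
    using iv_integrable[OF that, of 1] by simp
  define \<xi>1 where "\<xi>1 n \<omega> = sample X {1..n} \<omega>" for n \<omega>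
  define Z1 where "Z1 n \<omega> = hhat2 n (sample X {n+1..2*n} \<omega>)" for n \<omega>
  \<comment> \<open>Reindexes the second half by \<open>{1..n}\<close>, so that both halves
    instantiate the same locale.\<close>
  define shift where "shift n x = (\<lambda>i\<in>{1..n}. x (n + i))" for n and x :: "nat \<Rightarrow> 'o"
  define \<xi>2 where "\<xi>2 n \<omega> = shift n (sample X {n+1..2*n} \<omega>)" for n \<omega>
  define Z2 where "Z2 n \<omega> = hhat1 n (sample X {1..n} \<omega>)" for n \<omega>
  have \<xi>1_eq: "\<xi>1 n \<omega> i = X i \<omega>" if "i \<in> {1..n}" for n \<omega> i
    using that by (simp add: \<xi>1_def sample_def)
  have \<xi>2_eq: "\<xi>2 n \<omega> i = X (n + i) \<omega>" if "i \<in> {1..n}" for n \<omega> i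
    using that by (simp add: \<xi>2_def shift_def sample_def)
  have shift_meas: "shift n \<in> ?Pi {n+1..2*n} \<rightarrow>\<^sub>M ?Pi {1..n}" for n
    unfolding shift_def by (rule measurable_restrict, rule measurable_component_singleton) auto
  have res_sample: "restrict (sample X {1..2*n} \<omega>) I = sample X I \<omega>" if "I \<subseteq> {1..2*n}" for n I \<omega>
    using that by (auto simp: sample_def restrict_def fun_eq_iff)
  have res_meas: "(\<lambda>x. restrict x I) \<in> ?Pi {1..2*n} \<rightarrow>\<^sub>M ?Pi I" if "I \<subseteq> {1..2*n}" for n I
    by (rule measurable_restrict_subset[OF that])
  have half1: "{1..n} \<subseteq> {1..2*n}" "{1..n} \<subseteq> {1..}" and half2: "{n+1..2*n} \<subseteq> {1..2*n}" "{n+1..2*n} \<subseteq> {1..}"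
    and all: "{1..2*n} \<subseteq> {1..}" and disj: "{1..n} \<inter> {n+1..2*n} = {}" for n :: nat
    by auto
  note S1 = BS.sample_measurable[OF half1(2)] and S2 = BS.sample_measurable[OF half2(2)] and S = BS.sample_measurable[OF all]
  have \<xi>1: "\<xi>1 n \<in> M \<rightarrow>\<^sub>M ?Pi {1..n}" and \<xi>2: "\<xi>2 n \<in> M \<rightarrow>\<^sub>M ?Pi {1..n}" if "n \<ge> 1" for n
    unfolding \<xi>1_def[abs_def] \<xi>2_def[abs_def] by (rule S1, rule measurable_compose[OF S2 shift_meas])
  have Z1: "Z1 n \<in> M \<rightarrow>\<^sub>M HS" and Z2: "Z2 n \<in> M \<rightarrow>\<^sub>M HS" if "n \<ge> 1" for n
    unfolding Z1_def[abs_def] Z2_def[abs_def]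
    by (rule measurable_compose[OF S2 hhat2_meas[OF that]], rule measurable_compose[OF S1 hhat1_meas[OF that]])
  have law1: "distr M (?Pi {1..n} \<Otimes>\<^sub>M HS) (\<lambda>\<omega>. (\<xi>1 n \<omega>, Z1 n \<omega>)) = ?Pi {1..n} \<Otimes>\<^sub>M distr M HS (Z1 n)" if n: "n \<ge> 1" for n
  proof -
    have "distr M (?Pi {1..n} \<Otimes>\<^sub>M HS) (\<lambda>\<omega>. (sample X {1..n} \<omega>, hhat2 n (sample X {n+1..2*n} \<omega>)))
      = distr M (?Pi {1..n}) (\<lambda>\<omega>. sample X {1..n} \<omega>) \<Otimes>\<^sub>M distr M HS (\<lambda>\<omega>. hhat2 n (sample X {n+1..2*n} \<omega>))"
      by (rule joint_law_map[OF S1 S2 BS.sample_joint_law[OF half1(2) half2(2) disj] _ hhat2_meas[OF n], of "\<lambda>x. x"]) simp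
    then show ?thesis
      using BS.sample_law[OF half1(2)[of n]] n by (simp add: \<xi>1_def Z1_def[abs_def])
  qed
  have law2: "distr M (?Pi {1..n} \<Otimes>\<^sub>M HS) (\<lambda>\<omega>. (\<xi>2 n \<omega>, Z2 n \<omega>)) = ?Pi {1..n} \<Otimes>\<^sub>M distr M HS (Z2 n)" if n: "n \<ge> 1" for n
  proof -
    have "distr M (?Pi {1..n}) (\<lambda>\<omega>. shift n (sample X {n+1..2*n} \<omega>)) = distr (distr M (?Pi {n+1..2*n}) (sample X {n+1..2*n})) (?Pi {1..n}) (shift n)"
      using distr_distr[OF shift_meas S2, of n] by (simp add: comp_def)
    also have "distr M (?Pi {n+1..2*n}) (sample X {n+1..2*n}) = ?Pi {n+1..2*n}"
      by (rule BS.sample_law[OF half2(2)]) (use n in auto)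
    also have "distr (?Pi {n+1..2*n}) (?Pi {1..n}) (shift n) = ?Pi {1..n}"
      unfolding shift_def[abs_def] by (rule distr_PiM_reindex) (use P in \<open>auto simp: inj_on_def\<close>)
    finally have L: "distr M (?Pi {1..n}) (\<lambda>\<omega>. shift n (sample X {n+1..2*n} \<omega>)) = ?Pi {1..n}" .
    have "distr M (?Pi {1..n} \<Otimes>\<^sub>M HS) (\<lambda>\<omega>. (shift n (sample X {n+1..2*n} \<omega>), hhat1 n (sample X {1..n} \<omega>)))
      = distr M (?Pi {1..n}) (\<lambda>\<omega>. shift n (sample X {n+1..2*n} \<omega>)) \<Otimes>\<^sub>M distr M HS (\<lambda>\<omega>. hhat1 n (sample X {1..n} \<omega>))"
      by (rule joint_law_map[OF S2 S1 BS.sample_joint_law[OF half2(2) half1(2)] shift_meas hhat1_meas[OF n]]) auto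
    then show ?thesis unfolding L by (simp add: \<xi>2_def Z2_def[abs_def])
  qed
  have WV_joint: "distr M (?Pi {1..2*n} \<Otimes>\<^sub>M (?B n \<Otimes>\<^sub>M ?B n)) (\<lambda>\<omega>. (sample X {1..2*n} \<omega>, (W n \<omega>, V n \<omega>)))
    = distr M (?Pi {1..2*n}) (sample X {1..2*n}) \<Otimes>\<^sub>M distr M (?B n \<Otimes>\<^sub>M ?B n) (\<lambda>\<omega>. (W n \<omega>, V n \<omega>))" if n: "n \<ge> 1" for n
    using joint_law_indep_set[OF S BS.WV_meas[OF n]] WV_indep_data[OF n]
    unfolding weight_algebra_def sample_algebra_def .
  \<comment> \<open>Evaluation sample and nuisance estimate are functions of the whole data, from
    which the weight pair is independent. Each half involves only one of the two weight vectors, so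
    the coupling of the pair plays no part here.\<close>
  have joint1: "distr M ((?Pi {1..n} \<Otimes>\<^sub>M HS) \<Otimes>\<^sub>M ?B n) (\<lambda>\<omega>. ((\<xi>1 n \<omega>, Z1 n \<omega>), W n \<omega>))
    = distr M (?Pi {1..n} \<Otimes>\<^sub>M HS) (\<lambda>\<omega>. (\<xi>1 n \<omega>, Z1 n \<omega>)) \<Otimes>\<^sub>M dirichlet n (\<lambda>_. 1)" if n: "n \<ge> 1" for n
  proof -
    have f: "(\<lambda>x. (restrict x {1..n}, hhat2 n (restrict x {n+1..2*n}))) \<in> ?Pi {1..2*n} \<rightarrow>\<^sub>M ?Pi {1..n} \<Otimes>\<^sub>M HS"
      by (rule measurable_Pair[OF res_meas[OF half1(1)] measurable_compose[OF res_meas[OF half2(1)] hhat2_meas[OF n]]])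
    from joint_law_map[OF S BS.WV_meas[OF n] WV_joint[OF n] f measurable_fst]
    show ?thesis
      unfolding res_sample[OF half1(1)] res_sample[OF half2(1)] fst_conv W_distr[OF n, symmetric] \<xi>1_def Z1_def .
  qed
  have joint2: "distr M ((?Pi {1..n} \<Otimes>\<^sub>M HS) \<Otimes>\<^sub>M ?B n) (\<lambda>\<omega>. ((\<xi>2 n \<omega>, Z2 n \<omega>), V n \<omega>))
    = distr M (?Pi {1..n} \<Otimes>\<^sub>M HS) (\<lambda>\<omega>. (\<xi>2 n \<omega>, Z2 n \<omega>)) \<Otimes>\<^sub>M dirichlet n (\<lambda>_. 1)" if n: "n \<ge> 1" for n
  proof -
    have f: "(\<lambda>x. (shift n (restrict x {n+1..2*n}), hhat1 n (restrict x {1..n}))) \<in> ?Pi {1..2*n} \<rightarrow>\<^sub>M ?Pi {1..n} \<Otimes>\<^sub>M HS"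
      by (rule measurable_Pair[OF measurable_compose[OF res_meas[OF half2(1)] shift_meas] measurable_compose[OF res_meas[OF half1(1)] hhat1_meas[OF n]]])
    from joint_law_map[OF S BS.WV_meas[OF n] WV_joint[OF n] f measurable_snd]
    show ?thesis
      unfolding res_sample[OF half1(1)] res_sample[OF half2(1)] snd_conv V_distr[OF n, symmetric] \<xi>2_def Z2_def .
  qed
  interpret H1: crossfit_half M P A B HS HN h0 \<theta>0 a \<delta> C \<xi>1 Z1 W th1 th1BB
  proof (intro crossfit_half.intro crossfit_half_axioms.intro)
    fix n :: nat assume n: "n \<ge> 1"
    show "AE \<omega> in M. Z1 n \<omega> \<in> HN (2*n)" using hhat2_in[OF n] by (simp add: Z1_def)
    show "AE \<omega> in M. (1 / real n) *\<^sub>R (\<Sum>i\<in>{1..n}. score A B (\<xi>1 n \<omega> i) (th1 n \<omega>) (Z1 n \<omega>)) = 0"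
      using th1[OF n] by (simp add: Z1_def \<xi>1_eq cong: sum.cong_simp)
    show "AE \<omega> in M. (\<Sum>i\<in>{1..n}. W n \<omega> i *\<^sub>R score A B (\<xi>1 n \<omega> i) (th1BB n \<omega>) (Z1 n \<omega>)) = 0"
      using th1BB[OF n] by (simp add: Z1_def \<xi>1_eq cong: sum.cong_simp)
  qed (fact M P h0 HN_sub A_meas B_meas score_mean A_inv score_L2 \<xi>1 Z1 W_meas law1 joint1 th_meas a i C ii \<delta> iii score_int iv_bias)+
  \<comment> \<open>The halves exchange roles: the second sample is evaluated at the estimate from
    the first, with the weights \<open>V\<close>.\<close>
  interpret H2: crossfit_half M P A B HS HN h0 \<theta>0 a \<delta> C \<xi>2 Z2 V th2 th2BB
  proof (intro crossfit_half.intro crossfit_half_axioms.intro)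
    fix n :: nat assume n: "n \<ge> 1"
    show "AE \<omega> in M. Z2 n \<omega> \<in> HN (2*n)" using hhat1_in[OF n] by (simp add: Z2_def)
    show "AE \<omega> in M. (1 / real n) *\<^sub>R (\<Sum>i\<in>{1..n}. score A B (\<xi>2 n \<omega> i) (th2 n \<omega>) (Z2 n \<omega>)) = 0"
      using th2[OF n] by (simp add: Z2_def \<xi>2_eq cong: sum.cong_simp)
    show "AE \<omega> in M. (\<Sum>i\<in>{1..n}. V n \<omega> i *\<^sub>R score A B (\<xi>2 n \<omega> i) (th2BB n \<omega>) (Z2 n \<omega>)) = 0"
      using th2BB[OF n] by (simp add: Z2_def \<xi>2_eq cong: sum.cong_simp)
  qed (fact M P h0 HN_sub A_meas B_meas score_mean A_inv score_L2 \<xi>2 Z2 V_meas law2 joint2 th_meas a i C ii \<delta> iii score_int iv_bias)+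
  have m0_meas: "m0 \<in> borel_measurable P" unfolding m0_def[abs_def] by (rule H1.m0_meas)
  have m0_sq: "integrable P (\<lambda>x. (norm (m0 x))\<^sup>2)" unfolding m0_def by (rule score_L2)
  have m0_int: "integrable P m0"
  proof (rule integrable_of_nn_integral_square(1)[OF P m0_meas])
    show "(\<integral>\<^sup>+x. ennreal ((norm (m0 x))\<^sup>2) \<partial>P) < \<infinity>"
      by (subst nn_integral_eq_integral[OF m0_sq]) simp_all
  qed
  have \<Sigma>_eq: "\<Sigma> = J ** (\<integral>x. outer (m0 x) \<partial>P) ** transpose J"
    by (simp add: \<Sigma>_def sandwich_variance_def J_def outer_def m0_def)
  note \<Sigma>_sym = sandwich_quadratic_form(1)[OF m0_meas m0_sq, of J, folded \<Sigma>_eq]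
    and \<Sigma>_form = sandwich_quadratic_form(2)[OF m0_meas m0_sq, of _ J, folded \<Sigma>_eq]
  have \<Sigma>_psd: "0 \<le> t \<bullet> (\<Sigma> *v t)" for t unfolding \<Sigma>_form by simp
  \<comment> \<open>The scalar influence in direction \<open>t\<close>; its sign is that of the
    leading term \<open>- J U\<close>.\<close>
  define \<beta> where "\<beta> t x = - (t \<bullet> (J *v m0 x))" for t x
  have \<beta>_lin: "bounded_linear (\<lambda>v. - (t \<bullet> (J *v v)))" for t
    by (intro bounded_linear_minus bounded_linear_compose[OF bounded_linear_inner_right matrix_vector_mul_bounded_linear])
  have \<beta>_meas: "\<beta> t \<in> borel_measurable P" for t
    unfolding \<beta>_def[abs_def] using m0_meas by measurable
  have \<beta>_mean: "(\<integral>x. \<beta> t x \<partial>P) = 0" for t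
  proof -
    have "(\<integral>x. m0 x \<partial>P) = 0" using score_mean by (simp add: m0_def)
    with integral_bounded_linear[OF \<beta>_lin m0_int, of t] show ?thesis by (simp add: \<beta>_def)
  qed
  have \<beta>_sq: "integrable P (\<lambda>x. (\<beta> t x)\<^sup>2)" for t
  proof (rule Bochner_Integration.integrable_bound)
    show "integrable P (\<lambda>x. (norm t * norm J)\<^sup>2 * (norm (m0 x))\<^sup>2)" using m0_sq by simp
    show "(\<lambda>x. (\<beta> t x)\<^sup>2) \<in> borel_measurable P" using \<beta>_meas by measurable
    show "AE x in P. norm ((\<beta> t x)\<^sup>2) \<le> norm ((norm t * norm J)\<^sup>2 * (norm (m0 x))\<^sup>2)"
    proof (rule AE_I2)
      fix x
      have "\<bar>\<beta> t x\<bar> \<le> norm t * (norm J * norm (m0 x))"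
        unfolding \<beta>_def abs_minus_cancel
        by (rule order_trans[OF Cauchy_Schwarz_ineq2 mult_left_mono[OF norm_matrix_vector_mult_le norm_ge_zero]])
      then have "\<bar>\<beta> t x\<bar>\<^sup>2 \<le> (norm t * (norm J * norm (m0 x)))\<^sup>2" by (intro power_mono) auto
      then show "norm ((\<beta> t x)\<^sup>2) \<le> norm ((norm t * norm J)\<^sup>2 * (norm (m0 x))\<^sup>2)"
        by (simp add: power_mult_distrib mult.assoc)
    qed
  qed
  have \<beta>_var: "(\<integral>x. (\<beta> t x)\<^sup>2 \<partial>P) = t \<bullet> (\<Sigma> *v t)" for t
    unfolding \<Sigma>_form by (simp add: \<beta>_def)
  have normal_cos: "(\<integral>x. cos (t \<bullet> x + s) \<partial>mv_normal 0 \<Sigma>) = cos s * exp (- (t \<bullet> (\<Sigma> *v t)) / 2)" for t s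
    by (rule integral_cos_mv_normal[OF \<Sigma>_sym \<Sigma>_psd])
  \<comment> \<open>The rate \<open>sqrt (2 n)\<close> and the average over two halves leave the
    factor \<open>sqrt 2 / 2\<close> in front of each expansion at rate
    \<open>sqrt n\<close>.\<close>
  have sqrt_split: "sqrt (real (2*n)) * (1 / 2) = (sqrt 2 / 2) * sqrt (real n)" for n
    by (simp add: real_sqrt_mult)
  have inner_J: "t \<bullet> (J *v m0 x) = - \<beta> t x" for t x by (simp add: \<beta>_def)
  have J_sum: "t \<bullet> (J *v (\<Sum>i\<in>I. c i *\<^sub>R m0 (x i))) = - (\<Sum>i\<in>I. c i * \<beta> t (x i))" for t I c and x :: "nat \<Rightarrow> 'o"
    by (simp add: linear_sum[OF matrix_vector_mul_linear] linear_scale[OF matrix_vector_mul_linear] inner_sum_right inner_J sum_negf)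
  define Y1 where "Y1 n \<omega> = sqrt (real (2*n)) *\<^sub>R (thetahat n \<omega> - \<theta>0)" for n \<omega>
  define L1 where "L1 n \<omega> = (sqrt 2 / 2) *\<^sub>R (- (J *v (H1.U n \<omega> + H2.U n \<omega>)))" for n \<omega>
  define Y2 where "Y2 n \<omega> = sqrt (real (2*n)) *\<^sub>R (thetahatBB n \<omega> - thetahat n \<omega>)" for n \<omega>
  define L2 where "L2 n \<omega> = (sqrt 2 / 2) *\<^sub>R (- (J *v (H1.V n \<omega> + H2.V n \<omega>)))" for n \<omega>
  have R1: "tends_zero M (\<lambda>n \<omega>. Y1 n \<omega> - L1 n \<omega>)"
  proof -
    have "Y1 n \<omega> - L1 n \<omega> = (sqrt 2 / 2) *\<^sub>R ((sqrt (real n) *\<^sub>R (th1 n \<omega> - \<theta>0) + J *v H1.U n \<omega>)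
        + (sqrt (real n) *\<^sub>R (th2 n \<omega> - \<theta>0) + J *v H2.U n \<omega>))" for n \<omega>
    proof -
      have "thetahat n \<omega> - \<theta>0 = (1 / 2) *\<^sub>R ((th1 n \<omega> - \<theta>0) + (th2 n \<omega> - \<theta>0))"
        by (simp add: thetahat_def scaleR_add_right scaleR_diff_right scaleR_left_distrib[symmetric])
      then have "Y1 n \<omega> = (sqrt 2 / 2) *\<^sub>R (sqrt (real n) *\<^sub>R ((th1 n \<omega> - \<theta>0) + (th2 n \<omega> - \<theta>0)))"
        unfolding Y1_def by (simp only: scaleR_scaleR sqrt_split)
      then show ?thesis
        unfolding L1_def by (simp add: scaleR_add_right scaleR_diff_right matrix_vector_right_distrib)
    qed
    then show ?thesis
      using tends_zero_scaleR[OF tends_zero_add[OF H1.estimator_expansion H2.estimator_expansion], of "sqrt 2 / 2"]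
      by (simp only: J_def)
  qed
  have R2: "tends_zero M (\<lambda>n \<omega>. Y2 n \<omega> - L2 n \<omega>)"
  proof -
    have "Y2 n \<omega> - L2 n \<omega> = (sqrt 2 / 2) *\<^sub>R ((sqrt (real n) *\<^sub>R (th1BB n \<omega> - th1 n \<omega>) + J *v H1.V n \<omega>)
        + (sqrt (real n) *\<^sub>R (th2BB n \<omega> - th2 n \<omega>) + J *v H2.V n \<omega>))" for n \<omega>
    proof -
      have "thetahatBB n \<omega> - thetahat n \<omega> = (1 / 2) *\<^sub>R ((th1BB n \<omega> - th1 n \<omega>) + (th2BB n \<omega> - th2 n \<omega>))"
        by (simp add: thetahat_def thetahatBB_def scaleR_add_right scaleR_diff_right)
      then have "Y2 n \<omega> = (sqrt 2 / 2) *\<^sub>R (sqrt (real n) *\<^sub>R ((th1BB n \<omega> - th1 n \<omega>) + (th2BB n \<omega> - th2 n \<omega>)))"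
        unfolding Y2_def by (simp only: scaleR_scaleR sqrt_split)
      then show ?thesis
        unfolding L2_def by (simp add: scaleR_add_right scaleR_diff_right matrix_vector_right_distrib)
    qed
    then show ?thesis
      using tends_zero_scaleR[OF tends_zero_add[OF H1.bootstrap_difference_expansion H2.bootstrap_difference_expansion], of "sqrt 2 / 2"]
      by (simp only: J_def)
  qed
  \<comment> \<open>Sign, scale and \<open>J\<close> are merged into one matrix so that
    \<open>bdd_prob_matrix\<close> applies.\<close>
  have L_eq: "(sqrt 2 / 2) *\<^sub>R (- (J *v v)) = ((- (sqrt 2 / 2)) *\<^sub>R J) *v v" for v
    unfolding scaleR_matrix_vector_assoc[symmetric] by simp
  have bdd_L1: "bdd_prob M L1" and bdd_L2: "bdd_prob M L2"
    unfolding L1_def[abs_def] L2_def[abs_def] L_eq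
    by (intro bdd_prob_matrix bdd_prob_add H1.bdd_U H2.bdd_U H1.bdd_V H2.bdd_V)+
  have bdd_Y1: "bdd_prob M Y1"
    using bdd_prob_add[OF tends_zero_imp_bdd_prob[OF R1] bdd_L1] by simp
  have bdd_Y2: "bdd_prob M Y2"
    using bdd_prob_add[OF tends_zero_imp_bdd_prob[OF R2] bdd_L2] by simp
  \<comment> \<open>To first order both halves use the scores at the true values, so their sums join
    into one i.i.d. sum over all \<open>2 n\<close> observations.\<close>
  have L1_form: "t \<bullet> L1 n \<omega> = 1 / sqrt (real (2*n)) * (\<Sum>i\<in>{1..2*n}. \<beta> t (X i \<omega>))" if n: "n \<ge> 1" for n \<omega> t
  proof -
    have U: "t \<bullet> (J *v (sqrt (real n) *\<^sub>R ((1 / real n) *\<^sub>R (\<Sum>i\<in>{1..n}. m0 (x i))))) = - (sqrt (real n) / real n * (\<Sum>i\<in>{1..n}. \<beta> t (x i)))" for x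
      using J_sum[of t "\<lambda>_. 1" x "{1..n}"] by (simp add: linear_scale[OF matrix_vector_mul_linear])
    have "H1.U n \<omega> = sqrt (real n) *\<^sub>R ((1 / real n) *\<^sub>R (\<Sum>i\<in>{1..n}. m0 (X i \<omega>)))"
      unfolding H1.U_def m0_def by (simp add: \<xi>1_eq cong: sum.cong_simp)
    moreover have "H2.U n \<omega> = sqrt (real n) *\<^sub>R ((1 / real n) *\<^sub>R (\<Sum>i\<in>{1..n}. m0 (X (n + i) \<omega>)))"
      unfolding H2.U_def m0_def by (simp add: \<xi>2_eq cong: sum.cong_simp)
    ultimately have "t \<bullet> L1 n \<omega> = (sqrt 2 / 2) * (sqrt (real n) / real n) * ((\<Sum>i\<in>{1..n}. \<beta> t (X i \<omega>)) + (\<Sum>i\<in>{1..n}. \<beta> t (X (n + i) \<omega>)))"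
      unfolding L1_def by (simp only: matrix_vector_right_distrib inner_scaleR_right inner_minus_right inner_add_right U) (simp add: algebra_simps)
    also have "(sqrt 2 / 2) * (sqrt (real n) / real n) = 1 / sqrt (real (2*n))"
      using n by (simp add: real_sqrt_mult field_simps)
    also have "(\<Sum>i\<in>{1..n}. \<beta> t (X i \<omega>)) + (\<Sum>i\<in>{1..n}. \<beta> t (X (n + i) \<omega>)) = (\<Sum>i\<in>{1..2*n}. \<beta> t (X i \<omega>))"
    proof -
      have split: "{1..2*n} = {1..n} \<union> (\<lambda>i. n + i) ` {1..n}" by (auto simp: image_iff Bex_def)
      have disj: "{1..n} \<inter> (\<lambda>i. n + i) ` {1..n} = {}" by auto
      have "(\<Sum>i\<in>{1..2*n}. \<beta> t (X i \<omega>)) = (\<Sum>i\<in>{1..n}. \<beta> t (X i \<omega>)) + (\<Sum>i\<in>(\<lambda>i. n + i) ` {1..n}. \<beta> t (X i \<omega>))"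
        unfolding split by (rule sum.union_disjoint[OF _ _ disj]) simp_all
      also have "(\<Sum>i\<in>(\<lambda>i. n + i) ` {1..n}. \<beta> t (X i \<omega>)) = (\<Sum>i\<in>{1..n}. \<beta> t (X (n + i) \<omega>))"
        by (rule sum.reindex[THEN trans]) (simp_all only: inj_on_def comp_def, simp)
      finally show ?thesis by simp
    qed
    finally show ?thesis .
  qed
  \<comment> \<open>The outer \<open>real n\<close> with \<open>sqrt (2 n)\<close> under each score
    is the normalisation of \<open>weights_cf\<close>.\<close>
  have L2_form: "t \<bullet> L2 n \<omega> = real n * ((\<Sum>i\<in>{1..n}. (W n \<omega> i - 1 / real n) * (\<beta> t (X i \<omega>) / sqrt (real (2*n))))
      + (\<Sum>i\<in>{1..n}. (V n \<omega> i - 1 / real n) * (\<beta> t (X (n + i) \<omega>) / sqrt (real (2*n)))))" if n: "n \<ge> 1" for n \<omega> t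
  proof -
    have Vt: "t \<bullet> (J *v (sqrt (real n) *\<^sub>R (\<Sum>i\<in>{1..n}. c i *\<^sub>R m0 (x i)))) = - (sqrt (real n) * (\<Sum>i\<in>{1..n}. c i * \<beta> t (x i)))" for x c
      using J_sum[of t c x "{1..n}"] by (simp add: linear_scale[OF matrix_vector_mul_linear])
    have "H1.V n \<omega> = sqrt (real n) *\<^sub>R (\<Sum>i\<in>{1..n}. (W n \<omega> i - 1 / real n) *\<^sub>R m0 (X i \<omega>))"
      unfolding H1.V_def m0_def by (simp add: \<xi>1_eq cong: sum.cong_simp)
    moreover have "H2.V n \<omega> = sqrt (real n) *\<^sub>R (\<Sum>i\<in>{1..n}. (V n \<omega> i - 1 / real n) *\<^sub>R m0 (X (n + i) \<omega>))"
      unfolding H2.V_def m0_def by (simp add: \<xi>2_eq cong: sum.cong_simp)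
    ultimately have "t \<bullet> L2 n \<omega> = (sqrt 2 / 2) * sqrt (real n) * ((\<Sum>i\<in>{1..n}. (W n \<omega> i - 1 / real n) * \<beta> t (X i \<omega>)) + (\<Sum>i\<in>{1..n}. (V n \<omega> i - 1 / real n) * \<beta> t (X (n + i) \<omega>)))"
      unfolding L2_def by (simp only: matrix_vector_right_distrib inner_scaleR_right inner_minus_right inner_add_right Vt) (simp add: algebra_simps)
    also have "(sqrt 2 / 2) * sqrt (real n) = real n / sqrt (real (2*n))"
      using n by (simp add: real_sqrt_mult field_simps)
    finally show ?thesis
      by (simp add: sum_divide_distrib[symmetric] add_divide_distrib[symmetric])
  qed
  have part1: "converges_in_distribution M Y1 (mv_normal 0 \<Sigma>)"
  proof (rule converges_in_distribution_trig[OF bdd_Y1 _ R1 prob_space_mv_normal sets_mv_normal])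
    show "L1 n \<in> borel_measurable M" if "n \<ge> 1" for n by (rule bdd_prob_measurable[OF bdd_L1 that])
    show "(\<lambda>n. \<integral>\<omega>. cos (t \<bullet> L1 n \<omega> + s) \<partial>M) \<longlonglongrightarrow> (\<integral>x. cos (t \<bullet> x + s) \<partial>mv_normal 0 \<Sigma>)" for t s
      unfolding normal_cos
      by (rule Lim_transform_eventually[OF BS.mean_cos_lim[OF \<beta>_meas \<beta>_mean \<beta>_sq \<beta>_var]])
         (use eventually_ge_1 in \<open>eventually_elim, simp only: L1_form\<close>)
  qed
  have part2: "cond_converges_in_distribution M (\<lambda>n. sample_algebra M P X {1..2*n}) Y2 (mv_normal 0 \<Sigma>)"
  proof (rule cond_converges_in_distribution_trig[OF _ bdd_Y2 _ R2 prob_space_mv_normal sets_mv_normal])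
    show "subalgebra M (sample_algebra M P X {1..2*n})" for n
      unfolding subalgebra_def sample_algebra_def using S measurable_space[OF S]
      by (auto simp: sets_vimage_algebra2 intro: measurable_sets)
    show "L2 n \<in> borel_measurable M" if "n \<ge> 1" for n by (rule bdd_prob_measurable[OF bdd_L2 that])
    show "(\<lambda>n. \<integral>\<omega>. \<bar>real_cond_exp M (sample_algebra M P X {1..2*n}) (\<lambda>\<omega>. cos (t \<bullet> L2 n \<omega> + s)) \<omega> - (\<integral>x. cos (t \<bullet> x + s) \<partial>mv_normal 0 \<Sigma>)\<bar> \<partial>M) \<longlonglongrightarrow> 0" for t s
      unfolding normal_cos
      by (rule Lim_transform_eventually[OF BS.conditional_cos_lim[OF \<beta>_meas \<beta>_mean \<beta>_sq \<beta>_var WV_indep_data]])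
         (assumption, use eventually_ge_1 in \<open>eventually_elim, simp only: L2_form\<close>)
  qed
  from part1 part2 show ?thesis
    unfolding Y1_def[abs_def] Y2_def[abs_def] by (rule conjI)
qed

end
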